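(* Assume $\mathcal J$ is countable. Let $S\models SCS_{SEP}$ (i.e. $S$ is a sorted complete system having the co-sorted embedding property). (1) Let $A$ be a subsystem of $S$ and let $a,b\in m(k,J)$. Then $\mathrm{tp}(a/A)=\mathrm{tp}(b/A)$ if and only if $a\vee A=b\vee A$ and there is an isomorphism $f:S_{(a\vee A)\cup\{a\}}\to S_{(b\vee A)\cup\{b\}}$ such that $f\restriction_{S_{a\vee A}}=\mathrm{id}_{S_{a\vee A}}$ and $f(a)=b$. (2) $\mathrm{Th}(S)$ is $\omega$-stable.
   Context: Fix a set $\mathcal J$ (of "sorts"). $\mathbb N$ is the set of positive integers and $\mathcal J^{<\mathbb N}=\bigcup_{n\in\mathbb N}\mathcal J^n$. For $J=(j_1,\dots,j_n)$ put $\|J\|=\{j_1,\dots,j_n\}$ and $\sqrt J=\{J'\in\mathcal J^{<\mathbb N}:\|J\|\subseteq\|J'\|\}$; $J^\frown J'$ is concatenation. Fix an arbitrary function $J^*_\subseteq:\mathbb N\times\mathcal J^{<\mathbb N}\to\mathcal J^{<\mathbb N}$ and put $J^*_\cap(J,J')=J^\frown J'$. For a profinite group $G$, $\mathcal N(G)$ is the set of open normal subgroups. A sorting data on $G$ is a family $F=\{F(N):N\in\mathcal N(G)\}$ of non-empty subsets of $\mathcal J^{<\mathbb N}$ such that: (i) $F(G)=\mathcal J^{<\mathbb N}$; (ii) $J\in F(N)\Leftrightarrow\sqrt J\subseteq F(N)$; (iii) if $N_1\subseteq N_2$, $[G:N_1]\le k$ and $J\in F(N_1)$, then $J^*_\subseteq(k,J)\in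 F(N_2)$; (iv) if $J_1\in F(N_1)$, $J_2\in F(N_2)$, then $J^*_\cap(J_1,J_2)\in F(N_1\cap N_2)$. The pair $(G,F)$ is a sorted profinite group. The language $\mathcal L_{SCS}(\mathcal J)$ has sorts $m(k,J)$ for $(k,J)\in\mathbb N\times\mathcal J^{<\mathbb N}$, binary relations $\le_{k,k',J,J'}$, $C_{k,k',J,J'}$ on $m(k,J)\times m(k',J')$ and ternary relations $P_{k,J}$ on $m(k,J)$ (subscripts are omitted). The sorted complete system $\mathcal S(G,F)$ of $(G,F)$ is the structure with $m(k,J)=\bigcup\{G/N\times\{k\}:N\in\mathcal N(G),[G:N]\le k,J\in F(N)\}$; $(gN,k)\le(g'N',k')$ iff $k\ge k'$ and $N\subseteq N'$; $C((gN,k),(g'N',k'))$ iff $k\ge k'$ and $gN\subseteq g'N'$; $P_{k,J}((g_1N,k),(g_2N,k),(g_3N,k))$ iff $g_3N=g_1g_2N$. $SCS$ is the first-order $\mathcal L_{SCS}(\mathcal J)$-theory axiomatizing sorted complete systems; every model of it is (naturally isomorphic to) the sorted complete system of a sorted profinite group, and its models are called sorted complete systems. A subsystem of $S\models SCS$ is a substructure of $S$ that is a model of $SCS$; for $X\subseteq S$, $S_X$ is the smallest subsystem containing $X$; a subsystem is finitely generated if it is $S_X$ for some finite $X$. $S$ has the co-sorted embedding property (co-SEP) if for all finitely generated subsystems $S_1,S_2\subseteq S$ and all embeddings $\Pi:S_2\to S_1$, $\Phi:S_2\to S_2$ there is an embedding $\Psi:S_1\to S$ with $\Psi\circ\Pi=\iota\circ\Phi$,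 where $\iota:S_2\to S$ is the inclusion. $SCS_{SEP}$ is the first-order theory of the sorted complete systems having co-SEP. On $S$ put $a\sim b$ iff $a\le b$ and $b\le a$, and let $[a]$ be the $\sim$-class of $a$; $S/\!\sim$ is a lattice for the order induced by $\le$, with join $\vee$. For $X\subseteq S$ put $\min X=\{x\in X: x\le y\text{ for all }y\in X\}$. For $a\in m(k,J)$ and a subsystem $S'$ of $S$, $a\vee S'$ denotes the set of all $c\in m(kk',J^*_\subseteq(k,J))$ such that $[c]=[a]\vee[b]$ with $b\in\min S'\cap m(k',J')$ (for some $(k',J')\in\mathbb N\times\mathcal J^{<\mathbb N}$). Types are complete types computed in $S$.
   Formalization: The order on S(G,F) is taken as N ⊆ N', without the condition k ≥ k' (with it min S' is always empty and (1) fails); and when min A is empty, a ∨ A is formed with those b in A for which [a] ∨ [b] is least. *)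

theory Defs
  imports "HOL-Algebra.Coset" "HOL-Analysis.Analysis"
begin

section \<open>Sorts\<close>

text \<open>The sort \<open>m(k,J)\<close> is named by the pair \<open>(k, J)\<close>. The positive integers are the
  natural numbers \<open>k \<ge> 1\<close>, and the elements of \<open>\<J>\<^sup>n\<close> for some \<open>n \<ge> 1\<close> are the nonempty
  lists over \<open>\<J>\<close>.\<close>

type_synonym 'j srt = "nat \<times> 'j list"

definition seqs :: "'j set \<Rightarrow> 'j list set" where
  "seqs \<J> = {J \<in> lists \<J>. J \<noteq> []}"

definition sorts :: "'j set \<Rightarrow> 'j srt set" where
  "sorts \<J> = {1..} \<times> seqs \<J>"

definition sqrt_seq :: "'j set \<Rightarrow> 'j list \<Rightarrow> 'j list set" where
  "sqrt_seq \<J> J = {J' \<in> seqs \<J>. set J \<subseteq> set J'}"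


section \<open>Sorted profinite groups\<close>

definition profinite_group :: "('g, 'm) monoid_scheme \<Rightarrow> 'g topology \<Rightarrow> bool" where
  "profinite_group G X \<longleftrightarrow>
     group G \<and> topspace X = carrier G \<and>
     continuous_map (prod_topology X X) X (\<lambda>(x, y). x \<otimes>\<^bsub>G\<^esub> y) \<and>
     continuous_map X X (\<lambda>x. inv\<^bsub>G\<^esub> x) \<and>
     compact_space X \<and> Hausdorff_space X \<and>
     (\<forall>Y. connectedin X Y \<longrightarrow> (\<exists>x. Y \<subseteq> {x}))"

definition open_normal :: "('g, 'm) monoid_scheme \<Rightarrow> 'g topology \<Rightarrow> 'g set set" where
  "open_normal G X = {N. N \<lhd> G \<and> openin X N}"

text \<open>Open subgroups of a compact group have finite index, so \<open>card\<close> is not applied to an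
  infinite set below.\<close>

definition index :: "('g, 'm) monoid_scheme \<Rightarrow> 'g set \<Rightarrow> nat" where
  "index G N = card (rcosets\<^bsub>G\<^esub> N)"

definition sorting_data ::
    "'j set \<Rightarrow> (nat \<Rightarrow> 'j list \<Rightarrow> 'j list) \<Rightarrow> ('g, 'm) monoid_scheme \<Rightarrow> 'g topology \<Rightarrow>
     ('g set \<Rightarrow> 'j list set) \<Rightarrow> bool" where
  "sorting_data \<J> Jsub G X F \<longleftrightarrow>
     (\<forall>N \<in> open_normal G X. F N \<subseteq> seqs \<J> \<and> F N \<noteq> {}) \<and>
     F (carrier G) = seqs \<J> \<and>
     (\<forall>N \<in> open_normal G X. \<forall>J \<in> seqs \<J>. J \<in> F N \<longleftrightarrow> sqrt_seq \<J> J \<subseteq> F N) \<and>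
     (\<forall>N1 \<in> open_normal G X. \<forall>N2 \<in> open_normal G X. \<forall>k \<ge> 1. \<forall>J.
        N1 \<subseteq> N2 \<and> index G N1 \<le> k \<and> J \<in> F N1 \<longrightarrow> Jsub k J \<in> F N2) \<and>
     (\<forall>N1 \<in> open_normal G X. \<forall>N2 \<in> open_normal G X. \<forall>J1 J2.
        J1 \<in> F N1 \<and> J2 \<in> F N2 \<longrightarrow> J1 @ J2 \<in> F (N1 \<inter> N2))"

definition sorted_profinite_group ::
    "'j set \<Rightarrow> (nat \<Rightarrow> 'j list \<Rightarrow> 'j list) \<Rightarrow> ('g, 'm) monoid_scheme \<Rightarrow> 'g topology \<Rightarrow>
     ('g set \<Rightarrow> 'j list set) \<Rightarrow> bool" where
  "sorted_profinite_group \<J> Jsub G X F \<longleftrightarrow> profinite_group G X \<and> sorting_data \<J> Jsub G X F"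


section \<open>Structures\<close>

text \<open>Different sorts may share values of type \<open>'a\<close>; as usual in many-sorted logic, such values
  count as different elements. So a subset of a structure is a set of pairs (sort, value), and a
  sort-preserving map is a family indexed by the sorts. The relations matter only on elements of
  the structure, and only for sorts in \<open>sorts \<J>\<close>.\<close>

record ('j, 'a) lstruct =
  univ :: "'j srt \<Rightarrow> 'a set"
  le :: "'j srt \<Rightarrow> 'j srt \<Rightarrow> 'a \<Rightarrow> 'a \<Rightarrow> bool"
  crel :: "'j srt \<Rightarrow> 'j srt \<Rightarrow> 'a \<Rightarrow> 'a \<Rightarrow> bool"
  prel :: "'j srt \<Rightarrow> 'a \<Rightarrow> 'a \<Rightarrow> 'a \<Rightarrow> bool"

definition elements :: "'j set \<Rightarrow> ('j, 'a) lstruct \<Rightarrow> ('j srt \<times> 'a) set" where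
  "elements \<J> S = Sigma (sorts \<J>) (univ S)"

definition substructure :: "('j, 'a) lstruct \<Rightarrow> ('j srt \<times> 'a) set \<Rightarrow> ('j, 'a) lstruct" where
  "substructure S A = S\<lparr>univ := \<lambda>s. {x. (s, x) \<in> A}\<rparr>"

definition embedding ::
    "'j set \<Rightarrow> ('j, 'a) lstruct \<Rightarrow> ('j, 'b) lstruct \<Rightarrow> ('j srt \<Rightarrow> 'a \<Rightarrow> 'b) \<Rightarrow> bool" where
  "embedding \<J> S T f \<longleftrightarrow>
     (\<forall>s \<in> sorts \<J>. f s ` univ S s \<subseteq> univ T s \<and> inj_on (f s) (univ S s)) \<and>
     (\<forall>s \<in> sorts \<J>. \<forall>t \<in> sorts \<J>. \<forall>x \<in> univ S s. \<forall>y \<in> univ S t.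
        (le S s t x y \<longleftrightarrow> le T s t (f s x) (f t y)) \<and>
        (crel S s t x y \<longleftrightarrow> crel T s t (f s x) (f t y))) \<and>
     (\<forall>s \<in> sorts \<J>. \<forall>x \<in> univ S s. \<forall>y \<in> univ S s. \<forall>z \<in> univ S s.
        prel S s x y z \<longleftrightarrow> prel T s (f s x) (f s y) (f s z))"

definition isomorphism ::
    "'j set \<Rightarrow> ('j, 'a) lstruct \<Rightarrow> ('j, 'b) lstruct \<Rightarrow> ('j srt \<Rightarrow> 'a \<Rightarrow> 'b) \<Rightarrow> bool" where
  "isomorphism \<J> S T f \<longleftrightarrow>
     embedding \<J> S T f \<and> (\<forall>s \<in> sorts \<J>. f s ` univ S s = univ T s)"


section \<open>Sorted complete systems\<close>

text \<open>The order compares the subgroups only: \<open>(gN,k) \<le> (g'N',k')\<close> means \<open>N \<subseteq> N'\<close>, with no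
  condition \<open>k \<ge> k'\<close>. With that condition, no element would lie below elements of all the sorts,
  so \<open>min S'\<close> would be empty for every system \<open>S'\<close>; the join of the classes of \<open>(gN,k)\<close> and
  \<open>(g'N',k')\<close> would have second component \<open>min k k'\<close> and so no representative in a sort
  \<open>m(kk',_)\<close>, unless \<open>k = k' = 1\<close>; and smallest subsystems containing a given set would fail to
  exist, because a substructure that is again a sorted complete system could contain proper
  subgroups of the groups \<open>G/N\<close>. The two versions of the order are definable from each other in
  \<open>S(G,F)\<close> by first-order formulas. The relation \<open>C\<close> keeps its condition \<open>k \<ge> k'\<close>.\<close>

definition complete_system ::
    "('g, 'm) monoid_scheme \<Rightarrow> 'g topology \<Rightarrow> ('g set \<Rightarrow> 'j list set) \<Rightarrow>
     ('j, 'g set \<times> nat) lstruct" where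
  "complete_system G X F =
     \<lparr>univ = (\<lambda>(k, J). \<Union> {carrier (G Mod N) \<times> {k} | N.
                          N \<in> open_normal G X \<and> index G N \<le> k \<and> J \<in> F N}),
      le = (\<lambda>_ _ (c, k) (c', k'). \<exists>N \<in> open_normal G X. \<exists>N' \<in> open_normal G X.
              c \<in> carrier (G Mod N) \<and> c' \<in> carrier (G Mod N') \<and> N \<subseteq> N'),
      crel = (\<lambda>_ _ (c, k) (c', k'). k \<ge> k' \<and> c \<subseteq> c'),
      prel = (\<lambda>_ (c1, _) (c2, _) (c3, _). \<exists>N \<in> open_normal G X.
              c1 \<in> carrier (G Mod N) \<and> c2 \<in> carrier (G Mod N) \<and> c3 = c1 \<otimes>\<^bsub>G Mod N\<^esub> c2)\<rparr>"

text \<open>The models of \<open>SCS\<close>, as the structures isomorphic to some \<open>S(G,F)\<close>. Fixing the type of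
  the elements of \<open>G\<close> is no restriction: an element of the profinite group is determined by its
  cosets modulo the open normal subgroups, hence by a set of elements of the structure.\<close>

definition sorted_complete_system ::
    "'j set \<Rightarrow> (nat \<Rightarrow> 'j list \<Rightarrow> 'j list) \<Rightarrow> ('j, 'a) lstruct \<Rightarrow> bool" where
  "sorted_complete_system \<J> Jsub S \<longleftrightarrow>
     (\<exists>(G :: ('j srt \<times> 'a) set monoid) X F f.
        sorted_profinite_group \<J> Jsub G X F \<and> isomorphism \<J> S (complete_system G X F) f)"

definition subsystem ::
    "'j set \<Rightarrow> (nat \<Rightarrow> 'j list \<Rightarrow> 'j list) \<Rightarrow> ('j, 'a) lstruct \<Rightarrow> ('j srt \<times> 'a) set \<Rightarrow> bool" where
  "subsystem \<J> Jsub S A \<longleftrightarrow>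
     A \<subseteq> elements \<J> S \<and> sorted_complete_system \<J> Jsub (substructure S A)"

definition generated ::
    "'j set \<Rightarrow> (nat \<Rightarrow> 'j list \<Rightarrow> 'j list) \<Rightarrow> ('j, 'a) lstruct \<Rightarrow> ('j srt \<times> 'a) set \<Rightarrow>
     ('j srt \<times> 'a) set" where
  "generated \<J> Jsub S X = \<Inter> {A. subsystem \<J> Jsub S A \<and> X \<subseteq> A}"

definition finitely_generated_subsystem ::
    "'j set \<Rightarrow> (nat \<Rightarrow> 'j list \<Rightarrow> 'j list) \<Rightarrow> ('j, 'a) lstruct \<Rightarrow> ('j srt \<times> 'a) set \<Rightarrow> bool" where
  "finitely_generated_subsystem \<J> Jsub S A \<longleftrightarrow>
     subsystem \<J> Jsub S A \<and> (\<exists>X \<subseteq> elements \<J> S. finite X \<and> A = generated \<J> Jsub S X)"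

definition co_SEP ::
    "'j set \<Rightarrow> (nat \<Rightarrow> 'j list \<Rightarrow> 'j list) \<Rightarrow> ('j, 'a) lstruct \<Rightarrow> bool" where
  "co_SEP \<J> Jsub S \<longleftrightarrow>
     (\<forall>S1 S2 \<pi> \<rho>.
        finitely_generated_subsystem \<J> Jsub S S1 \<and>
        finitely_generated_subsystem \<J> Jsub S S2 \<and>
        embedding \<J> (substructure S S2) (substructure S S1) \<pi> \<and>
        embedding \<J> (substructure S S2) (substructure S S2) \<rho> \<longrightarrow>
        (\<exists>\<psi>. embedding \<J> (substructure S S1) S \<psi> \<and>
             (\<forall>(s, x) \<in> S2. \<psi> s (\<pi> s x) = \<rho> s x)))"

definition models_SCS_SEP ::
    "'j set \<Rightarrow> (nat \<Rightarrow> 'j list \<Rightarrow> 'j list) \<Rightarrow> ('j, 'a) lstruct \<Rightarrow> bool" where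
  "models_SCS_SEP \<J> Jsub S \<longleftrightarrow> sorted_complete_system \<J> Jsub S \<and> co_SEP \<J> Jsub S"


section \<open>Joins with a subsystem\<close>

definition below :: "('j, 'a) lstruct \<Rightarrow> 'j srt \<times> 'a \<Rightarrow> 'j srt \<times> 'a \<Rightarrow> bool" where
  "below S x y = le S (fst x) (fst y) (snd x) (snd y)"

definition min_elems :: "('j, 'a) lstruct \<Rightarrow> ('j srt \<times> 'a) set \<Rightarrow> ('j srt \<times> 'a) set" where
  "min_elems S X = {x \<in> X. \<forall>y \<in> X. below S x y}"

text \<open>\<open>[c] = [a] \<or> [b]\<close> in the lattice of classes modulo \<open>\<sim>\<close>.\<close>

definition is_join ::
    "'j set \<Rightarrow> ('j, 'a) lstruct \<Rightarrow> 'j srt \<times> 'a \<Rightarrow> 'j srt \<times> 'a \<Rightarrow> 'j srt \<times> 'a \<Rightarrow> bool" where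
  "is_join \<J> S a b c \<longleftrightarrow>
     below S a c \<and> below S b c \<and>
     (\<forall>d \<in> elements \<J> S. below S a d \<and> below S b d \<longrightarrow> below S c d)"

text \<open>If the group of \<open>A\<close> is infinite then \<open>min A\<close> is empty. The joins \<open>[a] \<or> [b]\<close> with \<open>b \<in> A\<close>
  nevertheless have a least element, because only finitely many classes lie above \<open>[a]\<close>; the
  elements \<open>b\<close> at which it is attained then replace those of \<open>min A\<close>. When \<open>min A\<close> is nonempty,
  its elements attain the same least join.\<close>

definition join_base ::
    "'j set \<Rightarrow> ('j, 'a) lstruct \<Rightarrow> 'j srt \<times> 'a \<Rightarrow> ('j srt \<times> 'a) set \<Rightarrow> ('j srt \<times> 'a) set" where
  "join_base \<J> S a A =
     (if min_elems S A \<noteq> {} then min_elems S A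
      else {b \<in> A. \<forall>b' \<in> A. \<forall>c \<in> elements \<J> S. \<forall>c' \<in> elements \<J> S.
              is_join \<J> S a b c \<and> is_join \<J> S a b' c' \<longrightarrow> below S c c'})"

definition join_with ::
    "'j set \<Rightarrow> (nat \<Rightarrow> 'j list \<Rightarrow> 'j list) \<Rightarrow> ('j, 'a) lstruct \<Rightarrow> 'j srt \<times> 'a \<Rightarrow>
     ('j srt \<times> 'a) set \<Rightarrow> ('j srt \<times> 'a) set" where
  "join_with \<J> Jsub S a A =
     {c \<in> elements \<J> S. \<exists>k J k' J' b.
        fst a = (k, J) \<and> ((k', J'), b) \<in> join_base \<J> S a A \<and>
        fst c = (k * k', Jsub k J) \<and> is_join \<J> S a ((k', J'), b) c}"


section \<open>First-order logic\<close>

text \<open>Formulas of \<open>\<L>\<^sub>S\<^sub>C\<^sub>S(\<J>)\<close> with constants from \<open>'c\<close>. Atomic formulas name the sorts of their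
  arguments, and the variables of different sorts are different, even if they have the same
  number. In the same way \<open>Const a\<close> at a place of sort \<open>s\<close> is a constant for the element \<open>(s, a)\<close>.\<close>

datatype 'c tm = Var nat | Const 'c

datatype ('j, 'c) fm =
    Eq "'j srt" "'c tm" "'c tm"
  | Le "'j srt" "'j srt" "'c tm" "'c tm"
  | Crel "'j srt" "'j srt" "'c tm" "'c tm"
  | Prel "'j srt" "'c tm" "'c tm" "'c tm"
  | Neg "('j, 'c) fm"
  | Conj "('j, 'c) fm" "('j, 'c) fm"
  | Ex "'j srt" nat "('j, 'c) fm"

primrec val :: "('c \<Rightarrow> 'a) \<Rightarrow> (nat \<Rightarrow> 'a) \<Rightarrow> 'c tm \<Rightarrow> 'a" where
  "val I e (Var n) = e n"
| "val I e (Const c) = I c"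

primrec sat ::
    "('j, 'a) lstruct \<Rightarrow> ('c \<Rightarrow> 'a) \<Rightarrow> ('j srt \<Rightarrow> nat \<Rightarrow> 'a) \<Rightarrow> ('j, 'c) fm \<Rightarrow> bool" where
  "sat S I e (Eq s t u) \<longleftrightarrow> val I (e s) t = val I (e s) u"
| "sat S I e (Le s s' t u) \<longleftrightarrow> le S s s' (val I (e s) t) (val I (e s') u)"
| "sat S I e (Crel s s' t u) \<longleftrightarrow> crel S s s' (val I (e s) t) (val I (e s') u)"
| "sat S I e (Prel s t u v) \<longleftrightarrow> prel S s (val I (e s) t) (val I (e s) u) (val I (e s) v)"
| "sat S I e (Neg \<phi>) \<longleftrightarrow> \<not> sat S I e \<phi>"
| "sat S I e (Conj \<phi> \<psi>) \<longleftrightarrow> sat S I e \<phi> \<and> sat S I e \<psi>"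
| "sat S I e (Ex s n \<phi>) \<longleftrightarrow> (\<exists>x \<in> univ S s. sat S I (e(s := (e s)(n := x))) \<phi>)"

primrec tm_vars :: "'j srt \<Rightarrow> 'c tm \<Rightarrow> ('j srt \<times> nat) set" where
  "tm_vars s (Var n) = {(s, n)}"
| "tm_vars s (Const c) = {}"

primrec tm_consts :: "'j srt \<Rightarrow> 'c tm \<Rightarrow> ('j srt \<times> 'c) set" where
  "tm_consts s (Var n) = {}"
| "tm_consts s (Const c) = {(s, c)}"

primrec free_vars :: "('j, 'c) fm \<Rightarrow> ('j srt \<times> nat) set" where
  "free_vars (Eq s t u) = tm_vars s t \<union> tm_vars s u"
| "free_vars (Le s s' t u) = tm_vars s t \<union> tm_vars s' u"
| "free_vars (Crel s s' t u) = tm_vars s t \<union> tm_vars s' u"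
| "free_vars (Prel s t u v) = tm_vars s t \<union> tm_vars s u \<union> tm_vars s v"
| "free_vars (Neg \<phi>) = free_vars \<phi>"
| "free_vars (Conj \<phi> \<psi>) = free_vars \<phi> \<union> free_vars \<psi>"
| "free_vars (Ex s n \<phi>) = free_vars \<phi> - {(s, n)}"

primrec fm_consts :: "('j, 'c) fm \<Rightarrow> ('j srt \<times> 'c) set" where
  "fm_consts (Eq s t u) = tm_consts s t \<union> tm_consts s u"
| "fm_consts (Le s s' t u) = tm_consts s t \<union> tm_consts s' u"
| "fm_consts (Crel s s' t u) = tm_consts s t \<union> tm_consts s' u"
| "fm_consts (Prel s t u v) = tm_consts s t \<union> tm_consts s u \<union> tm_consts s v"
| "fm_consts (Neg \<phi>) = fm_consts \<phi>"
| "fm_consts (Conj \<phi> \<psi>) = fm_consts \<phi> \<union> fm_consts \<psi>"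
| "fm_consts (Ex s n \<phi>) = fm_consts \<phi>"

primrec fm_sorts :: "('j, 'c) fm \<Rightarrow> 'j srt set" where
  "fm_sorts (Eq s t u) = {s}"
| "fm_sorts (Le s s' t u) = {s, s'}"
| "fm_sorts (Crel s s' t u) = {s, s'}"
| "fm_sorts (Prel s t u v) = {s}"
| "fm_sorts (Neg \<phi>) = fm_sorts \<phi>"
| "fm_sorts (Conj \<phi> \<psi>) = fm_sorts \<phi> \<union> fm_sorts \<psi>"
| "fm_sorts (Ex s n \<phi>) = insert s (fm_sorts \<phi>)"

text \<open>The formulas with parameters in \<open>A\<close> and free variables among \<open>x\<^sub>0, \<dots>, x\<^sub>n\<^sub>-\<^sub>1\<close>, where \<open>x\<^sub>i\<close>
  has the sort \<open>\<sigma> ! i\<close> and \<open>n\<close> is the length of \<open>\<sigma>\<close>.\<close>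

definition formulas :: "'j set \<Rightarrow> ('j srt \<times> 'c) set \<Rightarrow> 'j srt list \<Rightarrow> ('j, 'c) fm set" where
  "formulas \<J> A \<sigma> =
     {\<phi>. fm_sorts \<phi> \<subseteq> sorts \<J> \<and> fm_consts \<phi> \<subseteq> A \<and>
         free_vars \<phi> \<subseteq> {(\<sigma> ! i, i) | i. i < length \<sigma>}}"

definition sat_tuple :: "('j, 'a) lstruct \<Rightarrow> 'a list \<Rightarrow> ('j, 'a) fm \<Rightarrow> bool" where
  "sat_tuple S as \<phi> = sat S id (\<lambda>_ i. as ! i) \<phi>"

definition tp ::
    "'j set \<Rightarrow> ('j, 'a) lstruct \<Rightarrow> ('j srt \<times> 'a) set \<Rightarrow> 'j srt \<times> 'a \<Rightarrow> ('j, 'a) fm set" where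
  "tp \<J> S A a = {\<phi> \<in> formulas \<J> A [fst a]. sat_tuple S [snd a] \<phi>}"

definition complete_types ::
    "'j set \<Rightarrow> ('j, 'a) lstruct \<Rightarrow> ('j srt \<times> 'a) set \<Rightarrow> 'j srt list \<Rightarrow> ('j, 'a) fm set set" where
  "complete_types \<J> S A \<sigma> =
     {p. p \<subseteq> formulas \<J> A \<sigma> \<and>
         (\<forall>\<phi> \<in> formulas \<J> A \<sigma>. \<phi> \<in> p \<or> Neg \<phi> \<in> p) \<and>
         (\<forall>q \<subseteq> p. finite q \<longrightarrow>
            (\<exists>as. list_all2 (\<lambda>a s. a \<in> univ S s) as \<sigma> \<and> (\<forall>\<phi> \<in> q. sat_tuple S as \<phi>)))}"

text \<open>Sentences of the language itself have no constants, so neither the type of constants nor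
  their interpretation matters.\<close>

definition holds :: "('j, 'a) lstruct \<Rightarrow> ('j, unit) fm \<Rightarrow> bool" where
  "holds S \<phi> \<longleftrightarrow> (\<forall>I e. sat S I e \<phi>)"

definition Th :: "'j set \<Rightarrow> ('j, 'a) lstruct \<Rightarrow> ('j, unit) fm set" where
  "Th \<J> S = {\<phi> \<in> formulas \<J> {} []. holds S \<phi>}"

text \<open>The models are those with elements of type \<open>'b\<close>; a theorem with \<open>'b\<close> as a free type variable
  speaks about all models.\<close>

definition omega_stable :: "'b itself \<Rightarrow> 'j set \<Rightarrow> ('j, unit) fm set \<Rightarrow> bool" where
  "omega_stable _ \<J> T \<longleftrightarrow>
     (\<forall>(M :: ('j, 'b) lstruct) A \<sigma>.
        (\<forall>\<phi> \<in> T. holds M \<phi>) \<and> A \<subseteq> elements \<J> M \<and> countable A \<and> \<sigma> \<in> lists (sorts \<J>) \<longrightarrow>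
        countable (complete_types \<J> M A \<sigma>))"

end

theory Submission
  imports Defs "HOL-Algebra.Zassenhaus"
begin

text \<open>
  In coordinates, an element of \<open>S\<close> is a coset of an open normal subgroup of \<open>G\<close>, and an isomorphism
  between two subsystems is an isomorphism between two quotients of \<open>G\<close>, i.e. a Goursat
  correspondence \<open>R \<subseteq> G \<times> G\<close>. The co-sorted embedding property extends a correspondence to further
  cosets, so correspondences form a back-and-forth system and preserve all formulas. Since a sort
  bounds the indices of its subgroups, tuples of given sorts fall into finitely many classes under
  correspondences; each class is therefore definable, and tuples have the same type exactly if they
  correspond.

  For (1), the isomorphism determines a correspondence that is the identity modulo \<open>N0\<close>, where the
  elements of \<open>a \<or> A\<close> are the cosets of \<open>N0\<close>; a fibre product extends it by the identity on any finite part
  of \<open>A\<close>. For (2), let \<open>N x\<close> be the intersection of the subgroups of the entries of a tuple \<open>x\<close>. The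
  type of \<open>x\<close> over \<open>A\<close> is determined up to finitely many possibilities by a finite tuple \<open>y\<close> from
  \<open>A\<close> at which the index of \<open>N x N y\<close> is maximal. That index is definable and bounded, so the
  argument transfers to all models of the theory of \<open>S\<close>, and the types over \<open>A\<close> are no more
  than the finite tuples from \<open>A\<close>, up to a countable factor.
\<close>

section \<open>Cosets and correspondences between groups\<close>

text \<open>Two obstacles shape the development. A sort bounds the index of a subgroup only from
  above, and \<open>C\<close> compares cosets only from a larger bound to a smaller one; so an
  element is often exchanged for one with the same coset in another sort, and
  \<open>index G N\<close> is the usual choice of the bound. Moreover, a model of
  \<open>Th \<J> S\<close> is known through its sentences only: neither coordinates nor the
  co-sorted embedding property are at hand there. So types are counted with constant-free formulas.
  Rank is a formula obtained by definability in \<open>S\<close>, and the pigeonhole argument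
  becomes a formula that is valid for all tuples of \<open>S\<close> and is then transferred.
  Definability also does the work of saturation: as each class of tuples is isolated by one formula,
  equivalent tuples can be extended inside \<open>S\<close>. A correspondence controls finitely many
  elements at a time. This suffices because a formula mentions finitely many parameters, and the
  whole of \<open>A\<close> enters only through \<open>N0\<close>, which lies in the product of the
  subgroup of \<open>a\<close> with every subgroup of \<open>A\<close>; this is the condition under
  which the fibre product has projections onto \<open>G\<close>.\<close>

context group
begin

lemma rcos_mem:
  assumes "N \<lhd> G" "a \<in> carrier G"
  shows "x \<in> N #> a \<longleftrightarrow> x \<in> carrier G \<and> x \<otimes> inv a \<in> N"
proof -
  interpret N: normal N G by fact
  have "x \<in> N #> a \<Longrightarrow> x \<in> carrier G"
    using assms(2) N.elemrcos_carrier[OF is_group] by blast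
  then show ?thesis
    using N.rcos_module[OF is_group assms(2)] by blast
qed

lemma rcosets_mem:
  assumes "N \<lhd> G" "c \<in> rcosets N" "x \<in> c"
  shows "y \<in> c \<longleftrightarrow> y \<in> carrier G \<and> y \<otimes> inv x \<in> N"
proof -
  interpret N: normal N G by fact
  obtain a where a: "a \<in> carrier G" "c = N #> a"
    using assms(2) by (auto simp: RCOSETS_def)
  have x: "x \<in> carrier G" using a assms(3) rcos_mem[OF assms(1)] by blast
  have "c = N #> x"
    using a assms(3) repr_independence[OF _ a(1) N.is_subgroup] by auto
  then show ?thesis using rcos_mem[OF assms(1) x] by auto
qed

lemma rcosets_eq_rcos:
  assumes "N \<lhd> G" "c \<in> rcosets N" "x \<in> c"
  shows "c = N #> x" "x \<in> carrier G"
proof -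
  interpret N: normal N G by fact
  show x: "x \<in> carrier G"
    using assms N.rcosets_carrier[OF is_group] by auto
  show "c = N #> x"
    using rcosets_mem[OF assms] rcos_mem[OF assms(1) x] by blast
qed

lemma rcosets_nonempty: "N \<lhd> G \<Longrightarrow> c \<in> rcosets N \<Longrightarrow> c \<noteq> {}"
  using subgroup.rcosets_non_empty[OF normal_imp_subgroup] by blast

lemma rcosets_subset_carrier: "N \<lhd> G \<Longrightarrow> c \<in> rcosets N \<Longrightarrow> c \<subseteq> carrier G"
  using rcosets_eq_rcos(2) by blast

lemma rcosets_eqI:
  assumes "N \<lhd> G" "c \<in> rcosets N" "d \<in> rcosets N" "x \<in> c" "x \<in> d"
  shows "c = d"
  using rcosets_eq_rcos(1)[OF assms(1,2,4)] rcosets_eq_rcos(1)[OF assms(1,3,5)] by simp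

lemma rcos_self_normal: "N \<lhd> G \<Longrightarrow> a \<in> carrier G \<Longrightarrow> a \<in> N #> a"
  by (rule rcos_self[OF _ normal_imp_subgroup])

lemma rcos_in_rcosets: "N \<lhd> G \<Longrightarrow> a \<in> carrier G \<Longrightarrow> N #> a \<in> rcosets N"
  by (auto simp: RCOSETS_def)

lemma rcosets_ex: "N \<lhd> G \<Longrightarrow> a \<in> carrier G \<Longrightarrow> \<exists>c \<in> rcosets N. a \<in> c"
  using rcos_self_normal[of N a] rcos_in_rcosets[of N a] by auto

lemma normal_in_rcosets: "N \<lhd> G \<Longrightarrow> N \<in> rcosets N"
  by (rule subgroup.subgroup_in_rcosets[OF normal_imp_subgroup is_group])

lemma normal_subset: "N \<lhd> G \<Longrightarrow> N \<subseteq> carrier G"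
  by (rule subgroup.subset[OF normal_imp_subgroup])

lemma normal_one: "N \<lhd> G \<Longrightarrow> \<one> \<in> N"
  by (rule subgroup.one_closed[OF normal_imp_subgroup])

lemma normal_mult: "N \<lhd> G \<Longrightarrow> x \<in> N \<Longrightarrow> y \<in> N \<Longrightarrow> x \<otimes> y \<in> N"
  by (rule subgroup.m_closed[OF normal_imp_subgroup])

lemma normal_inv: "N \<lhd> G \<Longrightarrow> x \<in> N \<Longrightarrow> inv x \<in> N"
  by (rule subgroup.m_inv_closed[OF normal_imp_subgroup])

lemma normal_conj: "N \<lhd> G \<Longrightarrow> x \<in> N \<Longrightarrow> g \<in> carrier G \<Longrightarrow> g \<otimes> x \<otimes> inv g \<in> N"
  by (rule normal.inv_op_closed2)

lemma carrier_normal: "carrier G \<lhd> G"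
  by (auto simp: normal_inv_iff subgroup_self)

lemma normal_Int: "M \<lhd> G \<Longrightarrow> N \<lhd> G \<Longrightarrow> M \<inter> N \<lhd> G"
  by (rule normal_subgroup_intersect)

lemma rcosets_carrier_eq: "rcosets (carrier G) = {carrier G}"
proof -
  have "carrier G #> a = carrier G" if "a \<in> carrier G" for a
    using rcos_mem[OF carrier_normal that] that by auto
  then show ?thesis by (auto simp: RCOSETS_def)
qed

text \<open>An element of the structure names a coset only. The stabilizer under left multiplication
  recovers the normal subgroup, so none has to be carried along with a coset.\<close>

definition rstab :: "'a set \<Rightarrow> 'a set" where
  "rstab c = {g \<in> carrier G. \<forall>x \<in> c. g \<otimes> x \<in> c}"

lemma rstab_rcosets:
  assumes "N \<lhd> G" "c \<in> rcosets N"
  shows "rstab c = N"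
proof -
  obtain x where x: "x \<in> c" using rcosets_nonempty assms by blast
  have "y \<in> rstab c \<longleftrightarrow> y \<in> N" for y
  proof
    assume "y \<in> rstab c"
    then have "y \<otimes> x \<in> c" "y \<in> carrier G" using x by (auto simp: rstab_def)
    then have "y \<otimes> x \<otimes> inv x \<in> N" using rcosets_mem[OF assms x] by auto
    moreover have "x \<in> carrier G" using x assms rcosets_eq_rcos by blast
    ultimately show "y \<in> N" using \<open>y \<in> carrier G\<close> by (simp add: m_assoc)
  next
    assume y: "y \<in> N"
    then have yc: "y \<in> carrier G" using assms normal_subset by blast
    have "y \<otimes> z \<in> c" if "z \<in> c" for z
    proof -
      have "z \<in> carrier G" using that assms rcosets_eq_rcos by blast
      then show ?thesis using rcosets_mem[OF assms that] y yc by (simp add: m_assoc)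
    qed
    then show "y \<in> rstab c" using yc by (auto simp: rstab_def)
  qed
  then show ?thesis by blast
qed

section \<open>Counting cosets of normal subgroups\<close>

lemma rcosets_Int_subset:
  assumes "M \<lhd> G" "N \<lhd> G"
  shows "rcosets (M \<inter> N) \<subseteq> (\<lambda>(A, B). A \<inter> B) ` ((rcosets M) \<times> (rcosets N))"
proof
  fix c assume "c \<in> rcosets (M \<inter> N)"
  then obtain a where a: "a \<in> carrier G" "c = (M \<inter> N) #> a" by (auto simp: RCOSETS_def)
  have "c = (M #> a) \<inter> (N #> a)"
    unfolding a(2) using rcos_mem[OF normal_Int[OF assms] a(1)] rcos_mem[OF assms(1) a(1)]
      rcos_mem[OF assms(2) a(1)] by blast
  then show "c \<in> (\<lambda>(A, B). A \<inter> B) ` ((rcosets M) \<times> (rcosets N))"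
    using rcos_in_rcosets assms a by auto
qed

lemma card_rcosets_Int:
  assumes "M \<lhd> G" "N \<lhd> G" "finite (rcosets M)" "finite (rcosets N)"
  shows "card (rcosets (M \<inter> N)) \<le> card (rcosets M) * card (rcosets N)"
  using surj_card_le[OF _ rcosets_Int_subset[OF assms(1,2)]] assms(3,4)
  by (simp add: card_cartesian_product)

text \<open>\<open>c <#> d\<close> is a single coset of \<open>N\<close>, and it meets
  \<open>e\<close>. So a product relation between cosets can be tested on any pair of
  representatives.\<close>

lemma rcosets_mult:
  assumes "N \<lhd> G" "c \<in> rcosets N" "d \<in> rcosets N" "e \<in> rcosets N"
    and "a \<in> c" "b \<in> d" "a \<otimes> b \<in> e" "a' \<in> c" "b' \<in> d"
  shows "a' \<otimes> b' \<in> e"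
proof -
  have "c <#> d \<in> rcosets N" by (rule normal.setmult_closed[OF assms(1-3)])
  moreover have "a \<otimes> b \<in> c <#> d" "a' \<otimes> b' \<in> c <#> d"
    using assms(5,6,8,9) by (auto simp: set_mult_def)
  ultimately show ?thesis using rcosets_eqI[OF assms(1) _ assms(4) _ assms(7)] by blast
qed

text \<open>The product set of \<open>M\<close> and \<open>c\<close>. For \<open>N\<close> contained
  in \<open>M\<close> it is the projection from cosets of \<open>N\<close> to cosets of
  \<open>M\<close>, in a form that does not mention \<open>N\<close>.\<close>

definition cover_coset :: "'a set \<Rightarrow> 'a set \<Rightarrow> 'a set" where
  "cover_coset M c = {y \<in> carrier G. \<exists>x \<in> c. y \<otimes> inv x \<in> M}"

lemma cover_coset_eq:
  assumes "M \<lhd> G" "N \<lhd> G" "N \<subseteq> M" "c \<in> rcosets N" "d \<in> rcosets M" "x \<in> c" "x \<in> d"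
  shows "cover_coset M c = d"
proof -
  have cd: "c \<subseteq> d"
    using rcosets_mem[OF assms(2,4,6)] rcosets_mem[OF assms(1,5,7)] assms(3) by blast
  then have "y \<in> d" if "y \<in> cover_coset M c" for y
    using that rcosets_mem[OF assms(1,5)] unfolding cover_coset_def by blast
  moreover have "y \<in> cover_coset M c" if "y \<in> d" for y
    using that rcosets_mem[OF assms(1,5,7)] assms(6) unfolding cover_coset_def by blast
  ultimately show ?thesis by blast
qed

lemma cover_coset_image:
  assumes "M \<lhd> G" "N \<lhd> G" "N \<subseteq> M"
  shows "cover_coset M ` (rcosets N) = rcosets M"
proof (intro equalityI subsetI)
  fix d assume "d \<in> cover_coset M ` (rcosets N)"
  then obtain c where c: "c \<in> rcosets N" "d = cover_coset M c" by blast
  obtain x where x: "x \<in> c" using rcosets_nonempty[OF assms(2) c(1)] by blast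
  obtain d' where d': "d' \<in> rcosets M" "x \<in> d'"
    using rcosets_ex[OF assms(1) rcosets_eq_rcos(2)[OF assms(2) c(1) x]] by blast
  show "d \<in> rcosets M"
    using cover_coset_eq[OF assms c(1) d'(1) x d'(2)] c(2) d'(1) by simp
next
  fix d assume d: "d \<in> rcosets M"
  obtain x where x: "x \<in> d" using rcosets_nonempty[OF assms(1) d(1)] by blast
  obtain c where c: "c \<in> rcosets N" "x \<in> c"
    using rcosets_ex[OF assms(2) rcosets_eq_rcos(2)[OF assms(1) d(1) x]] by blast
  show "d \<in> cover_coset M ` (rcosets N)"
    using cover_coset_eq[OF assms c(1) d(1) c(2) x] c(1) by blast
qed

lemma card_rcosets_mono:
  assumes "M \<lhd> G" "N \<lhd> G" "N \<subseteq> M" "finite (rcosets N)"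
  shows "card (rcosets M) \<le> card (rcosets N)" "finite (rcosets M)"
  using cover_coset_image[OF assms(1-3)] assms(4) card_image_le[OF assms(4), of "cover_coset M"]
  by (metis, metis finite_imageI)

lemma rcosets_sub_coset:
  assumes "M \<lhd> G" "N \<lhd> G" "N \<subseteq> M" "c \<in> rcosets N" "d \<in> rcosets M" "x \<in> c" "x \<in> d"
  shows "c \<subseteq> d"
  using rcosets_mem[OF assms(2,4,6)] rcosets_mem[OF assms(1,5,7)] assms(3) by blast

text \<open>The projection \<open>cover_coset M\<close> is onto, hence injective by counting. Every
  coset of \<open>N\<close> that meets \<open>M\<close> goes to \<open>M\<close>, as
  \<open>N\<close> itself does, so there is only one.\<close>

lemma card_rcosets_eq_imp_eq:
  assumes "M \<lhd> G" "N \<lhd> G" "N \<subseteq> M" "finite (rcosets N)" "card (rcosets N) \<le> card (rcosets M)"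
  shows "M = N"
proof -
  have "card (cover_coset M ` (rcosets N)) = card (rcosets N)"
    using cover_coset_image[OF assms(1-3)] card_rcosets_mono[OF assms(1-4)] assms(5) by simp
  then have inj: "inj_on (cover_coset M) (rcosets N)"
    by (rule eq_card_imp_inj_on[OF assms(4)])
  have "m \<in> N" if m: "m \<in> M" for m
  proof -
    obtain c where c: "c \<in> rcosets N" "m \<in> c"
      using rcosets_ex[OF assms(2)] m normal_subset[OF assms(1)] by blast
    have "cover_coset M c = M"
      by (rule cover_coset_eq[OF assms(1-3) c(1) normal_in_rcosets[OF assms(1)] c(2) m])
    moreover have "cover_coset M N = M"
      by (rule cover_coset_eq[OF assms(1-3) normal_in_rcosets[OF assms(2)]
            normal_in_rcosets[OF assms(1)] normal_one[OF assms(2)] normal_one[OF assms(1)]])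
    ultimately have "c = N"
      using inj_onD[OF inj _ c(1) normal_in_rcosets[OF assms(2)]] by simp
    then show ?thesis using c by simp
  qed
  then show ?thesis using assms(3) by blast
qed

section \<open>Products of normal subgroups\<close>

lemma set_mult_iff: "x \<in> M <#> N \<longleftrightarrow> (\<exists>m \<in> M. \<exists>n \<in> N. x = m \<otimes> n)"
  by (auto simp: set_mult_def)

lemma set_mult_normal:
  assumes "M \<lhd> G" "N \<lhd> G"
  shows "M <#> N \<lhd> G" "M \<subseteq> M <#> N" "N \<subseteq> M <#> N"
proof -
  show "M <#> N \<lhd> G"
  proof (subst normal_inv_iff, intro conjI ballI)
    show "subgroup (M <#> N) G"
      by (rule mult_norm_subgroup[OF assms(1) normal_imp_subgroup[OF assms(2)]])
    fix x h assume x: "x \<in> carrier G" and "h \<in> M <#> N"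
    then obtain m n where mn: "m \<in> M" "n \<in> N" "h = m \<otimes> n" unfolding set_mult_iff by blast
    then have c: "m \<in> carrier G" "n \<in> carrier G" using assms normal_subset by blast+
    have "(x \<otimes> m \<otimes> inv x) \<otimes> (x \<otimes> n \<otimes> inv x) = x \<otimes> m \<otimes> ((inv x \<otimes> x) \<otimes> (n \<otimes> inv x))"
      using c x by (simp only: m_assoc m_closed inv_closed)
    then have "x \<otimes> h \<otimes> inv x = (x \<otimes> m \<otimes> inv x) \<otimes> (x \<otimes> n \<otimes> inv x)"
      using mn c x by (simp add: m_assoc)
    then show "x \<otimes> h \<otimes> inv x \<in> M <#> N"
      using normal_conj[OF assms(1) mn(1) x] normal_conj[OF assms(2) mn(2) x]
      unfolding set_mult_iff by blast
  qed
  show "M \<subseteq> M <#> N"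
    unfolding set_mult_iff subset_iff
    using normal_one[OF assms(2)] normal_subset[OF assms(1)] r_one by (metis subsetD)
  show "N \<subseteq> M <#> N"
    unfolding set_mult_iff subset_iff
    using normal_one[OF assms(1)] normal_subset[OF assms(2)] l_one by (metis subsetD)
qed

lemma set_mult_least:
  assumes "M \<lhd> G" "M1 \<subseteq> M" "M2 \<subseteq> M"
  shows "M1 <#> M2 \<subseteq> M"
  using assms(2,3) normal_mult[OF assms(1)] unfolding set_mult_iff subset_iff by blast

end

text \<open>A Goursat correspondence, i.e. a subgroup of \<open>H \<times> G\<close> with both projections onto: it carries
  the same information as an isomorphism between a quotient of \<open>H\<close> and a quotient of \<open>G\<close>.\<close>

definition goursat ::
    "('h, 'm) monoid_scheme \<Rightarrow> ('g, 'n) monoid_scheme \<Rightarrow> ('h \<times> 'g) set \<Rightarrow> bool" where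
  "goursat H G R \<longleftrightarrow>
     R \<subseteq> carrier H \<times> carrier G \<and>
     (\<forall>h \<in> carrier H. \<exists>g. (h, g) \<in> R) \<and> (\<forall>g \<in> carrier G. \<exists>h. (h, g) \<in> R) \<and>
     (\<forall>h g h' g'. (h, g) \<in> R \<and> (h', g') \<in> R \<longrightarrow> (h \<otimes>\<^bsub>H\<^esub> h', g \<otimes>\<^bsub>G\<^esub> g') \<in> R) \<and>
     (\<forall>h g. (h, g) \<in> R \<longrightarrow> (inv\<^bsub>H\<^esub> h, inv\<^bsub>G\<^esub> g) \<in> R)"

text \<open>For a Goursat correspondence, \<open>C\<close> and \<open>D\<close> are the two
  pullbacks of one subset of the common quotient. The pointwise form passes directly to converses,
  composites and intersections, which an equation for the image of \<open>C\<close> would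
  not.\<close>

definition matches :: "('h \<times> 'g) set \<Rightarrow> 'h set \<Rightarrow> 'g set \<Rightarrow> bool" where
  "matches R C D \<longleftrightarrow> (\<forall>h g. (h, g) \<in> R \<longrightarrow> (h \<in> C \<longleftrightarrow> g \<in> D))"

lemma goursatD:
  assumes "goursat H G R"
  shows "(h, g) \<in> R \<Longrightarrow> h \<in> carrier H" "(h, g) \<in> R \<Longrightarrow> g \<in> carrier G"
    "h \<in> carrier H \<Longrightarrow> \<exists>g. (h, g) \<in> R" "g \<in> carrier G \<Longrightarrow> \<exists>h. (h, g) \<in> R"
    "(h, g) \<in> R \<Longrightarrow> (h', g') \<in> R \<Longrightarrow> (h \<otimes>\<^bsub>H\<^esub> h', g \<otimes>\<^bsub>G\<^esub> g') \<in> R"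
    "(h, g) \<in> R \<Longrightarrow> (inv\<^bsub>H\<^esub> h, inv\<^bsub>G\<^esub> g) \<in> R"
proof -
  have R: "R \<subseteq> carrier H \<times> carrier G"
    using assms unfolding goursat_def by (elim conjE)
  then show "(h, g) \<in> R \<Longrightarrow> h \<in> carrier H" "(h, g) \<in> R \<Longrightarrow> g \<in> carrier G" by auto
  note a = assms[unfolded goursat_def, THEN conjunct2]
  note 1 = a[THEN conjunct1] and b = a[THEN conjunct2]
  note 2 = b[THEN conjunct1] and c = b[THEN conjunct2]
  note 3 = c[THEN conjunct1] and 4 = c[THEN conjunct2]
  show "h \<in> carrier H \<Longrightarrow> \<exists>g. (h, g) \<in> R" using 1 by (rule bspec)
  show "g \<in> carrier G \<Longrightarrow> \<exists>h. (h, g) \<in> R" using 2 by (rule bspec)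
  show "(h, g) \<in> R \<Longrightarrow> (h', g') \<in> R \<Longrightarrow> (h \<otimes>\<^bsub>H\<^esub> h', g \<otimes>\<^bsub>G\<^esub> g') \<in> R"
    using 3[rule_format, of h g h' g'] by simp
  show "(h, g) \<in> R \<Longrightarrow> (inv\<^bsub>H\<^esub> h, inv\<^bsub>G\<^esub> g) \<in> R"
    using 4[rule_format, of h g] by simp
qed

lemma goursatI:
  assumes "\<And>h g. (h, g) \<in> R \<Longrightarrow> h \<in> carrier H \<and> g \<in> carrier G"
    and "\<And>h. h \<in> carrier H \<Longrightarrow> \<exists>g. (h, g) \<in> R" "\<And>g. g \<in> carrier G \<Longrightarrow> \<exists>h. (h, g) \<in> R"
    and "\<And>h g h' g'. (h, g) \<in> R \<Longrightarrow> (h', g') \<in> R \<Longrightarrow> (h \<otimes>\<^bsub>H\<^esub> h', g \<otimes>\<^bsub>G\<^esub> g') \<in> R"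
    and "\<And>h g. (h, g) \<in> R \<Longrightarrow> (inv\<^bsub>H\<^esub> h, inv\<^bsub>G\<^esub> g) \<in> R"
  shows "goursat H G R"
  unfolding goursat_def
proof (intro conjI ballI allI impI subsetI)
  fix p assume "p \<in> R" then show "p \<in> carrier H \<times> carrier G" using assms(1) by (cases p) simp
qed (use assms(2,3) in \<open>simp_all\<close>, (elim conjE, rule assms(4); assumption), rule assms(5))

lemma goursat_converse:
  assumes "goursat H G R" shows "goursat G H (R\<inverse>)"
proof (rule goursatI; unfold converse_iff)
  note d = goursatD[OF assms]
  show "g \<in> carrier G \<and> h \<in> carrier H" if "(h, g) \<in> R" for g h using d(1,2)[OF that] by simp
qed (fact goursatD[OF assms])+

lemma goursat_comp:
  assumes "goursat K H Q" "goursat H G R"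
  shows "goursat K G (Q O R)"
proof -
  note q = goursatD[OF assms(1)] and r = goursatD[OF assms(2)]
  have "\<exists>g. (k, g) \<in> Q O R" if kK: "k \<in> carrier K" for k
  proof -
    obtain h where h: "(k, h) \<in> Q" using q(3)[OF kK] by blast
    then obtain g where "(h, g) \<in> R" using q(2)[OF h] r(3) by blast
    then show ?thesis using h by blast
  qed
  moreover have "\<exists>k. (k, g) \<in> Q O R" if gG: "g \<in> carrier G" for g
  proof -
    obtain h where h: "(h, g) \<in> R" using r(4)[OF gG] by blast
    then obtain k where "(k, h) \<in> Q" using r(1)[OF h] q(4) by blast
    then show ?thesis using h by blast
  qed
  moreover have "(k \<otimes>\<^bsub>K\<^esub> k', g \<otimes>\<^bsub>G\<^esub> g') \<in> Q O R" if kg: "(k, g) \<in> Q O R" "(k', g') \<in> Q O R" for k k' g g'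
  proof -
    obtain h h' where h: "(k, h) \<in> Q" "(h, g) \<in> R" "(k', h') \<in> Q" "(h', g') \<in> R"
      using kg by (auto simp: relcomp_unfold)
    show ?thesis
      using q(5)[OF h(1,3)] r(5)[OF h(2,4)] by (rule relcompI)
  qed
  moreover have "(inv\<^bsub>K\<^esub> k, inv\<^bsub>G\<^esub> g) \<in> Q O R" if kg: "(k, g) \<in> Q O R" for k g
  proof -
    obtain h where h: "(k, h) \<in> Q" "(h, g) \<in> R" using kg by (auto simp: relcomp_unfold)
    show ?thesis using q(6)[OF h(1)] r(6)[OF h(2)] by (rule relcompI)
  qed
  moreover have "k \<in> carrier K \<and> g \<in> carrier G" if kg: "(k, g) \<in> Q O R" for k g
    using kg q(1) r(2) by auto
  ultimately show ?thesis by (intro goursatI)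
qed

lemma matches_converse: "matches (R\<inverse>) D C \<longleftrightarrow> matches R C D"
  unfolding matches_def by blast

lemma matches_comp: "matches Q B C \<Longrightarrow> matches R C D \<Longrightarrow> matches (Q O R) B D"
  unfolding matches_def by blast

lemma matches_Int: "matches R C D \<Longrightarrow> matches R C' D' \<Longrightarrow> matches R (C \<inter> C') (D \<inter> D')"
  unfolding matches_def by blast

lemma matches_carrier: "goursat H G R \<Longrightarrow> matches R (carrier H) (carrier G)"
  unfolding matches_def using goursatD(1,2)[of H G R] by blast

lemma matches_subset:
  assumes "goursat H G R" "matches R C D" "matches R C' D'" "C \<subseteq> carrier H" "D \<subseteq> carrier G"
  shows "C \<subseteq> C' \<longleftrightarrow> D \<subseteq> D'"
proof
  assume sub: "C \<subseteq> C'"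
  show "D \<subseteq> D'"
  proof
    fix g assume g: "g \<in> D"
    then obtain h where h: "(h, g) \<in> R" using goursatD(4)[OF assms(1)] assms(5) by blast
    then show "g \<in> D'" using g assms(2,3) sub unfolding matches_def by blast
  qed
next
  assume sub: "D \<subseteq> D'"
  show "C \<subseteq> C'"
  proof
    fix h assume h: "h \<in> C"
    then obtain g where g: "(h, g) \<in> R" using goursatD(3)[OF assms(1)] assms(4) by blast
    then show "h \<in> C'" using h assms(2,3) sub unfolding matches_def by blast
  qed
qed

lemma matches_unique:
  assumes "goursat H G R" "matches R C D" "matches R C D'" "D \<subseteq> carrier G" "D' \<subseteq> carrier G"
  shows "D = D'"
proof -
  have "g \<in> D \<longleftrightarrow> g \<in> D'" if "g \<in> carrier G" for g
    using goursatD(4)[OF assms(1) that] assms(2,3) unfolding matches_def by blast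
  then show ?thesis using assms(4,5) by blast
qed

lemma matches_unique':
  assumes "goursat H G R" "matches R C D" "matches R C' D" "C \<subseteq> carrier H" "C' \<subseteq> carrier H"
  shows "C = C'"
proof -
  have "h \<in> C \<longleftrightarrow> h \<in> C'" if "h \<in> carrier H" for h
    using goursatD(3)[OF assms(1) that] assms(2,3) unfolding matches_def by blast
  then show ?thesis using assms(4,5) by blast
qed

section \<open>Transport of cosets and normal subgroups along a correspondence\<close>

locale two_groups = H: group H + G: group G for H (structure) and G (structure) +
  fixes R
  assumes gour: "goursat H G R"
begin

lemmas gourD = goursatD[OF gour]

lemma matches_rstab_aux:
  assumes m: "matches R C D" and "D \<subseteq> carrier G" and hg: "(h, g) \<in> R" and h: "h \<in> H.rstab C"
  shows "g \<in> G.rstab D"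
proof -
  have "g \<otimes>\<^bsub>G\<^esub> y \<in> D" if y: "y \<in> D" for y
  proof -
    obtain x where x: "(x, y) \<in> R" using gourD(4) y assms(2) by blast
    then have "x \<in> C" using m y by (auto simp: matches_def)
    then have "h \<otimes>\<^bsub>H\<^esub> x \<in> C" using h by (auto simp: H.rstab_def)
    then show ?thesis using gourD(5)[OF hg x] m by (auto simp: matches_def)
  qed
  then show ?thesis using gourD(2)[OF hg] by (auto simp: G.rstab_def)
qed

text \<open>An element lies in \<open>c\<close> iff its quotient by a fixed \<open>a\<close> in
  \<open>c\<close> lies in \<open>N\<close>. As \<open>R\<close> is closed under products and
  inverses, this passes to the partners, with a partner of \<open>a\<close> as the new base
  point.\<close>

lemma image_coset:
  assumes "N \<lhd> H" "N' \<lhd> G" "matches R N N'" "c \<in> rcosets\<^bsub>H\<^esub> N"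
  shows "R `` c \<in> rcosets\<^bsub>G\<^esub> N'" "matches R c (R `` c)"
proof -
  obtain a where a: "a \<in> c" using H.rcosets_nonempty assms by blast
  then have ac: "a \<in> carrier H" using H.rcosets_eq_rcos assms by blast
  then obtain a' where a': "(a, a') \<in> R" using gourD(3) by blast
  have a'c: "a' \<in> carrier G" using gourD(2) a' by blast
  have key: "h \<in> c \<longleftrightarrow> g \<in> N' #>\<^bsub>G\<^esub> a'" if "(h, g) \<in> R" for h g
  proof -
    have "(h \<otimes>\<^bsub>H\<^esub> inv\<^bsub>H\<^esub> a, g \<otimes>\<^bsub>G\<^esub> inv\<^bsub>G\<^esub> a') \<in> R"
      by (rule gourD(5)[OF that gourD(6)[OF a']])
    then show ?thesis
      using H.rcosets_mem[OF assms(1,4) a, of h] G.rcos_mem[OF assms(2) a'c, of g] assms(3)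
        gourD(1,2)[OF that]
      unfolding matches_def by blast
  qed
  have "R `` c = N' #>\<^bsub>G\<^esub> a'"
  proof (intro equalityI subsetI)
    fix g assume "g \<in> R `` c" then show "g \<in> N' #>\<^bsub>G\<^esub> a'" using key by blast
  next
    fix g assume g: "g \<in> N' #>\<^bsub>G\<^esub> a'"
    then have "g \<in> carrier G" using G.rcos_mem[OF assms(2) a'c] by blast
    then obtain h where "(h, g) \<in> R" using gourD(4) by blast
    then show "g \<in> R `` c" using key g by blast
  qed
  then show "R `` c \<in> rcosets\<^bsub>G\<^esub> N'" "matches R c (R `` c)"
    using key G.rcos_in_rcosets[OF assms(2) a'c] by (auto simp: matches_def)
qed

end

lemma two_groups_sym:
  assumes "two_groups H G R" shows "two_groups G H (R\<inverse>)"
  using assms goursat_converse[of H G R] by (simp add: two_groups_def two_groups_axioms_def)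

context two_groups
begin

lemma matches_rstab:
  assumes "matches R C D" "C \<subseteq> carrier H" "D \<subseteq> carrier G"
  shows "matches R (H.rstab C) (G.rstab D)"
proof -
  interpret conv: two_groups G H "R\<inverse>" by (rule two_groups_sym) unfold_locales
  show ?thesis
    unfolding matches_def
    using matches_rstab_aux[OF assms(1,3)] conv.matches_rstab_aux[of D C] assms
    by (auto simp: matches_converse)
qed

text \<open>A normal subgroup is the stabilizer of each of its cosets, and stabilizers of matching
  sets match. So it is enough to keep track of matching cosets.\<close>

lemma matches_normal:
  assumes "N \<lhd> H" "N' \<lhd> G" "c \<in> rcosets\<^bsub>H\<^esub> N" "d \<in> rcosets\<^bsub>G\<^esub> N'" "matches R c d"
  shows "matches R N N'"
  using matches_rstab[OF assms(5) H.rcosets_subset_carrier[OF assms(1,3)]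
      G.rcosets_subset_carrier[OF assms(2,4)]]
  unfolding H.rstab_rcosets[OF assms(1,3)] G.rstab_rcosets[OF assms(2,4)] .

text \<open>Two elements with a common partner differ by an element of \<open>N\<close>, because the
  identity lies in \<open>N'\<close>. Hence a subgroup above \<open>N\<close> is a union of classes
  of \<open>R\<close> and matches its image.\<close>

lemma image_normal:
  assumes "N \<lhd> H" "N' \<lhd> G" "matches R N N'" "N \<subseteq> M" "M \<lhd> H"
  shows "R `` M \<lhd> G" "N' \<subseteq> R `` M" "matches R M (R `` M)"
proof -
  have key: "h \<in> M \<longleftrightarrow> g \<in> R `` M" if hg: "(h, g) \<in> R" for h g
  proof
    assume "g \<in> R `` M"
    then obtain k where k: "k \<in> M" "(k, g) \<in> R" by blast
    have c: "h \<in> carrier H" "k \<in> carrier H" "g \<in> carrier G" using gourD(1,2)[OF hg] gourD(1)[OF k(2)] by blast+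
    have "(h \<otimes>\<^bsub>H\<^esub> inv\<^bsub>H\<^esub> k, g \<otimes>\<^bsub>G\<^esub> inv\<^bsub>G\<^esub> g) \<in> R"
      by (rule gourD(5)[OF hg gourD(6)[OF k(2)]])
    then have "h \<otimes>\<^bsub>H\<^esub> inv\<^bsub>H\<^esub> k \<in> N"
      using assms(3) c G.normal_one[OF assms(2)] by (auto simp: matches_def)
    then have "(h \<otimes>\<^bsub>H\<^esub> inv\<^bsub>H\<^esub> k) \<otimes>\<^bsub>H\<^esub> k \<in> M"
      using H.normal_mult[OF assms(5)] assms(4) k by blast
    then show "h \<in> M" using c by (simp add: H.m_assoc)
  qed (use hg in blast)
  then show "matches R M (R `` M)" by (auto simp: matches_def)
  have sub: "R `` M \<subseteq> carrier G" using gourD(2) by blast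
  show "N' \<subseteq> R `` M"
    using assms(3,4) gourD(4) G.normal_subset[OF assms(2)] unfolding matches_def by blast
  show "R `` M \<lhd> G"
  proof (subst G.normal_inv_iff, intro conjI ballI)
    show "subgroup (R `` M) G"
    proof (rule G.subgroupI)
      show "R `` M \<subseteq> carrier G" by (rule sub)
      show "R `` M \<noteq> {}" using H.normal_one[OF assms(5)] gourD(3)[of "\<one>\<^bsub>H\<^esub>"] by blast
      show "inv\<^bsub>G\<^esub> g \<in> R `` M" if g: "g \<in> R `` M" for g
      proof -
        obtain h where h: "h \<in> M" "(h, g) \<in> R" using g by blast
        show ?thesis using gourD(6)[OF h(2)] H.normal_inv[OF assms(5) h(1)] by blast
      qed
      show "g \<otimes>\<^bsub>G\<^esub> g' \<in> R `` M" if g: "g \<in> R `` M" "g' \<in> R `` M" for g g'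
      proof -
        obtain h where h: "h \<in> M" "(h, g) \<in> R" using g by blast
        obtain h' where h': "h' \<in> M" "(h', g') \<in> R" using g by blast
        show ?thesis using gourD(5)[OF h(2) h'(2)] H.normal_mult[OF assms(5) h(1) h'(1)] by blast
      qed
    qed
    fix x g assume x: "x \<in> carrier G" and "g \<in> R `` M"
    then obtain h where h: "h \<in> M" "(h, g) \<in> R" by blast
    obtain y where y: "(y, x) \<in> R" using gourD(4) x by blast
    have "(y \<otimes>\<^bsub>H\<^esub> h \<otimes>\<^bsub>H\<^esub> inv\<^bsub>H\<^esub> y, x \<otimes>\<^bsub>G\<^esub> g \<otimes>\<^bsub>G\<^esub> inv\<^bsub>G\<^esub> x) \<in> R"
      by (rule gourD(5)[OF gourD(5)[OF y h(2)] gourD(6)[OF y]])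
    then show "x \<otimes>\<^bsub>G\<^esub> g \<otimes>\<^bsub>G\<^esub> inv\<^bsub>G\<^esub> x \<in> R `` M"
      using H.normal_conj[OF assms(5) h(1)] gourD(1)[OF y] by blast
  qed
qed

lemma rcosets_bij:
  assumes "N \<lhd> H" "N' \<lhd> G" "matches R N N'"
  shows "bij_betw (\<lambda>c. R `` c) (rcosets\<^bsub>H\<^esub> N) (rcosets\<^bsub>G\<^esub> N')"
proof -
  interpret conv: two_groups G H "R\<inverse>" by (rule two_groups_sym) unfold_locales
  have m': "matches (R\<inverse>) N' N" using assms(3) by (simp add: matches_converse)
  have "R\<inverse> `` (R `` c) = c" if "c \<in> rcosets\<^bsub>H\<^esub> N" for c
    using image_coset[OF assms that] conv.image_coset[OF assms(2,1) m']
      matches_unique'[OF gour] H.rcosets_subset_carrier[OF assms(1)] that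
    by (metis matches_converse)
  moreover have "R `` (R\<inverse> `` d) = d" if "d \<in> rcosets\<^bsub>G\<^esub> N'" for d
    using conv.image_coset[OF assms(2,1) m' that] image_coset[OF assms]
      matches_unique[OF gour] G.rcosets_subset_carrier[OF assms(2)] that
    by (metis matches_converse)
  ultimately show ?thesis
    using image_coset(1)[OF assms] conv.image_coset(1)[OF assms(2,1) m']
    by (intro bij_betw_byWitness[where f' = "\<lambda>d. R\<inverse> `` d"]) auto
qed

text \<open>Correspondences preserve indices, and therefore the bounds that sorts impose on
  them.\<close>

lemma card_rcosets_eq:
  assumes "N \<lhd> H" "N' \<lhd> G" "matches R N N'"
  shows "card (rcosets\<^bsub>H\<^esub> N) = card (rcosets\<^bsub>G\<^esub> N')"
  using rcosets_bij[OF assms] bij_betw_same_card by blast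

end

section \<open>Coordinates of a sorted complete system\<close>

locale sorted_group =
  fixes \<J> :: "'j set" and Jsub :: "nat \<Rightarrow> 'j list \<Rightarrow> 'j list"
    and G :: "'g monoid" (structure) and X :: "'g topology" and F :: "'g set \<Rightarrow> 'j list set"
  assumes sorted: "sorted_profinite_group \<J> Jsub G X F"
begin

lemma profinite: "profinite_group G X" and data: "sorting_data \<J> Jsub G X F"
  using sorted by (simp_all add: sorted_profinite_group_def)

sublocale group G
  using profinite by (simp add: profinite_group_def)

lemma top_carrier: "topspace X = carrier G" and compact: "compact_space X"
  using profinite by (simp_all add: profinite_group_def)

abbreviation ON :: "'g set set" where "ON \<equiv> open_normal G X"

lemma ON_normal: "N \<in> ON \<Longrightarrow> N \<lhd> G" and ON_open: "N \<in> ON \<Longrightarrow> openin X N"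
  by (simp_all add: open_normal_def)

text \<open>The coset is the preimage of \<open>N\<close> under right multiplication by the inverse
  of \<open>a\<close>, which is continuous.\<close>

lemma open_rcoset:
  assumes "N \<in> ON" "a \<in> carrier G"
  shows "openin X (N #> a)"
proof -
  have "continuous_map X (prod_topology X X) (\<lambda>x. (x, inv a))"
    using assms by (auto simp: continuous_map_pairwise o_def top_carrier)
  moreover have "continuous_map (prod_topology X X) X (\<lambda>(x, y). x \<otimes> y)"
    using profinite by (simp add: profinite_group_def)
  ultimately have "continuous_map X X ((\<lambda>(x, y). x \<otimes> y) \<circ> (\<lambda>x. (x, inv a)))"
    by (rule continuous_map_compose)
  then have "openin X {x \<in> topspace X. ((\<lambda>(x, y). x \<otimes> y) \<circ> (\<lambda>x. (x, inv a))) x \<in> N}"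
    by (rule openin_continuous_map_preimage) (rule ON_open[OF assms(1)])
  also have "{x \<in> topspace X. ((\<lambda>(x, y). x \<otimes> y) \<circ> (\<lambda>x. (x, inv a))) x \<in> N} = N #> a"
    using rcos_mem[OF ON_normal[OF assms(1)] assms(2)] by (auto simp: top_carrier)
  finally show ?thesis .
qed

text \<open>The cosets form an open cover of a compact space by disjoint nonempty sets, so a finite
  subcover already contains all of them.\<close>

lemma finite_rcosets:
  assumes "N \<in> ON" shows "finite (rcosets N)"
proof -
  note n = ON_normal[OF assms]
  have cover: "carrier G \<subseteq> \<Union> (rcosets N)" using rcosets_ex[OF n] by blast
  have "\<forall>U \<in> rcosets N. openin X U"
    using open_rcoset[OF assms] by (auto simp: RCOSETS_def)
  then obtain V where V: "finite V" "V \<subseteq> rcosets N" "carrier G \<subseteq> \<Union>V"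
    using compact cover unfolding compact_space_def compactin_def top_carrier by blast
  have "rcosets N \<subseteq> V"
  proof
    fix c assume c: "c \<in> rcosets N"
    obtain x where x: "x \<in> c" using rcosets_nonempty[OF n c] by blast
    then obtain d where d: "d \<in> V" "x \<in> d" using rcosets_eq_rcos(2)[OF n c x] V(3) by blast
    then have "c = d" using rcosets_eqI[OF n c _ x] V(2) by blast
    then show "c \<in> V" using d by simp
  qed
  then show ?thesis using V(1) finite_subset by blast
qed

lemma carrier_ON: "carrier G \<in> ON"
  using carrier_normal openin_topspace[of X] by (simp add: open_normal_def top_carrier)

lemma Int_ON: "M \<in> ON \<Longrightarrow> N \<in> ON \<Longrightarrow> M \<inter> N \<in> ON"
  by (simp add: open_normal_def normal_Int openin_Int)

text \<open>\<open>M\<close> is a union of cosets of \<open>N\<close>, and these are open.\<close>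

lemma upper_ON:
  assumes "N \<in> ON" "N \<subseteq> M" "M \<lhd> G"
  shows "M \<in> ON"
proof -
  have "N #> a \<subseteq> M" if "a \<in> M" for a
    using assms(2) normal_mult[OF assms(3) _ that] by (auto simp: r_coset_def)
  moreover have "a \<in> N #> a" "openin X (N #> a)" if "a \<in> M" for a
    using rcos_self_normal[OF ON_normal[OF assms(1)]] open_rcoset[OF assms(1)]
      that normal_subset[OF assms(3)] by blast+
  ultimately have "openin X M" by (subst openin_subopen) blast
  then show ?thesis using assms(3) by (simp add: open_normal_def)
qed

lemma set_mult_ON: "M \<in> ON \<Longrightarrow> N \<lhd> G \<Longrightarrow> M <#> N \<in> ON"
  using upper_ON[OF _ set_mult_normal(2,1)] ON_normal by blast

lemma index_carrier: "index G (carrier G) = 1"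
  by (simp add: index_def rcosets_carrier_eq)

lemma index_mono: "M \<in> ON \<Longrightarrow> N \<in> ON \<Longrightarrow> N \<subseteq> M \<Longrightarrow> index G M \<le> index G N"
  unfolding index_def using card_rcosets_mono(1) ON_normal finite_rcosets by blast

lemma index_eq_imp_eq: "M \<in> ON \<Longrightarrow> N \<in> ON \<Longrightarrow> N \<subseteq> M \<Longrightarrow> index G N \<le> index G M \<Longrightarrow> M = N"
  unfolding index_def using card_rcosets_eq_imp_eq ON_normal finite_rcosets by blast

lemma index_Int: "M \<in> ON \<Longrightarrow> N \<in> ON \<Longrightarrow> index G (M \<inter> N) \<le> index G M * index G N"
  unfolding index_def using card_rcosets_Int ON_normal finite_rcosets by blast

lemma index_pos: "N \<in> ON \<Longrightarrow> 1 \<le> index G N"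
  unfolding index_def
  using finite_rcosets normal_in_rcosets[OF ON_normal] card_gt_0_iff[of "rcosets N"]
  by (metis One_nat_def Suc_leI empty_iff)

lemma F_seqs: "N \<in> ON \<Longrightarrow> F N \<subseteq> seqs \<J>"
  and F_nonempty: "N \<in> ON \<Longrightarrow> F N \<noteq> {}"
  and F_carrier: "F (carrier G) = seqs \<J>"
  and F_sqrt: "N \<in> ON \<Longrightarrow> J \<in> F N \<Longrightarrow> J' \<in> sqrt_seq \<J> J \<Longrightarrow> J' \<in> F N"
  and F_up: "N \<in> ON \<Longrightarrow> M \<in> ON \<Longrightarrow> k \<ge> 1 \<Longrightarrow> N \<subseteq> M \<Longrightarrow> index G N \<le> k \<Longrightarrow> J \<in> F N \<Longrightarrow>
     Jsub k J \<in> F M"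
  and F_Int: "N \<in> ON \<Longrightarrow> M \<in> ON \<Longrightarrow> J \<in> F N \<Longrightarrow> J' \<in> F M \<Longrightarrow> J @ J' \<in> F (N \<inter> M)"
proof -
  note d = data[unfolded sorting_data_def]
  show s: "N \<in> ON \<Longrightarrow> F N \<subseteq> seqs \<J>" using d[THEN conjunct1] by simp
  show "N \<in> ON \<Longrightarrow> F N \<noteq> {}" using d[THEN conjunct1] by simp
  note d = d[THEN conjunct2]
  show "F (carrier G) = seqs \<J>" using d[THEN conjunct1] by simp
  note d = d[THEN conjunct2]
  show "N \<in> ON \<Longrightarrow> J \<in> F N \<Longrightarrow> J' \<in> sqrt_seq \<J> J \<Longrightarrow> J' \<in> F N"
    using d[THEN conjunct1] s by blast
  note d = d[THEN conjunct2]
  show "N \<in> ON \<Longrightarrow> M \<in> ON \<Longrightarrow> k \<ge> 1 \<Longrightarrow> N \<subseteq> M \<Longrightarrow> index G N \<le> k \<Longrightarrow> J \<in> F N \<Longrightarrow>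
     Jsub k J \<in> F M"
    using d[THEN conjunct1] by blast
  note d = d[THEN conjunct2]
  show "N \<in> ON \<Longrightarrow> M \<in> ON \<Longrightarrow> J \<in> F N \<Longrightarrow> J' \<in> F M \<Longrightarrow> J @ J' \<in> F (N \<inter> M)"
    using d by blast
qed

lemma seqs_nonempty: "seqs \<J> \<noteq> {}"
  using F_nonempty[OF carrier_ON] F_carrier by simp

lemma ex_cs_univ:
  "(c, k') \<in> univ (complete_system G X F) (k, J) \<longleftrightarrow>
     k' = k \<and> (\<exists>N \<in> ON. index G N \<le> k \<and> J \<in> F N \<and> c \<in> rcosets N)"
  by (auto simp: complete_system_def FactGroup_def)

end

text \<open>An arbitrary structure with fixed coordinates in a complete system. The type of the
  group elements is left open because embeddings compare systems whose coordinates lie in different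
  groups.\<close>

locale coords = sorted_group \<J> Jsub G X F
  for \<J> :: "'j set" and Jsub and G :: "'g monoid" (structure) and X F +
  fixes S :: "('j, 'a) lstruct" and h :: "'j srt \<Rightarrow> 'a \<Rightarrow> 'g set \<times> nat"
  assumes iso: "isomorphism \<J> S (complete_system G X F) h"
begin

definition cst :: "'j srt \<times> 'a \<Rightarrow> 'g set" where
  "cst z = fst (h (fst z) (snd z))"

text \<open>Computed from the coset alone: elements with the same coset have the same subgroup even
  if their sorts differ.\<close>

definition nrm :: "'j srt \<times> 'a \<Rightarrow> 'g set" where
  "nrm z = rstab (cst z)"

lemma h_emb: "embedding \<J> S (complete_system G X F) h"
  using iso by (simp add: isomorphism_def)

lemma h_elem:
  assumes "((k, J), x) \<in> elements \<J> S"
  shows "h (k, J) x = (cst ((k, J), x), k)"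
    "\<exists>N \<in> ON. index G N \<le> k \<and> J \<in> F N \<and> cst ((k, J), x) \<in> rcosets N"
proof -
  have "h (k, J) x \<in> univ (complete_system G X F) (k, J)"
    using assms iso by (auto simp: isomorphism_def elements_def)
  moreover obtain c k' where ck: "h (k, J) x = (c, k')" by force
  ultimately show "h (k, J) x = (cst ((k, J), x), k)"
    "\<exists>N \<in> ON. index G N \<le> k \<and> J \<in> F N \<and> cst ((k, J), x) \<in> rcosets N"
    using ex_cs_univ by (auto simp: cst_def)
qed

lemma elem_props:
  assumes "z \<in> elements \<J> S"
  shows "nrm z \<in> ON" "cst z \<in> rcosets (nrm z)" "index G (nrm z) \<le> fst (fst z)"
    "snd (fst z) \<in> F (nrm z)"
proof -
  obtain k J x where z: "z = ((k, J), x)" by (metis prod.exhaust)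
  obtain N where N: "N \<in> ON" "index G N \<le> k" "J \<in> F N" "cst z \<in> rcosets N"
    using h_elem(2) assms z by blast
  then have "nrm z = N" using rstab_rcosets[OF ON_normal] by (simp add: nrm_def)
  then show "nrm z \<in> ON" "cst z \<in> rcosets (nrm z)" "index G (nrm z) \<le> fst (fst z)"
    "snd (fst z) \<in> F (nrm z)" using N z by auto
qed

lemma nrm_normal: "z \<in> elements \<J> S \<Longrightarrow> nrm z \<lhd> G"
  using elem_props(1) ON_normal by blast

lemma nrm_subset: "z \<in> elements \<J> S \<Longrightarrow> nrm z \<subseteq> carrier G"
  using nrm_normal normal_subset by blast

lemma cst_subset: "z \<in> elements \<J> S \<Longrightarrow> cst z \<subseteq> carrier G"
  using elem_props(2) rcosets_subset_carrier[OF nrm_normal] by blast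

lemma cst_nonempty: "z \<in> elements \<J> S \<Longrightarrow> cst z \<noteq> {}"
  using elem_props(2) rcosets_nonempty[OF nrm_normal] by blast

lemma nrm_eqI: "z \<in> elements \<J> S \<Longrightarrow> N \<lhd> G \<Longrightarrow> cst z \<in> rcosets N \<Longrightarrow> nrm z = N"
  using rstab_rcosets by (simp add: nrm_def)

lemma elem_exists:
  assumes "s \<in> sorts \<J>" "N \<in> ON" "index G N \<le> fst s" "snd s \<in> F N" "c \<in> rcosets N"
  shows "\<exists>x. (s, x) \<in> elements \<J> S \<and> cst (s, x) = c \<and> nrm (s, x) = N"
proof -
  obtain k J where s: "s = (k, J)" by force
  have "(c, k) \<in> univ (complete_system G X F) s"
    unfolding s ex_cs_univ using assms s by auto
  then have "(c, k) \<in> h s ` univ S s"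
    using iso assms(1) by (auto simp: isomorphism_def)
  then obtain x where x: "x \<in> univ S s" "h s x = (c, k)" by auto
  then have e: "(s, x) \<in> elements \<J> S" "cst (s, x) = c"
    using assms(1) by (simp_all add: elements_def cst_def)
  then show ?thesis using nrm_eqI[OF e(1) ON_normal[OF assms(2)]] assms(5) by auto
qed

lemma cst_inj:
  assumes "z \<in> elements \<J> S" "w \<in> elements \<J> S" "fst z = fst w" "cst z = cst w"
  shows "z = w"
proof -
  obtain k J x y where z: "z = ((k, J), x)" "w = ((k, J), y)" by (metis assms(3) prod.exhaust_sel)
  have "h (k, J) x = h (k, J) y" using h_elem(1)[of k J] assms z by auto
  then have "x = y"
    using h_emb assms z by (auto simp: embedding_def elements_def dest!: inj_onD)
  then show ?thesis using z by simp
qed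

lemma le_iff:
  assumes "(s, x) \<in> elements \<J> S" "(t, y) \<in> elements \<J> S"
  shows "le S s t x y \<longleftrightarrow> nrm (s, x) \<subseteq> nrm (t, y)"
proof -
  obtain k J k' J' where s: "s = (k, J)" "t = (k', J')" by (metis prod.exhaust)
  have "le S s t x y \<longleftrightarrow> le (complete_system G X F) s t (h s x) (h t y)"
    using h_emb assms by (auto simp: embedding_def elements_def)
  also have "\<dots> \<longleftrightarrow> (\<exists>N \<in> ON. \<exists>N' \<in> ON. cst (s, x) \<in> rcosets N \<and> cst (t, y) \<in> rcosets N' \<and> N \<subseteq> N')"
    using h_elem(1) assms s by (simp add: complete_system_def FactGroup_def)
  also have "\<dots> \<longleftrightarrow> nrm (s, x) \<subseteq> nrm (t, y)"
    using elem_props(1,2)[OF assms(1)] elem_props(1,2)[OF assms(2)] nrm_eqI[OF assms(1) ON_normal]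
      nrm_eqI[OF assms(2) ON_normal] by blast
  finally show ?thesis .
qed

lemma crel_iff:
  assumes "(s, x) \<in> elements \<J> S" "(t, y) \<in> elements \<J> S"
  shows "crel S s t x y \<longleftrightarrow> fst t \<le> fst s \<and> cst (s, x) \<subseteq> cst (t, y)"
proof -
  obtain k J k' J' where s: "s = (k, J)" "t = (k', J')" by (metis prod.exhaust)
  have "crel S s t x y \<longleftrightarrow> crel (complete_system G X F) s t (h s x) (h t y)"
    using h_emb assms by (auto simp: embedding_def elements_def)
  also have "\<dots> \<longleftrightarrow> fst t \<le> fst s \<and> cst (s, x) \<subseteq> cst (t, y)"
    using h_elem(1) assms s by (simp add: complete_system_def)
  finally show ?thesis .
qed

text \<open>The right-hand side speaks of single group elements instead of products of cosets; this
  is the form that a correspondence carries over.\<close>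

lemma prel_iff:
  assumes "(s, x) \<in> elements \<J> S" "(s, y) \<in> elements \<J> S" "(s, z) \<in> elements \<J> S"
  shows "prel S s x y z \<longleftrightarrow> nrm (s, x) = nrm (s, y) \<and> nrm (s, z) = nrm (s, x) \<and>
    (\<exists>g \<in> cst (s, x). \<exists>g' \<in> cst (s, y). g \<otimes> g' \<in> cst (s, z))"
proof -
  obtain k J where s: "s = (k, J)" by (metis prod.exhaust)
  have "prel S s x y z \<longleftrightarrow> prel (complete_system G X F) s (h s x) (h s y) (h s z)"
    using h_emb assms by (auto simp: embedding_def elements_def)
  also have "\<dots> \<longleftrightarrow> (\<exists>N \<in> ON. cst (s, x) \<in> rcosets N \<and> cst (s, y) \<in> rcosets N \<and>
      cst (s, z) = cst (s, x) <#> cst (s, y))"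
    using h_elem(1) assms s by (simp add: complete_system_def FactGroup_def)
  also have "\<dots> \<longleftrightarrow> nrm (s, x) = nrm (s, y) \<and> nrm (s, z) = nrm (s, x) \<and>
    (\<exists>g \<in> cst (s, x). \<exists>g' \<in> cst (s, y). g \<otimes> g' \<in> cst (s, z))" (is "?L \<longleftrightarrow> ?R")
  proof -
    have prod: "cst (s, x) <#> cst (s, y) \<in> rcosets N"
      if "N \<in> ON" "cst (s, x) \<in> rcosets N" "cst (s, y) \<in> rcosets N" for N
      using normal.setmult_closed[OF ON_normal] that by blast
    show ?thesis
    proof
      assume ?L
      then obtain N where N: "N \<in> ON" "cst (s, x) \<in> rcosets N" "cst (s, y) \<in> rcosets N"
        and p: "cst (s, z) = cst (s, x) <#> cst (s, y)" by blast
      have "nrm (s, x) = N" "nrm (s, y) = N" "nrm (s, z) = N"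
        using nrm_eqI[OF assms(1) ON_normal[OF N(1)] N(2)] nrm_eqI[OF assms(2) ON_normal[OF N(1)] N(3)]
          nrm_eqI[OF assms(3) ON_normal[OF N(1)]] prod[OF N] p by auto
      moreover obtain g g' where "g \<in> cst (s, x)" "g' \<in> cst (s, y)"
        using cst_nonempty assms by blast
      moreover from this have "g \<otimes> g' \<in> cst (s, z)" unfolding p set_mult_iff by blast
      ultimately show ?R by blast
    next
      assume R: ?R
      then obtain g g' where g: "g \<in> cst (s, x)" "g' \<in> cst (s, y)" "g \<otimes> g' \<in> cst (s, z)" by blast
      let ?N = "nrm (s, x)"
      have N: "?N \<in> ON" "cst (s, x) \<in> rcosets ?N" "cst (s, y) \<in> rcosets ?N" "cst (s, z) \<in> rcosets ?N"
        using elem_props(1,2)[OF assms(1)] elem_props(2)[OF assms(2)] elem_props(2)[OF assms(3)] R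
        by auto
      have "g \<otimes> g' \<in> cst (s, x) <#> cst (s, y)" using g unfolding set_mult_iff by blast
      then have "cst (s, z) = cst (s, x) <#> cst (s, y)"
        using rcosets_eqI[OF ON_normal[OF N(1)] N(4) prod[OF N(1-3)] g(3)] by blast
      then show ?L using N by blast
    qed
  qed
  finally show ?thesis .
qed

end

section \<open>Embeddings and correspondences\<close>

lemma (in group) rcosets_mem_iff_subset:
  assumes "M \<lhd> G" "N \<lhd> G" "N \<subseteq> M" "c \<in> rcosets N" "d \<in> rcosets M" "x \<in> c"
  shows "x \<in> d \<longleftrightarrow> c \<subseteq> d"
  using rcosets_sub_coset[OF assms] assms(6) by blast

definition emb :: "('j srt \<Rightarrow> 'a \<Rightarrow> 'b) \<Rightarrow> 'j srt \<times> 'a \<Rightarrow> 'j srt \<times> 'b" where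
  "emb \<psi> z = (fst z, \<psi> (fst z) (snd z))"

lemma emb_simps [simp]: "fst (emb \<psi> z) = fst z" "emb \<psi> (s, x) = (s, \<psi> s x)"
  by (simp_all add: emb_def)

text \<open>In \<open>embedding_correspondence\<close> this is instantiated twice for one subsystem
  \<open>B\<close>, with \<open>\<psi>\<close> the inclusion and with \<open>\<psi>\<close> an
  arbitrary embedding; the group of \<open>B\<close> then mediates between the two.\<close>

locale two_coords =
  B: coords \<J> Jsub H XH FH B hH + S: coords \<J> Jsub G X F S h
  for \<J> :: "'j set" and Jsub and H :: "'h monoid" (structure) and XH FH
    and B :: "('j, 'a) lstruct" and hH and G :: "'g monoid" (structure) and X F
    and S :: "('j, 'b) lstruct" and h +
  fixes \<psi> :: "'j srt \<Rightarrow> 'a \<Rightarrow> 'b"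
  assumes psi: "embedding \<J> B S \<psi>"
begin

abbreviation "e \<equiv> emb \<psi>"

lemma e_elem: "z \<in> elements \<J> B \<Longrightarrow> e z \<in> elements \<J> S"
  using psi by (force simp: embedding_def elements_def emb_def)

lemma e_inj: "z \<in> elements \<J> B \<Longrightarrow> w \<in> elements \<J> B \<Longrightarrow> e z = e w \<Longrightarrow> z = w"
proof -
  assume a: "z \<in> elements \<J> B" "w \<in> elements \<J> B" "e z = e w"
  then have "fst z = fst w" "\<psi> (fst z) (snd z) = \<psi> (fst z) (snd w)" by (auto simp: emb_def)
  moreover have "inj_on (\<psi> (fst z)) (univ B (fst z))" "snd z \<in> univ B (fst z)" "snd w \<in> univ B (fst z)"
    using psi a(1,2) \<open>fst z = fst w\<close> by (auto simp: embedding_def elements_def)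
  ultimately show "z = w" by (metis inj_onD prod.expand)
qed

lemma e_le:
  assumes "z \<in> elements \<J> B" "w \<in> elements \<J> B"
  shows "B.nrm z \<subseteq> B.nrm w \<longleftrightarrow> S.nrm (e z) \<subseteq> S.nrm (e w)"
proof -
  obtain s x t y where z: "z = (s, x)" "w = (t, y)" by (metis prod.exhaust)
  have "le B s t x y \<longleftrightarrow> le S s t (\<psi> s x) (\<psi> t y)"
    using psi assms z by (auto simp: embedding_def elements_def)
  then show ?thesis
    using B.le_iff[of s x t y] S.le_iff[of s "\<psi> s x" t "\<psi> t y"] assms z e_elem[of z] e_elem[of w]
    by simp
qed

text \<open>The relation \<open>C\<close> includes a condition on first components, so inclusion of
  cosets is visible to an embedding only from a larger bound to a smaller one.\<close>

lemma e_crel: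
  assumes "z \<in> elements \<J> B" "w \<in> elements \<J> B" "fst (fst w) \<le> fst (fst z)"
  shows "B.cst z \<subseteq> B.cst w \<longleftrightarrow> S.cst (e z) \<subseteq> S.cst (e w)"
proof -
  obtain s x t y where z: "z = (s, x)" "w = (t, y)" by (metis prod.exhaust)
  have "crel B s t x y \<longleftrightarrow> crel S s t (\<psi> s x) (\<psi> t y)"
    using psi assms z by (auto simp: embedding_def elements_def)
  then show ?thesis
    using B.crel_iff[of s x t y] S.crel_iff[of s "\<psi> s x" t "\<psi> t y"] assms z e_elem[of z] e_elem[of w]
    by simp
qed

lemma e_prel:
  assumes "(s, x) \<in> elements \<J> B" "(s, y) \<in> elements \<J> B" "(s, z) \<in> elements \<J> B"
  shows "prel B s x y z \<longleftrightarrow> prel S s (\<psi> s x) (\<psi> s y) (\<psi> s z)"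
  using psi assms by (auto simp: embedding_def elements_def)

text \<open>One of the two bounds is the larger, so \<open>e_crel\<close> gives an inclusion between
  the image cosets. Both are cosets of the same subgroup, hence equal.\<close>

lemma e_cst_eq:
  assumes "z \<in> elements \<J> B" "w \<in> elements \<J> B" "B.cst z = B.cst w"
  shows "S.cst (e z) = S.cst (e w)"
proof -
  have *: "S.cst (e z) = S.cst (e w)" if zw: "z \<in> elements \<J> B" "w \<in> elements \<J> B" "B.cst z = B.cst w"
    and le: "fst (fst w) \<le> fst (fst z)" for z w
  proof -
    have sub: "S.cst (e z) \<subseteq> S.cst (e w)" using e_crel[OF zw(1,2) le] zw(3) by simp
    have "B.nrm z = B.nrm w" using zw(3) by (simp add: B.nrm_def)
    then have n: "S.nrm (e z) = S.nrm (e w)" using e_le zw(1,2) by blast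
    obtain g where g: "g \<in> S.cst (e z)" using S.cst_nonempty[OF e_elem[OF zw(1)]] by blast
    show ?thesis
      using S.rcosets_eqI[OF S.nrm_normal[OF e_elem[OF zw(2)]] _ S.elem_props(2)[OF e_elem[OF zw(2)]] g]
        S.elem_props(2)[OF e_elem[OF zw(1)]] n g sub by auto
  qed
  show ?thesis
    using *[OF assms] *[OF assms(2,1) assms(3)[symmetric]] by (metis nat_le_linear)
qed

text \<open>The elements of \<open>B\<close> in a sort \<open>(k, J)\<close> whose first component is exactly the index of \<open>N\<close>
  are as many as the cosets of \<open>N\<close>; the bound \<open>k\<close> on the index of the image then makes the
  map from the cosets of \<open>N\<close> to those of the image onto.\<close>

definition corr :: "'j srt \<times> 'a \<Rightarrow> ('h \<times> 'g) set" where
  "corr b = (let s = (index H (B.nrm b), snd (fst b)) in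
     {(x, g). \<exists>z. (s, z) \<in> elements \<J> B \<and> B.nrm (s, z) = B.nrm b \<and> x \<in> B.cst (s, z) \<and>
        g \<in> S.cst (s, \<psi> s z)})"

context
  fixes b s N
  assumes b: "b \<in> elements \<J> B"
    and s_def: "s = (index H (B.nrm b), snd (fst b))" and N_def: "N = B.nrm b"
begin

lemma s_sort: "s \<in> sorts \<J>"
proof -
  obtain t x where "b = (t, x)" by (cases b)
  then have "t \<in> sorts \<J>" using b by (simp add: elements_def)
  then show ?thesis
    using B.index_pos[OF B.elem_props(1)[OF b]] \<open>b = (t, x)\<close> by (auto simp: s_def sorts_def)
qed

lemma N_ON: "N \<in> B.ON" and N_normal: "N \<lhd> H"
  using B.elem_props(1)[OF b] B.ON_normal by (simp_all add: N_def)

lemma class_exists: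
  assumes "c \<in> rcosets\<^bsub>H\<^esub> N"
  obtains z where "(s, z) \<in> elements \<J> B" "B.cst (s, z) = c" "B.nrm (s, z) = N"
  using B.elem_exists[OF s_sort N_ON _ _ assms] B.elem_props(4)[OF b] by (auto simp: s_def N_def)

lemma corr_iff:
  "(x, g) \<in> corr b \<longleftrightarrow> (\<exists>z. (s, z) \<in> elements \<J> B \<and> B.nrm (s, z) = N \<and> x \<in> B.cst (s, z) \<and>
        g \<in> S.cst (s, \<psi> s z))"
  by (simp add: corr_def Let_def s_def N_def)

definition "img = S.nrm (e b)"

lemma img_ON: "img \<in> S.ON" and img_normal: "img \<lhd> G"
  using S.elem_props(1)[OF e_elem[OF b]] S.ON_normal by (simp_all add: img_def)

lemma class_img:
  assumes "(s, z) \<in> elements \<J> B" "B.nrm (s, z) = N"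
  shows "S.nrm (s, \<psi> s z) = img" "S.cst (s, \<psi> s z) \<in> rcosets\<^bsub>G\<^esub> img" "B.cst (s, z) \<in> rcosets\<^bsub>H\<^esub> N"
proof -
  show n: "S.nrm (s, \<psi> s z) = img"
    using e_le[OF assms(1) b] e_le[OF b assms(1)] assms(2) by (simp add: img_def N_def)
  show "S.cst (s, \<psi> s z) \<in> rcosets\<^bsub>G\<^esub> img"
    using S.elem_props(2)[OF e_elem[OF assms(1)]] n by simp
  show "B.cst (s, z) \<in> rcosets\<^bsub>H\<^esub> N" using B.elem_props(2)[OF assms(1)] assms(2) by simp
qed

lemma cosets_onto:
  assumes "d \<in> rcosets\<^bsub>G\<^esub> img"
  obtains z where "(s, z) \<in> elements \<J> B" "B.nrm (s, z) = N" "S.cst (s, \<psi> s z) = d"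
proof -
  define Z where "Z = {z. (s, z) \<in> elements \<J> B \<and> B.nrm (s, z) = N}"
  have bij: "bij_betw (\<lambda>z. B.cst (s, z)) Z (rcosets\<^bsub>H\<^esub> N)"
  proof (rule bij_betw_imageI)
    show "inj_on (\<lambda>z. B.cst (s, z)) Z"
    proof (rule inj_onI)
      fix z w assume "z \<in> Z" "w \<in> Z" "B.cst (s, z) = B.cst (s, w)"
      then have "(s, z) = (s, w)" by (intro B.cst_inj) (auto simp: Z_def)
      then show "z = w" by simp
    qed
    show "(\<lambda>z. B.cst (s, z)) ` Z = rcosets\<^bsub>H\<^esub> N"
    proof (intro equalityI subsetI)
      fix c assume "c \<in> rcosets\<^bsub>H\<^esub> N"
      then show "c \<in> (\<lambda>z. B.cst (s, z)) ` Z" by (elim class_exists) (auto simp: Z_def)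
    qed (use class_img(3) in \<open>auto simp: Z_def\<close>)
  qed
  have cZ: "card Z = fst s"
    using bij_betw_same_card[OF bij] by (simp add: index_def s_def N_def)
  have fZ: "finite Z"
    using bij_betw_finite[OF bij] B.finite_rcosets[OF N_ON] by simp
  have inj: "inj_on (\<lambda>z. S.cst (s, \<psi> s z)) Z"
  proof (rule inj_onI)
    fix z w assume z: "z \<in> Z" "w \<in> Z" and eq: "S.cst (s, \<psi> s z) = S.cst (s, \<psi> s w)"
    then have el: "(s, z) \<in> elements \<J> B" "(s, w) \<in> elements \<J> B" by (auto simp: Z_def)
    have "e (s, z) = e (s, w)" using S.cst_inj[OF e_elem[OF el(1)] e_elem[OF el(2)]] eq by simp
    then show "z = w" using e_inj[OF el] by simp
  qed
  obtain c where "c \<in> rcosets\<^bsub>H\<^esub> N" using B.normal_in_rcosets[OF N_normal] by blast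
  then obtain z0 where z0: "(s, z0) \<in> elements \<J> B" "B.nrm (s, z0) = N" by (elim class_exists)
  \<comment> \<open>The images stay in the sort \<open>s\<close>, whose first component is the
    cardinality of \<open>Z\<close>. Here the preservation of sorts bounds the index of the
    image.\<close>
  have "index G img \<le> fst s"
    using S.elem_props(3)[OF e_elem[OF z0(1)]] class_img(1)[OF z0] by simp
  then have "card (rcosets\<^bsub>G\<^esub> img) \<le> card ((\<lambda>z. S.cst (s, \<psi> s z)) ` Z)"
    using card_image[OF inj] cZ by (simp add: index_def)
  moreover have "(\<lambda>z. S.cst (s, \<psi> s z)) ` Z \<subseteq> rcosets\<^bsub>G\<^esub> img"
    using class_img(2) by (auto simp: Z_def)
  ultimately have "(\<lambda>z. S.cst (s, \<psi> s z)) ` Z = rcosets\<^bsub>G\<^esub> img"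
    using S.finite_rcosets[OF img_ON] card_seteq by blast
  then have "d \<in> (\<lambda>z. S.cst (s, \<psi> s z)) ` Z" using assms by simp
  then show ?thesis using that by (auto simp: Z_def)
qed

lemma corr_mult:
  assumes "(x, g) \<in> corr b" "(x', g') \<in> corr b"
  shows "(x \<otimes>\<^bsub>H\<^esub> x', g \<otimes>\<^bsub>G\<^esub> g') \<in> corr b"
proof -
  obtain z where z: "(s, z) \<in> elements \<J> B" "B.nrm (s, z) = N" "x \<in> B.cst (s, z)" "g \<in> S.cst (s, \<psi> s z)"
    using assms(1) unfolding corr_iff by blast
  obtain w where w: "(s, w) \<in> elements \<J> B" "B.nrm (s, w) = N" "x' \<in> B.cst (s, w)" "g' \<in> S.cst (s, \<psi> s w)"
    using assms(2) unfolding corr_iff by blast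
  have "x \<otimes>\<^bsub>H\<^esub> x' \<in> carrier H"
    using z(1,3) w(1,3) B.cst_subset by blast
  then obtain c where c: "c \<in> rcosets\<^bsub>H\<^esub> N" "x \<otimes>\<^bsub>H\<^esub> x' \<in> c" using B.rcosets_ex[OF N_normal] by blast
  obtain v where v: "(s, v) \<in> elements \<J> B" "B.cst (s, v) = c" "B.nrm (s, v) = N"
    using class_exists[OF c(1)] .
  have "prel B s z w v" using B.prel_iff[OF z(1) w(1) v(1)] z w v c by auto
  then have "prel S s (\<psi> s z) (\<psi> s w) (\<psi> s v)" using e_prel[OF z(1) w(1) v(1)] by simp
  then obtain y y' where y: "y \<in> S.cst (s, \<psi> s z)" "y' \<in> S.cst (s, \<psi> s w)" "y \<otimes>\<^bsub>G\<^esub> y' \<in> S.cst (s, \<psi> s v)"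
    using S.prel_iff[of s "\<psi> s z" "\<psi> s w" "\<psi> s v"] e_elem[OF z(1)] e_elem[OF w(1)] e_elem[OF v(1)]
    by auto
  have "g \<otimes>\<^bsub>G\<^esub> g' \<in> S.cst (s, \<psi> s v)"
    by (rule S.rcosets_mult[OF img_normal class_img(2)[OF z(1,2)] class_img(2)[OF w(1,2)]
          class_img(2)[OF v(1,3)] y z(4) w(4)])
  then show ?thesis unfolding corr_iff using v c by blast
qed

lemma corr_carrier: "(x, g) \<in> corr b \<Longrightarrow> x \<in> carrier H \<and> g \<in> carrier G"
  unfolding corr_iff using B.cst_subset S.cst_subset[OF e_elem] by fastforce

lemma corr_left:
  assumes "x \<in> carrier H" shows "\<exists>g. (x, g) \<in> corr b"
proof -
  obtain c where c: "c \<in> rcosets\<^bsub>H\<^esub> N" "x \<in> c" using B.rcosets_ex[OF N_normal assms] by blast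
  obtain z where z: "(s, z) \<in> elements \<J> B" "B.cst (s, z) = c" "B.nrm (s, z) = N"
    using class_exists[OF c(1)] .
  obtain g where "g \<in> S.cst (s, \<psi> s z)" using S.cst_nonempty[OF e_elem[OF z(1)]] by auto
  then show ?thesis unfolding corr_iff using z c by blast
qed

lemma corr_right:
  assumes "g \<in> carrier G" shows "\<exists>x. (x, g) \<in> corr b"
proof -
  obtain d where d: "d \<in> rcosets\<^bsub>G\<^esub> img" "g \<in> d" using S.rcosets_ex[OF img_normal assms] by blast
  obtain z where z: "(s, z) \<in> elements \<J> B" "B.nrm (s, z) = N" "S.cst (s, \<psi> s z) = d"
    using cosets_onto[OF d(1)] .
  obtain x where "x \<in> B.cst (s, z)" using B.cst_nonempty[OF z(1)] by auto
  then show ?thesis unfolding corr_iff using z d by blast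
qed

text \<open>The language has no symbol for inverses. Let \<open>g1\<close> be a partner of the
  inverse of \<open>x\<close>. Then \<open>u = g1 g\<close> is a partner of the identity, and so is
  \<open>u u\<close>; both lie in one coset of \<open>img\<close>, so \<open>u\<close> lies in
  \<open>img\<close>, and \<open>g1\<close> and the inverse of \<open>g\<close> lie in the same
  coset.\<close>

lemma corr_inv:
  assumes "(x, g) \<in> corr b" shows "(inv\<^bsub>H\<^esub> x, inv\<^bsub>G\<^esub> g) \<in> corr b"
proof -
  have c: "x \<in> carrier H" "g \<in> carrier G" using corr_carrier[OF assms] by auto
  obtain g1 where g1: "(inv\<^bsub>H\<^esub> x, g1) \<in> corr b" using corr_left c(1) by blast
  then have c1: "g1 \<in> carrier G" using corr_carrier by blast
  define u where "u = g1 \<otimes>\<^bsub>G\<^esub> g"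
  have uc: "u \<in> carrier G" using c c1 by (simp add: u_def)
  have u: "(\<one>\<^bsub>H\<^esub>, u) \<in> corr b" using corr_mult[OF g1 assms] c by (simp add: u_def)
  have "(\<one>\<^bsub>H\<^esub>, u \<otimes>\<^bsub>G\<^esub> u) \<in> corr b" using corr_mult[OF u u] by simp
  then obtain z where z: "(s, z) \<in> elements \<J> B" "B.nrm (s, z) = N" "\<one>\<^bsub>H\<^esub> \<in> B.cst (s, z)"
      "u \<otimes>\<^bsub>G\<^esub> u \<in> S.cst (s, \<psi> s z)"
    unfolding corr_iff by blast
  obtain w where w: "(s, w) \<in> elements \<J> B" "B.nrm (s, w) = N" "\<one>\<^bsub>H\<^esub> \<in> B.cst (s, w)" "u \<in> S.cst (s, \<psi> s w)"
    using u unfolding corr_iff by blast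
  have "B.cst (s, z) = B.cst (s, w)"
    by (rule B.rcosets_eqI[OF N_normal class_img(3)[OF z(1,2)] class_img(3)[OF w(1,2)] z(3) w(3)])
  then have "z = w" using B.cst_inj[OF z(1) w(1)] by simp
  then have "(u \<otimes>\<^bsub>G\<^esub> u) \<otimes>\<^bsub>G\<^esub> inv\<^bsub>G\<^esub> u \<in> img"
    using S.rcosets_mem[OF img_normal class_img(2)[OF w(1,2)] w(4)] z(4) by blast
  then have "u \<in> img" using uc by (simp add: S.m_assoc)
  then have "inv\<^bsub>G\<^esub> u \<in> img" by (rule S.normal_inv[OF img_normal])
  then have *: "inv\<^bsub>G\<^esub> g \<otimes>\<^bsub>G\<^esub> inv\<^bsub>G\<^esub> g1 \<in> img"
    using c c1 by (simp add: u_def S.inv_mult_group)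
  obtain v where v: "(s, v) \<in> elements \<J> B" "B.nrm (s, v) = N" "inv\<^bsub>H\<^esub> x \<in> B.cst (s, v)" "g1 \<in> S.cst (s, \<psi> s v)"
    using g1 unfolding corr_iff by blast
  have "inv\<^bsub>G\<^esub> g \<in> S.cst (s, \<psi> s v)"
    using S.rcosets_mem[OF img_normal class_img(2)[OF v(1,2)] v(4)] * c by blast
  then show ?thesis unfolding corr_iff using v by blast
qed

lemma corr_matches:
  assumes b': "b' \<in> elements \<J> B" "B.nrm b \<subseteq> B.nrm b'"
  shows "matches (corr b) (B.cst b') (S.cst (e b'))"
  unfolding matches_def
proof (intro allI impI)
  fix x g assume "(x, g) \<in> corr b"
  then obtain z where z: "(s, z) \<in> elements \<J> B" "B.nrm (s, z) = N" "x \<in> B.cst (s, z)" "g \<in> S.cst (s, \<psi> s z)"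
    unfolding corr_iff by blast
  \<comment> \<open>\<open>crel\<close> needs the larger bound on the left, so the coset is
    represented once more in a sort whose first component dominates that of
    \<open>b'\<close>.\<close>
  define t where "t = (max (fst s) (fst (fst b')), snd s)"
  have "t \<in> sorts \<J>" using s_sort by (auto simp: t_def sorts_def)
  moreover have "index H N \<le> fst t" "snd t \<in> FH N"
    using B.elem_props(3,4)[OF z(1)] z(2) by (simp_all add: t_def)
  ultimately obtain w where w: "(t, w) \<in> elements \<J> B" "B.cst (t, w) = B.cst (s, z)" "B.nrm (t, w) = N"
    using B.elem_exists[OF _ N_ON _ _ class_img(3)[OF z(1,2)]] by blast
  have eq: "S.cst (e (t, w)) = S.cst (e (s, z))"
    by (rule e_cst_eq[OF w(1) z(1) w(2)])
  have "x \<in> B.cst b' \<longleftrightarrow> B.cst (t, w) \<subseteq> B.cst b'"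
    using B.rcosets_mem_iff_subset[OF B.nrm_normal[OF b'(1)] N_normal _ _ B.elem_props(2)[OF b'(1)]]
      class_img(3)[OF z(1,2)] z(3) w(2) b'(2) N_def by auto
  also have "\<dots> \<longleftrightarrow> S.cst (e (t, w)) \<subseteq> S.cst (e b')"
    by (rule e_crel[OF w(1) b'(1)]) (simp add: t_def)
  also have "\<dots> \<longleftrightarrow> g \<in> S.cst (e b')"
  proof -
    have "S.nrm (e b) \<subseteq> S.nrm (e b')" using e_le[OF b b'(1)] b'(2) by simp
    then have "img \<subseteq> S.nrm (e b')" by (simp add: img_def)
    moreover have "S.cst (e (t, w)) \<in> rcosets\<^bsub>G\<^esub> img" "g \<in> S.cst (e (t, w))"
      using class_img(2)[OF z(1,2)] eq z(4) by auto
    ultimately show ?thesis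
      using S.rcosets_mem_iff_subset[OF S.nrm_normal[OF e_elem[OF b'(1)]] img_normal _ _
          S.elem_props(2)[OF e_elem[OF b'(1)]]] by blast
  qed
  finally show "x \<in> B.cst b' \<longleftrightarrow> g \<in> S.cst (e b')" .
qed

end

lemma corr_goursat:
  assumes "b \<in> elements \<J> B" shows "goursat H G (corr b)"
  using corr_carrier[OF assms refl refl] corr_left[OF assms refl refl]
    corr_right[OF assms refl refl] corr_mult[OF assms refl refl] corr_inv[OF assms refl refl]
  by (rule goursatI)

lemma corr_two_groups: "b \<in> elements \<J> B \<Longrightarrow> two_groups H G (corr b)"
  using corr_goursat by unfold_locales

lemma corr_matches_nrm:
  assumes "b \<in> elements \<J> B" "b' \<in> elements \<J> B" "B.nrm b \<subseteq> B.nrm b'"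
  shows "matches (corr b) (B.nrm b') (S.nrm (e b'))"
  by (rule two_groups.matches_normal[OF corr_two_groups[OF assms(1)] B.nrm_normal[OF assms(2)]
        S.nrm_normal[OF e_elem[OF assms(2)]] B.elem_props(2)[OF assms(2)]
        S.elem_props(2)[OF e_elem[OF assms(2)]] corr_matches[OF assms(1) refl refl assms(2,3)]])

text \<open>The coset of \<open>(s, y)\<close> is pulled back to a coset of \<open>M\<close>, which
  is represented in \<open>B\<close> in the same sort since indices are preserved. The image of that
  element has the sort and the coset of \<open>(s, y)\<close>, and these determine an
  element.\<close>

lemma in_image:
  assumes b: "b \<in> elements \<J> B" and y: "(s, y) \<in> elements \<J> S"
    and M: "M \<in> B.ON" "B.nrm b \<subseteq> M" "matches (corr b) M (S.nrm (s, y))" "snd s \<in> FH M"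
  shows "(s, y) \<in> e ` elements \<J> B"
proof -
  interpret R: two_groups H G "corr b" by (rule corr_two_groups[OF b])
  interpret conv: two_groups G H "(corr b)\<inverse>" by (rule two_groups_sym) unfold_locales
  note n = S.nrm_normal[OF y] B.ON_normal[OF M(1)]
  have m: "matches ((corr b)\<inverse>) (S.nrm (s, y)) M" using M(3) by (simp add: matches_converse)
  define D where "D = (corr b)\<inverse> `` S.cst (s, y)"
  have D: "D \<in> rcosets\<^bsub>H\<^esub> M" "matches (corr b) D (S.cst (s, y))"
    using conv.image_coset[OF n m S.elem_props(2)[OF y]] by (simp_all add: D_def matches_converse)
  have "index H M \<le> fst s"
    using S.elem_props(3)[OF y] R.card_rcosets_eq[OF n(2,1) M(3)] by (simp add: index_def)
  moreover have "s \<in> sorts \<J>" using y by (simp add: elements_def)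
  ultimately obtain x where x: "(s, x) \<in> elements \<J> B" "B.cst (s, x) = D" "B.nrm (s, x) = M"
    using B.elem_exists[OF _ M(1) _ M(4) D(1)] by blast
  have "matches (corr b) D (S.cst (e (s, x)))"
    using corr_matches[OF b refl refl x(1)] x(2,3) M(2) by simp
  then have "S.cst (e (s, x)) = S.cst (s, y)"
    using matches_unique[OF R.gour _ D(2) S.cst_subset[OF e_elem[OF x(1)]] S.cst_subset[OF y]] by blast
  then have "e (s, x) = (s, y)"
    using S.cst_inj[OF e_elem[OF x(1)] y] by simp
  then show ?thesis using x(1) by (metis image_eqI)
qed

text \<open>This and the next three lemmas show that the image of a system is closed under the rules
  of sorting data: they hold in the coordinates of \<open>B\<close>, and the correspondence carries
  them to \<open>S\<close>.\<close>

lemma image_top: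
  assumes y: "(s, y) \<in> elements \<J> S" and n: "S.nrm (s, y) = carrier G"
  shows "(s, y) \<in> e ` elements \<J> B"
proof -
  have s: "s \<in> sorts \<J>" "snd s \<in> seqs \<J>" "1 \<le> fst s" using y by (auto simp: elements_def sorts_def)
  obtain x where x: "(s, x) \<in> elements \<J> B" "B.nrm (s, x) = carrier H"
    using B.elem_exists[OF s(1) B.carrier_ON _ _ B.normal_in_rcosets[OF B.carrier_normal]] s
      B.index_carrier B.F_carrier by auto
  show ?thesis
  proof (rule in_image[OF x(1) y])
    show "matches (corr (s, x)) (carrier H) (S.nrm (s, y))"
      unfolding n by (rule matches_carrier[OF corr_goursat[OF x(1)]])
  qed (use x s B.F_carrier B.carrier_ON in auto)
qed

lemma image_sqrt:
  assumes z: "z \<in> e ` elements \<J> B" and y: "(s, y) \<in> elements \<J> S" and n: "S.nrm (s, y) = S.nrm z"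
    and s: "snd s \<in> sqrt_seq \<J> (snd (fst z))"
  shows "(s, y) \<in> e ` elements \<J> B"
proof -
  obtain b where b: "b \<in> elements \<J> B" "z = e b" using z by blast
  show ?thesis
  proof (rule in_image[OF b(1) y B.elem_props(1)[OF b(1)]])
    show "matches (corr b) (B.nrm b) (S.nrm (s, y))"
      unfolding n b(2) by (rule corr_matches_nrm[OF b(1) b(1)]) simp
    show "snd s \<in> FH (B.nrm b)"
      using B.F_sqrt[OF B.elem_props(1,4)[OF b(1)]] s b(2) by simp
  qed simp
qed

lemma image_up:
  assumes z: "z \<in> e ` elements \<J> B" and y: "(s, y) \<in> elements \<J> S" and n: "S.nrm z \<subseteq> S.nrm (s, y)"
    and k: "index G (S.nrm z) \<le> k" "1 \<le> k" "snd s = Jsub k (snd (fst z))"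
  shows "(s, y) \<in> e ` elements \<J> B"
proof -
  obtain b where b: "b \<in> elements \<J> B" "z = e b" using z by blast
  interpret R: two_groups H G "corr b" by (rule corr_two_groups[OF b(1)])
  interpret conv: two_groups G H "(corr b)\<inverse>" by (rule two_groups_sym) unfold_locales
  have m: "matches (corr b) (B.nrm b) (S.nrm z)"
    unfolding b(2) by (rule corr_matches_nrm[OF b(1) b(1)]) simp
  have zn: "S.nrm z \<lhd> G" unfolding b(2) by (rule S.nrm_normal[OF e_elem[OF b(1)]])
  define M where "M = (corr b)\<inverse> `` S.nrm (s, y)"
  have M: "M \<lhd> H" "B.nrm b \<subseteq> M" "matches (corr b) M (S.nrm (s, y))"
    using conv.image_normal[OF zn B.nrm_normal[OF b(1)] _ n S.nrm_normal[OF y]] m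
    by (simp_all add: M_def matches_converse)
  have ON: "M \<in> B.ON" by (rule B.upper_ON[OF B.elem_props(1)[OF b(1)] M(2,1)])
  have "index H (B.nrm b) \<le> k"
    using k(1) R.card_rcosets_eq[OF B.nrm_normal[OF b(1)] zn m] by (simp add: index_def)
  then have "snd s \<in> FH M"
    using B.F_up[OF B.elem_props(1)[OF b(1)] ON k(2) M(2) _ B.elem_props(4)[OF b(1)]] k(3) b(2) by simp
  then show ?thesis by (rule in_image[OF b(1) y ON M(2,3)])
qed

lemma image_Int:
  assumes z: "z \<in> e ` elements \<J> B" "w \<in> e ` elements \<J> B" and y: "(s, y) \<in> elements \<J> S"
    and n: "S.nrm (s, y) = S.nrm z \<inter> S.nrm w" and s: "snd s = snd (fst z) @ snd (fst w)"
  shows "(s, y) \<in> e ` elements \<J> B"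
proof -
  obtain b where b: "b \<in> elements \<J> B" "z = e b" using z(1) by blast
  obtain c where c: "c \<in> elements \<J> B" "w = e c" using z(2) by blast
  let ?M = "B.nrm b \<inter> B.nrm c"
  have M: "?M \<in> B.ON" by (rule B.Int_ON[OF B.elem_props(1)[OF b(1)] B.elem_props(1)[OF c(1)]])
  have F: "snd s \<in> FH ?M"
    using B.F_Int[OF B.elem_props(1)[OF b(1)] B.elem_props(1)[OF c(1)] B.elem_props(4)[OF b(1)]
        B.elem_props(4)[OF c(1)]] s b(2) c(2) by simp
  \<comment> \<open>A correspondence taken at \<open>b\<close> alone need not match the subgroup of
    \<open>c\<close>. It is taken at an element over the intersection, which lies below
    both.\<close>
  define t where "t = (index H ?M, snd s)"
  have "t \<in> sorts \<J>" using B.index_pos[OF M] y by (auto simp: t_def elements_def sorts_def)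
  moreover have "index H ?M \<le> fst t" "snd t \<in> FH ?M" using F by (simp_all add: t_def)
  ultimately obtain x where x: "(t, x) \<in> elements \<J> B" "B.nrm (t, x) = ?M"
    using B.elem_exists[OF _ M _ _ B.normal_in_rcosets[OF B.ON_normal[OF M]]] by blast
  show ?thesis
  proof (rule in_image[OF x(1) y M _ _ F])
    show "matches (corr (t, x)) ?M (S.nrm (s, y))"
      unfolding n b(2) c(2)
      using corr_matches_nrm[OF x(1) b(1)] corr_matches_nrm[OF x(1) c(1)] x(2)
      by (intro matches_Int) auto
  qed (use x in simp)
qed

end

section \<open>Generated subsystems\<close>

locale pair_coords =
  B: coords \<J> Jsub H XH FH B hH + S: coords \<J> Jsub G X F S h + two_groups H G R
  for \<J> :: "'j set" and Jsub and H :: "'h monoid" (structure) and XH FH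
    and B :: "('j, 'a) lstruct" and hH and G :: "'g monoid" (structure) and X F
    and S :: "('j, 'b) lstruct" and h and R
begin

lemma matches_nrm:
  assumes "z \<in> elements \<J> B" "w \<in> elements \<J> S" "matches R (B.cst z) (S.cst w)"
  shows "matches R (B.nrm z) (S.nrm w)"
  by (rule matches_normal[OF B.nrm_normal[OF assms(1)] S.nrm_normal[OF assms(2)]
        B.elem_props(2)[OF assms(1)] S.elem_props(2)[OF assms(2)] assms(3)])

text \<open>The relations reduce to inclusions of subgroups, inclusions of cosets, products, and
  first components of sorts. A correspondence preserves the first three, and \<open>f\<close> keeps
  the sorts.\<close>

lemma embedding_by_matches:
  assumes A: "A \<subseteq> elements \<J> B"
    and f: "\<And>z. z \<in> A \<Longrightarrow> emb f z \<in> elements \<J> S \<and> matches R (B.cst z) (S.cst (emb f z))"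
  shows "embedding \<J> (substructure B A) S f"
proof -
  note bc = B.cst_subset and sc = S.cst_subset and bn = B.nrm_subset and sn = S.nrm_subset
  have el: "z \<in> elements \<J> B" "emb f z \<in> elements \<J> S" "matches R (B.cst z) (S.cst (emb f z))"
    "matches R (B.nrm z) (S.nrm (emb f z))" if "z \<in> A" for z
    using A f[OF that] that matches_nrm by blast+
  have sub: "B.nrm z \<subseteq> B.nrm w \<longleftrightarrow> S.nrm (emb f z) \<subseteq> S.nrm (emb f w)"
    "B.cst z \<subseteq> B.cst w \<longleftrightarrow> S.cst (emb f z) \<subseteq> S.cst (emb f w)" if "z \<in> A" "w \<in> A" for z w
    using matches_subset[OF gour el(4)[OF that(1)] el(4)[OF that(2)] bn[OF el(1)[OF that(1)]] sn[OF el(2)[OF that(1)]]]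
      matches_subset[OF gour el(3)[OF that(1)] el(3)[OF that(2)] bc[OF el(1)[OF that(1)]] sc[OF el(2)[OF that(1)]]]
    by blast+
  have eq: "B.nrm z = B.nrm w \<longleftrightarrow> S.nrm (emb f z) = S.nrm (emb f w)"
    "B.cst z = B.cst w \<longleftrightarrow> S.cst (emb f z) = S.cst (emb f w)" if "z \<in> A" "w \<in> A" for z w
    using sub[OF that] sub[OF that(2,1)] by blast+
  have prod: "(\<exists>g \<in> B.cst z. \<exists>g' \<in> B.cst w. g \<otimes>\<^bsub>H\<^esub> g' \<in> B.cst v) \<longleftrightarrow>
      (\<exists>g \<in> S.cst (emb f z). \<exists>g' \<in> S.cst (emb f w). g \<otimes>\<^bsub>G\<^esub> g' \<in> S.cst (emb f v))" (is "?L \<longleftrightarrow> ?R")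
    if zwv: "z \<in> A" "w \<in> A" "v \<in> A" for z w v
  proof
    assume ?L
    then obtain g g' where g: "g \<in> B.cst z" "g' \<in> B.cst w" "g \<otimes>\<^bsub>H\<^esub> g' \<in> B.cst v" by blast
    obtain x where x: "(g, x) \<in> R" using gourD(3) g bc[OF el(1)[OF zwv(1)]] by blast
    obtain x' where x': "(g', x') \<in> R" using gourD(3) g bc[OF el(1)[OF zwv(2)]] by blast
    have "x \<in> S.cst (emb f z)" "x' \<in> S.cst (emb f w)" "x \<otimes>\<^bsub>G\<^esub> x' \<in> S.cst (emb f v)"
      using g x x' gourD(5)[OF x x'] el(3) zwv unfolding matches_def by blast+
    then show ?R by blast
  next
    assume ?R
    then obtain x x' where x: "x \<in> S.cst (emb f z)" "x' \<in> S.cst (emb f w)" "x \<otimes>\<^bsub>G\<^esub> x' \<in> S.cst (emb f v)" by blast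
    obtain g where g: "(g, x) \<in> R" using gourD(4) x sc[OF el(2)[OF zwv(1)]] by blast
    obtain g' where g': "(g', x') \<in> R" using gourD(4) x sc[OF el(2)[OF zwv(2)]] by blast
    have "g \<in> B.cst z" "g' \<in> B.cst w" "g \<otimes>\<^bsub>H\<^esub> g' \<in> B.cst v"
      using x g g' gourD(5)[OF g g'] el(3) zwv unfolding matches_def by blast+
    then show ?L by blast
  qed
  let ?A = "substructure B A"
  have un: "x \<in> univ ?A s \<longleftrightarrow> (s, x) \<in> A" for s x by (simp add: substructure_def)
  have rels: "le ?A = le B" "crel ?A = crel B" "prel ?A = prel B" by (simp_all add: substructure_def)
  show ?thesis
    unfolding embedding_def un rels
  proof (intro conjI ballI)
    fix s assume s: "s \<in> sorts \<J>"
    show "f s ` univ ?A s \<subseteq> univ S s"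
    proof
      fix y assume "y \<in> f s ` univ ?A s"
      then obtain x where "(s, x) \<in> A" "y = f s x" by (auto simp: un)
      then show "y \<in> univ S s" using el(2)[of "(s, x)"] by (simp add: elements_def)
    qed
    show "inj_on (f s) (univ ?A s)"
    proof (rule inj_onI)
      fix x y assume xy: "x \<in> univ ?A s" "y \<in> univ ?A s" "f s x = f s y"
      then have a: "(s, x) \<in> A" "(s, y) \<in> A" by (simp_all add: un)
      have "B.cst (s, x) = B.cst (s, y)" using eq(2)[OF a] xy(3) by simp
      then show "x = y" using B.cst_inj[OF el(1)[OF a(1)] el(1)[OF a(2)]] by simp
    qed
    {
      fix t x y assume "x \<in> univ ?A s" "y \<in> univ ?A t"
      then have a: "(s, x) \<in> A" "(t, y) \<in> A" by (simp_all add: un)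
      note e = el(1)[OF a(1)] el(1)[OF a(2)] el(2)[OF a(1), simplified] el(2)[OF a(2), simplified]
      show "le B s t x y = le S s t (f s x) (f t y)"
        using B.le_iff[OF e(1,2)] S.le_iff[OF e(3,4)] sub(1)[OF a] by simp
      show "crel B s t x y = crel S s t (f s x) (f t y)"
        using B.crel_iff[OF e(1,2)] S.crel_iff[OF e(3,4)] sub(2)[OF a] by simp
    }
    fix x y z assume "x \<in> univ ?A s" "y \<in> univ ?A s" "z \<in> univ ?A s"
    then have a: "(s, x) \<in> A" "(s, y) \<in> A" "(s, z) \<in> A" by (simp_all add: un)
    note e = el(1)[OF a(1)] el(1)[OF a(2)] el(1)[OF a(3)]
      el(2)[OF a(1), simplified] el(2)[OF a(2), simplified] el(2)[OF a(3), simplified]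
    show "prel B s x y z = prel S s (f s x) (f s y) (f s z)"
      using B.prel_iff[OF e(1-3)] S.prel_iff[OF e(4-6)] prod[OF a] eq(1)[OF a(1,2)] eq(1)[OF a(3,1)] by simp
  qed
qed

end

section \<open>Closure rules for sorting data, and finite quotients\<close>

context sorted_group
begin

text \<open>A tag \<open>(N, J)\<close> stands for all elements over \<open>N\<close> in sorts with
  sequence \<open>J\<close>. The rules are the clauses (i) to (iv) of sorting data read as closure
  conditions; they yield the tags that every subsystem with the tags in \<open>T\<close> must
  have.\<close>

inductive gen :: "('g set \<times> 'j list) set \<Rightarrow> 'g set \<Rightarrow> 'j list \<Rightarrow> bool" for T where
  tag: "(N, J) \<in> T \<Longrightarrow> gen T N J"
| top: "J \<in> seqs \<J> \<Longrightarrow> gen T (carrier G) J"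
| sqrt: "gen T N J \<Longrightarrow> J' \<in> sqrt_seq \<J> J \<Longrightarrow> gen T N J'"
| up: "gen T N J \<Longrightarrow> N \<subseteq> M \<Longrightarrow> M \<in> ON \<Longrightarrow> index G N \<le> k \<Longrightarrow> 1 \<le> k \<Longrightarrow> gen T M (Jsub k J)"
| meet: "gen T N J \<Longrightarrow> gen T M J' \<Longrightarrow> gen T (N \<inter> M) (J @ J')"

lemma gen_F:
  assumes "T \<subseteq> {(N, J). N \<in> ON \<and> J \<in> F N}" "gen T N J"
  shows "N \<in> ON \<and> J \<in> F N"
  using assms(2)
proof induction
  case (tag N J) then show ?case using assms(1) by blast
next
  case (top J) then show ?case using carrier_ON F_carrier by simp
next
  case (sqrt N J J') then show ?case using F_sqrt by blast
next
  case (up N J M k) then show ?case using F_up by blast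
next
  case (meet N J M J') then show ?case using Int_ON F_Int by blast
qed

text \<open>The quotient by this subgroup will carry the subsystem generated by \<open>T\<close>.
  The factor \<open>carrier G\<close> gives the right value if \<open>T\<close> is empty.\<close>

definition core :: "('g set \<times> 'j list) set \<Rightarrow> 'g set" where
  "core T = carrier G \<inter> \<Inter> (fst ` T)"

text \<open>Finiteness lets the rule \<open>meet\<close> combine all tags of \<open>T'\<close>. For
  a finite \<open>T\<close> the core is thus a generated subgroup, and with \<open>gen_F\<close> an
  open one.\<close>

lemma core_gen:
  assumes "finite T'" "T' \<subseteq> T"
  shows "\<exists>J. gen T (core T') J"
  using assms
proof (induction T')
  case empty
  obtain J where "J \<in> seqs \<J>" using seqs_nonempty by blast
  then show ?case using gen.top by (auto simp: core_def)
next
  case (insert t T')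
  obtain N J where t: "t = (N, J)" by force
  obtain J' where "gen T (core T') J'" using insert by blast
  moreover have "gen T N J" using insert.prems t by (auto intro: gen.tag)
  ultimately have "gen T (N \<inter> core T') (J @ J')" by (intro gen.meet)
  moreover have "N \<inter> core T' = core (insert t T')" by (auto simp: core_def t)
  ultimately show ?case by auto
qed

lemma core_least:
  assumes "T \<subseteq> {(N, J). N \<in> ON \<and> J \<in> F N}" "gen T N J"
  shows "core T \<subseteq> N"
  using assms(2)
proof induction
  case (tag N J) then show ?case by (force simp: core_def)
qed (auto simp: core_def)

end

text \<open>The quotient \<open>G/N\<close>, on a set of representatives of the cosets: the carrier then has the
  type of \<open>G\<close>, as the definition of sorted complete systems requires.\<close>

locale quotient = sorted_group +
  fixes N :: "'b set"
  assumes N: "N \<in> ON"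
begin

definition repr :: "'b \<Rightarrow> 'b" where
  "repr x = (SOME y. y \<in> N #> x)"

definition Q :: "'b monoid" where
  "Q = \<lparr>carrier = repr ` carrier G, monoid.mult = (\<lambda>x y. repr (x \<otimes> y)), one = repr \<one>\<rparr>"

lemma NG: "N \<lhd> G" using N ON_normal by blast

lemma repr_in: "x \<in> carrier G \<Longrightarrow> repr x \<in> N #> x"
  unfolding repr_def by (rule someI[of "\<lambda>y. y \<in> N #> x", OF rcos_self_normal[OF NG]])

lemma repr_carrier: "x \<in> carrier G \<Longrightarrow> repr x \<in> carrier G"
  using repr_in rcos_mem[OF NG] by blast

lemma repr_rcos: "x \<in> carrier G \<Longrightarrow> N #> repr x = N #> x"
  using rcosets_eq_rcos(1)[OF NG rcos_in_rcosets[OF NG] repr_in] by metis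

lemma repr_eq_iff:
  assumes "x \<in> carrier G" "y \<in> carrier G"
  shows "repr x = repr y \<longleftrightarrow> N #> x = N #> y"
  using repr_rcos assms by (metis repr_def)

lemma rcos_mult: "x \<in> carrier G \<Longrightarrow> y \<in> carrier G \<Longrightarrow> N #> (x \<otimes> y) = (N #> x) <#> (N #> y)"
  using normal.rcos_sum[OF NG] by simp

lemma repr_mult:
  "x \<in> carrier G \<Longrightarrow> y \<in> carrier G \<Longrightarrow> repr (x \<otimes> y) = repr (repr x \<otimes> repr y)"
  by (subst repr_eq_iff) (simp_all add: repr_carrier rcos_mult repr_rcos)

lemma Q_simps: "carrier Q = repr ` carrier G" "x \<otimes>\<^bsub>Q\<^esub> y = repr (x \<otimes> y)" "\<one>\<^bsub>Q\<^esub> = repr \<one>"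
  by (simp_all add: Q_def)

lemma repr_hom: "x \<in> carrier G \<Longrightarrow> y \<in> carrier G \<Longrightarrow> repr x \<otimes>\<^bsub>Q\<^esub> repr y = repr (x \<otimes> y)"
  using repr_mult by (simp add: Q_simps)

lemma Q_group: "group Q"
proof (rule groupI)
  show "x \<otimes>\<^bsub>Q\<^esub> y \<in> carrier Q" if "x \<in> carrier Q" "y \<in> carrier Q" for x y
    using that repr_hom by (auto simp: Q_simps(1))
  show "\<one>\<^bsub>Q\<^esub> \<in> carrier Q" by (simp add: Q_simps)
  show "x \<otimes>\<^bsub>Q\<^esub> y \<otimes>\<^bsub>Q\<^esub> z = x \<otimes>\<^bsub>Q\<^esub> (y \<otimes>\<^bsub>Q\<^esub> z)"
    if "x \<in> carrier Q" "y \<in> carrier Q" "z \<in> carrier Q" for x y z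
    using that by (auto simp: Q_simps(1) repr_hom m_assoc)
  show "\<one>\<^bsub>Q\<^esub> \<otimes>\<^bsub>Q\<^esub> x = x" if "x \<in> carrier Q" for x
    using that by (auto simp: Q_simps(1,3) repr_hom)
  show "\<exists>y \<in> carrier Q. y \<otimes>\<^bsub>Q\<^esub> x = \<one>\<^bsub>Q\<^esub>" if x: "x \<in> carrier Q" for x
  proof -
    obtain g where "g \<in> carrier G" "x = repr g" using x by (auto simp: Q_simps)
    then show ?thesis
      by (intro bexI[of _ "repr (inv g)"]) (auto simp: Q_simps(1,3) repr_hom)
  qed
qed

text \<open>The converse of the graph of the projection, so that transport along \<open>R\<close>
  leads from the quotient to \<open>G\<close>.\<close>

definition R :: "('b \<times> 'b) set" where
  "R = {(x, g). g \<in> carrier G \<and> x = repr g}"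

lemma R_goursat: "goursat Q G R"
proof (rule goursatI)
  interpret Q: group Q by (rule Q_group)
  fix x g assume "(x, g) \<in> R"
  then have g: "g \<in> carrier G" "x = repr g" by (auto simp: R_def)
  have "repr (inv g) \<otimes>\<^bsub>Q\<^esub> x = \<one>\<^bsub>Q\<^esub>" using g by (simp add: repr_hom Q_simps(3))
  then have "inv\<^bsub>Q\<^esub> x = repr (inv g)"
    using g by (intro Q.inv_equality) (auto simp: Q_simps(1))
  then show "(inv\<^bsub>Q\<^esub> x, inv g) \<in> R" using g by (simp add: R_def)
qed (auto simp: R_def Q_simps(1) repr_hom)

sublocale R: two_groups Q G R
  by (intro two_groups.intro two_groups_axioms.intro Q_group R_goursat) unfold_locales

lemma R_one: "matches R {\<one>\<^bsub>Q\<^esub>} N"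
proof -
  have "N #> g = N \<longleftrightarrow> g \<in> N" if "g \<in> carrier G" for g
    using rcos_self_normal[OF NG that] coset_join2[OF that normal_imp_subgroup[OF NG]] by auto
  then show ?thesis
    using repr_eq_iff[of _ \<one>] coset_mult_one[OF normal_subset[OF NG]]
    by (auto simp: matches_def R_def Q_simps(3))
qed

lemma R_normal:
  assumes "M \<lhd> Q"
  shows "R `` M \<in> ON" "N \<subseteq> R `` M" "matches R M (R `` M)"
proof -
  have "{\<one>\<^bsub>Q\<^esub>} \<subseteq> M" using R.H.normal_one[OF assms] by simp
  note n = R.image_normal[OF R.H.one_is_normal NG R_one this assms]
  show "N \<subseteq> R `` M" "matches R M (R `` M)" by (fact n(2,3))+
  show "R `` M \<in> ON" using upper_ON[OF N n(2,1)] .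
qed

lemma R_index: "M \<lhd> Q \<Longrightarrow> index Q M = index G (R `` M)"
  unfolding index_def using R.card_rcosets_eq R_normal ON_normal by blast

lemma R_inv_normal:
  assumes "N \<subseteq> M" "M \<lhd> G"
  shows "R\<inverse> `` M \<lhd> Q" "matches R (R\<inverse> `` M) M" "R `` (R\<inverse> `` M) = M"
proof -
  interpret conv: two_groups G Q "R\<inverse>" by (rule two_groups_sym) unfold_locales
  have m: "matches (R\<inverse>) N {\<one>\<^bsub>Q\<^esub>}" using R_one by (simp add: matches_converse)
  show n: "R\<inverse> `` M \<lhd> Q" and m: "matches R (R\<inverse> `` M) M"
    using conv.image_normal[OF NG R.H.one_is_normal m assms] by (simp_all add: matches_converse)
  show "R `` (R\<inverse> `` M) = M"
    using matches_unique[OF R_goursat R_normal(3)[OF n] m] normal_subset[OF ON_normal[OF R_normal(1)[OF n]]]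
      normal_subset[OF assms(2)] by blast
qed

text \<open>Normal subgroups of the quotient correspond to those of \<open>G\<close> above
  \<open>N\<close>. A predicate on the latter, in the application \<open>gen T\<close>, is read as
  sorting data on the former.\<close>

definition FQ :: "('b set \<Rightarrow> 'a list \<Rightarrow> bool) \<Rightarrow> 'b set \<Rightarrow> 'a list set" where
  "FQ P M = {J. P (R `` M) J}"

text \<open>The representative is a function of the coset, and there are finitely many cosets. This
  makes the discrete topology on the quotient compact.\<close>

lemma Q_finite: "finite (carrier Q)"
proof -
  have "repr ` carrier G \<subseteq> (\<lambda>c. SOME y. y \<in> c) ` (rcosets N)"
    unfolding repr_def using rcos_in_rcosets[OF NG] by auto
  then show ?thesis using finite_rcosets[OF N] finite_surj by (auto simp: Q_simps)
qed

lemma Q_open_normal: "open_normal Q (discrete_topology (carrier Q)) = {M. M \<lhd> Q}"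
  using R.H.normal_subset by (auto simp: open_normal_def)

lemma Q_profinite: "profinite_group Q (discrete_topology (carrier Q))"
proof -
  have "continuous_map (prod_topology (discrete_topology (carrier Q)) (discrete_topology (carrier Q)))
      (discrete_topology (carrier Q)) (\<lambda>(x, y). x \<otimes>\<^bsub>Q\<^esub> y)"
    by (auto simp flip: prod_topology_discrete_topology)
  then show ?thesis
    unfolding profinite_group_def
    using Q_group Q_finite
    by (auto simp: compact_space_discrete_topology connectedin_discrete_topology)
qed

end

context quotient
begin

lemma R_image_Int:
  assumes "M \<lhd> Q" "M' \<lhd> Q"
  shows "R `` (M \<inter> M') = R `` M \<inter> R `` M'"
  using matches_unique[OF R_goursat R_normal(3)[OF R.H.normal_Int[OF assms]]
      matches_Int[OF R_normal(3)[OF assms(1)] R_normal(3)[OF assms(2)]]]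
    R.gourD(2) by blast

lemma R_image_carrier: "R `` carrier Q = carrier G"
  using R.gourD(2,4) R.gourD(1) by blast

text \<open>The clauses are the rules of \<open>gen\<close>, transported along \<open>R\<close>. The
  tag \<open>(N, J0)\<close> makes all values nonempty: the rule \<open>up\<close> derives from it a
  sequence for every subgroup above \<open>N\<close>.\<close>

lemma Q_sorted:
  assumes T: "T \<subseteq> {(M, J). M \<in> ON \<and> J \<in> F M}" and J0: "gen T N J0"
  shows "sorted_profinite_group \<J> Jsub Q (discrete_topology (carrier Q)) (FQ (gen T))"
  unfolding sorted_profinite_group_def sorting_data_def Q_open_normal
proof (intro conjI ballI allI impI Q_profinite)
  fix M assume "M \<in> {M. M \<lhd> Q}"
  then have M: "M \<lhd> Q" by simp
  show "FQ (gen T) M \<subseteq> seqs \<J>"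
    using gen_F[OF T] F_seqs by (auto simp: FQ_def)
  show "FQ (gen T) M \<noteq> {}"
    using gen.up[OF J0 R_normal(2)[OF M] R_normal(1)[OF M] order_refl index_pos[OF N]]
    by (auto simp: FQ_def)
  {
    fix J assume J: "J \<in> seqs \<J>"
    show "J \<in> FQ (gen T) M \<longleftrightarrow> sqrt_seq \<J> J \<subseteq> FQ (gen T) M"
    proof
      assume "J \<in> FQ (gen T) M"
      then show "sqrt_seq \<J> J \<subseteq> FQ (gen T) M" using gen.sqrt by (auto simp: FQ_def)
    next
      assume "sqrt_seq \<J> J \<subseteq> FQ (gen T) M"
      then show "J \<in> FQ (gen T) M" using J by (auto simp: sqrt_seq_def)
    qed
  }
  fix M' assume "M' \<in> {M. M \<lhd> Q}"
  then have M': "M' \<lhd> Q" by simp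
  {
    fix k J assume k: "1 \<le> k" "M \<subseteq> M' \<and> index Q M \<le> k \<and> J \<in> FQ (gen T) M"
    then have "gen T (R `` M) J" "R `` M \<subseteq> R `` M'" "index G (R `` M) \<le> k"
      using R_index[OF M] by (auto simp: FQ_def)
    then show "Jsub k J \<in> FQ (gen T) M'"
      unfolding FQ_def using gen.up[OF _ _ R_normal(1)[OF M'] _ k(1)] by blast
  }
  fix J J' assume "J \<in> FQ (gen T) M \<and> J' \<in> FQ (gen T) M'"
  then show "J @ J' \<in> FQ (gen T) (M \<inter> M')"
    unfolding FQ_def R_image_Int[OF M M'] using gen.meet by blast
next
  show "FQ (gen T) (carrier Q) = seqs \<J>"
    unfolding FQ_def R_image_carrier using gen_F[OF T] F_seqs[OF carrier_ON] gen.top by blast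
qed

end

context sorted_group
begin

lemma coords_complete_system: "coords \<J> Jsub G X F (complete_system G X F) (\<lambda>s x. x)"
  by unfold_locales (simp add: isomorphism_def embedding_def)

end

section \<open>Subsystems with finitely many tags\<close>

context coords
begin

definition tags :: "('j srt \<times> 'a) set \<Rightarrow> ('g set \<times> 'j list) set" where
  "tags Y = (\<lambda>z. (nrm z, snd (fst z))) ` Y"

text \<open>Membership depends on the tag only: with one coset of a subgroup, a subsystem contains
  all the others, in every sort with the same sequence whose bound admits them.\<close>

definition Gen :: "('j srt \<times> 'a) set \<Rightarrow> ('j srt \<times> 'a) set" where
  "Gen Y = {z \<in> elements \<J> S. gen (tags Y) (nrm z) (snd (fst z))}"

lemma tags_F: "Y \<subseteq> elements \<J> S \<Longrightarrow> tags Y \<subseteq> {(N, J). N \<in> ON \<and> J \<in> F N}"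
  using elem_props(1,4) by (auto simp: tags_def)

lemma Gen_superset: "Y \<subseteq> elements \<J> S \<Longrightarrow> Y \<subseteq> Gen Y"
  by (auto simp: Gen_def tags_def intro!: gen.tag)

lemma Gen_elements: "Gen Y \<subseteq> elements \<J> S"
  by (auto simp: Gen_def)

text \<open>Finitely many tags have an open core, and the elements of \<open>Gen Y\<close> are
  cosets of subgroups above it. Projecting to the finite quotient by the core is an isomorphism to
  the complete system with sorting data \<open>gen (tags Y)\<close>.\<close>

lemma Gen_isomorphic:
  assumes Y: "Y \<subseteq> elements \<J> S" "finite (tags Y)"
  shows "\<exists>(K :: 'g monoid) XK FK f. sorted_profinite_group \<J> Jsub K XK FK \<and>
    isomorphism \<J> (substructure S (Gen Y)) (complete_system K XK FK) f"
proof -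
  note T = tags_F[OF Y(1)]
  define N where "N = core (tags Y)"
  obtain J0 where J0: "gen (tags Y) N J0" using core_gen[OF Y(2) order_refl] by (auto simp: N_def)
  have N: "N \<in> ON" using gen_F[OF T J0] by simp
  interpret q: quotient \<J> Jsub G X F N by unfold_locales (fact N)
  define XK where "XK = discrete_topology (carrier q.Q)"
  define FK where "FK = q.FQ (gen (tags Y))"
  have sorted: "sorted_profinite_group \<J> Jsub q.Q XK FK"
    unfolding XK_def FK_def by (rule q.Q_sorted[OF T J0])
  let ?C = "complete_system q.Q XK FK"
  interpret K: sorted_group \<J> Jsub q.Q XK FK by unfold_locales (fact sorted)
  interpret C: coords \<J> Jsub q.Q XK FK ?C "\<lambda>s x. x" by (rule K.coords_complete_system)
  interpret conv: two_groups G q.Q "q.R\<inverse>" by (rule two_groups_sym) unfold_locales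
  interpret P: pair_coords \<J> Jsub G X F S h q.Q XK FK ?C "\<lambda>s x. x" "q.R\<inverse>" by unfold_locales
  have KON: "K.ON = {M. M \<lhd> q.Q}" unfolding XK_def by (rule q.Q_open_normal)
  define f where "f s x = (q.R\<inverse> `` cst (s, x), fst s)" for s x
  have above: "N \<subseteq> nrm z" if "z \<in> Gen Y" for z
    using core_least[OF T] that by (auto simp: Gen_def N_def)
  have mono: "matches (q.R\<inverse>) N {\<one>\<^bsub>q.Q\<^esub>}" using q.R_one by (simp add: matches_converse)
  have f: "emb f z \<in> elements \<J> ?C \<and> matches (q.R\<inverse>) (cst z) (C.cst (emb f z))" if z: "z \<in> Gen Y" for z
  proof -
    obtain k J x where zk: "z = ((k, J), x)" by (metis prod.exhaust)
    have ze: "z \<in> elements \<J> S" using z by (simp add: Gen_def)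
    note n = q.R_inv_normal[OF above[OF z] nrm_normal[OF ze]]
    have m: "matches (q.R\<inverse>) (nrm z) (q.R\<inverse> `` nrm z)" using n(2) by (simp add: matches_converse)
    note c = conv.image_coset[OF nrm_normal[OF ze] n(1) m elem_props(2)[OF ze]]
    have "index q.Q (q.R\<inverse> `` nrm z) \<le> k"
      using q.R_index[OF n(1)] n(3) elem_props(3)[OF ze] zk by simp
    moreover have "J \<in> FK (q.R\<inverse> `` nrm z)"
      unfolding FK_def q.FQ_def n(3) using z zk by (simp add: Gen_def)
    ultimately have "(q.R\<inverse> `` cst z, k) \<in> univ ?C (k, J)"
      unfolding K.ex_cs_univ KON using n(1) c(1) by blast
    then have "emb f z \<in> elements \<J> ?C"
      using ze by (simp add: zk f_def elements_def)
    moreover have "C.cst (emb f z) = q.R\<inverse> `` cst z" by (simp add: C.cst_def f_def zk)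
    ultimately show ?thesis using c(2) by simp
  qed
  have emb: "embedding \<J> (substructure S (Gen Y)) ?C f"
    by (rule P.embedding_by_matches[OF Gen_elements f])
  moreover have "f s ` univ (substructure S (Gen Y)) s = univ ?C s" if s: "s \<in> sorts \<J>" for s
  proof
    show "f s ` univ (substructure S (Gen Y)) s \<subseteq> univ ?C s"
      using emb s by (simp add: embedding_def)
    show "univ ?C s \<subseteq> f s ` univ (substructure S (Gen Y)) s"
    proof
      fix y assume y: "y \<in> univ ?C s"
      obtain k J c k' where sk: "s = (k, J)" "y = (c, k')" by force
      then obtain M where M: "k' = k" "M \<lhd> q.Q" "index q.Q M \<le> k" "J \<in> FK M" "c \<in> rcosets\<^bsub>q.Q\<^esub> M"
        using y K.ex_cs_univ KON by blast
      note n = q.R_normal[OF M(2)]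
      have d: "q.R `` c \<in> rcosets (q.R `` M)" "matches q.R c (q.R `` c)"
        using q.R.image_coset[OF M(2) ON_normal[OF n(1)] n(3) M(5)] by blast+
      have g: "gen (tags Y) (q.R `` M) J" using M(4) by (simp add: FK_def q.FQ_def)
      have "index G (q.R `` M) \<le> fst s" "snd s \<in> F (q.R `` M)"
        using q.R_index[OF M(2)] M(3) gen_F[OF T g] sk by auto
      then obtain x where x: "(s, x) \<in> elements \<J> S" "cst (s, x) = q.R `` c" "nrm (s, x) = q.R `` M"
        using elem_exists[OF s n(1) _ _ d(1)] by blast
      have xG: "(s, x) \<in> Gen Y" using x g sk by (simp add: Gen_def)
      have "C.cst (emb f (s, x)) = c"
        using f[OF xG] d(2) x(2) matches_unique[OF conv.gour] q.R.H.rcosets_subset_carrier[OF M(2,5)]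
          C.cst_subset by (metis matches_converse)
      then have "f s x = y" by (simp add: C.cst_def f_def sk M(1))
      then show "y \<in> f s ` univ (substructure S (Gen Y)) s"
        using xG by (auto simp: substructure_def)
    qed
  qed
  ultimately have "isomorphism \<J> (substructure S (Gen Y)) ?C f" by (simp add: isomorphism_def)
  then show ?thesis using sorted by blast
qed

end

text \<open>The definition of sorted complete systems prescribes the type of the group elements.
  Here the group has that type, and so have the quotients built from it.\<close>

locale scs = coords \<J> Jsub G X F S h
  for \<J> :: "'j set" and Jsub and G :: "('j srt \<times> 'a) set monoid" (structure) and X F
    and S :: "('j, 'a) lstruct" and h
begin

lemma subsystem_Gen:
  assumes "Y \<subseteq> elements \<J> S" "finite (tags Y)"
  shows "subsystem \<J> Jsub S (Gen Y)"
  using Gen_isomorphic[OF assms] Gen_elements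
  by (simp add: subsystem_def sorted_complete_system_def)

end

section \<open>Closure properties of subsystems\<close>

context coords
begin

lemma subsystem_coords:
  fixes A :: "('j srt \<times> 'a) set"
  assumes "subsystem \<J> Jsub S A"
  obtains K :: "('j srt \<times> 'a) set monoid" and XK FK f where
    "coords \<J> Jsub K XK FK (substructure S A) f"
    "elements \<J> (substructure S A) = A"
proof -
  obtain K :: "('j srt \<times> 'a) set monoid" and XK FK f where
    "sorted_profinite_group \<J> Jsub K XK FK" "isomorphism \<J> (substructure S A) (complete_system K XK FK) f"
    using assms by (auto simp: subsystem_def sorted_complete_system_def)
  then have "coords \<J> Jsub K XK FK (substructure S A) f" by unfold_locales
  moreover have "elements \<J> (substructure S A) = A"
    using assms by (auto simp: subsystem_def elements_def substructure_def)
  ultimately show ?thesis using that by blast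
qed

lemma embedding_inclusion: "A \<subseteq> elements \<J> S \<Longrightarrow> embedding \<J> (substructure S A) S (\<lambda>s x. x)"
  by (auto simp: embedding_def substructure_def elements_def)

lemma emb_id [simp]: "emb (\<lambda>s x. x) = (\<lambda>z. z)"
  by (auto simp: emb_def)

text \<open>A subsystem has coordinates of its own, and it is the image of its inclusion, which is
  an embedding.\<close>

lemma subsystem_closed:
  assumes A: "subsystem \<J> Jsub S A" and y: "(s, y) \<in> elements \<J> S"
  shows "nrm (s, y) = carrier G \<Longrightarrow> (s, y) \<in> A"
    and "z \<in> A \<Longrightarrow> nrm (s, y) = nrm z \<Longrightarrow> snd s \<in> sqrt_seq \<J> (snd (fst z)) \<Longrightarrow> (s, y) \<in> A"
    and "z \<in> A \<Longrightarrow> nrm z \<subseteq> nrm (s, y) \<Longrightarrow> index G (nrm z) \<le> k \<Longrightarrow> 1 \<le> k \<Longrightarrow>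
      snd s = Jsub k (snd (fst z)) \<Longrightarrow> (s, y) \<in> A"
    and "z \<in> A \<Longrightarrow> w \<in> A \<Longrightarrow> nrm (s, y) = nrm z \<inter> nrm w \<Longrightarrow> snd s = snd (fst z) @ snd (fst w) \<Longrightarrow>
      (s, y) \<in> A"
proof -
  obtain K :: "('j srt \<times> 'a) set monoid" and XK FK f where
    K: "coords \<J> Jsub K XK FK (substructure S A) f" and el: "elements \<J> (substructure S A) = A"
    using subsystem_coords[OF A] .
  interpret K: coords \<J> Jsub K XK FK "substructure S A" f by (rule K)
  have "embedding \<J> (substructure S A) S (\<lambda>s x. x)"
    using embedding_inclusion A by (simp add: subsystem_def)
  then interpret two_coords \<J> Jsub K XK FK "substructure S A" f G X F S h "\<lambda>s x. x"
    by unfold_locales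
  note i = image_top[OF y] image_sqrt[OF _ y] image_up[OF _ y] image_Int[OF _ _ y]
  show "nrm (s, y) = carrier G \<Longrightarrow> (s, y) \<in> A" using i(1) by (simp add: el)
  show "z \<in> A \<Longrightarrow> nrm (s, y) = nrm z \<Longrightarrow> snd s \<in> sqrt_seq \<J> (snd (fst z)) \<Longrightarrow> (s, y) \<in> A"
    using i(2) by (simp add: el)
  show "z \<in> A \<Longrightarrow> nrm z \<subseteq> nrm (s, y) \<Longrightarrow> index G (nrm z) \<le> k \<Longrightarrow> 1 \<le> k \<Longrightarrow>
      snd s = Jsub k (snd (fst z)) \<Longrightarrow> (s, y) \<in> A"
    using i(3) by (simp add: el)
  show "z \<in> A \<Longrightarrow> w \<in> A \<Longrightarrow> nrm (s, y) = nrm z \<inter> nrm w \<Longrightarrow> snd s = snd (fst z) @ snd (fst w) \<Longrightarrow>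
      (s, y) \<in> A"
    using i(4) by (simp add: el)
qed

text \<open>The sort whose first component is exactly the index always admits the subgroup, so every
  tag has a representative there.\<close>

lemma rep_exists:
  assumes "N \<in> ON" "J \<in> F N"
  shows "\<exists>x. ((index G N, J), x) \<in> elements \<J> S \<and> nrm ((index G N, J), x) = N"
proof -
  have "(index G N, J) \<in> sorts \<J>"
    using index_pos[OF assms(1)] F_seqs[OF assms(1)] assms(2) by (auto simp: sorts_def)
  moreover have "index G N \<le> fst (index G N, J)" "snd (index G N, J) \<in> F N"
    using assms(2) by simp_all
  ultimately show ?thesis
    using elem_exists[OF _ assms(1) _ _ normal_in_rcosets[OF ON_normal[OF assms(1)]]] by blast
qed

lemma Gen_least:
  assumes A: "subsystem \<J> Jsub S A" and Y: "Y \<subseteq> A" "Y \<subseteq> elements \<J> S"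
  shows "Gen Y \<subseteq> A"
proof -
  note T = tags_F[OF Y(2)]
  have sq: "J \<in> sqrt_seq \<J> J" if "J \<in> F N" "N \<in> ON" for J N
    using that F_seqs by (auto simp: sqrt_seq_def)
  \<comment> \<open>The claim covers all \<open>k\<close> and \<open>y\<close>, so that the
    induction hypothesis applies to the representative given by \<open>rep_exists\<close>, from
    which the closure property then leads to an arbitrary element.\<close>
  have "\<forall>k y. ((k, J), y) \<in> elements \<J> S \<and> nrm ((k, J), y) = N \<longrightarrow> ((k, J), y) \<in> A"
    if "gen (tags Y) N J" for N J
    using that
  proof induction
    case (tag N J)
    then obtain z where z: "z \<in> Y" "nrm z = N" "snd (fst z) = J" by (auto simp: tags_def)
    show ?case
    proof (intro allI impI, elim conjE)
      fix k y assume y: "((k, J), y) \<in> elements \<J> S" "nrm ((k, J), y) = N"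
      show "((k, J), y) \<in> A"
        using subsystem_closed(2)[OF A y(1), of z] z y Y(1) sq[OF elem_props(4,1)[OF y(1)]] by auto
    qed
  next
    case (top J) then show ?case using subsystem_closed(1)[OF A] by blast
  next
    case (sqrt N J J')
    note NJ = gen_F[OF T sqrt.hyps(1)]
    obtain x where x: "((index G N, J), x) \<in> elements \<J> S" "nrm ((index G N, J), x) = N"
      using rep_exists NJ by blast
    then have "((index G N, J), x) \<in> A" using sqrt.IH by blast
    then show ?case using subsystem_closed(2)[OF A] x(2) sqrt.hyps(2) by auto
  next
    case (up N J M k)
    note NJ = gen_F[OF T up.hyps(1)]
    obtain x where x: "((index G N, J), x) \<in> elements \<J> S" "nrm ((index G N, J), x) = N"
      using rep_exists NJ by blast
    then have "((index G N, J), x) \<in> A" using up.IH by blast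
    then show ?case using subsystem_closed(3)[OF A] x(2) up.hyps by auto
  next
    case (meet N J M J')
    note NJ = gen_F[OF T meet.hyps(1)] gen_F[OF T meet.hyps(2)]
    obtain x where x: "((index G N, J), x) \<in> elements \<J> S" "nrm ((index G N, J), x) = N"
      using rep_exists NJ by blast
    obtain y where y: "((index G M, J'), y) \<in> elements \<J> S" "nrm ((index G M, J'), y) = M"
      using rep_exists NJ by blast
    have "((index G N, J), x) \<in> A" "((index G M, J'), y) \<in> A" using meet.IH x y by blast+
    then show ?case using subsystem_closed(4)[OF A] x(2) y(2) by auto
  qed
  then show ?thesis by (auto simp: Gen_def)
qed

end

context scs
begin

lemma generated_eq:
  assumes "Y \<subseteq> elements \<J> S" "finite (tags Y)"
  shows "generated \<J> Jsub S Y = Gen Y"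
  unfolding generated_def
  using subsystem_Gen[OF assms] Gen_superset[OF assms(1)] Gen_least assms(1) by blast

end

section \<open>Extending correspondences\<close>

context coords
begin

lemma gen_mono: "gen T N J \<Longrightarrow> T \<subseteq> T' \<Longrightarrow> gen T' N J"
  by (induction rule: gen.induct) (auto intro: gen.intros)

lemma Gen_mono:
  assumes "Y \<subseteq> Y'" shows "Gen Y \<subseteq> Gen Y'"
proof -
  have "tags Y \<subseteq> tags Y'" using assms by (auto simp: tags_def)
  then show ?thesis using gen_mono by (auto simp: Gen_def)
qed

lemma finite_Int_ON:
  assumes "finite A" "A \<subseteq> ON" shows "carrier G \<inter> \<Inter>A \<in> ON"
  using assms
proof (induction A)
  case (insert N A)
  then have "N \<inter> (carrier G \<inter> \<Inter>A) \<in> ON" using Int_ON[of N "carrier G \<inter> \<Inter>A"] by simp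
  moreover have "N \<inter> (carrier G \<inter> \<Inter>A) = carrier G \<inter> \<Inter>(insert N A)" by auto
  ultimately show ?case by simp
qed (simp add: carrier_ON)

text \<open>A correspondence taken at such a \<open>b\<close> matches all elements of
  \<open>Z\<close> at once.\<close>

lemma lower_bound:
  assumes "finite Z" "Z \<subseteq> elements \<J> S"
  shows "\<exists>b \<in> elements \<J> S. \<forall>z \<in> Z. nrm b \<subseteq> nrm z"
proof -
  let ?N = "carrier G \<inter> \<Inter>(nrm ` Z)"
  have N: "?N \<in> ON" using assms elem_props(1) by (intro finite_Int_ON) auto
  obtain J where "J \<in> F ?N" using F_nonempty[OF N] by blast
  then show ?thesis using rep_exists[OF N] by blast
qed

end

section \<open>Transport of generated subsystems along a correspondence\<close>

locale self_pair = coords \<J> Jsub G X F S h + two_groups G G R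
  for \<J> :: "'j set" and Jsub and G :: "'g monoid" (structure) and X F
    and S :: "('j, 'a) lstruct" and h and R
begin

sublocale pair: pair_coords \<J> Jsub G X F S h G X F S h R
  by unfold_locales

text \<open>Every rule is invariant under correspondences. For \<open>up\<close>: a subgroup above
  \<open>N\<close> has an open image above \<open>N'\<close> that matches it, and \<open>N\<close>
  and \<open>N'\<close> have the same index.\<close>

lemma gen_transfer:
  assumes T: "T \<subseteq> {(N, J). N \<in> ON \<and> J \<in> F N}" "T' \<subseteq> {(N, J). N \<in> ON \<and> J \<in> F N}"
    and tr: "\<And>N J. (N, J) \<in> T \<Longrightarrow> \<exists>N'. (N', J) \<in> T' \<and> matches R N N'"
    and g: "gen T N J"
  shows "\<exists>N'. gen T' N' J \<and> matches R N N'"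
  using g
proof induction
  case (tag N J) then show ?case using tr gen.tag by blast
next
  case (top J) then show ?case using gen.top matches_carrier[OF gour] by blast
next
  case (sqrt N J J') then show ?case using gen.sqrt by blast
next
  case (up N J M k)
  then obtain N' where N': "gen T' N' J" "matches R N N'" by blast
  have n: "N \<in> ON" "N' \<in> ON" using gen_F[OF T(1) up.hyps(1)] gen_F[OF T(2) N'(1)] by blast+
  note m = image_normal[OF ON_normal[OF n(1)] ON_normal[OF n(2)] N'(2) up.hyps(2) ON_normal[OF up.hyps(3)]]
  have "index G N' \<le> k"
    using card_rcosets_eq[OF ON_normal[OF n(1)] ON_normal[OF n(2)] N'(2)] up.hyps(4) by (simp add: index_def)
  then have "gen T' (R `` M) (Jsub k J)"
    using gen.up[OF N'(1) m(2) upper_ON[OF n(2) m(2,1)] _ up.hyps(5)] by blast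
  then show ?case using m(3) by blast
next
  case (meet N J M J') then show ?case using gen.meet matches_Int by blast
qed

text \<open>The choice is a description: a coset has at most one match, and an element is determined
  by its sort and its coset.\<close>

definition match :: "'j srt \<Rightarrow> 'a \<Rightarrow> 'a" where
  "match s x = (SOME y. (s, y) \<in> elements \<J> S \<and> matches R (cst (s, x)) (cst (s, y)))"

lemma match_eq:
  assumes "w \<in> elements \<J> S" "fst w = fst z" "matches R (cst z) (cst w)"
  shows "emb match z = w"
proof -
  obtain s x y where z: "z = (s, x)" "w = (s, y)" by (metis assms(2) prod.exhaust_sel)
  have "(s, match s x) \<in> elements \<J> S \<and> matches R (cst (s, x)) (cst (s, match s x))"
    unfolding match_def by (rule someI[of _ y]) (use assms z in simp)
  then have "cst (s, match s x) = cst (s, y)"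
    using matches_unique[OF gour _ _ cst_subset cst_subset] assms z by blast
  then show ?thesis using cst_inj \<open>(s, match s x) \<in> elements \<J> S \<and> _\<close> assms z by fastforce
qed

text \<open>Tags forget first components, so the generators have to agree in their sequences only.
  The image of \<open>z\<close> fits into the sort of \<open>z\<close> because indices are
  preserved.\<close>

lemma Gen_transfer:
  assumes Y: "Y \<subseteq> elements \<J> S" "Y' \<subseteq> elements \<J> S"
    and tr: "\<And>y. y \<in> Y \<Longrightarrow> \<exists>y' \<in> Y'. snd (fst y') = snd (fst y) \<and> matches R (cst y) (cst y')"
    and z: "z \<in> Gen Y"
  shows "emb match z \<in> Gen Y'" "matches R (cst z) (cst (emb match z))"
proof -
  have ze: "z \<in> elements \<J> S" and g: "gen (tags Y) (nrm z) (snd (fst z))" using z by (auto simp: Gen_def)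
  have "\<exists>N'. (N', J) \<in> tags Y' \<and> matches R N N'" if NJ: "(N, J) \<in> tags Y" for N J
  proof -
    obtain y where y: "y \<in> Y" "N = nrm y" "J = snd (fst y)" using NJ by (auto simp: tags_def)
    then obtain y' where y': "y' \<in> Y'" "snd (fst y') = J" "matches R (cst y) (cst y')" using tr by metis
    then have "matches R N (nrm y')" using pair.matches_nrm Y y by blast
    then show ?thesis using y' by (auto simp: tags_def)
  qed
  then obtain N' where N': "gen (tags Y') N' (snd (fst z))" "matches R (nrm z) N'"
    using gen_transfer[OF tags_F[OF Y(1)] tags_F[OF Y(2)] _ g] by blast
  have n: "N' \<in> ON" "snd (fst z) \<in> F N'" using gen_F[OF tags_F[OF Y(2)] N'(1)] by blast+
  note c = image_coset[OF nrm_normal[OF ze] ON_normal[OF n(1)] N'(2) elem_props(2)[OF ze]]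
  have "index G N' \<le> fst (fst z)"
    using card_rcosets_eq[OF nrm_normal[OF ze] ON_normal[OF n(1)] N'(2)] elem_props(3)[OF ze]
    by (simp add: index_def)
  moreover have "fst z \<in> sorts \<J>" using ze by (auto simp: elements_def)
  ultimately obtain x where x: "(fst z, x) \<in> elements \<J> S" "cst (fst z, x) = R `` cst z" "nrm (fst z, x) = N'"
    using elem_exists[OF _ n(1) _ n(2) c(1)] by blast
  have "emb match z = (fst z, x)" using match_eq[OF x(1)] x(2) c(2) by simp
  then show "emb match z \<in> Gen Y'" "matches R (cst z) (cst (emb match z))"
    using x N'(1) c(2) by (auto simp: Gen_def)
qed

lemma match_embedding:
  assumes "Y \<subseteq> elements \<J> S" "Y' \<subseteq> elements \<J> S"
    and "\<And>y. y \<in> Y \<Longrightarrow> \<exists>y' \<in> Y'. snd (fst y') = snd (fst y) \<and> matches R (cst y) (cst y')"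
  shows "embedding \<J> (substructure S (Gen Y)) S match"
proof (rule pair.embedding_by_matches[OF Gen_elements])
  fix z assume z: "z \<in> Gen Y"
  have "emb match z \<in> Gen Y'" by (rule Gen_transfer(1)[OF assms(1,2) _ z]) (rule assms(3))
  moreover have "matches R (cst z) (cst (emb match z))"
    by (rule Gen_transfer(2)[OF assms(1,2) _ z]) (rule assms(3))
  ultimately show "emb match z \<in> elements \<J> S \<and> matches R (cst z) (cst (emb match z))"
    using Gen_elements by blast
qed

end

lemma self_pair_converse:
  assumes "self_pair \<J> Jsub G X F S h R" shows "self_pair \<J> Jsub G X F S h (R\<inverse>)"
proof -
  interpret self_pair \<J> Jsub G X F S h R by (rule assms)
  show ?thesis using two_groups_sym[OF two_groups_axioms] by (intro self_pair.intro coords_axioms)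
qed

lemma embedding_into_substructure:
  "embedding \<J> T S f \<Longrightarrow> (\<And>s x. s \<in> sorts \<J> \<Longrightarrow> x \<in> univ T s \<Longrightarrow> (s, f s x) \<in> A) \<Longrightarrow>
   embedding \<J> T (substructure S A) f"
  by (auto simp: embedding_def substructure_def)

context self_pair
begin

text \<open>Surjectivity is the same construction applied to the converse correspondence.\<close>

lemma match_isomorphism:
  assumes Y: "Y \<subseteq> elements \<J> S" "Y' \<subseteq> elements \<J> S"
    and tr: "\<And>y. y \<in> Y \<Longrightarrow> \<exists>y' \<in> Y'. snd (fst y') = snd (fst y) \<and> matches R (cst y) (cst y')"
    and tr': "\<And>y'. y' \<in> Y' \<Longrightarrow> \<exists>y \<in> Y. snd (fst y) = snd (fst y') \<and> matches R (cst y) (cst y')"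
  shows "isomorphism \<J> (substructure S (Gen Y)) (substructure S (Gen Y')) match"
proof -
  interpret conv: self_pair \<J> Jsub G X F S h "R\<inverse>" by (rule self_pair_converse) unfold_locales
  have el: "(s, match s x) \<in> Gen Y'" if "(s, x) \<in> Gen Y" for s x
  proof -
    have "emb match (s, x) \<in> Gen Y'" by (rule Gen_transfer(1)[OF Y _ that]) (rule tr)
    then show ?thesis by simp
  qed
  have "embedding \<J> (substructure S (Gen Y)) (substructure S (Gen Y')) match"
  proof (rule embedding_into_substructure[OF match_embedding[OF Y tr]])
    fix s x assume "x \<in> univ (substructure S (Gen Y)) s"
    then have "(s, x) \<in> Gen Y" by (simp add: substructure_def)
    then show "(s, match s x) \<in> Gen Y'" by (rule el)
  qed
  moreover have "match s ` {x. (s, x) \<in> Gen Y} = {x. (s, x) \<in> Gen Y'}" for s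
  proof
    show "match s ` {x. (s, x) \<in> Gen Y} \<subseteq> {x. (s, x) \<in> Gen Y'}" using el by blast
    show "{x. (s, x) \<in> Gen Y'} \<subseteq> match s ` {x. (s, x) \<in> Gen Y}"
    proof
      fix y assume "y \<in> {x. (s, x) \<in> Gen Y'}"
      then have y: "(s, y) \<in> Gen Y'" by simp
      have t: "\<exists>y \<in> Y. snd (fst y) = snd (fst y') \<and> matches (R\<inverse>) (cst y') (cst y)" if "y' \<in> Y'" for y'
        using tr'[OF that] by (simp add: matches_converse)
      have "emb conv.match (s, y) \<in> Gen Y" by (rule conv.Gen_transfer(1)[OF Y(2,1) _ y]) (rule t)
      moreover have "matches (R\<inverse>) (cst (s, y)) (cst (emb conv.match (s, y)))"
        by (rule conv.Gen_transfer(2)[OF Y(2,1) _ y]) (rule t)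
      ultimately have "(s, conv.match s y) \<in> Gen Y" "matches R (cst (s, conv.match s y)) (cst (s, y))"
        by (simp_all add: matches_converse)
      moreover from this have "emb match (s, conv.match s y) = (s, y)"
        using y Gen_elements by (intro match_eq) auto
      ultimately have "y = match s (conv.match s y)" "conv.match s y \<in> {x. (s, x) \<in> Gen Y}" by simp_all
      then show "y \<in> match s ` {x. (s, x) \<in> Gen Y}" by (rule image_eqI)
    qed
  qed
  ultimately show ?thesis by (simp add: isomorphism_def substructure_def)
qed

end

context scs
begin

lemma finitely_generated_Gen:
  assumes "Y \<subseteq> elements \<J> S" "finite Y"
  shows "finitely_generated_subsystem \<J> Jsub S (Gen Y)"
proof -
  have "finite (tags Y)" using assms(2) by (simp add: tags_def)
  then show ?thesis
    unfolding finitely_generated_subsystem_def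
    using subsystem_Gen[OF assms(1)] generated_eq[OF assms(1)] assms by metis
qed

text \<open>An embedding of a subsystem and the inclusion, read in coordinates of the subsystem,
  compose to a correspondence of \<open>G\<close> with itself.\<close>

lemma embedding_correspondence:
  assumes A: "subsystem \<J> Jsub S A" and \<psi>: "embedding \<J> (substructure S A) S \<psi>"
    and Z: "finite Z" "Z \<subseteq> A"
  shows "\<exists>R. goursat G G R \<and> (\<forall>z \<in> Z. emb \<psi> z \<in> elements \<J> S \<and> matches R (cst z) (cst (emb \<psi> z)))"
proof -
  obtain K :: "('j srt \<times> 'a) set monoid" and XK FK f where
    K: "coords \<J> Jsub K XK FK (substructure S A) f" and el: "elements \<J> (substructure S A) = A"
    using subsystem_coords[OF A] .
  interpret K: coords \<J> Jsub K XK FK "substructure S A" f by (rule K)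
  have "embedding \<J> (substructure S A) S (\<lambda>s x. x)"
    using embedding_inclusion A by (simp add: subsystem_def)
  then interpret i: two_coords \<J> Jsub K XK FK "substructure S A" f G X F S h "\<lambda>s x. x"
    by unfold_locales
  interpret p: two_coords \<J> Jsub K XK FK "substructure S A" f G X F S h \<psi>
    by unfold_locales (fact \<psi>)
  obtain b where b: "b \<in> elements \<J> (substructure S A)" "\<forall>z \<in> Z. K.nrm b \<subseteq> K.nrm z"
    using K.lower_bound[of Z] Z el by auto
  let ?R = "(i.corr b)\<inverse> O p.corr b"
  have "goursat G G ?R"
    by (rule goursat_comp[OF goursat_converse[OF i.corr_goursat[OF b(1)]] p.corr_goursat[OF b(1)]])
  moreover have "emb \<psi> z \<in> elements \<J> S \<and> matches ?R (cst z) (cst (emb \<psi> z))" if "z \<in> Z" for z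
  proof -
    have z: "z \<in> elements \<J> (substructure S A)" "K.nrm b \<subseteq> K.nrm z" using that Z el b by auto
    have "matches (i.corr b) (K.cst z) (cst z)" using i.corr_matches[OF b(1) refl refl z] by simp
    then have "matches ((i.corr b)\<inverse>) (cst z) (K.cst z)" by (simp add: matches_converse)
    then show ?thesis
      using matches_comp[OF _ p.corr_matches[OF b(1) refl refl z]] p.e_elem[OF z(1)] by blast
  qed
  ultimately show ?thesis by blast
qed

end

section \<open>The extension property\<close>

locale sep = scs +
  assumes co_SEP: "co_SEP \<J> Jsub S"
begin

text \<open>The co-sorted embedding property is applied to \<open>?S1\<close>, generated by
  \<open>x\<close> and the first components of \<open>D\<close>, and to \<open>?S2\<close>,
  generated by the second components. The embedding of \<open>?S2\<close> into \<open>?S1\<close> is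
  induced by the converse of \<open>R\<close>, and that of \<open>?S2\<close> into itself is the
  identity. The resulting \<open>\<psi>\<close> sends each first component to its second component
  and \<open>x\<close> to the required \<open>y\<close>. Its correspondence \<open>R'\<close> keeps
  the matches in \<open>D\<close> but need not contain \<open>R\<close>.\<close>

lemma extend:
  assumes R: "goursat G G R" and D: "finite D" "D \<subseteq> elements \<J> S \<times> elements \<J> S"
    and m: "\<And>a b. (a, b) \<in> D \<Longrightarrow> fst a = fst b \<and> matches R (cst a) (cst b)"
    and x: "x \<in> elements \<J> S"
  shows "\<exists>R' y. goursat G G R' \<and> y \<in> elements \<J> S \<and> fst y = fst x \<and> matches R' (cst x) (cst y) \<and>
     (\<forall>(a, b) \<in> D. matches R' (cst a) (cst b))"
proof -
  let ?Y1 = "fst ` D" and ?Y2 = "snd ` D"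
  let ?S1 = "Gen (insert x ?Y1)" and ?S2 = "Gen ?Y2"
  have Y: "?Y1 \<subseteq> elements \<J> S" "?Y2 \<subseteq> elements \<J> S" "insert x ?Y1 \<subseteq> elements \<J> S" using D x by auto
  have fin: "finite (insert x ?Y1)" "finite ?Y2" using D by auto
  interpret c: self_pair \<J> Jsub G X F S h "R\<inverse>"
    using goursat_converse[OF R] by unfold_locales
  have tr: "\<exists>y' \<in> ?Y1. snd (fst y') = snd (fst y) \<and> matches (R\<inverse>) (cst y) (cst y')" if y: "y \<in> ?Y2" for y
  proof -
    obtain a where a: "(a, y) \<in> D" using y by auto
    then show ?thesis using m[OF a] by (intro bexI[of _ a]) (auto simp: matches_converse intro: image_eqI[of a fst "(a, y)"])
  qed
  let ?\<pi> = "c.match"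
  have sub: "Gen ?Y1 \<subseteq> ?S1" by (rule Gen_mono) auto
  have e1: "embedding \<J> (substructure S ?S2) (substructure S ?S1) ?\<pi>"
  proof (intro embedding_into_substructure[OF c.match_embedding[OF Y(2,1) tr]])
    fix s y assume "y \<in> univ (substructure S ?S2) s"
    then have sy: "(s, y) \<in> ?S2" by (simp add: substructure_def)
    have "emb c.match (s, y) \<in> Gen ?Y1" by (rule c.Gen_transfer(1)[OF Y(2,1) _ sy]) (rule tr)
    then have "(s, c.match s y) \<in> Gen ?Y1" by (simp only: emb_simps)
    then show "(s, c.match s y) \<in> ?S1" using sub by blast
  qed
  have e2: "embedding \<J> (substructure S ?S2) (substructure S ?S2) (\<lambda>s x. x)"
    by (auto simp: embedding_def)
  obtain \<psi> where \<psi>: "embedding \<J> (substructure S ?S1) S \<psi>"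
    "\<forall>(s, x) \<in> ?S2. \<psi> s (?\<pi> s x) = x"
    using co_SEP[unfolded co_SEP_def, rule_format, OF conjI[OF finitely_generated_Gen[OF Y(3) fin(1)]
          conjI[OF finitely_generated_Gen[OF Y(2) fin(2)] conjI[OF e1 e2]]]] by blast
  have subs: "subsystem \<J> Jsub S ?S1"
    using finitely_generated_Gen[OF Y(3) fin(1)] by (simp add: finitely_generated_subsystem_def)
  obtain R' where R': "goursat G G R'"
    "\<And>z. z \<in> insert x ?Y1 \<Longrightarrow> emb \<psi> z \<in> elements \<J> S \<and> matches R' (cst z) (cst (emb \<psi> z))"
    using embedding_correspondence[OF subs \<psi>(1) fin(1) Gen_superset[OF Y(3)]] by blast
  have eab: "emb \<psi> a = b" if ab: "(a, b) \<in> D" for a b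
  proof -
    have "b \<in> ?S2" using Gen_superset[OF Y(2)] ab by force
    have "emb ?\<pi> b = a"
      using m[OF ab] ab D by (intro c.match_eq) (auto simp: matches_converse)
    then show ?thesis using \<psi>(2) \<open>b \<in> ?S2\<close> by (cases b) (auto simp: emb_def)
  qed
  have mD: "matches R' (cst a) (cst b)" if ab: "(a, b) \<in> D" for a b
  proof -
    have "a \<in> insert x ?Y1" using ab by force
    then show ?thesis using R'(2)[of a] eab[OF ab] by simp
  qed
  show ?thesis
  proof (intro exI conjI)
    show "goursat G G R'" by (rule R'(1))
    show "emb \<psi> x \<in> elements \<J> S" "matches R' (cst x) (cst (emb \<psi> x))" using R'(2)[of x] by simp_all
    show "fst (emb \<psi> x) = fst x" by simp
    show "\<forall>(a, b) \<in> D. matches R' (cst a) (cst b)" using mD by blast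
  qed
qed

end

section \<open>Invariance of formulas\<close>

lemma finite_tm_vars [simp]: "finite (tm_vars s t)"
  by (cases t) auto

lemma finite_free_vars [simp]: "finite (free_vars \<phi>)"
  by (induction \<phi>) auto

lemma finite_tm_consts [simp]: "finite (tm_consts s t)"
  by (cases t) auto

lemma finite_fm_consts [simp]: "finite (fm_consts \<phi>)"
  by (induction \<phi>) auto

lemma val_no_const: "tm_consts s t = {} \<Longrightarrow> \<exists>n. t = Var n"
  by (cases t) auto

context self_pair
begin

text \<open>The first components of \<open>D\<close> form a substructure, in general not a
  subsystem, on which \<open>match\<close> is an embedding that takes them to the second components.
  Invariance of atomic formulas is read off from it.\<close>

lemma matched_atoms:
  assumes "\<And>z w. (z, w) \<in> D \<Longrightarrow> z \<in> elements \<J> S \<and> w \<in> elements \<J> S \<and> fst w = fst z \<and> matches R (cst z) (cst w)"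
  shows "((s, x), (s, x')) \<in> D \<Longrightarrow> ((s, y), (s, y')) \<in> D \<Longrightarrow> x = y \<longleftrightarrow> x' = y'"
    and "((s, x), (s, x')) \<in> D \<Longrightarrow> ((t, y), (t, y')) \<in> D \<Longrightarrow> le S s t x y \<longleftrightarrow> le S s t x' y'"
    and "((s, x), (s, x')) \<in> D \<Longrightarrow> ((t, y), (t, y')) \<in> D \<Longrightarrow> crel S s t x y \<longleftrightarrow> crel S s t x' y'"
    and "((s, x), (s, x')) \<in> D \<Longrightarrow> ((s, y), (s, y')) \<in> D \<Longrightarrow> ((s, z), (s, z')) \<in> D \<Longrightarrow>
      prel S s x y z \<longleftrightarrow> prel S s x' y' z'"
proof -
  have m: "emb match z = w" if "(z, w) \<in> D" for z w
    using assms[OF that] match_eq by blast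
  have emb: "embedding \<J> (substructure S (fst ` D)) S match"
  proof (rule pair.embedding_by_matches)
    show "fst ` D \<subseteq> elements \<J> S" using assms by auto
    fix z assume "z \<in> fst ` D"
    then obtain w where "(z, w) \<in> D" by auto
    then show "emb match z \<in> elements \<J> S \<and> matches R (cst z) (cst (emb match z))"
      using assms m by metis
  qed
  have el: "s \<in> sorts \<J> \<and> x \<in> univ (substructure S (fst ` D)) s \<and> match s x = x'"
    if d: "((s, x), (s, x')) \<in> D" for s x x'
    using m[OF d] assms[OF d] d by (force simp: substructure_def elements_def)
  have rels: "le (substructure S A) = le S" "crel (substructure S A) = crel S"
    "prel (substructure S A) = prel S" for A
    by (simp_all add: substructure_def)
  note e = emb[unfolded embedding_def rels]
  show "x = y \<longleftrightarrow> x' = y'" if "((s, x), (s, x')) \<in> D" "((s, y), (s, y')) \<in> D"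
  proof -
    have "inj_on (match s) (univ (substructure S (fst ` D)) s)" using e el[OF that(1)] by blast
    then show ?thesis using el[OF that(1)] el[OF that(2)] by (metis inj_onD)
  qed
  show "le S s t x y \<longleftrightarrow> le S s t x' y'" if "((s, x), (s, x')) \<in> D" "((t, y), (t, y')) \<in> D"
    using e[THEN conjunct2, THEN conjunct1] el[OF that(1)] el[OF that(2)] by blast
  show "crel S s t x y \<longleftrightarrow> crel S s t x' y'" if "((s, x), (s, x')) \<in> D" "((t, y), (t, y')) \<in> D"
    using e[THEN conjunct2, THEN conjunct1] el[OF that(1)] el[OF that(2)] by blast
  show "prel S s x y z \<longleftrightarrow> prel S s x' y' z'"
    if "((s, x), (s, x')) \<in> D" "((s, y), (s, y')) \<in> D" "((s, z), (s, z')) \<in> D"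
    using e[THEN conjunct2, THEN conjunct2] el[OF that(1)] el[OF that(2)] el[OF that(3)] by blast
qed

end

context sep
begin

definition agree where
  "agree R V e e' \<longleftrightarrow> (\<forall>(s, n) \<in> V. (s, e s n) \<in> elements \<J> S \<and> (s, e' s n) \<in> elements \<J> S \<and>
    matches R (cst (s, e s n)) (cst (s, e' s n)))"

lemma agreeD:
  assumes "agree R V e e'" "(s, n) \<in> V"
  shows "(s, e s n) \<in> elements \<J> S" "(s, e' s n) \<in> elements \<J> S" "matches R (cst (s, e s n)) (cst (s, e' s n))"
  using assms unfolding agree_def by blast+

lemma agree_mono: "agree R V e e' \<Longrightarrow> W \<subseteq> V \<Longrightarrow> agree R W e e'"
  unfolding agree_def by blast

lemma agree_converse: "agree R V e e' \<Longrightarrow> agree (R\<inverse>) V e' e"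
  unfolding agree_def matches_converse by blast

lemma agree_extend:
  assumes R: "goursat G G R" and a: "agree R V e e'" "finite V" and x: "(s, x) \<in> elements \<J> S"
  shows "\<exists>R' y. goursat G G R' \<and> (s, y) \<in> elements \<J> S \<and> matches R' (cst (s, x)) (cst (s, y)) \<and>
    agree R' V e e'"
proof -
  define D where "D = (\<lambda>(t, m). ((t, e t m), (t, e' t m))) ` V"
  have D: "finite D" "D \<subseteq> elements \<J> S \<times> elements \<J> S"
    using a agreeD(1,2)[OF a(1)] by (auto simp: D_def)
  have "fst z = fst w \<and> matches R (cst z) (cst w)" if "(z, w) \<in> D" for z w
    using that agreeD(3)[OF a(1)] by (auto simp: D_def)
  then obtain R' y where R': "goursat G G R'" "y \<in> elements \<J> S" "fst y = s" "matches R' (cst (s, x)) (cst y)"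
    "\<forall>(z, w) \<in> D. matches R' (cst z) (cst w)"
    using extend[OF R D _ x] by auto
  have "agree R' V e e'"
    unfolding agree_def
  proof (clarify, intro conjI)
    fix t m assume tm: "(t, m) \<in> V"
    show "(t, e t m) \<in> elements \<J> S" "(t, e' t m) \<in> elements \<J> S" by (fact agreeD[OF a(1) tm])+
    have "((t, e t m), (t, e' t m)) \<in> D" using tm by (force simp: D_def)
    then show "matches R' (cst (t, e t m)) (cst (t, e' t m))" using R'(5) by blast
  qed
  moreover have "y = (s, snd y)" using R'(3) by (cases y) simp
  ultimately show ?thesis using R' by metis
qed

text \<open>Back and forth. The correspondence controls the values of the finitely many free
  variables; at a quantifier it is replaced by one that also matches the new value, which is why
  \<open>R\<close> varies in the induction. The other direction uses the converse.\<close>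

lemma sat_agree:
  assumes "goursat G G R" "agree R (free_vars \<phi>) e e'" "fm_consts \<phi> = {}" "fm_sorts \<phi> \<subseteq> sorts \<J>"
  shows "sat S I e \<phi> \<longleftrightarrow> sat S I e' \<phi>"
  using assms
proof (induction \<phi> arbitrary: R e e')
  have atoms: "e s n = e s m \<longleftrightarrow> e' s n = e' s m" if "goursat G G R" "agree R {(s, n), (s, m)} e e'" for R e e' s n m
  proof -
    interpret self_pair \<J> Jsub G X F S h R by unfold_locales (fact that(1))
    show ?thesis
      using that(2) by (intro matched_atoms(1)[of "{((s, e s n), (s, e' s n)), ((s, e s m), (s, e' s m))}"])
        (auto simp: agree_def)
  qed
  have atoms2: "(le S s t (e s n) (e t m) \<longleftrightarrow> le S s t (e' s n) (e' t m)) \<and>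
      (crel S s t (e s n) (e t m) \<longleftrightarrow> crel S s t (e' s n) (e' t m))"
    if "goursat G G R" "agree R {(s, n), (t, m)} e e'" for R e e' s t n m
  proof -
    interpret self_pair \<J> Jsub G X F S h R by unfold_locales (fact that(1))
    show ?thesis
      using that(2)
      by (intro conjI matched_atoms(2,3)[of "{((s, e s n), (s, e' s n)), ((t, e t m), (t, e' t m))}"])
        (auto simp: agree_def)
  qed
  have atoms3: "prel S s (e s n) (e s m) (e s k) \<longleftrightarrow> prel S s (e' s n) (e' s m) (e' s k)"
    if "goursat G G R" "agree R {(s, n), (s, m), (s, k)} e e'" for R e e' s n m k
  proof -
    interpret self_pair \<J> Jsub G X F S h R by unfold_locales (fact that(1))
    show ?thesis
      using that(2)
      by (intro matched_atoms(4)[of "{((s, e s n), (s, e' s n)), ((s, e s m), (s, e' s m)), ((s, e s k), (s, e' s k))}"])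
        (auto simp: agree_def)
  qed
  {
    case (Eq s t u)
    then obtain n m where "t = Var n" "u = Var m" using val_no_const[of s t] val_no_const[of s u] by auto
    then show ?case using atoms[OF Eq(1), of s n m e e'] Eq(2) by (simp add: insert_commute)
  next
    case (Le s s' t u)
    then obtain n m where "t = Var n" "u = Var m" using val_no_const[of s t] val_no_const[of s' u] by auto
    then show ?case using atoms2[OF Le(1), of s n s' m e e'] Le(2) by (simp add: insert_commute)
  next
    case (Crel s s' t u)
    then obtain n m where "t = Var n" "u = Var m" using val_no_const[of s t] val_no_const[of s' u] by auto
    then show ?case using atoms2[OF Crel(1), of s n s' m e e'] Crel(2) by (simp add: insert_commute)
  next
    case (Prel s t u v)
    then obtain n m k where "t = Var n" "u = Var m" "v = Var k"
      using val_no_const[of s t] val_no_const[of s u] val_no_const[of s v] by auto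
    then show ?case using atoms3[OF Prel(1), of s n m k e e'] Prel(2) by (simp add: insert_commute)
  next
    case (Neg \<phi>) then show ?case using Neg.IH[of R e e'] by simp
  next
    case (Conj \<phi> \<psi>)
    then show ?case
      using Conj.IH(1)[OF Conj.prems(1) agree_mono[OF Conj.prems(2)]]
        Conj.IH(2)[OF Conj.prems(1) agree_mono[OF Conj.prems(2)]] by simp
  next
    case (Ex s n \<phi>)
    have step: "sat S I e' (Ex s n \<phi>)"
      if R: "goursat G G R" and a: "agree R (free_vars (Ex s n \<phi>)) e e'" and st: "sat S I e (Ex s n \<phi>)"
      for R e e'
    proof -
      obtain x where x: "x \<in> univ S s" "sat S I (e(s := (e s)(n := x))) \<phi>" using st by auto
      have xe: "(s, x) \<in> elements \<J> S" using x(1) Ex.prems(4) by (simp add: elements_def)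
      obtain R' y where R': "goursat G G R'" "(s, y) \<in> elements \<J> S" "matches R' (cst (s, x)) (cst (s, y))"
        "agree R' (free_vars (Ex s n \<phi>)) e e'"
        using agree_extend[OF R a finite_free_vars xe] by blast
      have cc: "fm_consts \<phi> = {}" "fm_sorts \<phi> \<subseteq> sorts \<J>" using Ex.prems(3,4) by auto
      have "agree R' (free_vars \<phi>) (e(s := (e s)(n := x))) (e'(s := (e' s)(n := y)))"
        unfolding agree_def
      proof clarify
        fix t m assume tm: "(t, m) \<in> free_vars \<phi>"
        show "(t, (e(s := (e s)(n := x))) t m) \<in> elements \<J> S \<and>
          (t, (e'(s := (e' s)(n := y))) t m) \<in> elements \<J> S \<and>
          matches R' (cst (t, (e(s := (e s)(n := x))) t m)) (cst (t, (e'(s := (e' s)(n := y))) t m))"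
          using agreeD[OF R'(4), of t m] R'(2,3) xe tm by (cases "t = s \<and> m = n") auto
      qed
      then have "sat S I (e(s := (e s)(n := x))) \<phi> \<longleftrightarrow> sat S I (e'(s := (e' s)(n := y))) \<phi>"
        by (rule Ex.IH[OF R'(1) _ cc])
      with x(2) have "sat S I (e'(s := (e' s)(n := y))) \<phi>" by simp
      then show ?thesis using R'(2) by (auto simp: elements_def)
    qed
    show ?case
      using step[OF Ex.prems(1,2)] step[OF goursat_converse[OF Ex.prems(1)] agree_converse[OF Ex.prems(2)]]
      by blast
  }
qed

end

section \<open>Substitution\<close>

text \<open>Simultaneous substitution for free variables and for constants, which can turn either
  into the other. The bound variable is renamed to a number that is new for its sort, so nothing is
  captured.\<close>

primrec fsub :: "('j srt \<Rightarrow> nat \<Rightarrow> 'd tm) \<Rightarrow> ('j srt \<Rightarrow> 'c \<Rightarrow> 'd tm) \<Rightarrow> ('j, 'c) fm \<Rightarrow> ('j, 'd) fm" where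
  "fsub \<rho> \<kappa> (Eq s t u) = Eq s (case_tm (\<rho> s) (\<kappa> s) t) (case_tm (\<rho> s) (\<kappa> s) u)"
| "fsub \<rho> \<kappa> (Le s s' t u) = Le s s' (case_tm (\<rho> s) (\<kappa> s) t) (case_tm (\<rho> s') (\<kappa> s') u)"
| "fsub \<rho> \<kappa> (Crel s s' t u) = Crel s s' (case_tm (\<rho> s) (\<kappa> s) t) (case_tm (\<rho> s') (\<kappa> s') u)"
| "fsub \<rho> \<kappa> (Prel s t u v) =
     Prel s (case_tm (\<rho> s) (\<kappa> s) t) (case_tm (\<rho> s) (\<kappa> s) u) (case_tm (\<rho> s) (\<kappa> s) v)"
| "fsub \<rho> \<kappa> (Neg \<phi>) = Neg (fsub \<rho> \<kappa> \<phi>)"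
| "fsub \<rho> \<kappa> (Conj \<phi> \<psi>) = Conj (fsub \<rho> \<kappa> \<phi>) (fsub \<rho> \<kappa> \<psi>)"
| "fsub \<rho> \<kappa> (Ex s n \<phi>) =
     (let m = (SOME m. (s, m) \<notin> (\<Union>(t, i) \<in> free_vars (Ex s n \<phi>). tm_vars t (\<rho> t i)) \<union>
                (\<Union>(t, c) \<in> fm_consts \<phi>. tm_vars t (\<kappa> t c)))
      in Ex s m (fsub (\<rho>(s := (\<rho> s)(n := Var m))) \<kappa> \<phi>))"

lemma fresh_var:
  fixes s :: "'s" assumes "finite (A :: ('s \<times> nat) set)"
  shows "(s, SOME m. (s, m) \<notin> A) \<notin> A"
proof -
  have "finite (snd ` A)" using assms by simp
  then obtain m where "m \<notin> snd ` A" using ex_new_if_finite infinite_UNIV_nat by blast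
  then have "(s, m) \<notin> A" by force
  then show ?thesis by (rule someI)
qed

lemma fm_sorts_fsub [simp]: "fm_sorts (fsub \<rho> \<kappa> \<phi>) = fm_sorts \<phi>"
  by (induction \<phi> arbitrary: \<rho>) (auto simp: Let_def)

lemma fm_consts_fsub:
  "fm_consts (fsub \<rho> \<kappa> \<phi>) \<subseteq>
    (\<Union>(t, i) \<in> free_vars \<phi>. tm_consts t (\<rho> t i)) \<union> (\<Union>(t, c) \<in> fm_consts \<phi>. tm_consts t (\<kappa> t c))"
proof (induction \<phi> arbitrary: \<rho>)
  case (Eq s t u)
  show ?case by (cases t; cases u) auto
next
  case (Le s s' t u)
  show ?case by (cases t; cases u) auto
next
  case (Crel s s' t u)
  show ?case by (cases t; cases u) auto
next
  case (Prel s t u v)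
  show ?case by (cases t; cases u; cases v) auto
next
  case (Neg \<phi>) then show ?case by simp
next
  case (Conj \<phi> \<psi>)
  show ?case using Conj(1)[of \<rho>] Conj(2)[of \<rho>] by simp blast
next
  case (Ex s n \<phi>)
  define m where "m = (SOME m. (s, m) \<notin> (\<Union>(t, i) \<in> free_vars \<phi> - {(s, n)}. tm_vars t (\<rho> t i)) \<union>
                (\<Union>(t, c) \<in> fm_consts \<phi>. tm_vars t (\<kappa> t c)))"
  have "(\<Union>(t, i) \<in> free_vars \<phi>. tm_consts t ((\<rho>(s := (\<rho> s)(n := Var m))) t i)) \<subseteq>
      (\<Union>(t, i) \<in> free_vars \<phi> - {(s, n)}. tm_consts t (\<rho> t i))"
    by (auto split: if_splits)
  note L = this
  have sub: "\<And>X L L' K. X \<subseteq> L \<union> K \<Longrightarrow> L \<subseteq> L' \<Longrightarrow> X \<subseteq> L' \<union> K" by blast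
  show ?case
    unfolding fsub.simps Let_def fm_consts.simps free_vars.simps
    unfolding m_def[symmetric]
    by (rule sub[OF Ex(1) L])
qed

lemma free_vars_fsub:
  "free_vars (fsub \<rho> \<kappa> \<phi>) \<subseteq>
    (\<Union>(t, i) \<in> free_vars \<phi>. tm_vars t (\<rho> t i)) \<union> (\<Union>(t, c) \<in> fm_consts \<phi>. tm_vars t (\<kappa> t c))"
proof (induction \<phi> arbitrary: \<rho>)
  case (Eq s t u)
  show ?case by (cases t; cases u) auto
next
  case (Le s s' t u)
  show ?case by (cases t; cases u) auto
next
  case (Crel s s' t u)
  show ?case by (cases t; cases u) auto
next
  case (Prel s t u v)
  show ?case by (cases t; cases u; cases v) auto
next
  case (Neg \<phi>) then show ?case by simp
next
  case (Conj \<phi> \<psi>)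
  show ?case using Conj(1)[of \<rho>] Conj(2)[of \<rho>] by simp blast
next
  case (Ex s n \<phi>)
  define m where "m = (SOME m. (s, m) \<notin> (\<Union>(t, i) \<in> free_vars \<phi> - {(s, n)}. tm_vars t (\<rho> t i)) \<union>
                (\<Union>(t, c) \<in> fm_consts \<phi>. tm_vars t (\<kappa> t c)))"
  have "(\<Union>(t, i) \<in> free_vars \<phi>. tm_vars t ((\<rho>(s := (\<rho> s)(n := Var m))) t i)) \<subseteq>
      (\<Union>(t, i) \<in> free_vars \<phi> - {(s, n)}. tm_vars t (\<rho> t i)) \<union> {(s, m)}"
    by (auto split: if_splits)
  note L = this
  have sub: "\<And>X L L' K p. X \<subseteq> L \<union> K \<Longrightarrow> L \<subseteq> L' \<union> {p} \<Longrightarrow> X - {p} \<subseteq> L' \<union> K" by blast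
  show ?case
    unfolding fsub.simps Let_def fm_consts.simps free_vars.simps
    unfolding m_def[symmetric]
    by (rule sub[OF Ex(1) L])
qed

lemma val_case:
  assumes "\<And>i. (s, i) \<in> tm_vars s t \<Longrightarrow> val I' (e' s) (\<rho> s i) = e s i"
    and "\<And>c. (s, c) \<in> tm_consts s t \<Longrightarrow> val I' (e' s) (\<kappa> s c) = I c"
  shows "val I' (e' s) (case_tm (\<rho> s) (\<kappa> s) t) = val I (e s) t"
  using assms by (cases t) auto

lemma sat_fsub:
  assumes "\<And>s i. (s, i) \<in> free_vars \<phi> \<Longrightarrow> val I' (e' s) (\<rho> s i) = e s i"
    and "\<And>s c. (s, c) \<in> fm_consts \<phi> \<Longrightarrow> val I' (e' s) (\<kappa> s c) = I c"
  shows "sat M I' e' (fsub \<rho> \<kappa> \<phi>) \<longleftrightarrow> sat M I e \<phi>"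
  using assms
proof (induction \<phi> arbitrary: \<rho> e e')
  case (Eq s t u)
  then show ?case using val_case[of s t I' e' \<rho> e \<kappa> I] val_case[of s u I' e' \<rho> e \<kappa> I] by simp
next
  case (Le s s' t u)
  then show ?case using val_case[of s t I' e' \<rho> e \<kappa> I] val_case[of s' u I' e' \<rho> e \<kappa> I] by simp
next
  case (Crel s s' t u)
  then show ?case using val_case[of s t I' e' \<rho> e \<kappa> I] val_case[of s' u I' e' \<rho> e \<kappa> I] by simp
next
  case (Prel s t u v)
  then show ?case
    using val_case[of s t I' e' \<rho> e \<kappa> I] val_case[of s u I' e' \<rho> e \<kappa> I] val_case[of s v I' e' \<rho> e \<kappa> I] by simp
next
  case (Neg \<phi>)
  then show ?case
    using Neg.IH[of e' \<rho> e] unfolding free_vars.simps fm_consts.simps sat.simps fsub.simps by blast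
next
  case (Conj \<phi> \<psi>)
  have "val I' (e' s) (\<rho> s i) = e s i" if "(s, i) \<in> free_vars \<phi> \<union> free_vars \<psi>" for s i
    using Conj.prems(1)[of s i] that by simp
  moreover have "val I' (e' s) (\<kappa> s c) = I c" if "(s, c) \<in> fm_consts \<phi> \<union> fm_consts \<psi>" for s c
    using Conj.prems(2)[of s c] that by simp
  ultimately show ?case
    using Conj.IH[of e' \<rho> e] unfolding sat.simps fsub.simps by blast
next
  case (Ex s n \<phi>)
  let ?A = "(\<Union>(t, i) \<in> free_vars (Ex s n \<phi>). tm_vars t (\<rho> t i)) \<union> (\<Union>(t, c) \<in> fm_consts \<phi>. tm_vars t (\<kappa> t c))"
  define m where "m = (SOME m. (s, m) \<notin> ?A)"
  have m: "(s, m) \<notin> ?A" unfolding m_def by (rule fresh_var) auto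
  have "sat M I' (e'(s := (e' s)(m := x))) (fsub (\<rho>(s := (\<rho> s)(n := Var m))) \<kappa> \<phi>) \<longleftrightarrow>
      sat M I (e(s := (e s)(n := x))) \<phi>" for x
  proof (rule Ex.IH)
    fix t i assume ti: "(t, i) \<in> free_vars \<phi>"
    show "val I' ((e'(s := (e' s)(m := x))) t) ((\<rho>(s := (\<rho> s)(n := Var m))) t i) = (e(s := (e s)(n := x))) t i"
    proof (cases "(t, i) = (s, n)")
      case False
      then have fr: "(t, i) \<in> free_vars (Ex s n \<phi>)" using ti by simp
      then have "(s, m) \<notin> tm_vars t (\<rho> t i)" using m by blast
      then have "val I' ((e'(s := (e' s)(m := x))) t) (\<rho> t i) = val I' (e' t) (\<rho> t i)"
        by (cases "\<rho> t i") auto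
      then show ?thesis using Ex.prems(1)[OF fr] False by auto
    qed simp
  next
    fix t c assume tc: "(t, c) \<in> fm_consts \<phi>"
    then have "(s, m) \<notin> tm_vars t (\<kappa> t c)" using m by blast
    then have "val I' ((e'(s := (e' s)(m := x))) t) (\<kappa> t c) = val I' (e' t) (\<kappa> t c)"
      by (cases "\<kappa> t c") auto
    then show "val I' ((e'(s := (e' s)(m := x))) t) (\<kappa> t c) = I c" using Ex.prems(2) tc by simp
  qed
  then show ?case by (simp add: Let_def m_def[simplified])
qed

lemma sat_cong:
  assumes "\<forall>(s, i) \<in> free_vars \<phi>. e s i = e' s i" "\<forall>(s, c) \<in> fm_consts \<phi>. I c = I' c"
  shows "sat M I e \<phi> \<longleftrightarrow> sat M I' e' \<phi>"
  using assms
proof (induction \<phi> arbitrary: e e')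
  case (Ex s n \<phi>)
  have "sat M I (e(s := (e s)(n := x))) \<phi> \<longleftrightarrow> sat M I' (e'(s := (e' s)(n := x))) \<phi>" for x
  proof (rule Ex.IH)
    show "\<forall>(t, i) \<in> free_vars \<phi>. (e(s := (e s)(n := x))) t i = (e'(s := (e' s)(n := x))) t i"
    proof clarify
      fix t i assume "(t, i) \<in> free_vars \<phi>"
      then show "(e(s := (e s)(n := x))) t i = (e'(s := (e' s)(n := x))) t i"
        using bspec[OF Ex.prems(1), of "(t, i)"] by (cases "t = s"; cases "i = n") simp_all
    qed
  qed (use Ex.prems(2) in simp)
  then show ?case by simp
next
  case (Conj \<phi> \<psi>)
  have "sat M I e \<phi> \<longleftrightarrow> sat M I' e' \<phi>" by (rule Conj.IH(1)) (use Conj.prems in \<open>simp_all add: ball_Un\<close>)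
  moreover have "sat M I e \<psi> \<longleftrightarrow> sat M I' e' \<psi>"
    by (rule Conj.IH(2)) (use Conj.prems in \<open>simp_all add: ball_Un\<close>)
  ultimately show ?case by simp
next
  case (Eq s t u) then show ?case by (cases t; cases u) simp_all
next
  case (Le s s' t u) then show ?case by (cases t; cases u) simp_all
next
  case (Crel s s' t u) then show ?case by (cases t; cases u) simp_all
next
  case (Prel s t u v) then show ?case by (cases t; cases u; cases v) simp_all
qed simp

section \<open>Families of cosets of bounded index\<close>

text \<open>Closure under inverses follows because the fibres are cosets of one subgroup: with
  \<open>g1\<close> a partner of the inverse of \<open>x\<close> and \<open>u = g1 g\<close>, the
  fibre over the identity contains \<open>u\<close> and \<open>u u\<close>, so \<open>u\<close> lies
  in \<open>N\<close>.\<close>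

lemma goursat_of_fibres:
  assumes "group H" "group G" and N: "N \<lhd> G"
    and dom: "\<And>x g. (x, g) \<in> R \<Longrightarrow> x \<in> carrier H"
    and fib: "\<And>x. x \<in> carrier H \<Longrightarrow> \<exists>c \<in> rcosets\<^bsub>G\<^esub> N. \<forall>g. (x, g) \<in> R \<longleftrightarrow> g \<in> c"
    and onto: "\<And>g. g \<in> carrier G \<Longrightarrow> \<exists>x. (x, g) \<in> R"
    and mult: "\<And>x g x' g'. (x, g) \<in> R \<Longrightarrow> (x', g') \<in> R \<Longrightarrow> (x \<otimes>\<^bsub>H\<^esub> x', g \<otimes>\<^bsub>G\<^esub> g') \<in> R"
  shows "goursat H G R"
proof -
  interpret H: group H by fact
  interpret G: group G by fact
  have carr: "g \<in> carrier G" if "(x, g) \<in> R" for x g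
    using fib[OF dom[OF that]] that G.rcosets_subset_carrier[OF N] by blast
  have left: "\<exists>g. (x, g) \<in> R" if "x \<in> carrier H" for x
    using fib[OF that] G.rcosets_nonempty[OF N] by blast
  have inv: "(inv\<^bsub>H\<^esub> x, inv\<^bsub>G\<^esub> g) \<in> R" if xg: "(x, g) \<in> R" for x g
  proof -
    have c: "x \<in> carrier H" "g \<in> carrier G" using dom carr xg by blast+
    obtain g1 where g1: "(inv\<^bsub>H\<^esub> x, g1) \<in> R" using left c(1) by blast
    have c1: "g1 \<in> carrier G" using carr[OF g1] .
    define u where "u = g1 \<otimes>\<^bsub>G\<^esub> g"
    have uc: "u \<in> carrier G" using c c1 by (simp add: u_def)
    have u: "(\<one>\<^bsub>H\<^esub>, u) \<in> R" using mult[OF g1 xg] c by (simp add: u_def)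
    have uu: "(\<one>\<^bsub>H\<^esub>, u \<otimes>\<^bsub>G\<^esub> u) \<in> R" using mult[OF u u] by simp
    obtain c0 where c0: "c0 \<in> rcosets\<^bsub>G\<^esub> N" "\<forall>g. (\<one>\<^bsub>H\<^esub>, g) \<in> R \<longleftrightarrow> g \<in> c0" using fib by blast
    have "(u \<otimes>\<^bsub>G\<^esub> u) \<otimes>\<^bsub>G\<^esub> inv\<^bsub>G\<^esub> u \<in> N"
      using G.rcosets_mem[OF N c0(1), of u "u \<otimes>\<^bsub>G\<^esub> u"] c0(2) u uu by blast
    then have "u \<in> N" using uc by (simp add: G.m_assoc)
    then have "inv\<^bsub>G\<^esub> g \<otimes>\<^bsub>G\<^esub> inv\<^bsub>G\<^esub> g1 \<in> N"
      using G.normal_inv[OF N, of u] c c1 by (simp add: u_def G.inv_mult_group)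
    moreover obtain c2 where c2: "c2 \<in> rcosets\<^bsub>G\<^esub> N" "\<forall>g. (inv\<^bsub>H\<^esub> x, g) \<in> R \<longleftrightarrow> g \<in> c2"
      using fib[of "inv\<^bsub>H\<^esub> x"] c(1) by blast
    ultimately have "inv\<^bsub>G\<^esub> g \<in> c2"
      using G.rcosets_mem[OF N c2(1), of g1 "inv\<^bsub>G\<^esub> g"] g1 c by blast
    then show ?thesis using c2(2) by blast
  qed
  have "x \<in> carrier H \<and> g \<in> carrier G" if "(x, g) \<in> R" for x g
    using dom[OF that] carr[OF that] by simp
  then show ?thesis using left onto mult inv by (rule goursatI)
qed

context sorted_group
begin

text \<open>An enumeration \<open>t\<close> (with repetitions) of the cosets of \<open>N\<close> turns a family of cosets into
  finite combinatorial data, its multiplication table together with the index sets of the cosets.\<close>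

definition frame :: "nat \<Rightarrow> 'g set \<Rightarrow> (nat \<Rightarrow> 'g) \<Rightarrow> 'i set \<Rightarrow> ('i \<Rightarrow> 'g set) \<Rightarrow> bool" where
  "frame m N t K c \<longleftrightarrow> N \<lhd> G \<and> (\<forall>i < m. t i \<in> carrier G) \<and>
     (\<forall>g \<in> carrier G. \<exists>i < m. g \<in> N #> t i) \<and>
     (\<forall>k \<in> K. \<exists>M. M \<lhd> G \<and> N \<subseteq> M \<and> c k \<in> rcosets M)"

definition table :: "nat \<Rightarrow> 'g set \<Rightarrow> (nat \<Rightarrow> 'g) \<Rightarrow> 'i set \<Rightarrow> ('i \<Rightarrow> 'g set) \<Rightarrow>
    (nat \<times> nat \<times> nat) set \<times> ('i \<times> nat) set" where
  "table m N t K c = ({(i, j, l) \<in> {..<m} \<times> {..<m} \<times> {..<m}. t i \<otimes> t j \<in> N #> t l},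
     {(k, i) \<in> K \<times> {..<m}. t i \<in> c k})"

lemma frame_exists:
  assumes N: "N \<in> ON" "index G N \<le> m"
    and c: "\<And>k. k \<in> K \<Longrightarrow> \<exists>M. M \<lhd> G \<and> N \<subseteq> M \<and> c k \<in> rcosets M"
  shows "\<exists>t. frame m N t K c"
proof -
  note n = ON_normal[OF N(1)]
  obtain f where f: "bij_betw f {0..<index G N} (rcosets N)"
    using ex_bij_betw_nat_finite[OF finite_rcosets[OF N(1)]] by (auto simp: index_def)
  \<comment> \<open>From the index up to \<open>m\<close> the enumeration repeats the identity: the
    length has to be the same for all subgroups of index at most \<open>m\<close>.\<close>
  define t where "t i = (if i < index G N then SOME x. x \<in> f i else \<one>)" for i
  have t: "t i \<in> f i \<and> f i \<in> rcosets N" if "i < index G N" for i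
  proof -
    have "f i \<in> rcosets N" using f that by (auto simp: bij_betw_def)
    moreover from this have "(SOME x. x \<in> f i) \<in> f i" using rcosets_nonempty[OF n] some_in_eq by blast
    ultimately show ?thesis using that by (simp add: t_def)
  qed
  have tc: "t i \<in> carrier G" for i
    using t[of i] rcosets_eq_rcos(2)[OF n] by (cases "i < index G N") (auto simp: t_def)
  have cov: "\<exists>i < m. g \<in> N #> t i" if g: "g \<in> carrier G" for g
  proof -
    obtain d where d: "d \<in> rcosets N" "g \<in> d" using rcosets_ex[OF n g] by blast
    have "d \<in> f ` {0..<index G N}" using f d(1) by (simp add: bij_betw_def)
    then obtain i where i: "i < index G N" "f i = d" by auto
    then have "d = N #> t i" using rcosets_eq_rcos(1)[OF n] t[OF i(1)] by blast
    then show ?thesis using d i N(2) by (intro exI[of _ i]) simp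
  qed
  have "frame m N t K c" using n tc cov c unfolding frame_def by simp
  then show ?thesis by blast
qed

text \<open>The correspondence sends the coset of \<open>t i\<close> to that of \<open>t' i\<close>.
  Since enumerations have repetitions, equal cosets must be shown to have equal images. The table
  does not record equality of cosets directly; it is recovered from products with
  \<open>t u\<close>, where \<open>u\<close> is an index of the identity coset.\<close>

lemma frames_match:
  assumes "frame m N t K c" "frame m N' t' K c'" and eq: "table m N t K c = table m N' t' K c'"
  shows "\<exists>R. goursat G G R \<and> (\<forall>k \<in> K. matches R (c k) (c' k))"
proof -
  have n: "N \<lhd> G" "N' \<lhd> G" using assms by (auto simp: frame_def)
  have tc: "t i \<in> carrier G" "t' i \<in> carrier G" if "i < m" for i using assms that by (auto simp: frame_def)
  have cov: "\<exists>i < m. g \<in> N #> t i" "\<exists>i < m. g \<in> N' #> t' i" if "g \<in> carrier G" for g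
    using assms that by (auto simp: frame_def)
  have e1: "t i \<otimes> t j \<in> N #> t l \<longleftrightarrow> t' i \<otimes> t' j \<in> N' #> t' l" if "i < m" "j < m" "l < m" for i j l
  proof -
    have "(i, j, l) \<in> fst (table m N t K c) \<longleftrightarrow> (i, j, l) \<in> fst (table m N' t' K c')" using eq by simp
    then show ?thesis using that by (simp add: table_def)
  qed
  have e2: "t i \<in> c k \<longleftrightarrow> t' i \<in> c' k" if "k \<in> K" "i < m" for k i
  proof -
    have "(k, i) \<in> snd (table m N t K c) \<longleftrightarrow> (k, i) \<in> snd (table m N' t' K c')" using eq by simp
    then show ?thesis using that by (simp add: table_def)
  qed
  note co = rcos_in_rcosets[OF n(1) tc(1)] rcos_in_rcosets[OF n(2) tc(2)]
  note self = rcos_self_normal[OF n(1) tc(1)] rcos_self_normal[OF n(2) tc(2)]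
  obtain u where u: "u < m" "\<one> \<in> N #> t u" using cov(1) by blast
  have cu: "N #> t u = N"
    by (rule rcosets_eqI[OF n(1) co(1)[OF u(1)] normal_in_rcosets[OF n(1)] u(2) normal_one[OF n(1)]])
  then have "t u \<in> N" using self(1)[OF u(1)] by simp
  have "t u \<otimes> t u \<in> N #> t u"
    unfolding cu using \<open>t u \<in> N\<close> normal_mult[OF n(1)] by blast
  then have "t' u \<otimes> t' u \<in> N' #> t' u" using e1 u(1) by blast
  then have "(t' u \<otimes> t' u) \<otimes> inv t' u \<in> N'" using rcos_mem[OF n(2) tc(2)[OF u(1)]] by blast
  then have u': "t' u \<in> N'" using tc(2)[OF u(1)] by (simp add: m_assoc)
  have same: "N' #> t' i = N' #> t' j" if ij: "i < m" "j < m" "N #> t i = N #> t j" for i j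
  proof -
    have "t j \<otimes> inv t i \<in> N"
      using self(1)[OF ij(2)] ij(3) rcos_mem[OF n(1) tc(1)[OF ij(1)], of "t j"] by simp
    then have "t u \<otimes> (t j \<otimes> inv t i) \<in> N" by (rule normal_mult[OF n(1) \<open>t u \<in> N\<close>])
    then have "t u \<otimes> t j \<in> N #> t i"
      using rcos_mem[OF n(1) tc(1)[OF ij(1)]] tc(1) u(1) ij by (simp add: m_assoc)
    then have "t' u \<otimes> t' j \<in> N' #> t' i" using e1 u(1) ij by blast
    moreover have "t' u \<otimes> t' j \<in> N' #> t' j" using u' by (auto simp: r_coset_def)
    ultimately show ?thesis using rcosets_eqI[OF n(2) co(2)[OF ij(1)] co(2)[OF ij(2)]] by blast
  qed
  define R where "R = {(g, g'). \<exists>i < m. g \<in> N #> t i \<and> g' \<in> N' #> t' i}"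
  have "goursat G G R"
  proof (rule goursat_of_fibres[OF is_group is_group n(2)])
    show "x \<in> carrier G" if "(x, g) \<in> R" for x g
      using that rcos_mem[OF n(1) tc(1)] by (auto simp: R_def)
    show "\<exists>d \<in> rcosets N'. \<forall>g. (x, g) \<in> R \<longleftrightarrow> g \<in> d" if x: "x \<in> carrier G" for x
    proof -
      obtain i where i: "i < m" "x \<in> N #> t i" using cov(1)[OF x] by blast
      have "(x, g) \<in> R \<longleftrightarrow> g \<in> N' #> t' i" for g
      proof
        assume "(x, g) \<in> R"
        then obtain j where j: "j < m" "x \<in> N #> t j" "g \<in> N' #> t' j" by (auto simp: R_def)
        have "N #> t j = N #> t i" by (rule rcosets_eqI[OF n(1) co(1)[OF j(1)] co(1)[OF i(1)] j(2) i(2)])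
        then show "g \<in> N' #> t' i" using same[OF j(1) i(1)] j(3) by simp
      qed (use i in \<open>auto simp: R_def\<close>)
      then show ?thesis using co(2)[OF i(1)] by blast
    qed
    show "\<exists>x. (x, g) \<in> R" if "g \<in> carrier G" for g
      using cov(2)[OF that] self(1) by (auto simp: R_def)
    show "(x \<otimes> x', g \<otimes> g') \<in> R" if R1: "(x, g) \<in> R" "(x', g') \<in> R" for x g x' g'
    proof -
      obtain i where i: "i < m" "x \<in> N #> t i" "g \<in> N' #> t' i" using R1 by (auto simp: R_def)
      obtain j where j: "j < m" "x' \<in> N #> t j" "g' \<in> N' #> t' j" using R1 by (auto simp: R_def)
      obtain l where l: "l < m" "t i \<otimes> t j \<in> N #> t l" using cov(1)[of "t i \<otimes> t j"] tc i(1) j(1) by blast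
      have "x \<otimes> x' \<in> N #> t l"
        by (rule rcosets_mult[OF n(1) co(1)[OF i(1)] co(1)[OF j(1)] co(1)[OF l(1)]
              self(1)[OF i(1)] self(1)[OF j(1)] l(2) i(2) j(2)])
      moreover have "t' i \<otimes> t' j \<in> N' #> t' l" using e1 i j l by blast
      then have "g \<otimes> g' \<in> N' #> t' l"
        by (rule rcosets_mult[OF n(2) co(2)[OF i(1)] co(2)[OF j(1)] co(2)[OF l(1)]
              self(2)[OF i(1)] self(2)[OF j(1)] _ i(3) j(3)])
      ultimately show ?thesis using l(1) by (auto simp: R_def)
    qed
  qed
  moreover have "matches R (c k) (c' k)" if k: "k \<in> K" for k
  proof -
    obtain M where M: "M \<lhd> G" "N \<subseteq> M" "c k \<in> rcosets M" using assms(1) k by (auto simp: frame_def)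
    obtain M' where M': "M' \<lhd> G" "N' \<subseteq> M'" "c' k \<in> rcosets M'" using assms(2) k by (auto simp: frame_def)
    have "g \<in> c k \<longleftrightarrow> g' \<in> c' k" if i: "i < m" "g \<in> N #> t i" "g' \<in> N' #> t' i" for g g' i
    proof -
      have "g \<in> c k \<longleftrightarrow> t i \<in> c k"
        using rcosets_mem_iff_subset[OF M(1) n(1) M(2) co(1)[OF i(1)] M(3)] i(2) self(1)[OF i(1)] by blast
      moreover have "g' \<in> c' k \<longleftrightarrow> t' i \<in> c' k"
        using rcosets_mem_iff_subset[OF M'(1) n(2) M'(2) co(2)[OF i(1)] M'(3)] i(3) self(2)[OF i(1)] by blast
      ultimately show ?thesis using e2[OF k i(1)] by blast
    qed
    then show ?thesis by (auto simp: matches_def R_def)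
  qed
  ultimately show ?thesis by blast
qed

definition bounded_family :: "nat \<Rightarrow> 'i set \<Rightarrow> ('i \<Rightarrow> 'g set) \<Rightarrow> bool" where
  "bounded_family m K c \<longleftrightarrow>
     (\<exists>N \<in> ON. index G N \<le> m \<and> (\<forall>k \<in> K. \<exists>M. M \<lhd> G \<and> N \<subseteq> M \<and> c k \<in> rcosets M))"

text \<open>The code of a family is the table of a chosen frame. For fixed \<open>m\<close> and
  finite \<open>K\<close> there are finitely many tables, however many subgroups \<open>G\<close>
  has.\<close>

lemma finite_families:
  fixes K :: "'i set" assumes K: "finite K"
  shows "\<exists>code :: ('i \<Rightarrow> 'g set) \<Rightarrow> (nat \<times> nat \<times> nat) set \<times> ('i \<times> nat) set. finite (range code) \<and>
    (\<forall>c c'. bounded_family m K c \<and> bounded_family m K c' \<and> code c = code c' \<longrightarrow>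
       (\<exists>R. goursat G G R \<and> (\<forall>k \<in> K. matches R (c k) (c' k))))"
proof -
  define sel where "sel c = (SOME p. frame m (fst p) (snd p) K c)" for c :: "'i \<Rightarrow> 'g set"
  define code where "code c = table m (fst (sel c)) (snd (sel c)) K c" for c :: "'i \<Rightarrow> 'g set"
  have "code c \<in> Pow ({..<m} \<times> {..<m} \<times> {..<m}) \<times> Pow (K \<times> {..<m})" for c
    unfolding code_def table_def by blast
  then have sub: "range code \<subseteq> Pow ({..<m} \<times> {..<m} \<times> {..<m}) \<times> Pow (K \<times> {..<m})"
    by (rule image_subsetI)
  have "finite (range code)"
    by (rule finite_subset[OF sub]) (simp add: K)
  moreover have code: "\<exists>N t. frame m N t K c \<and> code c = table m N t K c" if c: "bounded_family m K c" for c
  proof -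
    obtain N where N: "N \<in> ON" "index G N \<le> m" "\<forall>k \<in> K. \<exists>M. M \<lhd> G \<and> N \<subseteq> M \<and> c k \<in> rcosets M"
      using c by (auto simp: bounded_family_def)
    have "\<exists>t. frame m N t K c" by (rule frame_exists[OF N(1,2)]) (rule N(3)[rule_format])
    then obtain t where "frame m N t K c" by blast
    then have "frame m (fst (N, t)) (snd (N, t)) K c" by simp
    then have "frame m (fst (sel c)) (snd (sel c)) K c"
      unfolding sel_def by (rule someI[of "\<lambda>p. frame m (fst p) (snd p) K c"])
    then show ?thesis unfolding code_def by blast
  qed
  moreover have "\<exists>R. goursat G G R \<and> (\<forall>k \<in> K. matches R (c k) (c' k))"
    if h: "bounded_family m K c" "bounded_family m K c'" "code c = code c'" for c c'
  proof -
    obtain N1 t1 where 1: "frame m N1 t1 K c" "code c = table m N1 t1 K c" using code[OF h(1)] by blast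
    obtain N2 t2 where 2: "frame m N2 t2 K c'" "code c' = table m N2 t2 K c'" using code[OF h(2)] by blast
    show ?thesis by (rule frames_match[OF 1(1) 2(1)]) (use 1(2) 2(2) h(3) in simp)
  qed
  ultimately show ?thesis by (intro exI[of _ code]) simp
qed

end

section \<open>Definability\<close>

lemma formulas_Neg: "\<phi> \<in> formulas \<J> A \<sigma> \<Longrightarrow> Neg \<phi> \<in> formulas \<J> A \<sigma>"
  by (simp add: formulas_def)

lemma formulas_Conj: "\<phi> \<in> formulas \<J> A \<sigma> \<Longrightarrow> \<psi> \<in> formulas \<J> A \<sigma> \<Longrightarrow> Conj \<phi> \<psi> \<in> formulas \<J> A \<sigma>"
  by (simp add: formulas_def)

text \<open>The empty conjunction. It must be closed and free of constants, hence the quantifier,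
  and true even if the sort is empty, hence the negated contradiction.\<close>

definition truth :: "'j srt \<Rightarrow> ('j, 'c) fm" where
  "truth s = (let \<phi> = Ex s 0 (Eq s (Var 0) (Var 0)) in Neg (Conj \<phi> (Neg \<phi>)))"

lemma sat_truth [simp]: "sat M I e (truth s)"
  by (simp add: truth_def Let_def)

lemma truth_formula: "s \<in> sorts \<J> \<Longrightarrow> truth s \<in> formulas \<J> A \<sigma>"
  by (simp add: truth_def Let_def formulas_def)

primrec conj_list :: "'j srt \<Rightarrow> ('j, 'c) fm list \<Rightarrow> ('j, 'c) fm" where
  "conj_list s [] = truth s"
| "conj_list s (\<phi> # \<phi>s) = Conj \<phi> (conj_list s \<phi>s)"

lemma sat_conj_list [simp]: "sat M I e (conj_list s \<phi>s) \<longleftrightarrow> (\<forall>\<phi> \<in> set \<phi>s. sat M I e \<phi>)"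
  by (induction \<phi>s) simp_all

lemma conj_list_formula:
  "s \<in> sorts \<J> \<Longrightarrow> set \<phi>s \<subseteq> formulas \<J> A \<sigma> \<Longrightarrow> conj_list s \<phi>s \<in> formulas \<J> A \<sigma>"
  by (induction \<phi>s) (simp_all add: truth_formula formulas_Conj)

lemma finite_conjunction:
  assumes "finite A" "\<And>a. a \<in> A \<Longrightarrow> f a \<in> formulas \<J> C \<sigma>" "s \<in> sorts \<J>"
  shows "\<exists>\<phi> \<in> formulas \<J> C \<sigma>. \<forall>e. sat M I e \<phi> \<longleftrightarrow> (\<forall>a \<in> A. sat M I e (f a))"
proof -
  obtain as where as: "set as = A" using finite_list[OF assms(1)] by blast
  show ?thesis
    by (intro bexI[of _ "conj_list s (map f as)"] conj_list_formula[OF assms(3)]) (use as assms(2) in auto)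
qed

lemma finite_disjunction:
  assumes "finite A" "\<And>a. a \<in> A \<Longrightarrow> f a \<in> formulas \<J> C \<sigma>" "s \<in> sorts \<J>"
  shows "\<exists>\<phi> \<in> formulas \<J> C \<sigma>. \<forall>e. sat M I e \<phi> \<longleftrightarrow> (\<exists>a \<in> A. sat M I e (f a))"
proof -
  obtain \<phi> where "\<phi> \<in> formulas \<J> C \<sigma>" "\<forall>e. sat M I e \<phi> \<longleftrightarrow> (\<forall>a \<in> A. sat M I e (Neg (f a)))"
    using finite_conjunction[of A "\<lambda>a. Neg (f a)"] assms formulas_Neg by blast
  then show ?thesis by (intro bexI[of _ "Neg \<phi>"]) (auto intro: formulas_Neg)
qed

lemma Ex_formula:
  assumes "\<phi> \<in> formulas \<J> A (\<sigma> @ [s])" "s \<in> sorts \<J>"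
  shows "Ex s (length \<sigma>) \<phi> \<in> formulas \<J> A \<sigma>"
proof -
  have "free_vars (Ex s (length \<sigma>) \<phi>) \<subseteq> {(\<sigma> ! i, i) | i. i < length \<sigma>}"
  proof
    fix v assume v: "v \<in> free_vars (Ex s (length \<sigma>) \<phi>)"
    then obtain i where i: "v = ((\<sigma> @ [s]) ! i, i)" "i < length (\<sigma> @ [s])"
      using assms by (force simp: formulas_def)
    then have "i \<noteq> length \<sigma>" using v by auto
    then show "v \<in> {(\<sigma> ! i, i) | i. i < length \<sigma>}" using i by (auto simp: nth_append)
  qed
  then show ?thesis using assms by (simp add: formulas_def)
qed

text \<open>All sorts read the same list; the condition on free variables in \<open>formulas\<close>
  ensures that a position is used at its own sort only.\<close>

definition env :: "('j srt \<times> 'a) list \<Rightarrow> 'j srt \<Rightarrow> nat \<Rightarrow> 'a" where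
  "env xs = (\<lambda>_ i. snd (xs ! i))"

definition tup :: "'j set \<Rightarrow> ('j, 'a) lstruct \<Rightarrow> 'j srt list \<Rightarrow> ('j srt \<times> 'a) list set" where
  "tup \<J> M \<sigma> = {xs. map fst xs = \<sigma> \<and> set xs \<subseteq> elements \<J> M}"

definition tsat :: "('j, 'a) lstruct \<Rightarrow> ('j srt \<times> 'a) list \<Rightarrow> ('j, unit) fm \<Rightarrow> bool" where
  "tsat M xs \<phi> \<longleftrightarrow> sat M (\<lambda>_. undefined) (env xs) \<phi>"

abbreviation pure_fms :: "'j set \<Rightarrow> 'j srt list \<Rightarrow> ('j, unit) fm set" where
  "pure_fms \<J> \<sigma> \<equiv> formulas \<J> {} \<sigma>"

lemma sat_tsat:
  assumes "\<phi> \<in> pure_fms \<J> (map fst xs)" "\<And>i. i < length xs \<Longrightarrow> e (fst (xs ! i)) i = snd (xs ! i)"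
  shows "sat M I e \<phi> \<longleftrightarrow> tsat M xs \<phi>"
  unfolding tsat_def
proof (rule sat_cong)
  show "\<forall>(s, i) \<in> free_vars \<phi>. e s i = env xs s i"
  proof clarify
    fix s i assume "(s, i) \<in> free_vars \<phi>"
    then have "i < length xs" "s = fst (xs ! i)" using assms(1) by (auto simp: formulas_def)
    then show "e s i = env xs s i" using assms(2) by (simp add: env_def)
  qed
  show "\<forall>(s, c) \<in> fm_consts \<phi>. I c = undefined" using assms(1) by (auto simp: formulas_def)
qed

lemma tsat_simps [simp]:
  "tsat M xs (Neg \<phi>) \<longleftrightarrow> \<not> tsat M xs \<phi>" "tsat M xs (Conj \<phi> \<psi>) \<longleftrightarrow> tsat M xs \<phi> \<and> tsat M xs \<psi>"
  by (simp_all add: tsat_def)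

lemma tsat_Ex:
  assumes "\<phi> \<in> pure_fms \<J> (map fst xs @ [s])"
  shows "tsat M xs (Ex s (length xs) \<phi>) \<longleftrightarrow> (\<exists>x \<in> univ M s. tsat M (xs @ [(s, x)]) \<phi>)"
proof -
  have "sat M (\<lambda>_. undefined) ((env xs)(s := (env xs s)(length xs := x))) \<phi> \<longleftrightarrow> tsat M (xs @ [(s, x)]) \<phi>" for x
    by (rule sat_tsat[of _ \<J>]) (use assms in \<open>auto simp: env_def nth_append less_Suc_eq\<close>)
  then show ?thesis by (simp add: tsat_def)
qed

lemma elements_sorts:
  assumes "set xs \<subseteq> elements \<J> M" shows "map fst xs \<in> lists (sorts \<J>)"
proof -
  have "fst z \<in> sorts \<J>" if "z \<in> elements \<J> M" for z using that by (cases z) (simp add: elements_def)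
  then have "\<forall>s \<in> set (map fst xs). s \<in> sorts \<J>" using assms by fastforce
  then show ?thesis by (simp only: in_lists_conv_set)
qed

definition tequiv :: "'j set \<Rightarrow> ('j, 'a) lstruct \<Rightarrow> ('j srt \<times> 'a) list \<Rightarrow> ('j srt \<times> 'a) list \<Rightarrow> bool" where
  "tequiv \<J> M xs ys \<longleftrightarrow> map fst xs = map fst ys \<and>
     (\<forall>\<phi> \<in> pure_fms \<J> (map fst xs). tsat M xs \<phi> \<longleftrightarrow> tsat M ys \<phi>)"

lemma tequiv_sym: "tequiv \<J> M xs ys \<Longrightarrow> tequiv \<J> M ys xs"
  by (auto simp: tequiv_def)

lemma tequiv_trans: "tequiv \<J> M xs ys \<Longrightarrow> tequiv \<J> M ys zs \<Longrightarrow> tequiv \<J> M xs zs"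
  by (auto simp: tequiv_def)

lemma tequiv_atoms:
  assumes eq: "tequiv \<J> M xs ys" and xs: "set xs \<subseteq> elements \<J> M"
    and ij: "i < length xs" "j < length xs" "k < length xs"
  shows "fst (xs ! i) = fst (xs ! j) \<Longrightarrow> xs ! i = xs ! j \<longleftrightarrow> ys ! i = ys ! j"
    and "le M (fst (xs ! i)) (fst (xs ! j)) (snd (xs ! i)) (snd (xs ! j)) \<longleftrightarrow>
      le M (fst (ys ! i)) (fst (ys ! j)) (snd (ys ! i)) (snd (ys ! j))"
    and "crel M (fst (xs ! i)) (fst (xs ! j)) (snd (xs ! i)) (snd (xs ! j)) \<longleftrightarrow>
      crel M (fst (ys ! i)) (fst (ys ! j)) (snd (ys ! i)) (snd (ys ! j))"
    and "fst (xs ! i) = fst (xs ! j) \<Longrightarrow> fst (xs ! k) = fst (xs ! i) \<Longrightarrow>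
      prel M (fst (xs ! i)) (snd (xs ! i)) (snd (xs ! j)) (snd (xs ! k)) \<longleftrightarrow>
      prel M (fst (ys ! i)) (snd (ys ! i)) (snd (ys ! j)) (snd (ys ! k))"
proof -
  have len: "length ys = length xs" using eq by (auto simp: tequiv_def dest: map_eq_imp_length_eq)
  have fst: "fst (ys ! n) = fst (xs ! n)" if "n < length xs" for n
    using eq that len by (metis nth_map tequiv_def)
  have s: "fst (xs ! n) \<in> sorts \<J>" if "n < length xs" for n
    using xs nth_mem[OF that] by (cases "xs ! n") (auto simp: elements_def)
  have tr: "tsat M xs \<phi> \<longleftrightarrow> tsat M ys \<phi>" if "\<phi> \<in> pure_fms \<J> (map fst xs)" for \<phi>
    using eq that by (simp add: tequiv_def)
  have fmI: "\<phi> \<in> pure_fms \<J> (map fst xs)"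
    if "fm_sorts \<phi> \<subseteq> sorts \<J>" "fm_consts \<phi> = {}" "\<forall>(s, n) \<in> free_vars \<phi>. n < length xs \<and> s = fst (xs ! n)"
    for \<phi> :: "('a, unit) fm"
    using that by (fastforce simp: formulas_def)
  show "xs ! i = xs ! j \<longleftrightarrow> ys ! i = ys ! j" if "fst (xs ! i) = fst (xs ! j)"
  proof -
    have "Eq (fst (xs ! i)) (Var i) (Var j) \<in> pure_fms \<J> (map fst xs)"
      using s[OF ij(1)] that ij by (intro fmI) simp_all
    from tr[OF this] show ?thesis
      using that fst ij by (simp add: tsat_def env_def prod_eq_iff)
  qed
  show "le M (fst (xs ! i)) (fst (xs ! j)) (snd (xs ! i)) (snd (xs ! j)) \<longleftrightarrow>
      le M (fst (ys ! i)) (fst (ys ! j)) (snd (ys ! i)) (snd (ys ! j))"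
  proof -
    have "Le (fst (xs ! i)) (fst (xs ! j)) (Var i) (Var j) \<in> pure_fms \<J> (map fst xs)"
      using s[OF ij(1)] s[OF ij(2)] ij by (intro fmI) simp_all
    from tr[OF this] show ?thesis using fst ij by (simp add: tsat_def env_def)
  qed
  show "crel M (fst (xs ! i)) (fst (xs ! j)) (snd (xs ! i)) (snd (xs ! j)) \<longleftrightarrow>
      crel M (fst (ys ! i)) (fst (ys ! j)) (snd (ys ! i)) (snd (ys ! j))"
  proof -
    have "Crel (fst (xs ! i)) (fst (xs ! j)) (Var i) (Var j) \<in> pure_fms \<J> (map fst xs)"
      using s[OF ij(1)] s[OF ij(2)] ij by (intro fmI) simp_all
    from tr[OF this] show ?thesis using fst ij by (simp add: tsat_def env_def)
  qed
  show "prel M (fst (xs ! i)) (snd (xs ! i)) (snd (xs ! j)) (snd (xs ! k)) \<longleftrightarrow>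
      prel M (fst (ys ! i)) (snd (ys ! i)) (snd (ys ! j)) (snd (ys ! k))"
    if "fst (xs ! i) = fst (xs ! j)" "fst (xs ! k) = fst (xs ! i)"
  proof -
    have "Prel (fst (xs ! i)) (Var i) (Var j) (Var k) \<in> pure_fms \<J> (map fst xs)"
      using s[OF ij(1)] that ij by (intro fmI) simp_all
    from tr[OF this] show ?thesis using fst ij by (simp add: tsat_def env_def)
  qed
qed

context coords
begin

definition nrms :: "('j srt \<times> 'a) list \<Rightarrow> 'g set" where
  "nrms xs = carrier G \<inter> \<Inter>(nrm ` set xs)"

lemma nrms_ON: "set xs \<subseteq> elements \<J> S \<Longrightarrow> nrms xs \<in> ON"
  unfolding nrms_def using elem_props(1) by (intro finite_Int_ON) auto

lemma nrms_below: "x \<in> set xs \<Longrightarrow> nrms xs \<subseteq> nrm x"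
  by (auto simp: nrms_def)

lemma nrms_append: "nrms (xs @ ys) = nrms xs \<inter> nrms ys"
  by (auto simp: nrms_def)

text \<open>The bound depends on the sorts alone, so the tuples of given sorts are families of
  uniformly bounded index.\<close>

lemma nrms_index:
  "set xs \<subseteq> elements \<J> S \<Longrightarrow> index G (nrms xs) \<le> prod_list (map fst (map fst xs))"
proof (induction xs)
  case Nil then show ?case using index_carrier by (simp add: nrms_def)
next
  case (Cons x xs)
  have "nrms (x # xs) = nrm x \<inter> nrms xs" by (auto simp: nrms_def)
  moreover have "index G (nrm x \<inter> nrms xs) \<le> index G (nrm x) * index G (nrms xs)"
    using Cons.prems by (intro index_Int elem_props(1) nrms_ON) auto
  moreover have "\<dots> \<le> fst (fst x) * prod_list (map fst (map fst xs))"
    using Cons elem_props(3)[of x] by (intro mult_le_mono) auto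
  ultimately show ?case by simp
qed

lemma nrms_coset:
  assumes "set xs \<subseteq> elements \<J> S" "x \<in> set xs"
  shows "\<exists>M. M \<lhd> G \<and> nrms xs \<subseteq> M \<and> cst x \<in> rcosets M"
  using assms nrm_normal elem_props(2) nrms_below by blast

end

context sep
begin

definition corresp where
  "corresp xs ys \<longleftrightarrow> map fst xs = map fst ys \<and>
     (\<exists>R. goursat G G R \<and> (\<forall>i < length xs. matches R (cst (xs ! i)) (cst (ys ! i))))"

lemma corresp_tequiv:
  assumes c: "corresp xs ys" and el: "set xs \<subseteq> elements \<J> S" "set ys \<subseteq> elements \<J> S"
  shows "tequiv \<J> S xs ys"
  unfolding tequiv_def
proof (intro conjI ballI)
  show m: "map fst xs = map fst ys" using c by (simp add: corresp_def)
  then have len: "length ys = length xs" using map_eq_imp_length_eq by metis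
  have fst: "fst (ys ! n) = fst (xs ! n)" if "n < length xs" for n
    using m that len by (metis nth_map)
  obtain R where R: "goursat G G R" "\<forall>i < length xs. matches R (cst (xs ! i)) (cst (ys ! i))"
    using c by (auto simp: corresp_def)
  fix \<phi> assume \<phi>: "\<phi> \<in> pure_fms \<J> (map fst xs)"
  have "agree R (free_vars \<phi>) (env xs) (env ys)"
    unfolding agree_def
  proof clarify
    fix s i assume "(s, i) \<in> free_vars \<phi>"
    then have i: "i < length xs" "s = fst (xs ! i)" using \<phi> by (auto simp: formulas_def)
    have "(s, env xs s i) = xs ! i" "(s, env ys s i) = ys ! i"
      using i fst[OF i(1)] by (simp_all add: env_def prod_eq_iff)
    moreover have "xs ! i \<in> elements \<J> S" "ys ! i \<in> elements \<J> S" using i len el by auto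
    ultimately show "(s, env xs s i) \<in> elements \<J> S \<and> (s, env ys s i) \<in> elements \<J> S \<and>
        matches R (cst (s, env xs s i)) (cst (s, env ys s i))"
      using R(2) i(1) by simp
  qed
  moreover have "fm_consts \<phi> = {}" "fm_sorts \<phi> \<subseteq> sorts \<J>" using \<phi> by (simp_all add: formulas_def)
  ultimately show "tsat S xs \<phi> \<longleftrightarrow> tsat S ys \<phi>"
    unfolding tsat_def by (rule sat_agree[OF R(1)])
qed

text \<open>Tuples with equal codes correspond, and \<open>P\<close> contains one tuple for each
  code that occurs.\<close>

lemma finite_classes:
  assumes "\<sigma> \<in> lists (sorts \<J>)"
  shows "\<exists>P. finite P \<and> P \<subseteq> tup \<J> S \<sigma> \<and> (\<forall>xs \<in> tup \<J> S \<sigma>. \<exists>p \<in> P. corresp p xs)"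
proof -
  define m where "m = prod_list (map fst \<sigma>)"
  obtain code :: "(nat \<Rightarrow> ('a srt \<times> 'b) set set) \<Rightarrow> (nat \<times> nat \<times> nat) set \<times> (nat \<times> nat) set"
    where code: "finite (range code)"
    and match: "\<forall>c c'. bounded_family m {..<length \<sigma>} c \<and> bounded_family m {..<length \<sigma>} c' \<and>
       code c = code c' \<longrightarrow> (\<exists>R. goursat G G R \<and> (\<forall>k \<in> {..<length \<sigma>}. matches R (c k) (c' k)))"
    using finite_families[OF finite_lessThan, of m] by blast
  define f where "f xs = code (\<lambda>i. cst (xs ! i))" for xs
  have c: "corresp xs ys" if xy: "xs \<in> tup \<J> S \<sigma>" "ys \<in> tup \<J> S \<sigma>" "f xs = f ys" for xs ys
  proof -
    have *: "bounded_family m {..<length \<sigma>} (\<lambda>i. cst (zs ! i))" if zs: "zs \<in> tup \<J> S \<sigma>" for zs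
    proof -
      have el: "set zs \<subseteq> elements \<J> S" "map fst zs = \<sigma>" using zs by (auto simp: tup_def)
      have "index G (nrms zs) \<le> m" using nrms_index[OF el(1)] el(2) by (simp add: m_def)
      moreover have "\<exists>M. M \<lhd> G \<and> nrms zs \<subseteq> M \<and> cst (zs ! k) \<in> rcosets M" if "k \<in> {..<length \<sigma>}" for k
        using nrms_coset[OF el(1)] that el(2) by (metis length_map lessThan_iff nth_mem)
      ultimately show ?thesis using nrms_ON[OF el(1)] unfolding bounded_family_def by blast
    qed
    have "\<exists>R. goursat G G R \<and> (\<forall>k \<in> {..<length \<sigma>}. matches R (cst (xs ! k)) (cst (ys ! k)))"
      using match *[OF xy(1)] *[OF xy(2)] xy(3) by (simp add: f_def)
    then show ?thesis using xy by (auto simp: corresp_def tup_def)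
  qed
  define g where "g b = (SOME xs. xs \<in> tup \<J> S \<sigma> \<and> f xs = b)" for b
  have g: "g (f xs) \<in> tup \<J> S \<sigma> \<and> f (g (f xs)) = f xs" if "xs \<in> tup \<J> S \<sigma>" for xs
    unfolding g_def by (rule someI[of _ xs]) (use that in simp)
  have "finite (f ` tup \<J> S \<sigma>)"
    by (rule finite_subset[OF _ code]) (auto simp: f_def)
  then show ?thesis
    using g c by (intro exI[of _ "g ` f ` tup \<J> S \<sigma>"]) auto
qed

text \<open>With finitely many representatives, the class of \<open>p\<close> is defined by the
  conjunction \<open>\<theta> p\<close> of formulas that separate \<open>p\<close> from the
  inequivalent ones. An invariant property is the disjunction of the classes that have it.\<close>

lemma definable:
  assumes \<sigma>: "\<sigma> \<in> lists (sorts \<J>)"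
    and Q: "\<And>xs ys. xs \<in> tup \<J> S \<sigma> \<Longrightarrow> ys \<in> tup \<J> S \<sigma> \<Longrightarrow> tequiv \<J> S xs ys \<Longrightarrow> Q xs \<Longrightarrow> Q ys"
  shows "\<exists>\<phi> \<in> pure_fms \<J> \<sigma>. \<forall>xs \<in> tup \<J> S \<sigma>. tsat S xs \<phi> \<longleftrightarrow> Q xs"
proof -
  obtain P where P: "finite P" "P \<subseteq> tup \<J> S \<sigma>" "\<forall>xs \<in> tup \<J> S \<sigma>. \<exists>p \<in> P. corresp p xs"
    using finite_classes[OF \<sigma>] by blast
  have P3: "\<exists>p \<in> P. tequiv \<J> S p xs" if "xs \<in> tup \<J> S \<sigma>" for xs
    using P(2,3) that corresp_tequiv unfolding tup_def by (metis (no_types, lifting) mem_Collect_eq subsetD)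
  have eqD: "tsat S xs \<phi> \<longleftrightarrow> tsat S ys \<phi>"
    if "xs \<in> tup \<J> S \<sigma>" "tequiv \<J> S xs ys" "\<phi> \<in> pure_fms \<J> \<sigma>" for xs ys \<phi>
    using that by (auto simp: tup_def tequiv_def)
  obtain s where s: "s \<in> sorts \<J>" using seqs_nonempty by (auto simp: sorts_def)
  have "\<exists>\<delta> \<in> pure_fms \<J> \<sigma>. tsat S p \<delta> \<and> \<not> tsat S q \<delta>"
    if pq: "p \<in> P" "q \<in> P" "\<not> tequiv \<J> S p q" for p q
  proof -
    have "map fst p = \<sigma>" "map fst q = \<sigma>" using pq P(2) by (auto simp: tup_def)
    then obtain \<delta> where "\<delta> \<in> pure_fms \<J> \<sigma>" "tsat S p \<delta> \<noteq> tsat S q \<delta>"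
      using pq(3) by (auto simp: tequiv_def)
    then show ?thesis using formulas_Neg[of \<delta>] tsat_simps(1) by metis
  qed
  then obtain \<delta> where \<delta>: "\<And>p q. p \<in> P \<Longrightarrow> q \<in> P \<Longrightarrow> \<not> tequiv \<J> S p q \<Longrightarrow>
      \<delta> p q \<in> pure_fms \<J> \<sigma> \<and> tsat S p (\<delta> p q) \<and> \<not> tsat S q (\<delta> p q)"
    by metis
  have "\<exists>\<theta>. \<theta> \<in> pure_fms \<J> \<sigma> \<and> (\<forall>e. sat S (\<lambda>_. undefined) e \<theta> \<longleftrightarrow>
      (\<forall>q \<in> {q \<in> P. \<not> tequiv \<J> S p q}. sat S (\<lambda>_. undefined) e (\<delta> p q)))" if "p \<in> P" for p
  proof -
    have "\<exists>\<theta> \<in> pure_fms \<J> \<sigma>. \<forall>e. sat S (\<lambda>_. undefined) e \<theta> \<longleftrightarrow>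
      (\<forall>q \<in> {q \<in> P. \<not> tequiv \<J> S p q}. sat S (\<lambda>_. undefined) e (\<delta> p q))"
      by (rule finite_conjunction[OF _ _ s]) (use P(1) \<delta> that in auto)
    then show ?thesis by blast
  qed
  then obtain \<theta> where \<theta>: "\<And>p. p \<in> P \<Longrightarrow> \<theta> p \<in> pure_fms \<J> \<sigma> \<and> (\<forall>e. sat S (\<lambda>_. undefined) e (\<theta> p) \<longleftrightarrow>
      (\<forall>q \<in> {q \<in> P. \<not> tequiv \<J> S p q}. sat S (\<lambda>_. undefined) e (\<delta> p q)))"
    using bchoice[of P "\<lambda>p \<theta>. \<theta> \<in> pure_fms \<J> \<sigma> \<and> (\<forall>e. sat S (\<lambda>_. undefined) e \<theta> \<longleftrightarrow>
      (\<forall>q \<in> {q \<in> P. \<not> tequiv \<J> S p q}. sat S (\<lambda>_. undefined) e (\<delta> p q)))"] by blast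
  have \<theta>1: "\<theta> p \<in> pure_fms \<J> \<sigma>"
    and \<theta>2: "tsat S xs (\<theta> p) \<longleftrightarrow> (\<forall>q \<in> P. \<not> tequiv \<J> S p q \<longrightarrow> tsat S xs (\<delta> p q))"
    if "p \<in> P" for p xs
    using \<theta>[OF that] unfolding tsat_def by blast+
  have \<theta>iff: "tsat S xs (\<theta> p) \<longleftrightarrow> tequiv \<J> S p xs" if p: "p \<in> P" and xs: "xs \<in> tup \<J> S \<sigma>" for p xs
  proof -
    obtain q where q: "q \<in> P" "tequiv \<J> S q xs" using P3[OF xs] by blast
    have "tsat S xs (\<theta> p) \<longleftrightarrow> tsat S q (\<theta> p)" using eqD[OF _ q(2) \<theta>1[OF p]] q(1) P(2) by blast
    also have "\<dots> \<longleftrightarrow> tequiv \<J> S p q"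
    proof
      assume "tsat S q (\<theta> p)"
      then show "tequiv \<J> S p q" using \<theta>2[OF p, of q] \<delta>[OF p q(1)] q(1) by blast
    next
      assume eq: "tequiv \<J> S p q"
      have "tsat S p (\<theta> p)" using \<theta>2[OF p, of p] \<delta>[OF p] by blast
      then show "tsat S q (\<theta> p)" using eqD[OF _ eq \<theta>1[OF p]] p P(2) by blast
    qed
    also have "\<dots> \<longleftrightarrow> tequiv \<J> S p xs" using tequiv_trans[OF _ q(2)] tequiv_trans[OF _ tequiv_sym[OF q(2)]] by blast
    finally show ?thesis .
  qed
  have "\<exists>\<phi> \<in> pure_fms \<J> \<sigma>. \<forall>e. sat S (\<lambda>_. undefined) e \<phi> \<longleftrightarrow>
      (\<exists>p \<in> {p \<in> P. Q p}. sat S (\<lambda>_. undefined) e (\<theta> p))"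
    by (rule finite_disjunction[OF _ _ s]) (use P(1) \<theta>1 in auto)
  then obtain \<phi> where \<phi>: "\<phi> \<in> pure_fms \<J> \<sigma>" "\<And>xs. tsat S xs \<phi> \<longleftrightarrow> (\<exists>p \<in> P. Q p \<and> tsat S xs (\<theta> p))"
    unfolding tsat_def by blast
  have "tsat S xs \<phi> \<longleftrightarrow> Q xs" if xs: "xs \<in> tup \<J> S \<sigma>" for xs
  proof -
    obtain q where q: "q \<in> P" "tequiv \<J> S q xs" using P3[OF xs] by blast
    have "(\<exists>p \<in> P. Q p \<and> tequiv \<J> S p xs) \<longleftrightarrow> Q xs"
      using Q[OF _ xs] Q[OF xs _ tequiv_sym[OF q(2)]] q P(2) by blast
    then show ?thesis using \<phi>(2) \<theta>iff[OF _ xs] by blast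
  qed
  then show ?thesis using \<phi>(1) by blast
qed

text \<open>The class of \<open>xs @ [x]\<close> is defined by a single formula. Quantified
  existentially in the last variable it holds at \<open>xs\<close>, hence at \<open>ys\<close>, and
  a witness there is the required \<open>y\<close>.\<close>

lemma tequiv_extend:
  assumes eq: "tequiv \<J> S xs ys" and el: "set xs \<subseteq> elements \<J> S" "set ys \<subseteq> elements \<J> S"
    and x: "x \<in> elements \<J> S"
  shows "\<exists>y \<in> elements \<J> S. fst y = fst x \<and> tequiv \<J> S (xs @ [x]) (ys @ [y])"
proof -
  obtain s v where sv: "x = (s, v)" by (cases x)
  have s: "s \<in> sorts \<J>" "v \<in> univ S s" using x sv by (auto simp: elements_def)
  let ?\<sigma> = "map fst xs @ [s]"
  have m: "map fst ys = map fst xs" and len: "length ys = length xs"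
    using eq by (auto simp: tequiv_def dest: map_eq_imp_length_eq)
  have \<sigma>: "?\<sigma> \<in> lists (sorts \<J>)" using elements_sorts[OF el(1)] s(1) by simp
  obtain \<phi> where \<phi>: "\<phi> \<in> pure_fms \<J> ?\<sigma>" "\<forall>zs \<in> tup \<J> S ?\<sigma>. tsat S zs \<phi> \<longleftrightarrow> tequiv \<J> S (xs @ [x]) zs"
    using definable[OF \<sigma>, of "tequiv \<J> S (xs @ [x])"] tequiv_trans by blast
  have "xs @ [x] \<in> tup \<J> S ?\<sigma>" using el x sv by (simp add: tup_def)
  then have "tsat S (xs @ [x]) \<phi>" using \<phi>(2) by (simp add: tequiv_def)
  then have "tsat S xs (Ex s (length xs) \<phi>)"
    unfolding tsat_Ex[OF \<phi>(1)] using s(2) sv by blast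
  moreover have "Ex s (length xs) \<phi> \<in> pure_fms \<J> (map fst xs)"
    using Ex_formula[OF \<phi>(1) s(1)] by simp
  ultimately have "tsat S ys (Ex s (length ys) \<phi>)"
    using eq len by (simp add: tequiv_def)
  then obtain w where w: "w \<in> univ S s" "tsat S (ys @ [(s, w)]) \<phi>"
    using tsat_Ex[of \<phi> \<J> ys s] \<phi>(1) m by auto
  have "ys @ [(s, w)] \<in> tup \<J> S ?\<sigma>" using el s w m by (simp add: tup_def elements_def)
  then have "tequiv \<J> S (xs @ [x]) (ys @ [(s, w)])" using \<phi>(2) w(2) by blast
  then show ?thesis using w(1) s(1) sv by (intro bexI[of _ "(s, w)"]) (simp_all add: elements_def)
qed

lemma tequiv_extend_list:
  assumes "tequiv \<J> S xs ys" "set xs \<subseteq> elements \<J> S" "set ys \<subseteq> elements \<J> S" "set zs \<subseteq> elements \<J> S"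
  shows "\<exists>ws. set ws \<subseteq> elements \<J> S \<and> tequiv \<J> S (xs @ zs) (ys @ ws)"
  using assms(4)
proof (induction zs rule: rev_induct)
  case Nil then show ?case using assms(1) by (intro exI[of _ "[]"]) simp
next
  case (snoc z zs)
  then obtain ws where ws: "set ws \<subseteq> elements \<J> S" "tequiv \<J> S (xs @ zs) (ys @ ws)" by auto
  obtain w where "w \<in> elements \<J> S" "tequiv \<J> S ((xs @ zs) @ [z]) ((ys @ ws) @ [w])"
    using tequiv_extend[OF ws(2), of z] ws(1) assms(2,3) snoc.prems by auto
  then show ?case using ws(1) by (intro exI[of _ "ws @ [w]"]) simp
qed

end

section \<open>Exchange of parameters and variables\<close>

definition inst_consts :: "nat \<Rightarrow> ('j srt \<times> 'a) list \<Rightarrow> ('j, unit) fm \<Rightarrow> ('j, 'a) fm" where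
  "inst_consts n ds = fsub (\<lambda>s i. if i < n then Var i else Const (snd (ds ! (i - n)))) (\<lambda>s c. Const undefined)"

text \<open>A parameter may occur several times in \<open>ds\<close>; any of its positions serves,
  since all of them hold the same element.\<close>

definition abstract_consts :: "nat \<Rightarrow> ('j srt \<times> 'a) list \<Rightarrow> ('j, 'a) fm \<Rightarrow> ('j, unit) fm" where
  "abstract_consts n ds = fsub (\<lambda>s i. Var i) (\<lambda>s c. Var (n + (SOME j. j < length ds \<and> ds ! j = (s, c))))"

lemma inst_consts_formula:
  assumes "\<phi> \<in> pure_fms \<J> (\<sigma> @ map fst ds)" "set ds \<subseteq> A"
  shows "inst_consts (length \<sigma>) ds \<phi> \<in> formulas \<J> A \<sigma>"
proof -
  let ?\<rho> = "\<lambda>s i. if i < length \<sigma> then Var i else Const (snd (ds ! (i - length \<sigma>)))"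
  have fv: "i < length \<sigma> + length ds \<and> s = (\<sigma> @ map fst ds) ! i" if "(s, i) \<in> free_vars \<phi>" for s i
    using assms(1) that by (force simp: formulas_def)
  have c: "fm_consts \<phi> = {}" and so: "fm_sorts \<phi> \<subseteq> sorts \<J>" using assms(1) by (auto simp: formulas_def)
  have "tm_consts s (?\<rho> s i) \<subseteq> A" if "(s, i) \<in> free_vars \<phi>" for s i
  proof (cases "i < length \<sigma>")
    case False
    then have "i - length \<sigma> < length ds" "s = fst (ds ! (i - length \<sigma>))"
      using fv[OF that] by (auto simp: nth_append)
    then show ?thesis using False assms(2) nth_mem by fastforce
  qed simp
  then have 1: "fm_consts (inst_consts (length \<sigma>) ds \<phi>) \<subseteq> A"
    using fm_consts_fsub[of ?\<rho> "\<lambda>s c. Const undefined" \<phi>] c by (fastforce simp: inst_consts_def)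
  have "tm_vars s (?\<rho> s i) \<subseteq> {(\<sigma> ! i, i) | i. i < length \<sigma>}" if "(s, i) \<in> free_vars \<phi>" for s i
    using fv[OF that] by (auto simp: nth_append)
  then have 2: "free_vars (inst_consts (length \<sigma>) ds \<phi>) \<subseteq> {(\<sigma> ! i, i) | i. i < length \<sigma>}"
    using free_vars_fsub[of ?\<rho> "\<lambda>s c. Const undefined" \<phi>] c unfolding inst_consts_def by blast
  show ?thesis using 1 2 so by (simp add: formulas_def inst_consts_def)
qed

lemma sat_inst_consts:
  assumes "\<phi> \<in> pure_fms \<J> (map fst xs @ map fst ds)"
  shows "sat_tuple M (map snd xs) (inst_consts (length xs) ds \<phi>) \<longleftrightarrow> tsat M (xs @ ds) \<phi>"
  unfolding sat_tuple_def inst_consts_def tsat_def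
proof (rule sat_fsub)
  fix s i assume "(s, i) \<in> free_vars \<phi>"
  then have "i < length xs + length ds" using assms by (force simp: formulas_def)
  then show "val id ((\<lambda>_. (!) (map snd xs)) s) (if i < length xs then Var i else Const (snd (ds ! (i - length xs)))) =
      env (xs @ ds) s i"
    by (auto simp: env_def nth_append)
qed (use assms in \<open>simp add: formulas_def\<close>)

lemma abstract_consts_formula:
  assumes "\<phi> \<in> formulas \<J> A \<sigma>" "fm_consts \<phi> \<subseteq> set ds"
  shows "abstract_consts (length \<sigma>) ds \<phi> \<in> pure_fms \<J> (\<sigma> @ map fst ds)"
proof -
  let ?j = "\<lambda>s c. SOME j. j < length ds \<and> ds ! j = (s, c)"
  have j: "?j s c < length ds \<and> ds ! ?j s c = (s, c)" if "(s, c) \<in> fm_consts \<phi>" for s c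
    by (rule someI_ex) (use that assms(2) in \<open>auto simp: in_set_conv_nth\<close>)
  have fv: "i < length \<sigma> \<and> s = \<sigma> ! i" if "(s, i) \<in> free_vars \<phi>" for s i
    using assms(1) that by (force simp: formulas_def)
  have so: "fm_sorts \<phi> \<subseteq> sorts \<J>" using assms(1) by (auto simp: formulas_def)
  have 1: "fm_consts (abstract_consts (length \<sigma>) ds \<phi>) = {}"
    using fm_consts_fsub[of "\<lambda>s i. Var i" "\<lambda>s c. Var (length \<sigma> + ?j s c)" \<phi>]
    by (auto simp: abstract_consts_def)
  let ?V = "{((\<sigma> @ map fst ds) ! i, i) | i. i < length (\<sigma> @ map fst ds)}"
  have "tm_vars s (Var i) \<subseteq> ?V" if "(s, i) \<in> free_vars \<phi>" for s i
    using fv[OF that] by (auto simp: nth_append)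
  moreover have "tm_vars s (Var (length \<sigma> + ?j s c)) \<subseteq> ?V" if "(s, c) \<in> fm_consts \<phi>" for s c
  proof -
    have "((\<sigma> @ map fst ds) ! (length \<sigma> + ?j s c), length \<sigma> + ?j s c) = (s, length \<sigma> + ?j s c)"
      using j[OF that] by (simp add: nth_append)
    then show ?thesis using j[OF that] by force
  qed
  ultimately have 2: "free_vars (abstract_consts (length \<sigma>) ds \<phi>) \<subseteq> ?V"
    using free_vars_fsub[of "\<lambda>s i. Var i" "\<lambda>s c. Var (length \<sigma> + ?j s c)" \<phi>]
    unfolding abstract_consts_def by blast
  show ?thesis using 1 2 so by (simp add: formulas_def abstract_consts_def)
qed

lemma sat_abstract_consts:
  assumes "\<phi> \<in> formulas \<J> A (map fst xs)" "fm_consts \<phi> \<subseteq> set ds"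
  shows "tsat M (xs @ ds) (abstract_consts (length xs) ds \<phi>) \<longleftrightarrow> sat_tuple M (map snd xs) \<phi>"
  unfolding sat_tuple_def abstract_consts_def tsat_def
proof (rule sat_fsub)
  fix s i assume "(s, i) \<in> free_vars \<phi>"
  then have "i < length xs" using assms(1) by (force simp: formulas_def)
  then show "val (\<lambda>_. undefined) (env (xs @ ds) s) (Var i) = map snd xs ! i"
    by (simp add: env_def nth_append)
next
  fix s c assume sc: "(s, c) \<in> fm_consts \<phi>"
  let ?j = "SOME j. j < length ds \<and> ds ! j = (s, c)"
  have "?j < length ds \<and> ds ! ?j = (s, c)"
    by (rule someI_ex) (use sc assms(2) in \<open>auto simp: in_set_conv_nth\<close>)
  then show "val (\<lambda>_. undefined) (env (xs @ ds) s) (Var (length xs + ?j)) = id c"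
    by (simp add: env_def nth_append)
qed

text \<open>A formula has finitely many parameters. Equality of types over \<open>A\<close>
  therefore splits into equivalences of finite tuples, the form in which it can be compared with
  correspondences.\<close>

lemma tp_eq_iff:
  assumes "fst a = fst b"
  shows "tp \<J> M A a = tp \<J> M A b \<longleftrightarrow> (\<forall>ds. set ds \<subseteq> A \<longrightarrow> tequiv \<J> M ([a] @ ds) ([b] @ ds))"
proof
  assume eq: "tp \<J> M A a = tp \<J> M A b"
  show "\<forall>ds. set ds \<subseteq> A \<longrightarrow> tequiv \<J> M ([a] @ ds) ([b] @ ds)"
  proof (intro allI impI)
    fix ds assume ds: "set ds \<subseteq> A"
    show "tequiv \<J> M ([a] @ ds) ([b] @ ds)"
      unfolding tequiv_def
    proof (intro conjI ballI)
      fix \<phi> assume \<phi>: "\<phi> \<in> pure_fms \<J> (map fst ([a] @ ds))"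
      let ?\<psi> = "inst_consts 1 ds \<phi>"
      have "?\<psi> \<in> formulas \<J> A [fst a]"
        using inst_consts_formula[of \<phi> \<J> "[fst a]" ds A] \<phi> ds by simp
      moreover have "tsat M ([a] @ ds) \<phi> \<longleftrightarrow> sat_tuple M [snd a] ?\<psi>"
        using sat_inst_consts[of \<phi> \<J> "[a]" ds M] \<phi> by simp
      moreover have "tsat M ([b] @ ds) \<phi> \<longleftrightarrow> sat_tuple M [snd b] ?\<psi>"
        using sat_inst_consts[of \<phi> \<J> "[b]" ds M] \<phi> assms by simp
      ultimately show "tsat M ([a] @ ds) \<phi> \<longleftrightarrow> tsat M ([b] @ ds) \<phi>"
        using eq assms by (auto simp: tp_def)
    qed (simp add: assms)
  qed
next
  assume eq: "\<forall>ds. set ds \<subseteq> A \<longrightarrow> tequiv \<J> M ([a] @ ds) ([b] @ ds)"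
  have "sat_tuple M [snd a] \<phi> \<longleftrightarrow> sat_tuple M [snd b] \<phi>" if \<phi>: "\<phi> \<in> formulas \<J> A [fst a]" for \<phi>
  proof -
    obtain ds where ds: "set ds = fm_consts \<phi>" using finite_list[OF finite_fm_consts] by blast
    let ?\<psi> = "abstract_consts 1 ds \<phi>"
    have "set ds \<subseteq> A" using ds \<phi> by (simp add: formulas_def)
    moreover have "?\<psi> \<in> pure_fms \<J> (map fst ([a] @ ds))"
      using abstract_consts_formula[OF \<phi>, of ds] ds by simp
    ultimately have "tsat M ([a] @ ds) ?\<psi> \<longleftrightarrow> tsat M ([b] @ ds) ?\<psi>"
      using eq by (simp add: tequiv_def)
    then show ?thesis
      using sat_abstract_consts[of \<phi> \<J> A "[a]" ds M] sat_abstract_consts[of \<phi> \<J> A "[b]" ds M] \<phi> ds assms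
      by simp
  qed
  then show "tp \<J> M A a = tp \<J> M A b" using assms by (auto simp: tp_def)
qed

section \<open>Types and correspondences\<close>

context group
begin

text \<open>If the quotient of \<open>h\<close> by \<open>g\<close> is \<open>x y\<close> with
  \<open>x\<close> in \<open>M\<close> and \<open>y\<close> in \<open>N\<close>, then
  \<open>y g\<close> is the intermediate element. In \<open>amalgam\<close> it makes both
  projections of the fibre product onto.\<close>

lemma mem_set_mult_coset:
  assumes "M \<lhd> G" "N \<lhd> G" "N0 \<subseteq> M <#> N" "h \<otimes> inv g \<in> N0" "h \<in> carrier G" "g \<in> carrier G"
  shows "\<exists>g' \<in> carrier G. h \<otimes> inv g' \<in> M \<and> g' \<otimes> inv g \<in> N"
proof -
  obtain x y where xy: "x \<in> M" "y \<in> N" "h \<otimes> inv g = x \<otimes> y"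
    using assms(3,4) set_mult_iff by blast
  have c: "x \<in> carrier G" "y \<in> carrier G" using xy normal_subset assms by blast+
  have "h = x \<otimes> (y \<otimes> g)"
  proof -
    have "h = (h \<otimes> inv g) \<otimes> g" using assms by (simp add: m_assoc)
    then show ?thesis using xy(3) c assms by (simp add: m_assoc)
  qed
  then have "h \<otimes> inv (y \<otimes> g) = x" using c assms by (simp add: m_assoc inv_mult_group)
      (simp add: m_assoc[symmetric])
  moreover have "(y \<otimes> g) \<otimes> inv g = y" using c assms by (simp add: m_assoc)
  ultimately show ?thesis using xy c assms by (intro bexI[of _ "y \<otimes> g"]) simp_all
qed

lemma coset_rel_mult:
  assumes N: "N \<lhd> G" and "x \<otimes> inv y \<in> N" "x' \<otimes> inv y' \<in> N"
    and c: "x \<in> carrier G" "y \<in> carrier G" "x' \<in> carrier G" "y' \<in> carrier G"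
  shows "(x \<otimes> x') \<otimes> inv (y \<otimes> y') \<in> N"
proof -
  have "x \<in> N #> y" "x' \<in> N #> y'" using rcos_mem[OF N] assms by auto
  then have "x \<otimes> x' \<in> N #> (y \<otimes> y')"
    using rcosets_mult[OF N rcos_in_rcosets[OF N c(2)] rcos_in_rcosets[OF N c(4)]
        rcos_in_rcosets[OF N, of "y \<otimes> y'"] rcos_self_normal[OF N c(2)] rcos_self_normal[OF N c(4)]
        rcos_self_normal[OF N, of "y \<otimes> y'"]] c by simp
  then show ?thesis using rcos_mem[OF N] c by simp
qed

lemma coset_rel_inv:
  assumes N: "N \<lhd> G" and "x \<otimes> inv y \<in> N" and c: "x \<in> carrier G" "y \<in> carrier G"
  shows "inv x \<otimes> inv (inv y) \<in> N"
proof -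
  have "inv (x \<otimes> inv y) \<in> N" by (rule normal_inv[OF N assms(2)])
  then have "y \<otimes> inv x \<in> N" using c by (simp add: inv_mult_group)
  then have "inv x \<otimes> (y \<otimes> inv x) \<otimes> inv (inv x) \<in> N"
    by (rule normal_conj[OF N]) (use c in simp)
  then show ?thesis using c by (simp add: m_assoc)
qed

text \<open>Amalgamation: a correspondence that is trivial modulo \<open>N0\<close> and sends \<open>M\<close> to \<open>M'\<close> can be
  made trivial modulo a smaller \<open>N\<close>, if \<open>N0\<close> is contained in \<open>M N\<close> and in \<open>M' N\<close>. This is the
  fibre product of \<open>G/M\<close> and \<open>G/N\<close> over \<open>G/N0\<close>.\<close>

lemma amalgam:
  assumes R: "goursat G G R" and n: "M \<lhd> G" "M' \<lhd> G" "N \<lhd> G"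
    and triv: "\<And>h h'. (h, h') \<in> R \<Longrightarrow> h' \<otimes> inv h \<in> N0 \<and> h \<otimes> inv h' \<in> N0"
    and N0: "N0 \<subseteq> M <#> N" "N0 \<subseteq> M' <#> N"
  shows "\<exists>R'. goursat G G R' \<and> (\<forall>(g, g') \<in> R'. g' \<otimes> inv g \<in> N \<and>
    (\<exists>(h, h') \<in> R. h \<otimes> inv g \<in> M \<and> h' \<otimes> inv g' \<in> M'))"
proof -
  note r = goursatD[OF R]
  define R' where "R' = {(g, g'). g \<in> carrier G \<and> g' \<in> carrier G \<and> g' \<otimes> inv g \<in> N \<and>
    (\<exists>h h'. (h, h') \<in> R \<and> h \<otimes> inv g \<in> M \<and> h' \<otimes> inv g' \<in> M')}"
  have R'I: "(g, g') \<in> R'" if "g \<in> carrier G" "g' \<in> carrier G" "g' \<otimes> inv g \<in> N" "(h, h') \<in> R"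
    "h \<otimes> inv g \<in> M" "h' \<otimes> inv g' \<in> M'" for g g' h h'
    using that by (auto simp: R'_def)
  have R'E: "\<exists>h h'. g \<in> carrier G \<and> g' \<in> carrier G \<and> g' \<otimes> inv g \<in> N \<and> (h, h') \<in> R \<and>
      h \<otimes> inv g \<in> M \<and> h' \<otimes> inv g' \<in> M'" if "(g, g') \<in> R'" for g g'
    using that by (auto simp: R'_def)
  have one: "x \<otimes> inv x \<in> K" if "x \<in> carrier G" "K \<lhd> G" for x K
    using that normal_one by simp
  have "goursat G G R'"
  proof (rule goursatI)
    show "g \<in> carrier G \<and> g' \<in> carrier G" if "(g, g') \<in> R'" for g g'
      using that by (auto simp: R'_def)
    show "\<exists>g'. (g, g') \<in> R'" if g: "g \<in> carrier G" for g
    proof -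
      obtain h' where h': "(g, h') \<in> R" using r(3)[OF g] by blast
      obtain g' where "g' \<in> carrier G" "h' \<otimes> inv g' \<in> M'" "g' \<otimes> inv g \<in> N"
        using mem_set_mult_coset[OF n(2,3) N0(2) _ r(2)[OF h'] g] triv[OF h'] by blast
      then show ?thesis using R'I[OF g _ _ h' one[OF g n(1)]] by blast
    qed
    show "\<exists>g. (g, g') \<in> R'" if g': "g' \<in> carrier G" for g'
    proof -
      obtain h where h: "(h, g') \<in> R" using r(4)[OF g'] by blast
      obtain g where g: "g \<in> carrier G" "h \<otimes> inv g \<in> M" "g \<otimes> inv g' \<in> N"
        using mem_set_mult_coset[OF n(1,3) N0(1) _ r(1)[OF h] g'] triv[OF h] by blast
      have "inv (g \<otimes> inv g') \<in> N" by (rule normal_inv[OF n(3) g(3)])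
      then have "g' \<otimes> inv g \<in> N" using g g' by (simp add: inv_mult_group)
      then show ?thesis using R'I[OF g(1) g' _ h g(2) one[OF g' n(2)]] by blast
    qed
    show "(g1 \<otimes> g2, g1' \<otimes> g2') \<in> R'" if g: "(g1, g1') \<in> R'" "(g2, g2') \<in> R'" for g1 g1' g2 g2'
    proof -
      obtain h1 h1' where 1: "g1 \<in> carrier G" "g1' \<in> carrier G" "g1' \<otimes> inv g1 \<in> N" "(h1, h1') \<in> R"
        "h1 \<otimes> inv g1 \<in> M" "h1' \<otimes> inv g1' \<in> M'" using R'E[OF g(1)] by blast
      obtain h2 h2' where 2: "g2 \<in> carrier G" "g2' \<in> carrier G" "g2' \<otimes> inv g2 \<in> N" "(h2, h2') \<in> R"
        "h2 \<otimes> inv g2 \<in> M" "h2' \<otimes> inv g2' \<in> M'" using R'E[OF g(2)] by blast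
      note c = r(1,2)[OF 1(4)] r(1,2)[OF 2(4)]
      show ?thesis
        using 1 2 c
        by (intro R'I[OF _ _ _ r(5)[OF 1(4) 2(4)]] coset_rel_mult n) auto
    qed
    show "(inv g, inv g') \<in> R'" if g: "(g, g') \<in> R'" for g g'
    proof -
      obtain h h' where 1: "g \<in> carrier G" "g' \<in> carrier G" "g' \<otimes> inv g \<in> N" "(h, h') \<in> R"
        "h \<otimes> inv g \<in> M" "h' \<otimes> inv g' \<in> M'" using R'E[OF g] by blast
      note c = r(1,2)[OF 1(4)]
      show ?thesis
        using 1 c by (intro R'I[OF _ _ _ r(6)[OF 1(4)]] coset_rel_inv n) auto
    qed
  qed
  moreover have "\<forall>(g, g') \<in> R'. g' \<otimes> inv g \<in> N \<and> (\<exists>(h, h') \<in> R. h \<otimes> inv g \<in> M \<and> h' \<otimes> inv g' \<in> M')"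
    using R'E by fast
  ultimately show ?thesis by blast
qed

lemma rel_coset:
  assumes "K \<lhd> G" "M \<subseteq> K" "c \<in> rcosets K" "h \<otimes> inv g \<in> M" "h \<in> carrier G" "g \<in> carrier G"
  shows "h \<in> c \<longleftrightarrow> g \<in> c"
proof
  assume "g \<in> c" then show "h \<in> c" using rcosets_mem[OF assms(1,3), of g h] assms by blast
next
  assume h: "h \<in> c"
  have "inv (h \<otimes> inv g) \<in> K" using normal_inv[OF assms(1)] assms(2,4) by blast
  then have "g \<otimes> inv h \<in> K" using assms by (simp add: inv_mult_group)
  then show "g \<in> c" using rcosets_mem[OF assms(1,3) h] assms by blast
qed

end

context sep
begin

text \<open>\<open>xs\<close> is extended by the list \<open>zs\<close> of all elements over
  \<open>N = nrms xs\<close> in one sort, and \<open>ys\<close> by an equivalent list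
  \<open>ws\<close>. Atomic formulas express the multiplication of these cosets and their position
  relative to the given tuple, so sending the coset of \<open>zs ! j\<close> to that of
  \<open>ws ! j\<close> gives the correspondence.\<close>

lemma tequiv_corresp:
  assumes eq: "tequiv \<J> S xs ys" and el: "set xs \<subseteq> elements \<J> S" "set ys \<subseteq> elements \<J> S"
  shows "corresp xs ys"
proof -
  have m: "map fst xs = map fst ys" and len: "length ys = length xs"
    using eq by (auto simp: tequiv_def dest: map_eq_imp_length_eq)
  define N where "N = nrms xs"
  have N: "N \<in> ON" using nrms_ON[OF el(1)] by (simp add: N_def)
  note n = ON_normal[OF N]
  obtain J where J: "J \<in> F N" using F_nonempty[OF N] by blast
  \<comment> \<open>The first component is at least the index of \<open>N\<close>, so every coset of
    \<open>N\<close> occurs in this sort, and at least each first component in \<open>xs\<close>, so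
    that \<open>crel\<close> from \<open>zs\<close> to \<open>xs\<close> expresses
    inclusion.\<close>
  define s where "s = (index G N + sum_list (map (fst \<circ> fst) xs), J)"
  have s: "s \<in> sorts \<J>" using F_seqs[OF N] J index_pos[OF N] by (auto simp: s_def sorts_def)
  have s_ge: "fst (fst (xs ! i)) \<le> fst s" if "i < length xs" for i
  proof -
    have "(fst \<circ> fst) (xs ! i) \<in> set (map (fst \<circ> fst) xs)" using that by auto
    then have "(fst \<circ> fst) (xs ! i) \<le> sum_list (map (fst \<circ> fst) xs)" by (rule member_le_sum_list) simp
    then show ?thesis by (simp add: s_def)
  qed
  define Z where "Z = {z \<in> elements \<J> S. fst z = s \<and> nrm z = N}"
  have inj: "inj_on cst Z" using cst_inj by (auto simp: inj_on_def Z_def)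
  have "cst ` Z \<subseteq> rcosets N" using elem_props(2) by (auto simp: Z_def)
  then have "finite Z" using inj finite_rcosets[OF N] finite_imageD finite_subset by blast
  then obtain zs where zs: "set zs = Z" using finite_list by blast
  have zel: "z \<in> elements \<J> S" "fst z = s" "nrm z = N" if "z \<in> set zs" for z using that zs by (auto simp: Z_def)
  have zex: "\<exists>z \<in> set zs. cst z = c" if "c \<in> rcosets N" for c
    using elem_exists[OF s N _ _ that] J by (auto simp: zs Z_def s_def)
  obtain ws where ws: "set ws \<subseteq> elements \<J> S" and eq2: "tequiv \<J> S (xs @ zs) (ys @ ws)"
    using tequiv_extend_list[OF eq el, of zs] zel(1) by blast
  let ?us = "xs @ zs" and ?vs = "ys @ ws"
  have m2: "map fst ?us = map fst ?vs" using eq2 by (simp add: tequiv_def)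
  have lw: "length ws = length zs" using map_eq_imp_length_eq[OF m2] len by simp
  have wel: "ws ! j \<in> elements \<J> S" "fst (ws ! j) = s" if "j < length zs" for j
  proof -
    show "ws ! j \<in> elements \<J> S" using ws that lw by auto
    have "map fst ?us ! (length xs + j) = map fst ?vs ! (length xs + j)" using m2 by simp
    then show "fst (ws ! j) = s" using that lw len zel(2)[of "zs ! j"] by (simp add: nth_append)
  qed
  have usel: "set ?us \<subseteq> elements \<J> S" using el zel by auto
  note at = tequiv_atoms[OF eq2 usel]
  have zj: "zs ! j \<in> set zs" if "j < length zs" for j using that by simp
  obtain z0 where "z0 \<in> set zs" using zex[OF normal_in_rcosets[OF n]] by blast
  then have pos: "0 < length zs" by auto
  define N' where "N' = nrm (ws ! 0)"
  have le: "nrm (ws ! j) \<subseteq> nrm (ws ! i)" if "i < length zs" "j < length zs" for i j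
  proof -
    have "le S s s (snd (zs ! j)) (snd (zs ! i)) \<longleftrightarrow> le S s s (snd (ws ! j)) (snd (ws ! i))"
      using at(2)[of "length xs + j" "length xs + i" 0] that zel(2) wel(2) zj len lw pos
      by (simp add: nth_append)
    moreover have "(s, snd (zs ! k)) = zs ! k" "(s, snd (ws ! k)) = ws ! k" if "k < length zs" for k
      using zel(2)[OF zj[OF that]] wel(2)[OF that] by (simp_all add: prod_eq_iff)
    ultimately show ?thesis
      using le_iff[of s "snd (zs ! j)" s "snd (zs ! i)"] le_iff[of s "snd (ws ! j)" s "snd (ws ! i)"]
        zel(1,3)[OF zj] wel(1) that by simp
  qed
  have wn: "nrm (ws ! j) = N'" if "j < length zs" for j
    using le[OF that pos] le[OF pos that] by (auto simp: N'_def)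
  have n': "N' \<lhd> G" using nrm_normal[OF wel(1)[OF pos]] by (simp add: N'_def)
  have wc: "cst (ws ! j) \<in> rcosets N'" if "j < length zs" for j
    using elem_props(2)[OF wel(1)[OF that]] wn[OF that] by simp
  have zc: "cst (zs ! j) \<in> rcosets N" if "j < length zs" for j
    using elem_props(2)[OF zel(1)[OF zj[OF that]]] zel(3)[OF zj[OF that]] by simp
  have pair: "(s, snd (zs ! k)) = zs ! k" "(s, snd (ws ! k)) = ws ! k" if "k < length zs" for k
    using zel(2)[OF zj[OF that]] wel(2)[OF that] by (simp_all add: prod_eq_iff)
  define R where "R = {(g, g'). \<exists>j < length zs. g \<in> cst (zs ! j) \<and> g' \<in> cst (ws ! j)}"
  have "goursat G G R"
  proof (rule goursat_of_fibres[OF is_group is_group n'])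
    show "g \<in> carrier G" if "(g, g') \<in> R" for g g'
      using that cst_subset[OF zel(1)[OF zj]] by (auto simp: R_def)
    show "\<exists>c \<in> rcosets N'. \<forall>g'. (g, g') \<in> R \<longleftrightarrow> g' \<in> c" if g: "g \<in> carrier G" for g
    proof -
      obtain c where c: "c \<in> rcosets N" "g \<in> c" using rcosets_ex[OF n g] by blast
      obtain j where j: "j < length zs" "cst (zs ! j) = c" using zex[OF c(1)] by (metis in_set_conv_nth)
      have "g' \<in> cst (ws ! j)" if R1: "(g, g') \<in> R" for g'
      proof -
        obtain i where i: "i < length zs" "g \<in> cst (zs ! i)" "g' \<in> cst (ws ! i)" using R1 by (auto simp: R_def)
        have "cst (zs ! i) = cst (zs ! j)"
          unfolding j(2) by (rule rcosets_eqI[OF n zc[OF i(1)] c(1) i(2) c(2)])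
        then have "zs ! i = zs ! j"
          using cst_inj[OF zel(1)[OF zj[OF i(1)]] zel(1)[OF zj[OF j(1)]]] zel(2)[OF zj] i(1) j(1) by simp
        then have "ws ! i = ws ! j"
          using at(1)[of "length xs + i" "length xs + j" 0] i(1) j(1) pos len by (simp add: nth_append)
        then show ?thesis using i(3) by simp
      qed
      then show ?thesis using j c(2) wc[OF j(1)] by (auto simp: R_def)
    qed
    show "\<exists>g. (g, g') \<in> R" if g': "g' \<in> carrier G" for g'
    proof -
      obtain c where c: "c \<in> rcosets N'" "g' \<in> c" using rcosets_ex[OF n' g'] by blast
      have p: "N' \<in> ON" "index G N' \<le> fst s" "snd s \<in> F N'"
        using elem_props(1,3,4)[OF wel(1)[OF pos]] wel(2)[OF pos] by (simp_all add: N'_def)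
      obtain w where w: "(s, w) \<in> elements \<J> S" "cst (s, w) = c" "nrm (s, w) = N'"
        using elem_exists[OF s p c(1)] by blast
      have vel: "set ?vs \<subseteq> elements \<J> S" using el ws by auto
      \<comment> \<open>Could a coset of \<open>N'\<close> be missing from \<open>ws\<close>? The
        equivalence is extended in the opposite direction: \<open>z\<close> has the same order
        relations to \<open>zs ! 0\<close> as \<open>w\<close> to \<open>ws ! 0\<close>, so it is
        over \<open>N\<close> and occurs in \<open>zs\<close>.\<close>
      obtain z where z: "z \<in> elements \<J> S" "fst z = s" "tequiv \<J> S (?vs @ [(s, w)]) (?us @ [z])"
        using tequiv_extend[OF tequiv_sym[OF eq2] vel usel w(1)] by auto
      have vel2: "set (?vs @ [(s, w)]) \<subseteq> elements \<J> S" using vel w by simp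
      note at2 = tequiv_atoms[OF z(3) vel2]
      let ?n = "length ys + length ws"
      have ge: "(?vs @ [(s, w)]) ! (length ys + j) = ws ! j" "(?us @ [z]) ! (length ys + j) = zs ! j"
        if "j < length zs" for j using that lw len by (simp_all add: nth_append)
      have gn: "(?vs @ [(s, w)]) ! ?n = (s, w)" "(?us @ [z]) ! ?n = z"
        using lw len by (simp_all add: nth_append)
      have zp: "(s, snd z) = z" using z(2) by (simp add: prod_eq_iff)
      have l1: "le S s s w (snd (ws ! 0)) \<longleftrightarrow> le S s s (snd z) (snd (zs ! 0))"
        using at2(2)[of ?n "length ys + 0" 0] ge[OF pos] gn z(2) zel(2)[OF zj[OF pos]] wel(2)[OF pos] lw pos by simp
      have l2: "le S s s (snd (ws ! 0)) w \<longleftrightarrow> le S s s (snd (zs ! 0)) (snd z)"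
        using at2(2)[of "length ys + 0" ?n 0] ge[OF pos] gn z(2) zel(2)[OF zj[OF pos]] wel(2)[OF pos] lw pos by simp
      have "nrm z = N"
        using l1 l2 le_iff[of s w s "snd (ws ! 0)"] le_iff[of s "snd (ws ! 0)" s w]
          le_iff[of s "snd z" s "snd (zs ! 0)"] le_iff[of s "snd (zs ! 0)" s "snd z"]
          pair[OF pos] zp w wel(1)[OF pos] z(1) zel(1,3)[OF zj[OF pos]] wn[OF pos] by auto
      then have "z \<in> set zs" using z by (simp add: zs Z_def)
      then obtain j where j: "j < length zs" "z = zs ! j" by (auto simp: in_set_conv_nth)
      have "(s, w) = ws ! j"
        using at2(1)[of ?n "length ys + j" 0] ge[OF j(1)] gn j(2) wel(2)[OF j(1)] lw j(1) by simp
      moreover obtain g where "g \<in> cst (zs ! j)" using cst_nonempty[OF zel(1)[OF zj[OF j(1)]]] by blast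
      ultimately show ?thesis using c(2) w(2) j(1) by (auto simp: R_def)
    qed
    show "(g \<otimes> h, g' \<otimes> h') \<in> R" if R1: "(g, g') \<in> R" "(h, h') \<in> R" for g g' h h'
    proof -
      obtain i where i: "i < length zs" "g \<in> cst (zs ! i)" "g' \<in> cst (ws ! i)" using R1 by (auto simp: R_def)
      obtain j where j: "j < length zs" "h \<in> cst (zs ! j)" "h' \<in> cst (ws ! j)" using R1 by (auto simp: R_def)
      have "g \<otimes> h \<in> carrier G"
        using i(2) j(2) cst_subset[OF zel(1)[OF zj[OF i(1)]]] cst_subset[OF zel(1)[OF zj[OF j(1)]]] by blast
      then obtain c where c: "c \<in> rcosets N" "g \<otimes> h \<in> c" using rcosets_ex[OF n] by blast
      obtain l where l: "l < length zs" "cst (zs ! l) = c" using zex[OF c(1)] by (metis in_set_conv_nth)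
      have zi: "(s, snd (zs ! i)) \<in> elements \<J> S" "(s, snd (zs ! j)) \<in> elements \<J> S" "(s, snd (zs ! l)) \<in> elements \<J> S"
        using pair(1) zel(1)[OF zj] i(1) j(1) l(1) by simp_all
      have wi: "(s, snd (ws ! i)) \<in> elements \<J> S" "(s, snd (ws ! j)) \<in> elements \<J> S" "(s, snd (ws ! l)) \<in> elements \<J> S"
        using pair(2) wel(1) i(1) j(1) l(1) by simp_all
      have "prel S s (snd (zs ! i)) (snd (zs ! j)) (snd (zs ! l))"
        using prel_iff[OF zi] pair(1) i j l c(2) zel(3)[OF zj] by auto
      then have "prel S s (snd (ws ! i)) (snd (ws ! j)) (snd (ws ! l))"
        using at(4)[of "length xs + i" "length xs + j" "length xs + l"] i(1) j(1) l(1) zel(2)[OF zj] wel(2) lw len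
        by (simp add: nth_append)
      then obtain x y where xy: "x \<in> cst (ws ! i)" "y \<in> cst (ws ! j)" "x \<otimes> y \<in> cst (ws ! l)"
        using prel_iff[OF wi] pair(2) i(1) j(1) l(1) by auto
      have "g' \<otimes> h' \<in> cst (ws ! l)"
        by (rule rcosets_mult[OF n' wc[OF i(1)] wc[OF j(1)] wc[OF l(1)] xy i(3) j(3)])
      then show ?thesis using l c(2) by (auto simp: R_def)
    qed
  qed
  moreover have "matches R (cst (xs ! i)) (cst (ys ! i))" if i: "i < length xs" for i
  proof -
    have xi: "xs ! i \<in> elements \<J> S" "ys ! i \<in> elements \<J> S" using i el len by auto
    have fi: "fst (ys ! i) = fst (xs ! i)" using m i len by (metis nth_map)
    have Nx: "N \<subseteq> nrm (xs ! i)" unfolding N_def using i by (intro nrms_below) simp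
    have px: "(fst (xs ! i), snd (xs ! i)) = xs ! i" "(fst (xs ! i), snd (ys ! i)) = ys ! i"
      using fi by (simp_all add: prod_eq_iff)
    have "g \<in> cst (xs ! i) \<longleftrightarrow> g' \<in> cst (ys ! i)"
      if j: "j < length zs" "g \<in> cst (zs ! j)" "g' \<in> cst (ws ! j)" for g g' j
    proof -
      have u: "?us ! i = xs ! i" "?vs ! i = ys ! i" "?us ! (length xs + j) = zs ! j" "?vs ! (length xs + j) = ws ! j"
        using i j(1) len by (simp_all add: nth_append)
      have zi: "(s, snd (zs ! j)) \<in> elements \<J> S" "(s, snd (ws ! j)) \<in> elements \<J> S"
        using pair[OF j(1)] zel(1)[OF zj[OF j(1)]] wel(1)[OF j(1)] by simp_all
      have xe: "(fst (xs ! i), snd (xs ! i)) \<in> elements \<J> S" "(fst (xs ! i), snd (ys ! i)) \<in> elements \<J> S"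
        using px xi by simp_all
      have le: "le S s (fst (xs ! i)) (snd (zs ! j)) (snd (xs ! i)) \<longleftrightarrow> le S s (fst (xs ! i)) (snd (ws ! j)) (snd (ys ! i))"
        using at(2)[of "length xs + j" i i] i j(1) u zel(2)[OF zj[OF j(1)]] wel(2)[OF j(1)] fi by simp
      have cr: "crel S s (fst (xs ! i)) (snd (zs ! j)) (snd (xs ! i)) \<longleftrightarrow> crel S s (fst (xs ! i)) (snd (ws ! j)) (snd (ys ! i))"
        using at(3)[of "length xs + j" i i] i j(1) u zel(2)[OF zj[OF j(1)]] wel(2)[OF j(1)] fi by simp
      have Nw: "N' \<subseteq> nrm (ys ! i)"
        using le le_iff[OF zi(1) xe(1)] le_iff[OF zi(2) xe(2)] pair[OF j(1)] px zel(3)[OF zj[OF j(1)]] Nx wn[OF j(1)]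
        by simp
      have "g \<in> cst (xs ! i) \<longleftrightarrow> cst (zs ! j) \<subseteq> cst (xs ! i)"
        by (rule rcosets_mem_iff_subset[OF nrm_normal[OF xi(1)] n Nx zc[OF j(1)] elem_props(2)[OF xi(1)] j(2)])
      also have "\<dots> \<longleftrightarrow> cst (ws ! j) \<subseteq> cst (ys ! i)"
        using cr crel_iff[OF zi(1) xe(1)] crel_iff[OF zi(2) xe(2)] pair[OF j(1)] px s_ge[OF i] by simp
      also have "\<dots> \<longleftrightarrow> g' \<in> cst (ys ! i)"
        by (rule rcosets_mem_iff_subset[OF nrm_normal[OF xi(2)] n' Nw wc[OF j(1)] elem_props(2)[OF xi(2)] j(3), symmetric])
      finally show ?thesis .
    qed
    then show ?thesis by (auto simp: matches_def R_def)
  qed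
  ultimately show ?thesis using m by (auto simp: corresp_def)
qed

end

section \<open>Joins with a subsystem\<close>

context coords
begin

lemma below_iff: "x \<in> elements \<J> S \<Longrightarrow> y \<in> elements \<J> S \<Longrightarrow> below S x y \<longleftrightarrow> nrm x \<subseteq> nrm y"
  using le_iff[of "fst x" "snd x" "fst y" "snd y"] by (simp add: below_def)

text \<open>The order is inclusion of subgroups, and the least normal subgroup above two given ones
  is their product. As the product is open, some element of \<open>S\<close> lies over it and
  attains the join.\<close>

lemma is_join_iff:
  assumes "a \<in> elements \<J> S" "b \<in> elements \<J> S" "c \<in> elements \<J> S"
  shows "is_join \<J> S a b c \<longleftrightarrow> nrm c = nrm a <#> nrm b"
proof -
  let ?M = "nrm a <#> nrm b"
  note s = set_mult_normal[OF nrm_normal[OF assms(1)] nrm_normal[OF assms(2)]]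
  have M: "?M \<in> ON" using set_mult_ON[OF elem_props(1)[OF assms(1)] nrm_normal[OF assms(2)]] .
  obtain J where "J \<in> F ?M" using F_nonempty[OF M] by blast
  then obtain d where d: "d \<in> elements \<J> S" "nrm d = ?M" using rep_exists[OF M] by blast
  show ?thesis
  proof
    assume j: "is_join \<J> S a b c"
    then have "nrm a \<subseteq> nrm c" "nrm b \<subseteq> nrm c"
      using below_iff assms by (auto simp: is_join_def)
    then have "?M \<subseteq> nrm c" by (rule set_mult_least[OF nrm_normal[OF assms(3)]])
    moreover have "below S a d" "below S b d" using below_iff assms d s by auto
    then have "below S c d" using j d(1) by (simp add: is_join_def)
    then have "nrm c \<subseteq> ?M" using below_iff assms d by simp
    ultimately show "nrm c = ?M" by blast
  next
    assume c: "nrm c = ?M"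
    have "below S c d'" if "d' \<in> elements \<J> S" "below S a d'" "below S b d'" for d'
      using that below_iff assms c set_mult_least[OF nrm_normal[OF that(1)]] by simp
    then show "is_join \<J> S a b c" using below_iff assms c s by (simp add: is_join_def)
  qed
qed

context
  fixes A assumes A: "subsystem \<J> Jsub S A"
begin

lemma subsystem_elements: "A \<subseteq> elements \<J> S"
  using A by (simp add: subsystem_def)

lemma subsystem_top: "\<exists>d \<in> A. nrm d = carrier G"
proof -
  obtain J where "J \<in> F (carrier G)" using F_nonempty[OF carrier_ON] by blast
  then obtain x where "((index G (carrier G), J), x) \<in> elements \<J> S" "nrm ((index G (carrier G), J), x) = carrier G"
    using rep_exists[OF carrier_ON] by blast
  then show ?thesis using subsystem_closed(1)[OF A] by blast
qed

lemma subsystem_upper: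
  assumes "b \<in> A" "nrm b \<subseteq> M" "M \<in> ON"
  shows "\<exists>d \<in> A. nrm d = M"
proof -
  have b: "b \<in> elements \<J> S" using assms subsystem_elements by blast
  note p = elem_props[OF b]
  have "Jsub (index G (nrm b)) (snd (fst b)) \<in> F M"
    using F_up[OF p(1) assms(3) index_pos[OF p(1)] assms(2) order_refl p(4)] .
  then obtain x where x: "((index G M, Jsub (index G (nrm b)) (snd (fst b))), x) \<in> elements \<J> S"
    "nrm ((index G M, Jsub (index G (nrm b)) (snd (fst b))), x) = M"
    using rep_exists[OF assms(3)] by blast
  show ?thesis
    using subsystem_closed(3)[OF A x(1) assms(1) _ order_refl index_pos[OF p(1)]] x(2) assms(2) by auto
qed

lemma subsystem_Int:
  assumes "b \<in> A" "c \<in> A" shows "\<exists>d \<in> A. nrm d = nrm b \<inter> nrm c"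
proof -
  have bc: "b \<in> elements \<J> S" "c \<in> elements \<J> S" using assms subsystem_elements by blast+
  have M: "nrm b \<inter> nrm c \<in> ON" using Int_ON elem_props(1) bc by blast
  have "snd (fst b) @ snd (fst c) \<in> F (nrm b \<inter> nrm c)"
    using F_Int elem_props(1,4) bc by blast
  then obtain x where x: "((index G (nrm b \<inter> nrm c), snd (fst b) @ snd (fst c)), x) \<in> elements \<J> S"
    "nrm ((index G (nrm b \<inter> nrm c), snd (fst b) @ snd (fst c)), x) = nrm b \<inter> nrm c"
    using rep_exists[OF M] by blast
  show ?thesis using subsystem_closed(4)[OF A x(1) assms] x(2) by auto
qed

lemma subsystem_nrms:
  assumes "set ds \<subseteq> A" shows "\<exists>d \<in> A. nrm d = nrms ds"
  using assms
proof (induction ds)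
  case Nil then show ?case using subsystem_top by (simp add: nrms_def)
next
  case (Cons e ds)
  then obtain d where d: "d \<in> A" "nrm d = nrms ds" by auto
  have "nrms (e # ds) = nrm e \<inter> nrms ds" by (auto simp: nrms_def)
  then show ?case using subsystem_Int[of e d] Cons.prems d by simp
qed

lemma subsystem_coset:
  assumes "b \<in> A" "c \<in> rcosets (nrm b)" shows "\<exists>d \<in> A. fst d = fst b \<and> cst d = c \<and> nrm d = nrm b"
proof -
  have b: "b \<in> elements \<J> S" using assms subsystem_elements by blast
  note p = elem_props[OF b]
  have s: "fst b \<in> sorts \<J>" using b by (cases b) (simp add: elements_def)
  obtain x where x: "(fst b, x) \<in> elements \<J> S" "cst (fst b, x) = c" "nrm (fst b, x) = nrm b"
    using elem_exists[OF s p(1,3,4) assms(2)] by blast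
  have "snd (fst b) \<in> sqrt_seq \<J> (snd (fst b))" using F_seqs[OF p(1)] p(4) by (auto simp: sqrt_seq_def)
  then have "(fst b, x) \<in> A" using subsystem_closed(2)[OF A x(1) assms(1) x(3)] by simp
  then show ?thesis using x by (intro bexI[of _ "(fst b, x)"]) simp_all
qed

context
  fixes a assumes a: "a \<in> elements \<J> S"
begin

text \<open>Both branches of \<open>join_base\<close> give the least product. A minimal element of
  \<open>A\<close> has the smallest subgroup; the other branch states minimality of the joins, and
  becomes a statement on subgroups because elements over the products exist.\<close>

lemma join_base_least:
  assumes "b \<in> join_base \<J> S a A"
  shows "b \<in> A" "\<And>b'. b' \<in> A \<Longrightarrow> nrm a <#> nrm b \<subseteq> nrm a <#> nrm b'"
proof -
  show bA: "b \<in> A" using assms by (auto simp: join_base_def min_elems_def split: if_splits)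
  fix b' assume b': "b' \<in> A"
  have el: "b \<in> elements \<J> S" "b' \<in> elements \<J> S" using bA b' subsystem_elements by blast+
  show "nrm a <#> nrm b \<subseteq> nrm a <#> nrm b'"
  proof (cases "min_elems S A = {}")
    case False
    then have "below S b b'" using assms b' by (auto simp: join_base_def min_elems_def)
    then have "nrm b \<subseteq> nrm b'" using below_iff el by simp
    then show ?thesis by (rule mono_set_mult[OF order_refl])
  next
    case True
    have j: "\<exists>c \<in> elements \<J> S. nrm c = nrm a <#> nrm d" if "d \<in> elements \<J> S" for d
    proof -
      have M: "nrm a <#> nrm d \<in> ON" using set_mult_ON[OF elem_props(1)[OF a] nrm_normal[OF that]] .
      then show ?thesis using rep_exists[OF M] F_nonempty[OF M] by blast
    qed
    obtain c where c: "c \<in> elements \<J> S" "nrm c = nrm a <#> nrm b" using j[OF el(1)] by blast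
    obtain c' where c': "c' \<in> elements \<J> S" "nrm c' = nrm a <#> nrm b'" using j[OF el(2)] by blast
    have "is_join \<J> S a b c \<and> is_join \<J> S a b' c'" using is_join_iff a el c c' by simp
    then have "below S c c'" using assms True b' c(1) c'(1) by (auto simp: join_base_def)
    then show ?thesis using below_iff c c' by simp
  qed
qed

text \<open>The index of \<open>nrm a <#> nrm b\<close> is bounded by that of \<open>nrm a\<close>; an element \<open>b\<close> at which it
  is maximal belongs to the base, since \<open>A\<close> is directed.\<close>

lemma join_base_nonempty: "join_base \<J> S a A \<noteq> {}"
proof (cases "min_elems S A = {}")
  case True
  let ?i = "\<lambda>b. index G (nrm a <#> nrm b)"
  have ON: "nrm a <#> nrm b \<in> ON" if "b \<in> A" for b
    using set_mult_ON[OF elem_props(1)[OF a] nrm_normal] that subsystem_elements by blast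
  have bound: "?i b \<le> index G (nrm a)" if "b \<in> A" for b
    using index_mono[OF ON[OF that] elem_props(1)[OF a]] set_mult_normal(2)[OF nrm_normal[OF a] nrm_normal]
      that subsystem_elements by blast
  obtain d where "d \<in> A" using subsystem_top by blast
  define m where "m = Max (?i ` A)"
  have fin: "finite (?i ` A)" by (rule finite_subset[of _ "{..index G (nrm a)}"]) (use bound in auto)
  then have "m \<in> ?i ` A" using \<open>d \<in> A\<close> by (auto simp: m_def intro!: Max_in)
  then obtain b where b: "b \<in> A" "?i b = m" by auto
  have max: "?i b' \<le> m" if "b' \<in> A" for b' using that fin by (simp add: m_def)
  have least: "nrm a <#> nrm b \<subseteq> nrm a <#> nrm b'" if b': "b' \<in> A" for b'
  proof -
    obtain e where e: "e \<in> A" "nrm e = nrm b \<inter> nrm b'" using subsystem_Int[OF b(1) b'] by blast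
    have "nrm a <#> nrm e \<subseteq> nrm a <#> nrm b" "nrm a <#> nrm e \<subseteq> nrm a <#> nrm b'"
      unfolding e(2) by (intro mono_set_mult; simp)+
    moreover have "nrm a <#> nrm b = nrm a <#> nrm e"
      using index_eq_imp_eq[OF ON[OF b(1)] ON[OF e(1)]] calculation(1) max[OF e(1)] b(2) by simp
    ultimately show ?thesis by simp
  qed
  have "below S c c'"
    if c: "b' \<in> A" "c \<in> elements \<J> S" "c' \<in> elements \<J> S" "is_join \<J> S a b c \<and> is_join \<J> S a b' c'" for b' c c'
  proof -
    have "b \<in> elements \<J> S" "b' \<in> elements \<J> S" using b(1) c(1) subsystem_elements by blast+
    then have "nrm c = nrm a <#> nrm b" "nrm c' = nrm a <#> nrm b'" using is_join_iff a c by blast+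
    then show ?thesis using least[OF c(1)] below_iff[OF c(2,3)] by simp
  qed
  then have "b \<in> join_base \<J> S a A"
    using True b(1) unfolding join_base_def by simp
  then show ?thesis by blast
qed (auto simp: join_base_def)

text \<open>The joins may lie in many sorts, since \<open>k'\<close> varies, but they lie over one
  subgroup \<open>N0\<close> and share one sequence, so they have a single tag. That
  \<open>N0\<close> is contained in every product \<open>nrm a <#> nrm b\<close> is what the
  amalgamation will use.\<close>

lemma join_with_props:
  "\<exists>N0 \<in> ON. nrm a \<subseteq> N0 \<and> (\<exists>b \<in> A. N0 = nrm a <#> nrm b) \<and> (\<forall>b \<in> A. N0 \<subseteq> nrm a <#> nrm b) \<and>
    (\<forall>c \<in> join_with \<J> Jsub S a A.
       c \<in> elements \<J> S \<and> nrm c = N0 \<and> snd (fst c) = Jsub (fst (fst a)) (snd (fst a))) \<and>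
    (\<forall>C \<in> rcosets N0. \<exists>c \<in> join_with \<J> Jsub S a A. cst c = C)"
proof -
  obtain b where b: "b \<in> join_base \<J> S a A" using join_base_nonempty by blast
  note l = join_base_least[OF b]
  have be: "b \<in> elements \<J> S" using l(1) subsystem_elements by blast
  obtain k J where k: "fst a = (k, J)" by force
  obtain k' J' y where b': "b = ((k', J'), y)" by (metis prod.exhaust)
  have k1: "1 \<le> k" "1 \<le> k'" using a be k b' by (auto simp: elements_def sorts_def) 
  let ?N = "nrm a <#> nrm b"
  have N: "?N \<in> ON" using set_mult_ON[OF elem_props(1)[OF a] nrm_normal[OF be]] .
  have sub: "nrm a \<subseteq> ?N" using set_mult_normal(2)[OF nrm_normal[OF a] nrm_normal[OF be]] .
  have "c \<in> elements \<J> S \<and> nrm c = ?N \<and> snd (fst c) = Jsub (fst (fst a)) (snd (fst a))"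
    if c: "c \<in> join_with \<J> Jsub S a A" for c
  proof -
    obtain l1 J1 d where d: "((l1, J1), d) \<in> join_base \<J> S a A" "fst c = (k * l1, Jsub k J)"
      "is_join \<J> S a ((l1, J1), d) c" "c \<in> elements \<J> S"
      using c k by (auto simp: join_with_def)
    note l' = join_base_least[OF d(1)]
    have "nrm c = nrm a <#> nrm ((l1, J1), d)"
      using is_join_iff[OF a _ d(4)] d(3) l'(1) subsystem_elements by blast
    then have "nrm c = ?N" using l'(2)[OF l(1)] l(2)[OF l'(1)] by simp
    then show ?thesis using d k by simp
  qed
  moreover have "\<exists>c \<in> join_with \<J> Jsub S a A. cst c = C" if C: "C \<in> rcosets ?N" for C
  proof -
    have p: "index G (nrm a) \<le> k" "J \<in> F (nrm a)" using elem_props(3,4)[OF a] k by simp_all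
    have F: "Jsub k J \<in> F ?N" by (rule F_up[OF elem_props(1)[OF a] N k1(1) sub p])
    have "index G ?N \<le> k" using index_mono[OF N elem_props(1)[OF a] sub] p(1) by simp
    then have i: "index G ?N \<le> k * k'" using k1 by (metis le_trans mult.right_neutral mult_le_mono2)
    have s: "(k * k', Jsub k J) \<in> sorts \<J>" using F F_seqs[OF N] k1 by (auto simp: sorts_def)
    obtain x where x: "((k * k', Jsub k J), x) \<in> elements \<J> S" "cst ((k * k', Jsub k J), x) = C"
      "nrm ((k * k', Jsub k J), x) = ?N"
      using elem_exists[OF s N _ _ C] i F by auto
    have "((k * k', Jsub k J), x) \<in> join_with \<J> Jsub S a A"
      using x(1,3) k b b' is_join_iff[OF a be x(1)] by (auto simp: join_with_def)
    then show ?thesis using x(2) by blast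
  qed
  ultimately show ?thesis using N sub l by (intro bexI[of _ ?N]) auto
qed

lemma finite_tags_join:
  "finite (tags (join_with \<J> Jsub S a A))" "finite (tags (join_with \<J> Jsub S a A \<union> {a}))"
  "join_with \<J> Jsub S a A \<subseteq> elements \<J> S"
proof -
  obtain N0 where N0: "\<forall>c \<in> join_with \<J> Jsub S a A.
      c \<in> elements \<J> S \<and> nrm c = N0 \<and> snd (fst c) = Jsub (fst (fst a)) (snd (fst a))"
    using join_with_props by blast
  then show "join_with \<J> Jsub S a A \<subseteq> elements \<J> S" by blast
  have "tags (join_with \<J> Jsub S a A) \<subseteq> {(N0, Jsub (fst (fst a)) (snd (fst a)))}"
    using N0 by (auto simp: tags_def)
  then show "finite (tags (join_with \<J> Jsub S a A))" using finite_subset by blast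
  then show "finite (tags (join_with \<J> Jsub S a A \<union> {a}))" by (simp add: tags_def image_Un)
qed

end

end

end

lemma (in sorted_group) matches_fixed_above:
  assumes "goursat G G R" "N \<lhd> G" "\<forall>C \<in> rcosets N. matches R C C" "M \<lhd> G" "N \<subseteq> M" "D \<in> rcosets M"
  shows "matches R D D"
  unfolding matches_def
proof (intro allI impI)
  fix g g' assume gg: "(g, g') \<in> R"
  obtain C where C: "C \<in> rcosets N" "g \<in> C" using rcosets_ex[OF assms(2)] goursatD(1)[OF assms(1) gg] by blast
  then have "g' \<in> C" using bspec[OF assms(3) C(1)] gg by (auto simp: matches_def)
  then show "g \<in> D \<longleftrightarrow> g' \<in> D"
    using rcosets_mem_iff_subset[OF assms(4,2,5) C(1) assms(6)] C(2) by blast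
qed

context sep
begin

text \<open>\<open>R\<close> is only known to be trivial modulo \<open>N0\<close>, which may be
  coarser than the cosets in \<open>ds\<close>. The fibre product is trivial modulo
  \<open>nrms ds\<close>, and it agrees with \<open>R\<close> up to \<open>nrms xs\<close> and
  \<open>nrms ys\<close>, which leaves the matches of the given entries intact.\<close>

lemma amalgam_corresp:
  assumes R: "goursat G G R" and n0: "N0 \<lhd> G" and fix0: "\<And>C. C \<in> rcosets N0 \<Longrightarrow> matches R C C"
    and el: "set xs \<subseteq> elements \<J> S" "set ys \<subseteq> elements \<J> S" "set ds \<subseteq> elements \<J> S"
    and m: "map fst xs = map fst ys" "\<And>i. i < length xs \<Longrightarrow> matches R (cst (xs ! i)) (cst (ys ! i))"
    and N0: "N0 \<subseteq> nrms xs <#> nrms ds" "N0 \<subseteq> nrms ys <#> nrms ds"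
  shows "corresp (xs @ ds) (ys @ ds)"
proof -
  have triv: "h' \<otimes> inv h \<in> N0 \<and> h \<otimes> inv h' \<in> N0" if hh: "(h, h') \<in> R" for h h'
  proof -
    obtain C where C: "C \<in> rcosets N0" "h \<in> C" using rcosets_ex[OF n0] goursatD(1)[OF R hh] by blast
    then have "h' \<in> C" using fix0[OF C(1)] hh by (auto simp: matches_def)
    then show ?thesis using rcosets_mem[OF n0 C(1)] C(2) by blast
  qed
  have len: "length ys = length xs" using m(1) map_eq_imp_length_eq by metis
  note nn = ON_normal[OF nrms_ON[OF el(1)]] ON_normal[OF nrms_ON[OF el(2)]] ON_normal[OF nrms_ON[OF el(3)]]
  obtain R' where R': "goursat G G R'"
    "\<forall>(g, g') \<in> R'. g' \<otimes> inv g \<in> nrms ds \<and> (\<exists>(h, h') \<in> R. h \<otimes> inv g \<in> nrms xs \<and> h' \<otimes> inv g' \<in> nrms ys)"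
    using amalgam[OF R nn triv N0] by blast
  have "matches R' (cst (xs ! i)) (cst (ys ! i))" if i: "i < length xs" for i
    unfolding matches_def
  proof (intro allI impI)
    fix g g' assume gg: "(g, g') \<in> R'"
    then obtain h h' where h: "(h, h') \<in> R" "h \<otimes> inv g \<in> nrms xs" "h' \<otimes> inv g' \<in> nrms ys" using R'(2) by blast
    note c = goursatD(1,2)[OF R'(1) gg] goursatD(1,2)[OF R h(1)]
    have mem: "xs ! i \<in> set xs" "ys ! i \<in> set ys" using i len by auto
    then have e: "xs ! i \<in> elements \<J> S" "ys ! i \<in> elements \<J> S" using el by blast+
    have "h \<in> cst (xs ! i) \<longleftrightarrow> g \<in> cst (xs ! i)"
      by (rule rel_coset[OF nrm_normal[OF e(1)] nrms_below[OF mem(1)] elem_props(2)[OF e(1)] h(2) c(3,1)])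
    moreover have "h' \<in> cst (ys ! i) \<longleftrightarrow> g' \<in> cst (ys ! i)"
      by (rule rel_coset[OF nrm_normal[OF e(2)] nrms_below[OF mem(2)] elem_props(2)[OF e(2)] h(3) c(4,2)])
    moreover have "h \<in> cst (xs ! i) \<longleftrightarrow> h' \<in> cst (ys ! i)" using m(2)[OF i] h(1) by (auto simp: matches_def)
    ultimately show "g \<in> cst (xs ! i) \<longleftrightarrow> g' \<in> cst (ys ! i)" by blast
  qed
  moreover have "matches R' (cst x) (cst x)" if x: "x \<in> set ds" for x
    unfolding matches_def
  proof (intro allI impI)
    fix g g' assume gg: "(g, g') \<in> R'"
    have xe: "x \<in> elements \<J> S" using x el(3) by blast
    have "g' \<otimes> inv g \<in> nrms ds" using R'(2) gg by blast
    then have "g' \<in> cst x \<longleftrightarrow> g \<in> cst x"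
      by (rule rel_coset[OF nrm_normal[OF xe] nrms_below[OF x] elem_props(2)[OF xe] _
            goursatD(2)[OF R'(1) gg] goursatD(1)[OF R'(1) gg]])
    then show "g \<in> cst x \<longleftrightarrow> g' \<in> cst x" by simp
  qed
  ultimately have "\<forall>i < length (xs @ ds). matches R' (cst ((xs @ ds) ! i)) (cst ((ys @ ds) ! i))"
    using len by (auto simp: nth_append)
  then show ?thesis using R'(1) m(1) unfolding corresp_def by auto
qed

section \<open>Types over a subsystem\<close>

context
  fixes A assumes A: "subsystem \<J> Jsub S A"
begin

text \<open>\<open>A\<close> contains an element \<open>e\<close> over
  \<open>nrm a <#> nrm d\<close>, and the type of \<open>a\<close> says that \<open>a\<close> lies
  below \<open>e\<close>. Then so does \<open>b\<close>.\<close>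

lemma type_join_mono:
  assumes ab: "a \<in> elements \<J> S" "b \<in> elements \<J> S" "fst a = fst b"
    and tp: "tp \<J> S A a = tp \<J> S A b" and d: "d \<in> A"
  shows "nrm b <#> nrm d \<subseteq> nrm a <#> nrm d"
proof -
  have de: "d \<in> elements \<J> S" using d subsystem_elements[OF A] by blast
  note s = set_mult_normal[OF nrm_normal[OF ab(1)] nrm_normal[OF de]]
  obtain e where e: "e \<in> A" "nrm e = nrm a <#> nrm d"
    using subsystem_upper[OF A d s(3) set_mult_ON[OF elem_props(1)[OF ab(1)] nrm_normal[OF de]]] by blast
  have ee: "e \<in> elements \<J> S" using e subsystem_elements[OF A] by blast
  have eq: "tequiv \<J> S ([a] @ [e]) ([b] @ [e])" using tp tp_eq_iff[OF ab(3)] e(1) by simp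
  have "le S (fst a) (fst e) (snd a) (snd e) \<longleftrightarrow> le S (fst b) (fst e) (snd b) (snd e)"
    using tequiv_atoms(2)[OF eq, of 0 1 0] ab ee by simp
  then have "below S a e \<longleftrightarrow> below S b e" by (simp add: below_def)
  then have "nrm b \<subseteq> nrm e" using below_iff ab ee e(2) s(2) by simp
  then show ?thesis using set_mult_least[OF nrm_normal[OF ee]] e(2) s(3) by simp
qed

text \<open>By symmetry, \<open>a\<close> and \<open>b\<close> have the same products with the
  subgroups of \<open>A\<close>; besides the common sort these are all that \<open>join_with\<close>
  depends on.\<close>

lemma type_join_eq:
  assumes ab: "a \<in> elements \<J> S" "b \<in> elements \<J> S" "fst a = fst b"
    and tp: "tp \<J> S A a = tp \<J> S A b"
  shows "join_with \<J> Jsub S a A = join_with \<J> Jsub S b A"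
proof -
  have eq: "nrm a <#> nrm d = nrm b <#> nrm d" if "d \<in> A" for d
    using type_join_mono[OF ab tp that] type_join_mono[OF ab(2,1) ab(3)[symmetric] tp[symmetric] that] by blast
  have j: "is_join \<J> S a d c \<longleftrightarrow> is_join \<J> S b d c" if "d \<in> A" "c \<in> elements \<J> S" for d c
    using is_join_iff[OF ab(1) _ that(2)] is_join_iff[OF ab(2) _ that(2)] eq[OF that(1)]
      that(1) subsystem_elements[OF A] by blast
  have base: "join_base \<J> S a A = join_base \<J> S b A"
    using j by (auto simp: join_base_def)
  have "c \<in> join_with \<J> Jsub S a A \<longleftrightarrow> c \<in> join_with \<J> Jsub S b A" for c
    unfolding join_with_def using ab(3) base j join_base_least(1)[OF A ab(2)] by (simp cong: conj_cong)
  then show ?thesis by blast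
qed

text \<open>Finitely many parameters in \<open>A\<close> represent all cosets of \<open>N0\<close>.
  Equality of types over them yields a correspondence that takes the coset of \<open>a\<close> to
  that of \<open>b\<close> and fixes each coset of \<open>N0\<close>; it induces the
  isomorphism.\<close>

lemma type_imp_isomorphism:
  assumes ab: "a \<in> elements \<J> S" "b \<in> elements \<J> S" "fst a = fst b"
    and tp: "tp \<J> S A a = tp \<J> S A b"
  shows "\<exists>f. isomorphism \<J>
      (substructure S (generated \<J> Jsub S (join_with \<J> Jsub S a A \<union> {a})))
      (substructure S (generated \<J> Jsub S (join_with \<J> Jsub S b A \<union> {b}))) f \<and>
    (\<forall>(s, x) \<in> generated \<J> Jsub S (join_with \<J> Jsub S a A). f s x = x) \<and> f (fst a) (snd a) = snd b"
proof -
  let ?a = "join_with \<J> Jsub S a A" and ?b = "join_with \<J> Jsub S b A"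
  have ab_eq: "?b = ?a" using type_join_eq[OF assms] by simp
  obtain N0 where N0: "N0 \<in> ON" "nrm a \<subseteq> N0" "\<exists>d \<in> A. N0 = nrm a <#> nrm d"
    and N0c: "\<forall>c \<in> ?a. c \<in> elements \<J> S \<and> nrm c = N0 \<and> snd (fst c) = Jsub (fst (fst a)) (snd (fst a))"
    using join_with_props[OF A ab(1)] by blast
  note n0 = ON_normal[OF N0(1)]
  obtain d where d: "d \<in> A" "N0 = nrm a <#> nrm d" using N0(3) by blast
  have de: "d \<in> elements \<J> S" using d subsystem_elements[OF A] by blast
  obtain e where e: "e \<in> A" "nrm e = N0"
    using subsystem_upper[OF A d(1) _ N0(1)] set_mult_normal(3)[OF nrm_normal[OF ab(1)] nrm_normal[OF de]] d(2)
    by blast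
  \<comment> \<open>All elements of \<open>A\<close> over \<open>N0\<close> in one sort: exactly one
    for each coset of \<open>N0\<close>, hence finitely many.\<close>
  define D where "D = {x \<in> A. fst x = fst e \<and> nrm x = N0}"
  have De: "D \<subseteq> elements \<J> S" using subsystem_elements[OF A] by (auto simp: D_def)
  have "inj_on cst D"
  proof (rule inj_onI)
    fix x y assume "x \<in> D" "y \<in> D" "cst x = cst y"
    then show "x = y" using De by (intro cst_inj) (auto simp: D_def)
  qed
  moreover have "cst ` D \<subseteq> rcosets N0" using elem_props(2) De by (auto simp: D_def)
  ultimately have "finite D" using finite_rcosets[OF N0(1)] finite_imageD finite_subset by blast
  then obtain ds where ds: "set ds = D" using finite_list by blast
  have "tequiv \<J> S ([a] @ ds) ([b] @ ds)" using tp tp_eq_iff[OF ab(3)] ds by (simp add: D_def)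
  then have "corresp ([a] @ ds) ([b] @ ds)" using ab ds De by (intro tequiv_corresp) auto
  then obtain R where R: "goursat G G R" "\<forall>i < Suc (length ds). matches R (cst ((a # ds) ! i)) (cst ((b # ds) ! i))"
    by (auto simp: corresp_def)
  have Rab: "matches R (cst a) (cst b)" using R(2) by force
  have "matches R (cst x) (cst x)" if "x \<in> D" for x
    using that R(2) ds by (metis Suc_less_eq in_set_conv_nth nth_Cons_Suc)
  then have fix0: "matches R C C" if "C \<in> rcosets N0" for C
    using subsystem_coset[OF A e(1)] that e(2) by (force simp: D_def)
  have "\<forall>C \<in> rcosets N0. matches R C C" using fix0 by blast
  note fixed = matches_fixed_above[OF R(1) n0 this]
  interpret self_pair \<J> Jsub G X F S h R by unfold_locales (fact R(1))
  have Y: "?a \<union> {a} \<subseteq> elements \<J> S" "?a \<union> {b} \<subseteq> elements \<J> S" "?a \<subseteq> elements \<J> S"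
    using finite_tags_join(3)[OF A ab(1)] ab by auto
  have gen: "generated \<J> Jsub S (?a \<union> {a}) = Gen (?a \<union> {a})" "generated \<J> Jsub S (?b \<union> {b}) = Gen (?b \<union> {b})"
    "generated \<J> Jsub S ?a = Gen ?a"
    using generated_eq finite_tags_join[OF A ab(1)] finite_tags_join[OF A ab(2)] ab by auto
  have cc: "matches R (cst c) (cst c)" if "c \<in> ?a" for c
    using fix0[of "cst c"] bspec[OF N0c that] elem_props(2)[of c] by simp
  have iso: "isomorphism \<J> (substructure S (Gen (?a \<union> {a}))) (substructure S (Gen (?a \<union> {b}))) match"
    by (rule match_isomorphism[OF Y(1,2)]) (use cc Rab ab(3) in auto)
  \<comment> \<open>The elements generated by the joins are cosets of subgroups above
    \<open>N0\<close>, hence unions of fixed cosets.\<close>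
  have fixm: "match s x = x" if sx: "(s, x) \<in> Gen ?a" for s x
  proof -
    have el: "(s, x) \<in> elements \<J> S" using sx Gen_elements by blast
    have "core (tags ?a) \<subseteq> nrm (s, x)" using core_least[OF tags_F[OF Y(3)]] sx by (auto simp: Gen_def)
    moreover have "N0 \<subseteq> core (tags ?a)" using N0c normal_subset[OF n0] by (auto simp: core_def tags_def)
    ultimately have "matches R (cst (s, x)) (cst (s, x))"
      using fixed[OF nrm_normal[OF el] _ elem_props(2)[OF el]] by blast
    then show ?thesis using match_eq[OF el, of "(s, x)"] by simp
  qed
  have "isomorphism \<J> (substructure S (generated \<J> Jsub S (?a \<union> {a})))
      (substructure S (generated \<J> Jsub S (?b \<union> {b}))) match"
    unfolding gen(1,2) unfolding ab_eq by (rule iso)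
  moreover have "\<forall>(s, x) \<in> generated \<J> Jsub S ?a. match s x = x"
  proof
    fix z assume "z \<in> generated \<J> Jsub S ?a"
    then show "case z of (s, x) \<Rightarrow> match s x = x" unfolding gen(3) by (cases z) (simp add: fixm)
  qed
  moreover have "match (fst a) (snd a) = snd b"
    using match_eq[OF ab(2) ab(3)[symmetric] Rab] by (auto simp: emb_def)
  ultimately show ?thesis by blast
qed

text \<open>The isomorphism gives a correspondence that takes the coset of \<open>a\<close> to that
  of \<open>b\<close> and fixes the cosets of \<open>N0\<close>. For parameters \<open>ds\<close> in
  \<open>A\<close>, the subgroup \<open>nrms ds\<close> belongs to an element of \<open>A\<close>,
  so \<open>N0\<close> lies in its products with \<open>nrm a\<close> and \<open>nrm b\<close>, and
  amalgamation makes the correspondence fix \<open>ds\<close> as well.\<close>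

lemma isomorphism_imp_type:
  assumes ab: "a \<in> elements \<J> S" "b \<in> elements \<J> S" "fst a = fst b"
    and eq: "join_with \<J> Jsub S a A = join_with \<J> Jsub S b A"
    and f: "isomorphism \<J>
      (substructure S (generated \<J> Jsub S (join_with \<J> Jsub S a A \<union> {a})))
      (substructure S (generated \<J> Jsub S (join_with \<J> Jsub S b A \<union> {b}))) f"
    "\<forall>(s, x) \<in> generated \<J> Jsub S (join_with \<J> Jsub S a A). f s x = x" "f (fst a) (snd a) = snd b"
  shows "tp \<J> S A a = tp \<J> S A b"
proof -
  let ?a = "join_with \<J> Jsub S a A" and ?b = "join_with \<J> Jsub S b A"
  obtain N0 where N0: "N0 \<in> ON" "\<forall>d \<in> A. N0 \<subseteq> nrm a <#> nrm d"
    "\<forall>c \<in> ?a. c \<in> elements \<J> S \<and> nrm c = N0 \<and> snd (fst c) = Jsub (fst (fst a)) (snd (fst a))"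
    "\<forall>C \<in> rcosets N0. \<exists>c \<in> ?a. cst c = C"
    using join_with_props[OF A ab(1)] by blast
  note n0 = ON_normal[OF N0(1)]
  obtain N1 where N1: "\<forall>d \<in> A. N1 \<subseteq> nrm b <#> nrm d"
    "\<forall>c \<in> ?b. c \<in> elements \<J> S \<and> nrm c = N1 \<and> snd (fst c) = Jsub (fst (fst b)) (snd (fst b))"
    using join_with_props[OF A ab(2)] by blast
  obtain c where "c \<in> ?a" using N0(4) normal_in_rcosets[OF n0] by blast
  \<comment> \<open>The two sets of joins are equal and nonempty, and a common element determines
    the subgroup.\<close>
  then have "N1 = N0" using N0(3) N1(2) eq by metis
  then have N0b: "\<forall>d \<in> A. N0 \<subseteq> nrm b <#> nrm d" using N1(1) by simp
  have Y: "?a \<union> {a} \<subseteq> elements \<J> S" "?a \<subseteq> elements \<J> S"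
    using finite_tags_join(3)[OF A ab(1)] ab by auto
  have gen: "generated \<J> Jsub S (?a \<union> {a}) = Gen (?a \<union> {a})" "generated \<J> Jsub S (?b \<union> {b}) = Gen (?b \<union> {b})"
    "generated \<J> Jsub S ?a = Gen ?a"
    using generated_eq finite_tags_join[OF A ab(1)] finite_tags_join[OF A ab(2)] ab by auto
  have emb: "embedding \<J> (substructure S (Gen (?a \<union> {a}))) S f"
  proof -
    have "embedding \<J> (substructure S (Gen (?a \<union> {a}))) (substructure S (Gen (?b \<union> {b}))) f"
      using f(1) unfolding gen isomorphism_def by blast
    moreover have "univ (substructure S (Gen (?b \<union> {b}))) s \<subseteq> univ S s" if "s \<in> sorts \<J>" for s
      using Gen_elements by (auto simp: substructure_def elements_def)
    ultimately show ?thesis by (fastforce simp: embedding_def substructure_def)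
  qed
  \<comment> \<open>\<open>embedding_correspondence\<close> takes finitely many elements, while
    \<open>?a\<close> may be infinite; one element for each coset of \<open>N0\<close> is
    enough.\<close>
  define pick where "pick C = (SOME c. c \<in> ?a \<and> cst c = C)" for C
  have pick: "pick C \<in> ?a \<and> cst (pick C) = C" if "C \<in> rcosets N0" for C
    unfolding pick_def by (rule someI_ex) (use N0(4) that in blast)
  let ?Z = "insert a (pick ` (rcosets N0))"
  have Z: "finite ?Z" "?Z \<subseteq> Gen (?a \<union> {a})"
    using finite_rcosets[OF N0(1)] pick Gen_superset[OF Y(1)] by auto
  obtain R where R: "goursat G G R"
    "\<forall>z \<in> ?Z. emb f z \<in> elements \<J> S \<and> matches R (cst z) (cst (emb f z))"
    using embedding_correspondence[OF subsystem_Gen[OF Y(1) finite_tags_join(2)[OF A ab(1)]] emb Z] by blast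
  have "emb f a = (fst a, snd b)" by (simp add: emb_def f(3))
  then have "emb f a = b" by (simp add: ab(3))
  then have Rab: "matches R (cst a) (cst b)" using R(2) by auto
  have fix0: "matches R C C" if C: "C \<in> rcosets N0" for C
  proof -
    have "pick C \<in> Gen ?a" using pick[OF C] Gen_superset[OF Y(2)] by blast
    then have "emb f (pick C) = pick C" using f(2) unfolding gen by (cases "pick C") (auto simp: emb_def)
    then show ?thesis using R(2) pick[OF C] C by fastforce
  qed
  have "tequiv \<J> S ([a] @ ds) ([b] @ ds)" if ds: "set ds \<subseteq> A" for ds
  proof -
    have dse: "set ds \<subseteq> elements \<J> S" using ds subsystem_elements[OF A] by blast
    obtain d where d: "d \<in> A" "nrm d = nrms ds" using subsystem_nrms[OF A ds] by blast
    have "nrms [a] = nrm a" "nrms [b] = nrm b" using nrm_subset[OF ab(1)] nrm_subset[OF ab(2)] by (auto simp: nrms_def)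
    then have "corresp ([a] @ ds) ([b] @ ds)"
      using ab dse Rab bspec[OF N0(2) d(1)] bspec[OF N0b d(1)] d(2)
      by (intro amalgam_corresp[OF R(1) n0 fix0]) auto
    then show ?thesis using ab dse by (intro corresp_tequiv) auto
  qed
  then show ?thesis using tp_eq_iff[OF ab(3)] by blast
qed

end

end

section \<open>Counting types\<close>

context coords
begin

text \<open>The order of the largest quotient of \<open>G\<close> that is a quotient both by
  \<open>nrms xs\<close> and by \<open>nrms ys\<close>. Extending \<open>ys\<close> cannot lower it,
  and the sorts of \<open>xs\<close> bound it.\<close>

definition rk :: "('j srt \<times> 'a) list \<Rightarrow> ('j srt \<times> 'a) list \<Rightarrow> nat" where
  "rk xs ys = index G (nrms xs <#> nrms ys)"

context
  fixes xs ys assumes el: "set xs \<subseteq> elements \<J> S" "set ys \<subseteq> elements \<J> S"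
begin

lemma nrms_mult_ON: "nrms xs <#> nrms ys \<in> ON"
  using set_mult_ON[OF nrms_ON[OF el(1)] ON_normal[OF nrms_ON[OF el(2)]]] .

lemma rk_bound: "rk xs ys \<le> prod_list (map fst (map fst xs))"
proof -
  have "rk xs ys \<le> index G (nrms xs)"
    unfolding rk_def
    using index_mono[OF nrms_mult_ON nrms_ON[OF el(1)]]
      set_mult_normal(2)[OF ON_normal[OF nrms_ON[OF el(1)]] ON_normal[OF nrms_ON[OF el(2)]]] by blast
  then show ?thesis using nrms_index[OF el(1)] by linarith
qed

text \<open>One of the two products contains the other, so they coincide if the index does not grow.
  The conclusion is the hypothesis of \<open>amalgam_corresp\<close> for \<open>N0 = nrms ys\<close>
  and the parameters \<open>ys @ zs\<close>.\<close>

lemma rk_append_eq: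
  assumes zs: "set zs \<subseteq> elements \<J> S" and r: "rk xs (ys @ zs) \<le> rk xs ys"
  shows "nrms ys \<subseteq> nrms xs <#> nrms (ys @ zs)"
proof -
  have el': "set (ys @ zs) \<subseteq> elements \<J> S" using el zs by simp
  have N: "nrms xs <#> nrms (ys @ zs) \<in> ON"
    using set_mult_ON[OF nrms_ON[OF el(1)] ON_normal[OF nrms_ON[OF el']]] .
  have "nrms xs <#> nrms (ys @ zs) \<subseteq> nrms xs <#> nrms ys"
    by (rule mono_set_mult) (auto simp: nrms_append)
  then have "nrms xs <#> nrms ys = nrms xs <#> nrms (ys @ zs)"
    using index_eq_imp_eq[OF nrms_mult_ON N] r by (simp add: rk_def)
  then show ?thesis
    using set_mult_normal(3)[OF ON_normal[OF nrms_ON[OF el(1)]] ON_normal[OF nrms_ON[OF el(2)]]] by simp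
qed

end

end

context self_pair
begin

lemma matches_nrms:
  assumes "set xs \<subseteq> elements \<J> S" "set ys \<subseteq> elements \<J> S" "length ys = length xs"
    and "\<And>i. i < length xs \<Longrightarrow> matches R (cst (xs ! i)) (cst (ys ! i))"
  shows "matches R (nrms xs) (nrms ys)"
  using assms
proof (induction xs arbitrary: ys)
  case Nil
  then show ?case using matches_carrier[OF gour] by (simp add: nrms_def)
next
  case (Cons x xs)
  obtain y ys' where ys: "ys = y # ys'" "length ys' = length xs" using Cons.prems(3) by (cases ys) auto
  have "matches R (cst x) (cst y)" using Cons.prems(4)[of 0] ys by simp
  then have "matches R (nrm x) (nrm y)" using pair.matches_nrm Cons.prems(1,2) ys by simp
  moreover have "matches R (nrms xs) (nrms ys')"
  proof (rule Cons.IH)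
    show "matches R (cst (xs ! i)) (cst (ys' ! i))" if "i < length xs" for i
      using Cons.prems(4)[of "Suc i"] that ys by simp
  qed (use Cons.prems ys in auto)
  ultimately have "matches R (nrm x \<inter> nrms xs) (nrm y \<inter> nrms ys')" by (rule matches_Int)
  moreover have "nrms (x # xs) = nrm x \<inter> nrms xs" "nrms (y # ys') = nrm y \<inter> nrms ys'"
    by (auto simp: nrms_def)
  ultimately show ?case using ys by simp
qed

text \<open>The image of \<open>M <#> N\<close> is a normal subgroup of the same index that contains
  \<open>M'\<close> and \<open>N'\<close>, hence their product.\<close>

lemma index_mult_le:
  assumes "M \<in> ON" "M' \<in> ON" "N \<in> ON" "N' \<in> ON" "matches R M M'" "matches R N N'"
  shows "index G (M <#> N) \<le> index G (M' <#> N')"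
proof -
  note n = ON_normal[OF assms(1)] ON_normal[OF assms(2)] ON_normal[OF assms(3)] ON_normal[OF assms(4)]
  let ?P = "M <#> N"
  note s = set_mult_normal[OF n(1,3)]
  note i = image_normal[OF n(1,2) assms(5) s(2,1)]
  have "N' \<subseteq> R `` ?P"
    using matches_subset[OF gour assms(6) i(3) normal_subset[OF n(3)] normal_subset[OF n(4)]] s(3) by blast
  then have "M' <#> N' \<subseteq> R `` ?P" by (rule set_mult_least[OF i(1,2)])
  then have "index G (R `` ?P) \<le> index G (M' <#> N')"
    using index_mono[OF upper_ON[OF assms(2) i(2,1)] set_mult_ON[OF assms(2) n(4)]] by blast
  then show ?thesis using card_rcosets_eq[OF s(1) i(1,3)] by (simp add: index_def)
qed

end

context sep
begin

lemma rk_le_corresp: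
  assumes c: "corresp (xs @ ys) (xs' @ ys')" and len: "length xs' = length xs"
    and el: "set (xs @ ys) \<subseteq> elements \<J> S" "set (xs' @ ys') \<subseteq> elements \<J> S"
  shows "rk xs ys \<le> rk xs' ys'"
proof -
  have lens: "length ys' = length ys"
    using c len map_eq_imp_length_eq[of fst "xs @ ys" fst "xs' @ ys'"] by (simp add: corresp_def)
  obtain R where R: "goursat G G R"
    "\<forall>i < length (xs @ ys). matches R (cst ((xs @ ys) ! i)) (cst ((xs' @ ys') ! i))"
    using c by (auto simp: corresp_def)
  interpret self_pair \<J> Jsub G X F S h R by unfold_locales (fact R(1))
  have "matches R (cst (xs ! i)) (cst (xs' ! i))" if "i < length xs" for i
    using R(2)[rule_format, of i] that len by (simp add: nth_append)
  then have "matches R (nrms xs) (nrms xs')" using el len by (intro matches_nrms) auto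
  moreover have "matches R (cst (ys ! i)) (cst (ys' ! i))" if "i < length ys" for i
    using R(2)[rule_format, of "length xs + i"] that len by (simp add: nth_append)
  then have "matches R (nrms ys) (nrms ys')" using el lens by (intro matches_nrms) auto
  ultimately show ?thesis
    unfolding rk_def using el by (intro index_mult_le nrms_ON) auto
qed

text \<open>Equivalent tuples correspond and therefore have equal rank, so \<open>definable\<close>
  applies to the concatenated tuple, cut again at the length of \<open>\<sigma>\<close>.\<close>

lemma rank_formula:
  assumes "\<sigma> \<in> lists (sorts \<J>)" "\<tau> \<in> lists (sorts \<J>)"
  shows "\<exists>\<phi> \<in> pure_fms \<J> (\<sigma> @ \<tau>). \<forall>xs \<in> tup \<J> S \<sigma>. \<forall>ys \<in> tup \<J> S \<tau>. tsat S (xs @ ys) \<phi> \<longleftrightarrow> m \<le> rk xs ys"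
proof -
  let ?Q = "\<lambda>zs. m \<le> rk (take (length \<sigma>) zs) (drop (length \<sigma>) zs)"
  have "\<exists>\<phi> \<in> pure_fms \<J> (\<sigma> @ \<tau>). \<forall>zs \<in> tup \<J> S (\<sigma> @ \<tau>). tsat S zs \<phi> \<longleftrightarrow> ?Q zs"
  proof (rule definable)
    show "\<sigma> @ \<tau> \<in> lists (sorts \<J>)" using assms by simp
    fix zs ws assume zw: "zs \<in> tup \<J> S (\<sigma> @ \<tau>)" "ws \<in> tup \<J> S (\<sigma> @ \<tau>)" "tequiv \<J> S zs ws" "?Q zs"
    have el: "set zs \<subseteq> elements \<J> S" "set ws \<subseteq> elements \<J> S" using zw by (auto simp: tup_def)
    have len: "length zs = length \<sigma> + length \<tau>" "length ws = length \<sigma> + length \<tau>"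
      using zw by (auto simp: tup_def dest: map_eq_imp_length_eq arg_cong[of _ _ length])
    have "corresp zs ws" using tequiv_corresp[OF zw(3) el] .
    then have "rk (take (length \<sigma>) zs) (drop (length \<sigma>) zs) \<le> rk (take (length \<sigma>) ws) (drop (length \<sigma>) ws)"
      using el len by (intro rk_le_corresp) auto
    then show "?Q ws" using zw(4) by linarith
  qed
  then obtain \<phi> where \<phi>: "\<phi> \<in> pure_fms \<J> (\<sigma> @ \<tau>)" "\<forall>zs \<in> tup \<J> S (\<sigma> @ \<tau>). tsat S zs \<phi> \<longleftrightarrow> ?Q zs" by blast
  have "tsat S (xs @ ys) \<phi> \<longleftrightarrow> m \<le> rk xs ys" if xy: "xs \<in> tup \<J> S \<sigma>" "ys \<in> tup \<J> S \<tau>" for xs ys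
  proof -
    have "xs @ ys \<in> tup \<J> S (\<sigma> @ \<tau>)" "length xs = length \<sigma>" using xy by (auto simp: tup_def)
    then show ?thesis using \<phi>(2) by simp
  qed
  then show ?thesis using \<phi>(1) by blast
qed

text \<open>Once \<open>rk x y\<close> is as large as it can be, the type of \<open>x\<close> over all parameters is determined
  by its correspondence class relative to the cosets of \<open>nrms y\<close>, for which there are finitely
  many possibilities.\<close>

lemma rank_pigeonhole:
  "\<exists>B::nat. \<forall>ys \<in> tup \<J> S \<tau>. \<forall>x. (\<forall>c \<le> B. x c \<in> tup \<J> S \<sigma>) \<longrightarrow>
    (\<exists>c d. c < d \<and> d \<le> B \<and> (\<forall>zs. set zs \<subseteq> elements \<J> S \<and> rk (x c) (ys @ zs) \<le> rk (x c) ys \<and>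
       rk (x d) (ys @ zs) \<le> rk (x d) ys \<longrightarrow> corresp (x c @ ys @ zs) (x d @ ys @ zs)))"
proof -
  define n where "n = length \<sigma>"
  define m' where "m' = prod_list (map fst \<tau>)"
  \<comment> \<open>A bound for the index of the intersection of the subgroups of the two tuples, as
    the product of their separate bounds.\<close>
  define m where "m = prod_list (map fst \<sigma>) * m'"
  let ?K = "{..<n + m'}"
  obtain code :: "(nat \<Rightarrow> ('a srt \<times> 'b) set set) \<Rightarrow> (nat \<times> nat \<times> nat) set \<times> (nat \<times> nat) set"
    where code: "finite (range code)"
    and match: "\<forall>c c'. bounded_family m ?K c \<and> bounded_family m ?K c' \<and>
       code c = code c' \<longrightarrow> (\<exists>R. goursat G G R \<and> (\<forall>k \<in> ?K. matches R (c k) (c' k)))"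
    using finite_families[OF finite_lessThan, of m] by blast
  have "\<exists>c d. c < d \<and> d \<le> card (range code) \<and> (\<forall>zs. set zs \<subseteq> elements \<J> S \<and>
      rk (x c) (ys @ zs) \<le> rk (x c) ys \<and> rk (x d) (ys @ zs) \<le> rk (x d) ys \<longrightarrow>
      corresp (x c @ ys @ zs) (x d @ ys @ zs))"
    if ys: "ys \<in> tup \<J> S \<tau>" and x: "\<forall>c \<le> card (range code). x c \<in> tup \<J> S \<sigma>" for ys x
  proof -
    define N0 where "N0 = nrms ys"
    have yel: "set ys \<subseteq> elements \<J> S" using ys by (simp add: tup_def)
    have my: "map fst ys = \<tau>" using ys by (simp add: tup_def)
    have N0: "N0 \<in> ON" "index G N0 \<le> m'"
      using nrms_ON[OF yel] nrms_index[OF yel] unfolding my N0_def m'_def by blast+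
    note n0 = ON_normal[OF N0(1)]
    have "\<exists>t. frame m' N0 t ({} :: nat set) (\<lambda>_. {})" by (rule frame_exists[OF N0]) simp
    then obtain t where t: "\<forall>i < m'. t i \<in> carrier G" "\<forall>g \<in> carrier G. \<exists>i < m'. g \<in> N0 #> t i"
      by (auto simp: frame_def)
    \<comment> \<open>The first \<open>n\<close> members are the entries of \<open>u\<close>; the
      remaining \<open>m'\<close> enumerate the cosets of \<open>N0\<close> and do not depend on
      \<open>u\<close>. Equal codes thus give a correspondence that also fixes every coset of
      \<open>N0\<close>.\<close>
    define fam where "fam u k = (if k < n then cst (u ! k) else N0 #> t (k - n))" for u k
    have xel: "set (x c) \<subseteq> elements \<J> S" "map fst (x c) = \<sigma>" "length (x c) = n" if "c \<le> card (range code)" for c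
      using x that by (auto simp: tup_def n_def)
    have fam: "bounded_family m ?K (fam (x c))" if c: "c \<le> card (range code)" for c
    proof -
      have ON: "nrms (x c) \<inter> N0 \<in> ON" using Int_ON nrms_ON[OF xel(1)[OF c]] N0(1) by blast
      have "index G (nrms (x c) \<inter> N0) \<le> index G (nrms (x c)) * index G N0"
        using index_Int nrms_ON[OF xel(1)[OF c]] N0(1) by blast
      also have "\<dots> \<le> m" unfolding m_def
        by (rule mult_le_mono[OF nrms_index[OF xel(1)[OF c], unfolded xel(2)[OF c]] N0(2)])
      finally have idx: "index G (nrms (x c) \<inter> N0) \<le> m" .
      have "\<exists>M. M \<lhd> G \<and> nrms (x c) \<inter> N0 \<subseteq> M \<and> fam (x c) k \<in> rcosets M" if k: "k \<in> ?K" for k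
      proof (cases "k < n")
        case True
        then have "x c ! k \<in> set (x c)" using xel(3)[OF c] by simp
        then show ?thesis using nrms_coset[OF xel(1)[OF c]] True by (fastforce simp: fam_def)
      next
        case False
        then have "k - n < m'" using k by auto
        then show ?thesis using False n0 rcos_in_rcosets[OF n0] t(1) by (auto simp: fam_def intro!: exI[of _ N0])
      qed
      then show ?thesis using ON idx unfolding bounded_family_def by blast
    qed
    have "\<not> inj_on (\<lambda>c. code (fam (x c))) {..card (range code)}"
    proof
      assume "inj_on (\<lambda>c. code (fam (x c))) {..card (range code)}"
      then have "card {..card (range code)} \<le> card (range code)"
        by (rule card_inj_on_le) (use code in auto)
      then show False by simp
    qed
    then obtain c d where cd0: "c \<le> card (range code)" "d \<le> card (range code)" "c \<noteq> d" "code (fam (x c)) = code (fam (x d))"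
      by (auto simp: inj_on_def)
    obtain c d where cd: "c < d" "d \<le> card (range code)" "code (fam (x c)) = code (fam (x d))"
      using cd0 by (metis linorder_neqE_nat)
    have cB: "c \<le> card (range code)" using cd by simp
    obtain R where R: "goursat G G R" "\<forall>k \<in> ?K. matches R (fam (x c) k) (fam (x d) k)"
      using match fam[OF cB] fam[OF cd(2)] cd(3) by blast
    have Rx: "matches R (cst (x c ! i)) (cst (x d ! i))" if "i < length (x c)" for i
    proof -
      have i: "i < n" using that xel(3)[OF cB] by simp
      then have "i \<in> ?K" by simp
      then have "matches R (fam (x c) i) (fam (x d) i)" using R(2) by blast
      then show ?thesis using i by (simp add: fam_def)
    qed
    have fix0: "matches R C C" if C: "C \<in> rcosets N0" for C
    proof -
      obtain g where g: "g \<in> C" using rcosets_nonempty[OF n0 C] by blast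
      then have gc: "g \<in> carrier G" using rcosets_eq_rcos(2)[OF n0 C] by blast
      obtain i where i: "i < m'" "g \<in> N0 #> t i" using t(2) gc by blast
      have eq: "C = N0 #> t i"
        using rcosets_eqI[OF n0 C _ g i(2)] rcos_in_rcosets[OF n0] t(1) i(1) by blast
      have "n + i \<in> ?K" using i by simp
      then have "matches R (fam (x c) (n + i)) (fam (x d) (n + i))" using R(2) by blast
      then show ?thesis using eq by (simp add: fam_def)
    qed
    have "corresp (x c @ ys @ zs) (x d @ ys @ zs)"
      if z: "set zs \<subseteq> elements \<J> S" "rk (x c) (ys @ zs) \<le> rk (x c) ys" "rk (x d) (ys @ zs) \<le> rk (x d) ys" for zs
    proof (rule amalgam_corresp[OF R(1) n0 fix0 xel(1)[OF cB] xel(1)[OF cd(2)] _ _ Rx])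
      show "set (ys @ zs) \<subseteq> elements \<J> S" using z(1) yel by simp
      show "map fst (x c) = map fst (x d)" using xel(2) cB cd(2) by simp
      show "N0 \<subseteq> nrms (x c) <#> nrms (ys @ zs)" "N0 \<subseteq> nrms (x d) <#> nrms (ys @ zs)"
        unfolding N0_def
        using rk_append_eq[OF xel(1)[OF cB] yel z(1,2)] rk_append_eq[OF xel(1)[OF cd(2)] yel z(1,3)] by blast+
    qed
    then show ?thesis using cd by blast
  qed
  then show ?thesis by (intro exI[of _ "card (range code)"]) blast
qed

end

section \<open>Transfer to other models\<close>

lemma tup_snoc:
  "s \<in> sorts \<J> \<Longrightarrow> tup \<J> M (\<sigma> @ [s]) = {xs @ [(s, x)] | xs x. xs \<in> tup \<J> M \<sigma> \<and> x \<in> univ M s}"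
proof (intro equalityI subsetI)
  fix zs assume zs: "zs \<in> tup \<J> M (\<sigma> @ [s])"
  then obtain xs z where "zs = xs @ [z]" "map fst xs = \<sigma>" "fst z = s"
    by (auto simp: tup_def map_eq_append_conv)
  then show "zs \<in> {xs @ [(s, x)] | xs x. xs \<in> tup \<J> M \<sigma> \<and> x \<in> univ M s}"
    using zs by (cases z) (auto simp: tup_def elements_def)
qed (auto simp: tup_def elements_def)

lemma tup_all_snoc:
  assumes "\<phi> \<in> pure_fms \<J> (\<sigma> @ [s])" "s \<in> sorts \<J>"
  shows "(\<forall>xs \<in> tup \<J> M \<sigma>. tsat M xs (Neg (Ex s (length \<sigma>) (Neg \<phi>)))) \<longleftrightarrow>
    (\<forall>xs \<in> tup \<J> M (\<sigma> @ [s]). tsat M xs \<phi>)"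
proof -
  have "tsat M xs (Neg (Ex s (length \<sigma>) (Neg \<phi>))) \<longleftrightarrow> (\<forall>x \<in> univ M s. tsat M (xs @ [(s, x)]) \<phi>)"
    if "xs \<in> tup \<J> M \<sigma>" for xs
  proof -
    have m: "map fst xs = \<sigma>" "length xs = length \<sigma>" using that by (auto simp: tup_def)
    have "Neg \<phi> \<in> pure_fms \<J> (map fst xs @ [s])" using assms(1) m formulas_Neg by simp
    from tsat_Ex[OF this, of M] show ?thesis using m by simp
  qed
  then show ?thesis unfolding tup_snoc[OF assms(2)] by blast
qed

text \<open>\<open>Th\<close> contains sentences only, so the variables of the tuple are quantified
  universally one by one, starting with the last.\<close>

lemma transfer:
  fixes S :: "('j, 'a) lstruct" and M :: "('j, 'b) lstruct"
  assumes "\<forall>\<phi> \<in> Th \<J> S. holds M \<phi>"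
  shows "\<phi> \<in> pure_fms \<J> \<sigma> \<Longrightarrow> \<sigma> \<in> lists (sorts \<J>) \<Longrightarrow> \<forall>xs \<in> tup \<J> S \<sigma>. tsat S xs \<phi> \<Longrightarrow>
    \<forall>xs \<in> tup \<J> M \<sigma>. tsat M xs \<phi>"
proof (induction \<sigma> arbitrary: \<phi> rule: rev_induct)
  case Nil
  have "tsat S [] \<phi>" using Nil.prems(3) by (simp add: tup_def)
  then have "sat S I e \<phi>" for I e
    using sat_tsat[of \<phi> \<J> "[] :: ('j srt \<times> 'a) list" e S I] Nil.prems(1) by simp
  then have "holds S \<phi>" by (simp add: holds_def)
  then have "holds M \<phi>" using assms Nil.prems(1) by (simp add: Th_def)
  then show ?case by (simp add: tup_def holds_def tsat_def)
next
  case (snoc s \<sigma>)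
  have s: "s \<in> sorts \<J>" "\<sigma> \<in> lists (sorts \<J>)" using snoc.prems by simp_all
  have "Neg (Ex s (length \<sigma>) (Neg \<phi>)) \<in> pure_fms \<J> \<sigma>"
    using snoc.prems(1) s by (intro formulas_Neg Ex_formula)
  from snoc.IH[OF this s(2)] show ?case
    using snoc.prems(3) tup_all_snoc[OF snoc.prems(1) s(1), of S] tup_all_snoc[OF snoc.prems(1) s(1), of M]
    by blast
qed

text \<open>Allows conditions on several overlapping subtuples to be stated in one formula about a
  long tuple.\<close>

definition reindex :: "nat list \<Rightarrow> ('j, unit) fm \<Rightarrow> ('j, unit) fm" where
  "reindex is = fsub (\<lambda>s i. Var (is ! i)) (\<lambda>s c. Const c)"

lemma reindex_formula:
  assumes "\<phi> \<in> pure_fms \<J> (map ((!) \<sigma>) is)" "set is \<subseteq> {..<length \<sigma>}"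
  shows "reindex is \<phi> \<in> pure_fms \<J> \<sigma>"
proof -
  have fv: "i < length is \<and> s = \<sigma> ! (is ! i)" if "(s, i) \<in> free_vars \<phi>" for s i
    using assms(1) that by (force simp: formulas_def)
  have c: "fm_consts \<phi> = {}" using assms(1) by (simp add: formulas_def)
  have "fm_consts (reindex is \<phi>) = {}"
    using fm_consts_fsub[of "\<lambda>s i. Var (is ! i)" "\<lambda>s c. Const c" \<phi>] c by (auto simp: reindex_def)
  moreover have "tm_vars s (Var (is ! i)) \<subseteq> {(\<sigma> ! i, i) | i. i < length \<sigma>}" if "(s, i) \<in> free_vars \<phi>" for s i
  proof -
    have "is ! i \<in> set is" using fv[OF that] by simp
    then have "is ! i < length \<sigma>" using assms(2) by auto
    then show ?thesis using fv[OF that] by simp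
  qed
  then have "free_vars (reindex is \<phi>) \<subseteq> {(\<sigma> ! i, i) | i. i < length \<sigma>}"
    using free_vars_fsub[of "\<lambda>s i. Var (is ! i)" "\<lambda>s c. Const c" \<phi>] c unfolding reindex_def by blast
  ultimately show ?thesis using assms(1) by (simp add: formulas_def reindex_def)
qed

lemma tsat_reindex:
  assumes "\<phi> \<in> pure_fms \<J> (map fst (map ((!) zs) is))"
  shows "tsat M zs (reindex is \<phi>) \<longleftrightarrow> tsat M (map ((!) zs) is) \<phi>"
  unfolding tsat_def reindex_def
proof (rule sat_fsub)
  fix s i assume "(s, i) \<in> free_vars \<phi>"
  then have "i < length is" using assms by (force simp: formulas_def)
  then show "val (\<lambda>_. undefined) (env zs s) (Var (is ! i)) = env (map ((!) zs) is) s i"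
    by (simp add: env_def)
qed (use assms in \<open>simp add: formulas_def\<close>)

text \<open>A tuple that consists of \<open>D div n\<close> blocks \<open>x 0, x 1, \<dots>\<close> of length \<open>n\<close>, followed by \<open>y\<close>.\<close>

definition blocks :: "nat \<Rightarrow> nat \<Rightarrow> (nat \<Rightarrow> 'x list) \<Rightarrow> 'x list \<Rightarrow> 'x list" where
  "blocks n D x y = map (\<lambda>p. if p < D then x (p div n) ! (p mod n) else y ! (p - D)) [0..<D + length y]"

lemma blocks_length [simp]: "length (blocks n D x y) = D + length y"
  by (simp add: blocks_def)

lemma block_index:
  assumes "c \<le> B" "i < (n::nat)" shows "c * n + i < Suc B * n"
proof -
  have "c * n + i < Suc c * n" using assms(2) by simp
  also have "\<dots> \<le> Suc B * n" using assms(1) by (intro mult_le_mono1) simp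
  finally show ?thesis .
qed

lemma blocks_select:
  assumes "c \<le> B" "length (x c) = n"
  shows "map ((!) (blocks n (Suc B * n) x y)) [c * n..<c * n + n] = x c"
proof (rule nth_equalityI)
  fix i assume "i < length (map ((!) (blocks n (Suc B * n) x y)) [c * n..<c * n + n])"
  then have i: "i < n" by simp
  then show "map ((!) (blocks n (Suc B * n) x y)) [c * n..<c * n + n] ! i = x c ! i"
    using block_index[OF assms(1) i] by (simp add: blocks_def)
qed (simp add: assms(2))

lemma blocks_select_tail:
  assumes "k \<le> length y"
  shows "map ((!) (blocks n D x y)) [D..<D + k] = take k y"
  by (rule nth_equalityI) (use assms in \<open>auto simp: blocks_def\<close>)

lemma select_tup:
  assumes "zs \<in> tup \<J> M \<sigma>" "set is \<subseteq> {..<length \<sigma>}"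
  shows "map ((!) zs) is \<in> tup \<J> M (map ((!) \<sigma>) is)"
proof -
  have len: "length zs = length \<sigma>" using assms(1) by (auto simp: tup_def)
  have idx: "i < length zs" if "i \<in> set is" for i using assms(2) that len by auto
  have "map fst (map ((!) zs) is) = map ((!) \<sigma>) is"
    using assms(1) idx by (auto simp: tup_def)
  moreover have "set (map ((!) zs) is) \<subseteq> set zs" using idx by auto
  ultimately show ?thesis using assms(1) by (auto simp: tup_def)
qed

lemma tup_append: "xs \<in> tup \<J> M \<sigma> \<Longrightarrow> ys \<in> tup \<J> M \<tau> \<Longrightarrow> xs @ ys \<in> tup \<J> M (\<sigma> @ \<tau>)"
  by (simp add: tup_def)

lemma tup_split:
  assumes "zs \<in> tup \<J> M (\<sigma> @ \<tau>)"
  obtains xs ys where "zs = xs @ ys" "xs \<in> tup \<J> M \<sigma>" "ys \<in> tup \<J> M \<tau>"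
  using assms by (auto simp: tup_def map_eq_append_conv)

lemma tup_self: "set xs \<subseteq> elements \<J> M \<Longrightarrow> xs \<in> tup \<J> M (map fst xs)"
  by (simp add: tup_def)

lemma blocks_tup:
  assumes x: "\<And>c. c \<le> B \<Longrightarrow> x c \<in> tup \<J> M \<sigma>" and y: "y \<in> tup \<J> M \<tau>"
  shows "blocks (length \<sigma>) (Suc B * length \<sigma>) x y \<in> tup \<J> M (blocks (length \<sigma>) (Suc B * length \<sigma>) (\<lambda>_. \<sigma>) \<tau>)"
proof -
  let ?n = "length \<sigma>" and ?D = "Suc B * length \<sigma>"
  have ly: "length y = length \<tau>" using y by (auto simp: tup_def)
  have el: "blocks ?n ?D x y ! p \<in> elements \<J> M \<and>
      fst (blocks ?n ?D x y ! p) = blocks ?n ?D (\<lambda>_. \<sigma>) \<tau> ! p" if p: "p < ?D + length \<tau>" for p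
  proof (cases "p < ?D")
    case True
    then have n: "0 < ?n" by (cases "?n = 0") auto
    have "p div ?n \<le> B" using True n by (simp add: less_mult_imp_div_less less_Suc_eq_le[symmetric])
    note xc = x[OF this]
    have "length (map fst (x (p div ?n))) = ?n" using xc unfolding tup_def by simp
    then have m: "p mod ?n < length (x (p div ?n))" using n by simp
    then have "x (p div ?n) ! (p mod ?n) \<in> elements \<J> M" using xc by (auto simp: tup_def)
    moreover have "map fst (x (p div ?n)) ! (p mod ?n) = \<sigma> ! (p mod ?n)" using xc by (simp add: tup_def)
    then have "fst (x (p div ?n) ! (p mod ?n)) = \<sigma> ! (p mod ?n)" using m by simp
    ultimately show ?thesis using True p ly by (simp add: blocks_def)
  next
    case False
    then have m: "p - ?D < length y" using p ly by simp
    then have "y ! (p - ?D) \<in> elements \<J> M" "fst (y ! (p - ?D)) = \<tau> ! (p - ?D)"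
      using y by (auto simp: tup_def)
    then show ?thesis using False p ly by (simp add: blocks_def)
  qed
  have "map fst (blocks ?n ?D x y) = blocks ?n ?D (\<lambda>_. \<sigma>) \<tau>"
    by (rule nth_equalityI) (use el ly in auto)
  moreover have "set (blocks ?n ?D x y) \<subseteq> elements \<J> M"
  proof
    fix z assume "z \<in> set (blocks ?n ?D x y)"
    then obtain p where "p < ?D + length \<tau>" "z = blocks ?n ?D x y ! p"
      unfolding in_set_conv_nth blocks_length ly by blast
    then show "z \<in> elements \<J> M" using el by blast
  qed
  ultimately show ?thesis by (simp add: tup_def)
qed

lemma blocks_sorts:
  assumes "\<sigma> \<in> lists A" "\<tau> \<in> lists A"
  shows "blocks (length \<sigma>) (Suc B * length \<sigma>) (\<lambda>_. \<sigma>) \<tau> \<in> lists A"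
proof -
  let ?n = "length \<sigma>" and ?D = "Suc B * length \<sigma>"
  have "blocks ?n ?D (\<lambda>_. \<sigma>) \<tau> ! p \<in> A" if p: "p < ?D + length \<tau>" for p
  proof (cases "p < ?D")
    case True
    then have n: "0 < ?n" by (cases "?n = 0") auto
    then have "\<sigma> ! (p mod ?n) \<in> A" using assms(1) by (auto simp: in_lists_conv_set)
    then show ?thesis using True p by (simp add: blocks_def)
  next
    case False
    then have "\<tau> ! (p - ?D) \<in> A" using assms(2) p by (auto simp: in_lists_conv_set)
    then show ?thesis using False p by (simp add: blocks_def)
  qed
  then show ?thesis by (auto simp: in_lists_conv_set in_set_conv_nth)
qed

lemma tsat_reindex_tup:
  assumes "zs \<in> tup \<J> M \<sigma>" "set is \<subseteq> {..<length \<sigma>}" "\<phi> \<in> pure_fms \<J> (map ((!) \<sigma>) is)"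
  shows "tsat M zs (reindex is \<phi>) \<longleftrightarrow> tsat M (map ((!) zs) is) \<phi>"
proof (rule tsat_reindex)
  have "map fst (map ((!) zs) is) = map ((!) \<sigma>) is"
    using select_tup[OF assms(1,2)] unfolding tup_def by blast
  then show "\<phi> \<in> pure_fms \<J> (map fst (map ((!) zs) is))" using assms(3) by (simp only:)
qed

lemma complete_type_realize:
  assumes "p \<in> complete_types \<J> M A \<sigma>" "finite q" "q \<subseteq> p" "\<sigma> \<in> lists (sorts \<J>)"
  shows "\<exists>x \<in> tup \<J> M \<sigma>. \<forall>\<phi> \<in> q. sat_tuple M (map snd x) \<phi>"
proof -
  obtain as where as: "list_all2 (\<lambda>a s. a \<in> univ M s) as \<sigma>" "\<forall>\<phi> \<in> q. sat_tuple M as \<phi>"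
    using assms(1-3) by (auto simp: complete_types_def)
  have len: "length as = length \<sigma>" using as(1) by (rule list_all2_lengthD)
  have "set (zip \<sigma> as) \<subseteq> elements \<J> M"
  proof
    fix z assume "z \<in> set (zip \<sigma> as)"
    then obtain i where i: "i < length \<sigma>" "z = (\<sigma> ! i, as ! i)" by (auto simp: set_zip)
    then have "as ! i \<in> univ M (\<sigma> ! i)" using list_all2_nthD2[OF as(1)] by simp
    moreover have "\<sigma> ! i \<in> sorts \<J>" using assms(4) i(1) by (auto simp: in_lists_conv_set)
    ultimately show "z \<in> elements \<J> M" using i(2) by (simp add: elements_def)
  qed
  then have "zip \<sigma> as \<in> tup \<J> M \<sigma>" using len by (simp add: tup_def)
  moreover have "map snd (zip \<sigma> as) = as" using len by simp
  ultimately show ?thesis using as(2) by metis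
qed

text \<open>If the distinguishing formula lies in \<open>q\<close>, its negation is taken. Then
  \<open>q\<close> has to contain the double negation, a different formula; this follows from
  completeness, as \<open>q\<close> cannot contain a formula and its negation.\<close>

lemma complete_types_separated:
  assumes p: "p \<in> complete_types \<J> M A \<sigma>" and q: "q \<in> complete_types \<J> M A \<sigma>" and "p \<noteq> q"
    and \<sigma>: "\<sigma> \<in> lists (sorts \<J>)"
  shows "\<exists>\<phi> \<in> formulas \<J> A \<sigma>. \<phi> \<in> p \<and> Neg \<phi> \<in> q"
proof -
  have D: "r \<subseteq> formulas \<J> A \<sigma> \<and> (\<forall>\<phi> \<in> formulas \<J> A \<sigma>. \<phi> \<in> r \<or> Neg \<phi> \<in> r)"
    if "r \<in> complete_types \<J> M A \<sigma>" for r
    using that by (simp add: complete_types_def)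
  consider \<phi> where "\<phi> \<in> p" "\<phi> \<notin> q" | \<phi> where "\<phi> \<in> q" "\<phi> \<notin> p" using \<open>p \<noteq> q\<close> by blast
  then show ?thesis
  proof cases
    case 1
    then show ?thesis using D[OF p] D[OF q] by blast
  next
    case 2
    then have f: "\<phi> \<in> formulas \<J> A \<sigma>" "Neg \<phi> \<in> p" using D[OF p] D[OF q] by blast+
    have "Neg \<phi> \<notin> q"
    proof
      assume "Neg \<phi> \<in> q"
      then show False using complete_type_realize[OF q, of "{\<phi>, Neg \<phi>}"] 2 \<sigma> by (auto simp: sat_tuple_def)
    qed
    then have "Neg (Neg \<phi>) \<in> q" using D[OF q] formulas_Neg[OF f(1)] by blast
    then show ?thesis using f formulas_Neg by blast
  qed
qed

context sep
begin

section \<open>Types in an arbitrary model of the theory\<close>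

context
  fixes M :: "('a, 'm) lstruct" and A \<sigma>
  assumes T: "\<forall>\<phi> \<in> Th \<J> S. holds M \<phi>" and A: "A \<subseteq> elements \<J> M" and \<sigma>: "\<sigma> \<in> lists (sorts \<J>)"
begin

text \<open>Chosen in \<open>S\<close>, where it defines rank at least \<open>m\<close>. In
  \<open>M\<close>, where no coordinates are given, the formula itself takes the place of the
  rank.\<close>

definition chi :: "'a srt list \<Rightarrow> nat \<Rightarrow> ('a, unit) fm" where
  "chi \<tau> m = (SOME \<phi>. \<phi> \<in> pure_fms \<J> (\<sigma> @ \<tau>) \<and>
     (\<forall>xs \<in> tup \<J> S \<sigma>. \<forall>ys \<in> tup \<J> S \<tau>. tsat S (xs @ ys) \<phi> \<longleftrightarrow> m \<le> rk xs ys))"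

lemma chi:
  assumes "\<tau> \<in> lists (sorts \<J>)"
  shows "chi \<tau> m \<in> pure_fms \<J> (\<sigma> @ \<tau>)"
    "xs \<in> tup \<J> S \<sigma> \<Longrightarrow> ys \<in> tup \<J> S \<tau> \<Longrightarrow> tsat S (xs @ ys) (chi \<tau> m) \<longleftrightarrow> m \<le> rk xs ys"
proof -
  have "\<exists>\<phi>. \<phi> \<in> pure_fms \<J> (\<sigma> @ \<tau>) \<and>
     (\<forall>xs \<in> tup \<J> S \<sigma>. \<forall>ys \<in> tup \<J> S \<tau>. tsat S (xs @ ys) \<phi> \<longleftrightarrow> m \<le> rk xs ys)"
    using rank_formula[OF \<sigma> assms] by blast
  from someI_ex[OF this] show "chi \<tau> m \<in> pure_fms \<J> (\<sigma> @ \<tau>)"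
    "xs \<in> tup \<J> S \<sigma> \<Longrightarrow> ys \<in> tup \<J> S \<tau> \<Longrightarrow> tsat S (xs @ ys) (chi \<tau> m) \<longleftrightarrow> m \<le> rk xs ys"
    unfolding chi_def by blast+
qed

definition chi_inst :: "('a srt \<times> 'm) list \<Rightarrow> nat \<Rightarrow> ('a, 'm) fm" where
  "chi_inst ys m = inst_consts (length \<sigma>) ys (chi (map fst ys) m)"

lemma param_sorts: "set ys \<subseteq> A \<Longrightarrow> map fst ys \<in> lists (sorts \<J>)"
  using A elements_sorts[of ys] by blast

lemma chi_inst_formula: "set ys \<subseteq> A \<Longrightarrow> chi_inst ys m \<in> formulas \<J> A \<sigma>"
  unfolding chi_inst_def by (rule inst_consts_formula[OF chi(1)[OF param_sorts]])

lemma sat_chi_inst: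
  assumes "set ys \<subseteq> A" "x \<in> tup \<J> M \<sigma>"
  shows "sat_tuple M (map snd x) (chi_inst ys m) \<longleftrightarrow> tsat M (x @ ys) (chi (map fst ys) m)"
proof -
  have x: "map fst x = \<sigma>" "length x = length \<sigma>" using assms(2) by (auto simp: tup_def)
  have "chi (map fst ys) m \<in> pure_fms \<J> (map fst x @ map fst ys)"
    using chi(1)[OF param_sorts[OF assms(1)]] x(1) by simp
  from sat_inst_consts[OF this, of M] show ?thesis unfolding chi_inst_def x(2) .
qed

lemma chi_zero:
  assumes "x \<in> tup \<J> M \<sigma>" shows "tsat M x (chi [] 0)"
proof -
  have "chi [] 0 \<in> pure_fms \<J> \<sigma>" using chi(1)[of "[]"] by simp
  moreover have "\<forall>xs \<in> tup \<J> S \<sigma>. tsat S xs (chi [] 0)"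
    using chi(2)[of "[]" _ "[]"] by (auto simp: tup_def)
  ultimately show ?thesis using transfer[OF T _ \<sigma>] assms by blast
qed

text \<open>In \<open>S\<close> the rank is bounded by the sorts of the first tuple, whatever the
  parameters are; this is a universal statement and transfers.\<close>

lemma chi_bound:
  assumes "\<tau> \<in> lists (sorts \<J>)" "prod_list (map fst \<sigma>) < m" "z \<in> tup \<J> M (\<sigma> @ \<tau>)"
  shows "\<not> tsat M z (chi \<tau> m)"
proof -
  have "tsat S w (Neg (chi \<tau> m))" if w: "w \<in> tup \<J> S (\<sigma> @ \<tau>)" for w
  proof -
    obtain xs ys where xy: "w = xs @ ys" "xs \<in> tup \<J> S \<sigma>" "ys \<in> tup \<J> S \<tau>" using tup_split[OF w] .
    then have "set xs \<subseteq> elements \<J> S" "set ys \<subseteq> elements \<J> S" "map fst xs = \<sigma>" by (auto simp: tup_def)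
    then have "rk xs ys \<le> prod_list (map fst \<sigma>)" using rk_bound by blast
    then show ?thesis using chi(2)[OF assms(1) xy(2,3)] xy(1) assms(2) by simp
  qed
  moreover have "Neg (chi \<tau> m) \<in> pure_fms \<J> (\<sigma> @ \<tau>)" by (rule formulas_Neg[OF chi(1)[OF assms(1)]])
  moreover have "\<sigma> @ \<tau> \<in> lists (sorts \<J>)" using \<sigma> assms(1) by simp
  ultimately have "\<forall>z \<in> tup \<J> M (\<sigma> @ \<tau>). tsat M z (Neg (chi \<tau> m))" using transfer[OF T] by blast
  then show ?thesis using assms(3) by simp
qed

text \<open>According to \<open>p\<close>, a realization has rank at least \<open>m\<close> over
  \<open>ys\<close>, and no further parameters from \<open>A\<close> raise it above
  \<open>m\<close>.\<close>

definition maximal_at :: "('a, 'm) fm set \<Rightarrow> ('a srt \<times> 'm) list \<Rightarrow> nat \<Rightarrow> bool" where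
  "maximal_at p ys m \<longleftrightarrow> set ys \<subseteq> A \<and> chi_inst ys m \<in> p \<and>
     (\<forall>zs. set zs \<subseteq> A \<longrightarrow> chi_inst (ys @ zs) (Suc m) \<notin> p)"

text \<open>The ranks asserted by \<open>p\<close> include \<open>0\<close> and are bounded, because
  each formula of \<open>p\<close> is realized in \<open>M\<close>. A tuple for the greatest of them
  is maximal.\<close>

lemma maximal_exists:
  assumes p: "p \<in> complete_types \<J> M A \<sigma>"
  shows "\<exists>ys m. maximal_at p ys m"
proof -
  define P where "P = {m. \<exists>ys. set ys \<subseteq> A \<and> chi_inst ys m \<in> p}"
  have "chi_inst [] 0 \<in> p"
  proof (rule ccontr)
    assume "chi_inst [] 0 \<notin> p"
    then have "Neg (chi_inst [] 0) \<in> p"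
      using p chi_inst_formula[of "[]" 0] by (auto simp: complete_types_def)
    then obtain x where x: "x \<in> tup \<J> M \<sigma>" "\<not> sat_tuple M (map snd x) (chi_inst [] 0)"
      using complete_type_realize[OF p, of "{Neg (chi_inst [] 0)}"] \<sigma> by (auto simp: sat_tuple_def)
    then show False using sat_chi_inst[of "[]" x 0] chi_zero[OF x(1)] by simp
  qed
  then have "0 \<in> P" by (force simp: P_def)
  have "m \<le> prod_list (map fst \<sigma>)" if m: "m \<in> P" for m
  proof (rule ccontr)
    assume big: "\<not> m \<le> prod_list (map fst \<sigma>)"
    obtain ys where ys: "set ys \<subseteq> A" "chi_inst ys m \<in> p" using m by (auto simp: P_def)
    obtain x where x: "x \<in> tup \<J> M \<sigma>" "sat_tuple M (map snd x) (chi_inst ys m)"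
      using complete_type_realize[OF p, of "{chi_inst ys m}"] ys(2) \<sigma> by auto
    have "x @ ys \<in> tup \<J> M (\<sigma> @ map fst ys)" using x(1) ys(1) A by (intro tup_append tup_self) auto
    then show False
      using chi_bound[OF param_sorts[OF ys(1)]] big sat_chi_inst[OF ys(1) x(1)] x(2) by simp
  qed
  then have fin: "finite P" using finite_nat_set_iff_bounded_le by blast
  then have "Max P \<in> P" using \<open>0 \<in> P\<close> Max_in by blast
  then obtain ys where ys: "set ys \<subseteq> A" "chi_inst ys (Max P) \<in> p" by (auto simp: P_def)
  have "chi_inst (ys @ zs) (Suc (Max P)) \<notin> p" if "set zs \<subseteq> A" for zs
  proof
    assume "chi_inst (ys @ zs) (Suc (Max P)) \<in> p"
    then have "Suc (Max P) \<in> P" using ys(1) that by (auto simp: P_def intro!: exI[of _ "ys @ zs"])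
    then show False using Max_ge[OF fin] by fastforce
  qed
  then show ?thesis using ys by (auto simp: maximal_at_def)
qed

text \<open>Otherwise \<open>B + 1\<close> such types, with \<open>B\<close> from the pigeonhole lemma, are pairwise separated by
  formulas over finitely many parameters \<open>ys @ ds\<close>. That these formulas cannot be realized
  together with the rank conditions is a sentence which is true in \<open>S\<close>, hence in \<open>M\<close>.\<close>

lemma finite_maximal:
  assumes ys: "set ys \<subseteq> A"
  shows "finite {p \<in> complete_types \<J> M A \<sigma>. maximal_at p ys m}" (is "finite ?F")
proof (rule ccontr)
  assume inf: "infinite ?F"
  let ?n = "length \<sigma>"
  define \<tau>0 where "\<tau>0 = map fst ys"
  obtain B :: nat where B: "\<forall>Y \<in> tup \<J> S \<tau>0. \<forall>x. (\<forall>c \<le> B. x c \<in> tup \<J> S \<sigma>) \<longrightarrow>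
    (\<exists>c d. c < d \<and> d \<le> B \<and> (\<forall>zs. set zs \<subseteq> elements \<J> S \<and> rk (x c) (Y @ zs) \<le> rk (x c) Y \<and>
       rk (x d) (Y @ zs) \<le> rk (x d) Y \<longrightarrow> corresp (x c @ Y @ zs) (x d @ Y @ zs)))"
    using rank_pigeonhole[of \<tau>0 \<sigma>] by (rule exE)
  obtain X where X: "X \<subseteq> ?F" "finite X" "card X = Suc B"
    using infinite_arbitrarily_large[OF inf] by blast
  obtain q where q: "bij_betw q {0..<Suc B} X" using ex_bij_betw_nat_finite[OF X(2)] X(3) by auto
  have qF: "q c \<in> complete_types \<J> M A \<sigma>" "maximal_at (q c) ys m" if "c \<le> B" for c
  proof -
    have "c \<in> {0..<Suc B}" using that by simp
    then have "q c \<in> ?F" using X(1) bij_betw_apply[OF q] by blast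
    then show "q c \<in> complete_types \<J> M A \<sigma>" "maximal_at (q c) ys m" by blast+
  qed
  have q_ne: "q c \<noteq> q d" if "c < d" "d \<le> B" for c d
  proof
    assume "q c = q d"
    moreover have "c \<in> {0..<Suc B}" "d \<in> {0..<Suc B}" using that by auto
    ultimately have "c = d" by (rule inj_onD[OF bij_betw_imp_inj_on[OF q]])
    then show False using that by simp
  qed
  define sepf where "sepf c d = (SOME \<phi>. \<phi> \<in> formulas \<J> A \<sigma> \<and> \<phi> \<in> q c \<and> Neg \<phi> \<in> q d)" for c d
  have sepf: "sepf c d \<in> formulas \<J> A \<sigma> \<and> sepf c d \<in> q c \<and> Neg (sepf c d) \<in> q d" if "c < d" "d \<le> B" for c d
    unfolding sepf_def
    by (rule someI_ex) (use complete_types_separated[OF qF(1) qF(1) q_ne[OF that] \<sigma>] that in auto)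
  let ?P = "{(c, d). c < d \<and> d \<le> B}"
  have finP: "finite ?P" by (rule finite_subset[of _ "{..B} \<times> {..B}"]) auto
  obtain ds where ds: "set ds = (\<Union>(c, d) \<in> ?P. fm_consts (sepf c d))"
    using finite_list[of "\<Union>(c, d) \<in> ?P. fm_consts (sepf c d)"] finP by auto
  have dsA: "set ds \<subseteq> A" using sepf by (fastforce simp: ds formulas_def)
  \<comment> \<open>\<open>ds\<close> collects the parameters of all separating formulas. By
    maximality at \<open>ys\<close>, the types deny rank \<open>Suc m\<close> over the longer tuple
    \<open>y\<close>.\<close>
  define y where "y = ys @ ds"
  have yA: "set y \<subseteq> A" using ys dsA by (simp add: y_def)
  define \<tau> where "\<tau> = map fst y"
  have \<tau>s: "\<tau>0 \<in> lists (sorts \<J>)" "\<tau> \<in> lists (sorts \<J>)" using param_sorts ys yA by (auto simp: \<tau>0_def \<tau>_def)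
  define \<psi> where "\<psi> c d = abstract_consts ?n y (sepf c d)" for c d
  have cons: "fm_consts (sepf c d) \<subseteq> set y" if "c < d" "d \<le> B" for c d
    using that by (auto simp: y_def ds)
  have \<psi>: "\<psi> c d \<in> pure_fms \<J> (\<sigma> @ \<tau>)" if "c < d" "d \<le> B" for c d
    unfolding \<psi>_def \<tau>_def using abstract_consts_formula sepf[OF that] cons[OF that] by blast
  have sat\<psi>: "tsat M (x @ y) (\<psi> c d) \<longleftrightarrow> sat_tuple M (map snd x) (sepf c d)"
    if cd: "c < d" "d \<le> B" and x: "x \<in> tup \<J> M \<sigma>" for c d x
  proof -
    have x': "map fst x = \<sigma>" "length x = ?n" using x by (auto simp: tup_def)
    have "sepf c d \<in> formulas \<J> A (map fst x)" using sepf[OF cd] x' by simp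
    from sat_abstract_consts[OF this cons[OF cd], of M] show ?thesis unfolding \<psi>_def x'(2) .
  qed
  \<comment> \<open>The types need not be realized in \<open>M\<close>. It is enough to realize the
    finitely many formulas that concern ranks and the separation from the other types.\<close>
  have ex: "\<exists>x. x \<in> tup \<J> M \<sigma> \<and> tsat M (x @ ys) (chi \<tau>0 m) \<and> \<not> tsat M (x @ y) (chi \<tau> (Suc m)) \<and>
      (\<forall>d. c < d \<and> d \<le> B \<longrightarrow> tsat M (x @ y) (\<psi> c d)) \<and> (\<forall>d. d < c \<longrightarrow> \<not> tsat M (x @ y) (\<psi> d c))"
    if c: "c \<le> B" for c
  proof -
    let ?q = "{chi_inst ys m, Neg (chi_inst y (Suc m))} \<union> (\<lambda>d. sepf c d) ` {d. c < d \<and> d \<le> B} \<union>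
      (\<lambda>d. Neg (sepf d c)) ` {d. d < c}"
    have "chi_inst y (Suc m) \<notin> q c" using qF(2)[OF c] dsA by (simp add: maximal_at_def y_def)
    then have "Neg (chi_inst y (Suc m)) \<in> q c"
      using qF(1)[OF c] chi_inst_formula[OF yA] by (auto simp: complete_types_def)
    moreover have "chi_inst ys m \<in> q c" using qF(2)[OF c] by (simp add: maximal_at_def)
    ultimately have sub: "?q \<subseteq> q c" using sepf c by auto
    have fin: "finite ?q" by (auto intro: finite_subset[of _ "{..B}"])
    obtain x where x: "x \<in> tup \<J> M \<sigma>" "\<forall>\<phi> \<in> ?q. sat_tuple M (map snd x) \<phi>"
      using complete_type_realize[OF qF(1)[OF c] fin sub \<sigma>] by (rule bexE)
    have sat: "sat_tuple M (map snd x) \<phi>" if "\<phi> \<in> ?q" for \<phi> using x(2) that by (rule bspec)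
    have neg: "sat_tuple M u (Neg \<phi>) \<longleftrightarrow> \<not> sat_tuple M u \<phi>" for u \<phi> by (simp add: sat_tuple_def)
    show ?thesis
    proof (intro exI conjI allI impI)
      show "x \<in> tup \<J> M \<sigma>" by (rule x(1))
      have "sat_tuple M (map snd x) (chi_inst ys m)" by (rule sat) simp
      then show "tsat M (x @ ys) (chi \<tau>0 m)" unfolding sat_chi_inst[OF ys x(1)] \<tau>0_def .
      have "sat_tuple M (map snd x) (Neg (chi_inst y (Suc m)))" by (rule sat) simp
      then show "\<not> tsat M (x @ y) (chi \<tau> (Suc m))" unfolding neg sat_chi_inst[OF yA x(1)] \<tau>_def .
      show "tsat M (x @ y) (\<psi> c d)" if d: "c < d \<and> d \<le> B" for d
      proof -
        have "sat_tuple M (map snd x) (sepf c d)" by (rule sat) (use d in blast)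
        then show ?thesis unfolding sat\<psi>[OF conjunct1[OF d] conjunct2[OF d] x(1)] .
      qed
      show "\<not> tsat M (x @ y) (\<psi> d c)" if d: "d < c" for d
      proof -
        have "sat_tuple M (map snd x) (Neg (sepf d c))" by (rule sat) (use d in blast)
        then show ?thesis unfolding neg sat\<psi>[OF d c x(1)] .
      qed
    qed
  qed
  have "\<forall>c. \<exists>x. c \<le> B \<longrightarrow> x \<in> tup \<J> M \<sigma> \<and> tsat M (x @ ys) (chi \<tau>0 m) \<and>
      \<not> tsat M (x @ y) (chi \<tau> (Suc m)) \<and> (\<forall>d. c < d \<and> d \<le> B \<longrightarrow> tsat M (x @ y) (\<psi> c d)) \<and>
      (\<forall>d. d < c \<longrightarrow> \<not> tsat M (x @ y) (\<psi> d c))"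
    unfolding ex_simps by (intro allI impI ex)
  from choice[OF this] obtain x where xc: "\<forall>c. c \<le> B \<longrightarrow> x c \<in> tup \<J> M \<sigma> \<and> tsat M (x c @ ys) (chi \<tau>0 m) \<and>
      \<not> tsat M (x c @ y) (chi \<tau> (Suc m)) \<and> (\<forall>d. c < d \<and> d \<le> B \<longrightarrow> tsat M (x c @ y) (\<psi> c d)) \<and>
      (\<forall>d. d < c \<longrightarrow> \<not> tsat M (x c @ y) (\<psi> d c))"
    by (rule exE)
  have x: "x c \<in> tup \<J> M \<sigma>" "tsat M (x c @ ys) (chi \<tau>0 m)" "\<not> tsat M (x c @ y) (chi \<tau> (Suc m))"
    if "c \<le> B" for c
    using xc that by blast+
  have x\<psi>: "tsat M (x c @ y) (\<psi> c d)" "\<not> tsat M (x d @ y) (\<psi> c d)" if "c < d" "d \<le> B" for c d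
  proof -
    have "c \<le> B" using that by simp
    then show "tsat M (x c @ y) (\<psi> c d)" "\<not> tsat M (x d @ y) (\<psi> c d)" using xc that by blast+
  qed
  let ?D = "Suc B * ?n"
  \<comment> \<open>One long tuple holds \<open>x 0\<close> to \<open>x B\<close> and then
    \<open>y\<close>. The positions \<open>is0 c\<close> select \<open>x c @ ys\<close>, and
    \<open>is1 c\<close> select \<open>x c @ y\<close>.\<close>
  define \<Sigma> where "\<Sigma> = blocks ?n ?D (\<lambda>_. \<sigma>) \<tau>"
  define isx where "isx c = [c * ?n..<c * ?n + ?n]" for c
  define is0 where "is0 c = isx c @ [?D..<?D + length \<tau>0]" for c
  define is1 where "is1 c = isx c @ [?D..<?D + length \<tau>]" for c
  have l0: "length \<tau>0 \<le> length \<tau>" by (simp add: \<tau>0_def \<tau>_def y_def)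
  have t0: "take (length \<tau>0) \<tau> = \<tau>0" by (simp add: \<tau>0_def \<tau>_def y_def)
  have set_isx: "set (isx c) \<subseteq> {..<length \<Sigma>}" if "c \<le> B" for c
  proof
    fix i assume "i \<in> set (isx c)"
    then have "i - c * ?n < ?n" "i = c * ?n + (i - c * ?n)" by (auto simp: isx_def)
    then show "i \<in> {..<length \<Sigma>}" using block_index[OF that, of "i - c * ?n" ?n] by (simp add: \<Sigma>_def)
  qed
  have set_is: "set (is0 c) \<subseteq> {..<length \<Sigma>}" "set (is1 c) \<subseteq> {..<length \<Sigma>}" if "c \<le> B" for c
    using set_isx[OF that] l0 by (auto simp: is0_def is1_def \<Sigma>_def)
  have sel\<Sigma>: "map ((!) \<Sigma>) (isx c) = \<sigma>" "map ((!) \<Sigma>) (is0 c) = \<sigma> @ \<tau>0" "map ((!) \<Sigma>) (is1 c) = \<sigma> @ \<tau>"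
    if "c \<le> B" for c
  proof -
    show s: "map ((!) \<Sigma>) (isx c) = \<sigma>"
      unfolding \<Sigma>_def isx_def by (rule blocks_select[OF that]) simp
    show "map ((!) \<Sigma>) (is0 c) = \<sigma> @ \<tau>0" "map ((!) \<Sigma>) (is1 c) = \<sigma> @ \<tau>"
      using s blocks_select_tail[of "length \<tau>0" \<tau> ?n ?D "\<lambda>_. \<sigma>"] blocks_select_tail[of "length \<tau>" \<tau> ?n ?D "\<lambda>_. \<sigma>"] l0 t0
      by (simp_all add: is0_def is1_def \<Sigma>_def)
  qed
  have \<Sigma>s: "\<Sigma> \<in> lists (sorts \<J>)" unfolding \<Sigma>_def by (rule blocks_sorts[OF \<sigma> \<tau>s(2)])
  obtain s0 where s0: "s0 \<in> sorts \<J>" using seqs_nonempty by (auto simp: sorts_def)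
  \<comment> \<open>\<open>L1\<close> and \<open>L2\<close> say that each block has rank at least
    \<open>m\<close> over the short tuple and at most \<open>m\<close> over the long one;
    \<open>L3\<close> and \<open>L4\<close> say that the blocks \<open>c < d\<close> are separated
    by \<open>\<psi> c d\<close>.\<close>
  define L1 where "L1 = (\<lambda>c. reindex (is0 c) (chi \<tau>0 m)) ` {..B}"
  define L2 where "L2 = (\<lambda>c. Neg (reindex (is1 c) (chi \<tau> (Suc m)))) ` {..B}"
  define L3 where "L3 = (\<lambda>(c, d). reindex (is1 c) (\<psi> c d)) ` ?P"
  define L4 where "L4 = (\<lambda>(c, d). Neg (reindex (is1 d) (\<psi> c d))) ` ?P"
  have "finite (L1 \<union> L2 \<union> L3 \<union> L4)" using finP by (simp add: L1_def L2_def L3_def L4_def)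
  from finite_list[OF this] obtain L where L: "set L = L1 \<union> L2 \<union> L3 \<union> L4" by (rule exE)
  define \<Phi> where "\<Phi> = Neg (conj_list s0 L)"
  have re0: "reindex (is0 c) (chi \<tau>0 m) \<in> pure_fms \<J> \<Sigma>" if "c \<le> B" for c
    using reindex_formula[of "chi \<tau>0 m" \<J> \<Sigma> "is0 c"] chi(1)[OF \<tau>s(1)] sel\<Sigma>(2)[OF that] set_is(1)[OF that] by simp
  have re1: "reindex (is1 c) \<phi> \<in> pure_fms \<J> \<Sigma>" if "c \<le> B" "\<phi> \<in> pure_fms \<J> (\<sigma> @ \<tau>)" for c \<phi>
    using reindex_formula[of \<phi> \<J> \<Sigma> "is1 c"] that(2) sel\<Sigma>(3)[OF that(1)] set_is(2)[OF that(1)] by simp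
  have "set L \<subseteq> pure_fms \<J> \<Sigma>"
    unfolding L L1_def L2_def L3_def L4_def
    by (auto intro!: formulas_Neg re0 re1 chi(1)[OF \<tau>s(2)] \<psi>)
  then have \<Phi>: "\<Phi> \<in> pure_fms \<J> \<Sigma>" unfolding \<Phi>_def by (intro formulas_Neg conj_list_formula[OF s0])
  \<comment> \<open>In \<open>S\<close> these rank conditions prevent growth from the short to the
    long tuple, so two of the blocks correspond over the long tuple, against their
    separation.\<close>
  have S_all: "tsat S zs \<Phi>" if zs: "zs \<in> tup \<J> S \<Sigma>" for zs
  proof (rule ccontr)
    assume "\<not> tsat S zs \<Phi>"
    then have all: "tsat S zs \<phi>" if "\<phi> \<in> set L" for \<phi> using that by (simp add: \<Phi>_def tsat_def)
    define X where "X c = map ((!) zs) (isx c)" for c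
    define Y where "Y = map ((!) zs) [?D..<?D + length \<tau>]"
    have X: "X c \<in> tup \<J> S \<sigma>" if "c \<le> B" for c
      using select_tup[OF zs set_isx[OF that]] sel\<Sigma>(1)[OF that] by (simp add: X_def)
    have tail: "map ((!) \<Sigma>) [?D..<?D + length \<tau>] = \<tau>"
      using blocks_select_tail[of "length \<tau>" \<tau> ?n ?D "\<lambda>_. \<sigma>"] by (simp add: \<Sigma>_def)
    have "set [?D..<?D + length \<tau>] \<subseteq> {..<length \<Sigma>}" by (auto simp: \<Sigma>_def)
    from select_tup[OF zs this] have Y: "Y \<in> tup \<J> S \<tau>" unfolding tail Y_def .
    have lY: "length Y = length \<tau>" by (simp add: Y_def)
    have Y0: "take (length \<tau>0) Y \<in> tup \<J> S \<tau>0"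
      using Y t0 set_take_subset[of "length \<tau>0" Y] by (auto simp: tup_def take_map[symmetric])
    have i0: "map ((!) zs) (is0 c) = X c @ take (length \<tau>0) Y" for c
      using l0 by (simp add: is0_def X_def Y_def take_map)
    have i1: "map ((!) zs) (is1 c) = X c @ Y" for c by (simp add: is1_def X_def Y_def)
    have r0: "m \<le> rk (X c) (take (length \<tau>0) Y)" if c: "c \<le> B" for c
    proof -
      have "tsat S zs (reindex (is0 c) (chi \<tau>0 m))" using c by (intro all) (auto simp: L L1_def)
      then have "tsat S (X c @ take (length \<tau>0) Y) (chi \<tau>0 m)"
        using tsat_reindex_tup[OF zs set_is(1)[OF c], of "chi \<tau>0 m"] chi(1)[OF \<tau>s(1)] sel\<Sigma>(2)[OF c] i0 by simp
      then show ?thesis using chi(2)[OF \<tau>s(1) X[OF c] Y0] by simp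
    qed
    have r1: "rk (X c) Y \<le> m" if c: "c \<le> B" for c
    proof -
      have "tsat S zs (Neg (reindex (is1 c) (chi \<tau> (Suc m))))" using c by (intro all) (auto simp: L L2_def)
      then have "\<not> tsat S (X c @ Y) (chi \<tau> (Suc m))"
        using tsat_reindex_tup[OF zs set_is(2)[OF c], of "chi \<tau> (Suc m)"] chi(1)[OF \<tau>s(2)] sel\<Sigma>(3)[OF c] i1 by simp
      then show ?thesis using chi(2)[OF \<tau>s(2) X[OF c] Y] by simp
    qed
    obtain c d where cd: "c < d" "d \<le> B" and corr: "\<forall>zs. set zs \<subseteq> elements \<J> S \<and>
        rk (X c) (take (length \<tau>0) Y @ zs) \<le> rk (X c) (take (length \<tau>0) Y) \<and>
        rk (X d) (take (length \<tau>0) Y @ zs) \<le> rk (X d) (take (length \<tau>0) Y) \<longrightarrow>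
        corresp (X c @ take (length \<tau>0) Y @ zs) (X d @ take (length \<tau>0) Y @ zs)"
      using mp[OF spec[OF bspec[OF B Y0], of X]] X by blast
    have cB: "c \<le> B" using cd by simp
    have drop: "set (drop (length \<tau>0) Y) \<subseteq> elements \<J> S"
      using Y set_drop_subset[of "length \<tau>0" Y] by (auto simp: tup_def)
    have "corresp (X c @ Y) (X d @ Y)"
      using corr[rule_format, of "drop (length \<tau>0) Y"] drop r0[OF cB] r0[OF cd(2)] r1[OF cB] r1[OF cd(2)] by simp
    moreover have "set (X c @ Y) \<subseteq> elements \<J> S" "set (X d @ Y) \<subseteq> elements \<J> S" "map fst (X c @ Y) = \<sigma> @ \<tau>"
      using X[OF cB] X[OF cd(2)] Y by (auto simp: tup_def)
    ultimately have "tsat S (X c @ Y) (\<psi> c d) \<longleftrightarrow> tsat S (X d @ Y) (\<psi> c d)"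
      using corresp_tequiv \<psi>[OF cd] by (simp add: tequiv_def)
    moreover have "tsat S zs (reindex (is1 c) (\<psi> c d))" "tsat S zs (Neg (reindex (is1 d) (\<psi> c d)))"
      using cd by (intro all; force simp: L L3_def L4_def)+
    then have "tsat S (X c @ Y) (\<psi> c d)" "\<not> tsat S (X d @ Y) (\<psi> c d)"
      using tsat_reindex_tup[OF zs set_is(2)[OF cB], of "\<psi> c d"] tsat_reindex_tup[OF zs set_is(2)[OF cd(2)], of "\<psi> c d"]
        \<psi>[OF cd] sel\<Sigma>(3)[OF cB] sel\<Sigma>(3)[OF cd(2)] i1 by simp_all
    ultimately show False by blast
  qed
  \<comment> \<open>The partial realizations in \<open>M\<close> satisfy all of \<open>L\<close>,
    against the transferred formula.\<close>
  define Z where "Z = blocks ?n ?D x y"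
  have ytup: "y \<in> tup \<J> M \<tau>" using yA A by (auto simp: tup_def \<tau>_def)
  have Z: "Z \<in> tup \<J> M \<Sigma>" unfolding Z_def \<Sigma>_def by (rule blocks_tup[OF x(1) ytup])
  have len: "length (x c) = ?n" if "c \<le> B" for c using x(1)[OF that] by (auto simp: tup_def)
  have ly: "length y = length \<tau>" "length ys = length \<tau>0" by (simp_all add: \<tau>_def \<tau>0_def)
  have j0: "map ((!) Z) (is0 c) = x c @ ys" if "c \<le> B" for c
    using blocks_select[of _ B x ?n y, OF that len[OF that]] blocks_select_tail[of "length \<tau>0" y ?n ?D x] l0 ly
    by (simp add: Z_def is0_def isx_def y_def)
  have j1: "map ((!) Z) (is1 c) = x c @ y" if "c \<le> B" for c
    using blocks_select[of _ B x ?n y, OF that len[OF that]] blocks_select_tail[of "length \<tau>" y ?n ?D x] ly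
    by (simp add: Z_def is1_def isx_def)
  have "tsat M Z \<phi>" if "\<phi> \<in> set L" for \<phi>
  proof -
    have "tsat M Z (reindex (is0 c) (chi \<tau>0 m))" if c: "c \<le> B" for c
      using tsat_reindex_tup[OF Z set_is(1)[OF c], of "chi \<tau>0 m"] chi(1)[OF \<tau>s(1)] sel\<Sigma>(2)[OF c] j0[OF c] x(2)[OF c] by simp
    moreover have "tsat M Z (Neg (reindex (is1 c) (chi \<tau> (Suc m))))" if c: "c \<le> B" for c
      using tsat_reindex_tup[OF Z set_is(2)[OF c], of "chi \<tau> (Suc m)"] chi(1)[OF \<tau>s(2)] sel\<Sigma>(3)[OF c] j1[OF c] x(3)[OF c] by simp
    moreover have "tsat M Z (reindex (is1 c) (\<psi> c d))" "tsat M Z (Neg (reindex (is1 d) (\<psi> c d)))"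
      if cd: "c < d" "d \<le> B" for c d
    proof -
      have cB: "c \<le> B" using cd by simp
      show "tsat M Z (reindex (is1 c) (\<psi> c d))" "tsat M Z (Neg (reindex (is1 d) (\<psi> c d)))"
        using tsat_reindex_tup[OF Z set_is(2)[OF cB], of "\<psi> c d"] tsat_reindex_tup[OF Z set_is(2)[OF cd(2)], of "\<psi> c d"]
          \<psi>[OF cd] sel\<Sigma>(3)[OF cB] sel\<Sigma>(3)[OF cd(2)] j1[OF cB] j1[OF cd(2)] x\<psi>[OF cd] by simp_all
    qed
    ultimately show ?thesis using that unfolding L L1_def L2_def L3_def L4_def by fast
  qed
  then have "\<not> tsat M Z \<Phi>" by (simp add: \<Phi>_def tsat_def)
  then show False using transfer[OF T \<Phi> \<Sigma>s] S_all Z by blast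
qed

text \<open>Each type is one of finitely many that are maximal at some \<open>ys\<close> and
  \<open>m\<close>, and a countable \<open>A\<close> has countably many finite tuples.\<close>

lemma countable_complete_types:
  assumes "countable A" shows "countable (complete_types \<J> M A \<sigma>)"
proof -
  have "complete_types \<J> M A \<sigma> \<subseteq> (\<Union>(ys, m) \<in> lists A \<times> UNIV. {p \<in> complete_types \<J> M A \<sigma>. maximal_at p ys m})"
  proof
    fix p assume p: "p \<in> complete_types \<J> M A \<sigma>"
    then obtain ys m where "maximal_at p ys m" using maximal_exists by blast
    moreover from this have "ys \<in> lists A" by (auto simp: maximal_at_def in_lists_conv_set)
    ultimately show "p \<in> (\<Union>(ys, m) \<in> lists A \<times> UNIV. {p \<in> complete_types \<J> M A \<sigma>. maximal_at p ys m})"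
      using p by blast
  qed
  moreover have "countable (\<Union>(ys, m) \<in> lists A \<times> UNIV. {p \<in> complete_types \<J> M A \<sigma>. maximal_at p ys m})"
  proof (rule countable_UN)
    show "countable (lists A \<times> (UNIV :: nat set))" using assms by (intro countable_SIGMA countable_lists) auto
    fix i assume "i \<in> lists A \<times> (UNIV :: nat set)"
    then have "set (fst i) \<subseteq> A" by (auto simp: in_lists_conv_set)
    from countable_finite[OF finite_maximal[OF this, of "snd i"]]
    show "countable (case i of (ys, m) \<Rightarrow> {p \<in> complete_types \<J> M A \<sigma>. maximal_at p ys m})"
      by (simp add: case_prod_beta)
  qed
  ultimately show ?thesis using countable_subset by blast
qed

end

end

theorem theorem4p15:
  fixes \<J> :: "'j set"
    and Jsub :: "nat \<Rightarrow> 'j list \<Rightarrow> 'j list"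
    and S :: "('j, 'a) lstruct"
  assumes "countable \<J>"
    and "\<And>k J. k \<ge> 1 \<Longrightarrow> J \<in> seqs \<J> \<Longrightarrow> Jsub k J \<in> seqs \<J>"
    and "models_SCS_SEP \<J> Jsub S"
  shows "(\<forall>A k J a b.
            subsystem \<J> Jsub S A \<and> (k, J) \<in> sorts \<J> \<and> a \<in> univ S (k, J) \<and> b \<in> univ S (k, J) \<longrightarrow>
            (tp \<J> S A ((k, J), a) = tp \<J> S A ((k, J), b) \<longleftrightarrow>
               (let aA = join_with \<J> Jsub S ((k, J), a) A;
                    bA = join_with \<J> Jsub S ((k, J), b) A
                in aA = bA \<and>
                   (\<exists>f. isomorphism \<J>
                          (substructure S (generated \<J> Jsub S (aA \<union> {((k, J), a)})))
                          (substructure S (generated \<J> Jsub S (bA \<union> {((k, J), b)}))) f \<and>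
                        (\<forall>(s, x) \<in> generated \<J> Jsub S aA. f s x = x) \<and>
                        f (k, J) a = b))))
         \<and> omega_stable TYPE('b) \<J> (Th \<J> S)"
proof -
  obtain G :: "('j srt \<times> 'a) set monoid" and X F h where
    "sorted_profinite_group \<J> Jsub G X F" "isomorphism \<J> S (complete_system G X F) h" "co_SEP \<J> Jsub S"
    using assms(3) by (auto simp: models_SCS_SEP_def sorted_complete_system_def)
  then interpret sep \<J> Jsub G X F S h by unfold_locales
  show ?thesis
  proof (intro conjI allI impI, elim conjE)
    fix A k J a b
    assume A: "subsystem \<J> Jsub S A" and "(k, J) \<in> sorts \<J>" "a \<in> univ S (k, J)" "b \<in> univ S (k, J)"
    then have ab: "((k, J), a) \<in> elements \<J> S" "((k, J), b) \<in> elements \<J> S" "fst ((k, J), a) = fst ((k, J), b)"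
      by (simp_all add: elements_def)
    show "tp \<J> S A ((k, J), a) = tp \<J> S A ((k, J), b) \<longleftrightarrow>
       (let aA = join_with \<J> Jsub S ((k, J), a) A; bA = join_with \<J> Jsub S ((k, J), b) A
        in aA = bA \<and> (\<exists>f. isomorphism \<J>
              (substructure S (generated \<J> Jsub S (aA \<union> {((k, J), a)})))
              (substructure S (generated \<J> Jsub S (bA \<union> {((k, J), b)}))) f \<and>
            (\<forall>(s, x) \<in> generated \<J> Jsub S aA. f s x = x) \<and> f (k, J) a = b))"
      unfolding Let_def
    proof (intro iffI conjI; (elim conjE exE)?)
      assume tp: "tp \<J> S A ((k, J), a) = tp \<J> S A ((k, J), b)"
      show "join_with \<J> Jsub S ((k, J), a) A = join_with \<J> Jsub S ((k, J), b) A"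
        by (rule type_join_eq[OF A ab tp])
      show "\<exists>f. isomorphism \<J>
              (substructure S (generated \<J> Jsub S (join_with \<J> Jsub S ((k, J), a) A \<union> {((k, J), a)})))
              (substructure S (generated \<J> Jsub S (join_with \<J> Jsub S ((k, J), b) A \<union> {((k, J), b)}))) f \<and>
            (\<forall>(s, x) \<in> generated \<J> Jsub S (join_with \<J> Jsub S ((k, J), a) A). f s x = x) \<and> f (k, J) a = b"
        using type_imp_isomorphism[OF A ab tp] unfolding fst_conv snd_conv .
    next
      fix f
      assume eq: "join_with \<J> Jsub S ((k, J), a) A = join_with \<J> Jsub S ((k, J), b) A"
        and f: "isomorphism \<J>
              (substructure S (generated \<J> Jsub S (join_with \<J> Jsub S ((k, J), a) A \<union> {((k, J), a)})))
              (substructure S (generated \<J> Jsub S (join_with \<J> Jsub S ((k, J), b) A \<union> {((k, J), b)}))) f"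
          "\<forall>(s, x) \<in> generated \<J> Jsub S (join_with \<J> Jsub S ((k, J), a) A). f s x = x" "f (k, J) a = b"
      show "tp \<J> S A ((k, J), a) = tp \<J> S A ((k, J), b)"
        by (rule isomorphism_imp_type[OF A ab eq f(1,2)]) (simp add: f(3))
    qed
  next
    show "omega_stable TYPE('b) \<J> (Th \<J> S)"
      unfolding omega_stable_def
      by (intro allI impI, elim conjE) (rule countable_complete_types)
  qed
qed

end
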